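(* Let $(h_k)$, $(\varepsilon_k)$ be scales with $h_k/\varepsilon_k\to0$, and let $\varphi$ satisfy (BP) with exponent $s\in\mathbb{R}$. Let $(U^{h_k})$ be an $h_k$-bounded, $\varepsilon_k$-oscillatory sequence such that $(E^{h_k}[U^{h_k}])$ weakly converges to a measure $\nu$. Suppose moreover that $\widehat\varphi$ is continuous at (every point of) $2\pi\mathbb{Z}^d$ and that at least one of the following is satisfied: (D) $\operatorname{ess\,sup}_{\xi\in Q}\sum_{|n|\ge R}|\langle\xi+2\pi n\rangle^s\widehat\varphi(\xi+2\pi n)|^2\to0$ as $R\to\infty$; or (C) $\mu(\mathbb{R}^d\times\overline{D_{\tau_{\langle D_x\rangle^s\varphi}}})=0$ for every Wigner measure $\mu$ at scale $(h_k)$ of $(U^{h_k})$ (i.e. every weak limit in $\mathcal{S}'$ of a subsequence of $M^{h_k}[U^{h_k}]$), and $(U^{h_k})$ is compact at infinity. Then the densities $|\langle h_kD_x\rangle^sT_\varphi^{h_k}U^{h_k}|^2$ weakly converge to the measure $$\nu_\varphi(x)=\Big(\sum_{n\in\mathbb{Z}^d}|\langle2\pi n\rangle^s\widehat\varphi(2\pi n)|^2\Big)\nu(x).$$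
   Context: A scale is a sequence of positive numbers tending to $0$. Fourier transform: $\widehat u(\xi)=\int_{\mathbb{R}^d}u(x)e^{-ix\cdot\xi}dx$; $Q=[-\pi,\pi)^d$; $\langle\xi\rangle=(1+|\xi|^2)^{1/2}$; $\langle hD_x\rangle^s$ is the Fourier multiplier with symbol $\langle h\xi\rangle^s$. (BP) with exponent $s$: $\varphi\in H^s(\mathbb{R}^d)$ and there is $B>0$ with $\tau_{\langle D_x\rangle^s\varphi}(\xi):=\sum_{k\in\mathbb{Z}^d}|\langle\xi+2\pi k\rangle^s\widehat\varphi(\xi+2\pi k)|^2\le B$ for a.e. $\xi\in\mathbb{R}^d$. A precise (Borel) representative of $\widehat\varphi$ is fixed once and for all and used throughout (also in $\tau_{\langle D_x\rangle^s\varphi}$). $D_f$ denotes the set of points where $f$ is not continuous. $L^2(h\mathbb{Z}^d)$: functions $U:\mathbb{Z}^d\to\mathbb{C}$ with $\|U\|_h^2=h^d\sum_n|U_n|^2<\infty$; $\widehat U(\xi)=\sum_nU_ne^{-in\cdot\xi}$. $(U^{h_k})$ is $h_k$-bounded if $U^{h_k}\in L^2(h_k\mathbb{Z}^d)$ and $\|U^{h_k}\|_{h_k}\le C$ for all $k$. It is $\varepsilon_k$-oscillatory if $\limsup_{k\to\infty}h_k^d\int_{Q\setminus B(0;(h_k/\varepsilon_k)R)}|\widehat{U^{h_k}}(\xi)|^2d\xi\to0$ as $R\to\infty$. It is compact at infinity if $\limsup_{k\to\infty}h_k^d\sum_{|h_kn|>R}|U_n^{h_k}|^2\to0$ as $R\to\infty$.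 $E^h[U](x)=h^d\sum_{n\in\mathbb{Z}^d}|U_n|^2\delta_{hn}(x)$; $T_\varphi^hU(x)=\sum_{n\in\mathbb{Z}^d}U_n\varphi(x/h-n)$; for $U\in L^2(h\mathbb{Z}^d)$, $$M^\varepsilon[U](x,\xi)=\frac{h^{2d}}{(2\pi\varepsilon)^d}\sum_{m\in\mathbb{Z}^d}\overline{U_m}\,\widehat U(h\xi/\varepsilon)e^{im\cdot(h/\varepsilon)\xi}\delta_{hm}(x)\in\mathcal{S}'(\mathbb{R}^d\times\mathbb{R}^d).$$ Weak convergence of measures is convergence tested against $C_c(\mathbb{R}^d)$. *)

theory Defs
  imports "HOL-Analysis.Analysis" "HOL-Probability.Essential_Supremum"
begin

section \<open>Schwartz functions and tempered distributions\<close>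

primrec iter_deriv :: "'a::euclidean_space list \<Rightarrow> ('a \<Rightarrow> complex) \<Rightarrow> 'a \<Rightarrow> complex" where
  "iter_deriv [] f = f"
| "iter_deriv (v # vs) f = (\<lambda>x. frechet_derivative (iter_deriv vs f) (at x) v)"

definition smooth :: "('a::euclidean_space \<Rightarrow> complex) \<Rightarrow> bool" where
  "smooth f \<longleftrightarrow>
    (\<forall>vs. set vs \<subseteq> Basis \<longrightarrow> (\<forall>x. iter_deriv vs f differentiable (at x)))"

definition schwartz_values :: "nat \<Rightarrow> ('a::euclidean_space \<Rightarrow> complex) \<Rightarrow> real set" where
  "schwartz_values N f =
    {(1 + norm x) ^ N * norm (iter_deriv vs f x) | vs x. set vs \<subseteq> Basis \<and> length vs \<le> N}"

definition schwartz_seminorm :: "nat \<Rightarrow> ('a::euclidean_space \<Rightarrow> complex) \<Rightarrow> real" where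
  "schwartz_seminorm N f = Sup (schwartz_values N f)"

definition schwartz :: "('a::euclidean_space \<Rightarrow> complex) set" where
  "schwartz = {f. smooth f \<and> (\<forall>N. bdd_above (schwartz_values N f))}"

text \<open>
  A distribution is a functional on test functions. Only its values on the Schwartz space matter;
  the pairing is bilinear, without complex conjugation.
\<close>

type_synonym 'a distribution = "('a \<Rightarrow> complex) \<Rightarrow> complex"

definition tempered :: "'a::euclidean_space distribution \<Rightarrow> bool" where
  "tempered T \<longleftrightarrow>
    (\<forall>f\<in>schwartz. \<forall>g\<in>schwartz. \<forall>a b. T (\<lambda>x. a * f x + b * g x) = a * T f + b * T g) \<and>
    (\<exists>C N. \<forall>f\<in>schwartz. norm (T f) \<le> C * schwartz_seminorm N f)"

definition represents :: "'a::euclidean_space distribution \<Rightarrow> ('a \<Rightarrow> complex) \<Rightarrow> bool" where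
  "represents T g \<longleftrightarrow>
    g \<in> borel_measurable borel \<and>
    (\<forall>f\<in>schwartz. integrable lborel (\<lambda>x. g x * f x) \<and> T f = (LINT x|lborel. g x * f x))"

definition square_integrable :: "('a::euclidean_space \<Rightarrow> complex) \<Rightarrow> bool" where
  "square_integrable g \<longleftrightarrow>
    g \<in> borel_measurable borel \<and> integrable lborel (\<lambda>x. (norm (g x))\<^sup>2)"


section \<open>Fourier transform, Fourier multipliers, Sobolev spaces\<close>

definition fourier :: "('a::euclidean_space \<Rightarrow> complex) \<Rightarrow> 'a \<Rightarrow> complex" where
  "fourier u \<xi> = (LINT x|lborel. u x * cis (- (x \<bullet> \<xi>)))"

definition inv_fourier :: "('a::euclidean_space \<Rightarrow> complex) \<Rightarrow> 'a \<Rightarrow> complex" where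
  "inv_fourier u x = (LINT \<xi>|lborel. u \<xi> * cis (x \<bullet> \<xi>)) / (2 * pi) ^ DIM('a)"

definition dist_fourier :: "'a::euclidean_space distribution \<Rightarrow> 'a distribution" where
  "dist_fourier T = (\<lambda>f. T (fourier f))"

definition dist_inv_fourier :: "'a::euclidean_space distribution \<Rightarrow> 'a distribution" where
  "dist_inv_fourier T = (\<lambda>f. T (inv_fourier f))"

definition dist_mult :: "('a::euclidean_space \<Rightarrow> complex) \<Rightarrow> 'a distribution \<Rightarrow> 'a distribution" where
  "dist_mult m T = (\<lambda>f. T (\<lambda>x. m x * f x))"

definition fourier_multiplier ::
    "('a::euclidean_space \<Rightarrow> complex) \<Rightarrow> 'a distribution \<Rightarrow> 'a distribution" where
  "fourier_multiplier m T = dist_inv_fourier (dist_mult m (dist_fourier T))"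

definition japanese :: "'a::euclidean_space \<Rightarrow> real" where
  "japanese \<xi> = sqrt (1 + (norm \<xi>)\<^sup>2)"

text \<open>The operator $\langle hD_x\rangle^s$.\<close>

definition bessel_potential ::
    "real \<Rightarrow> real \<Rightarrow> 'a::euclidean_space distribution \<Rightarrow> 'a distribution" where
  "bessel_potential h s =
    fourier_multiplier (\<lambda>\<xi>. complex_of_real (japanese (h *\<^sub>R \<xi>) powr s))"

definition sobolev :: "real \<Rightarrow> 'a::euclidean_space distribution set" where
  "sobolev s =
    {T. tempered T \<and>
        (\<exists>g. represents (dist_fourier T) g \<and>
             square_integrable (\<lambda>\<xi>. complex_of_real (japanese \<xi> powr s) * g \<xi>))}"


section \<open>Lattice, periodized symbol, and the condition (BP)\<close>

text \<open>The dimension $d$ is \<open>CARD('n)\<close>; $\mathbb{Z}^d$ is the type \<open>int ^ 'n\<close>.\<close>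

definition latt :: "int ^ 'n::finite \<Rightarrow> real ^ 'n" where
  "latt n = (\<chi> i. real_of_int (n $ i))"

definition cellQ :: "(real ^ 'n::finite) set" where
  "cellQ = {\<xi>. \<forall>i. - pi \<le> \<xi> $ i \<and> \<xi> $ i < pi}"

text \<open>
  The summand $|\langle\xi+2\pi n\rangle^s\widehat\varphi(\xi+2\pi n)|^2$; the argument \<open>p\<close> is the
  chosen representative of $\widehat\varphi$. Sums are taken in \<^typ>\<open>ennreal\<close>, so that a
  divergent series has the value $\infty$.
\<close>

definition tau_term ::
    "real \<Rightarrow> (real ^ 'n::finite \<Rightarrow> complex) \<Rightarrow> real ^ 'n \<Rightarrow> int ^ 'n \<Rightarrow> ennreal" where
  "tau_term s p \<xi> n =
    ennreal ((japanese (\<xi> + (2 * pi) *\<^sub>R latt n) powr s * norm (p (\<xi> + (2 * pi) *\<^sub>R latt n)))\<^sup>2)"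

definition tau :: "real \<Rightarrow> (real ^ 'n::finite \<Rightarrow> complex) \<Rightarrow> real ^ 'n \<Rightarrow> ennreal" where
  "tau s p \<xi> = (\<Sum>\<^sub>\<infinity>n. tau_term s p \<xi> n)"

definition BP ::
    "real \<Rightarrow> (real ^ 'n::finite) distribution \<Rightarrow> (real ^ 'n \<Rightarrow> complex) \<Rightarrow> bool" where
  "BP s \<phi> p \<longleftrightarrow>
    \<phi> \<in> sobolev s \<and> (\<exists>B>0. AE \<xi> in lborel. tau s p \<xi> \<le> ennreal B)"

definition discont :: "('a::t2_space \<Rightarrow> 'b::topological_space) \<Rightarrow> 'a set" where
  "discont f = {x. \<not> isCont f x}"

definition conditionD :: "real \<Rightarrow> (real ^ 'n::finite \<Rightarrow> complex) \<Rightarrow> bool" where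
  "conditionD s p \<longleftrightarrow>
    ((\<lambda>R::real. esssup (restrict_space lborel cellQ)
        (\<lambda>\<xi>. \<Sum>\<^sub>\<infinity>n\<in>{n. norm (latt n) \<ge> R}. tau_term s p \<xi> n)) \<longlongrightarrow> 0) at_top"


section \<open>Lattice functions\<close>

definition is_scale :: "(nat \<Rightarrow> real) \<Rightarrow> bool" where
  "is_scale h \<longleftrightarrow> (\<forall>k. h k > 0) \<and> h \<longlonglongrightarrow> 0"

text \<open>The set of $L^2(h\mathbb{Z}^d)$ functions does not depend on $h > 0$; only the norm does.\<close>

definition lattice_L2 :: "(int ^ 'n::finite \<Rightarrow> complex) set" where
  "lattice_L2 = {U. (\<lambda>n. (norm (U n))\<^sup>2) summable_on UNIV}"

definition lattice_norm :: "real \<Rightarrow> (int ^ 'n::finite \<Rightarrow> complex) \<Rightarrow> real" where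
  "lattice_norm h U = sqrt (h ^ CARD('n) * (\<Sum>\<^sub>\<infinity>n. (norm (U n))\<^sup>2))"

text \<open>
  For $U\in L^2(h\mathbb{Z}^d)$ the series $\widehat U(\xi)=\sum_n U_n e^{-in\cdot\xi}$ converges in
  $L^2(Q)$; $\widehat U$ is a Borel, $2\pi\mathbb{Z}^d$-periodic version of its sum, which is
  determined up to a null set.
\<close>

definition is_lattice_fourier ::
    "(int ^ 'n::finite \<Rightarrow> complex) \<Rightarrow> (real ^ 'n \<Rightarrow> complex) \<Rightarrow> bool" where
  "is_lattice_fourier U F \<longleftrightarrow>
    F \<in> borel_measurable borel \<and>
    (\<forall>\<xi> n. F (\<xi> + (2 * pi) *\<^sub>R latt n) = F \<xi>) \<and>
    ((\<lambda>A. \<integral>\<^sup>+ \<xi>\<in>cellQ.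
        ennreal ((norm (F \<xi> - (\<Sum>n\<in>A. U n * cis (- (latt n \<bullet> \<xi>)))))\<^sup>2) \<partial>lborel)
      \<longlongrightarrow> 0) (finite_subsets_at_top UNIV)"

definition lattice_fourier ::
    "(int ^ 'n::finite \<Rightarrow> complex) \<Rightarrow> real ^ 'n \<Rightarrow> complex" where
  "lattice_fourier U = (SOME F. is_lattice_fourier U F)"

definition h_bounded ::
    "(nat \<Rightarrow> real) \<Rightarrow> (nat \<Rightarrow> int ^ 'n::finite \<Rightarrow> complex) \<Rightarrow> bool" where
  "h_bounded h U \<longleftrightarrow>
    (\<forall>k. U k \<in> lattice_L2) \<and> (\<exists>C. \<forall>k. lattice_norm (h k) (U k) \<le> C)"

definition oscillatory ::
    "(nat \<Rightarrow> real) \<Rightarrow> (nat \<Rightarrow> real) \<Rightarrow> (nat \<Rightarrow> int ^ 'n::finite \<Rightarrow> complex) \<Rightarrow> bool" where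
  "oscillatory h \<epsilon> U \<longleftrightarrow>
    ((\<lambda>R::real. limsup (\<lambda>k. ennreal (h k ^ CARD('n)) *
        (\<integral>\<^sup>+ \<xi>\<in>(cellQ - ball 0 (h k / \<epsilon> k * R)).
           ennreal ((norm (lattice_fourier (U k) \<xi>))\<^sup>2) \<partial>lborel))) \<longlongrightarrow> 0) at_top"

definition compact_at_infinity ::
    "(nat \<Rightarrow> real) \<Rightarrow> (nat \<Rightarrow> int ^ 'n::finite \<Rightarrow> complex) \<Rightarrow> bool" where
  "compact_at_infinity h U \<longleftrightarrow>
    ((\<lambda>R::real. limsup (\<lambda>k. ennreal (h k ^ CARD('n)) *
        (\<Sum>\<^sub>\<infinity>n\<in>{n. norm (h k *\<^sub>R latt n) > R}. ennreal ((norm (U k n))\<^sup>2)))) \<longlongrightarrow> 0) at_top"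


section \<open>Measures, energy densities and Wigner measures\<close>

definition radon_measure :: "'a::euclidean_space measure \<Rightarrow> bool" where
  "radon_measure M \<longleftrightarrow>
    sets M = sets borel \<and> (\<forall>K. compact K \<longrightarrow> emeasure M K < \<infinity>)"

definition weakly_converges ::
    "(nat \<Rightarrow> 'a::euclidean_space measure) \<Rightarrow> 'a measure \<Rightarrow> bool" where
  "weakly_converges M N \<longleftrightarrow>
    (\<forall>k. radon_measure (M k)) \<and> radon_measure N \<and>
    (\<forall>f :: 'a \<Rightarrow> real. continuous_on UNIV f \<and> compact (closure {x. f x \<noteq> 0}) \<longrightarrow>
       (\<lambda>k. LINT x|M k. f x) \<longlonglongrightarrow> (LINT x|N. f x))"

text \<open>$E^h[U]=h^d\sum_n|U_n|^2\delta_{hn}$, as the image under $n\mapsto hn$ of a weighted counting measure.\<close>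

definition energy_measure ::
    "real \<Rightarrow> (int ^ 'n::finite \<Rightarrow> complex) \<Rightarrow> (real ^ 'n) measure" where
  "energy_measure h U =
    distr (density (count_space UNIV) (\<lambda>n. ennreal (h ^ CARD('n) * (norm (U n))\<^sup>2)))
      borel (\<lambda>n. h *\<^sub>R latt n)"

text \<open>
  $M^\varepsilon[U]$ as a functional: the factor $\delta_{hm}(x)$ evaluates the test function at
  $x=hm$, and the remaining $\xi$-dependent factor is integrated.
\<close>

definition wigner_transform ::
    "real \<Rightarrow> real \<Rightarrow> (int ^ 'n::finite \<Rightarrow> complex) \<Rightarrow> ((real ^ 'n) \<times> (real ^ 'n)) distribution" where
  "wigner_transform h \<epsilon> U = (\<lambda>a.
    complex_of_real (h ^ (2 * CARD('n)) / (2 * pi * \<epsilon>) ^ CARD('n)) *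
    (\<Sum>\<^sub>\<infinity>m. LINT \<xi>|lborel.
        cnj (U m) * lattice_fourier U ((h / \<epsilon>) *\<^sub>R \<xi>) * cis ((h / \<epsilon>) * (latt m \<bullet> \<xi>)) *
        a (h *\<^sub>R latt m, \<xi>)))"

definition wigner_measure ::
    "(nat \<Rightarrow> real) \<Rightarrow> (nat \<Rightarrow> real) \<Rightarrow> (nat \<Rightarrow> int ^ 'n::finite \<Rightarrow> complex) \<Rightarrow>
      ((real ^ 'n) \<times> (real ^ 'n)) measure \<Rightarrow> bool" where
  "wigner_measure h \<epsilon> U \<mu> \<longleftrightarrow>
    radon_measure \<mu> \<and>
    (\<exists>r :: nat \<Rightarrow> nat. strict_mono r \<and>
      (\<forall>a\<in>schwartz. integrable \<mu> a \<and>
        (\<lambda>k. wigner_transform (h (r k)) (\<epsilon> (r k)) (U (r k)) a) \<longlonglongrightarrow> (LINT z|\<mu>. a z)))"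

definition conditionC ::
    "real \<Rightarrow> (real ^ 'n::finite \<Rightarrow> complex) \<Rightarrow> (nat \<Rightarrow> real) \<Rightarrow>
      (nat \<Rightarrow> int ^ 'n \<Rightarrow> complex) \<Rightarrow> bool" where
  "conditionC s p h U \<longleftrightarrow>
    (\<forall>\<mu>. wigner_measure h h U \<mu> \<longrightarrow> emeasure \<mu> (UNIV \<times> closure (discont (tau s p))) = 0) \<and>
    compact_at_infinity h U"


section \<open>The operator $T_\varphi^h$\<close>

text \<open>
  The distribution $\varphi(x/h-a)$, by the change of variables $x=h(y+a)$.
\<close>

definition dist_rescale ::
    "real \<Rightarrow> 'a::euclidean_space \<Rightarrow> 'a distribution \<Rightarrow> 'a distribution" where
  "dist_rescale h a T = (\<lambda>f. complex_of_real (h ^ DIM('a)) * T (\<lambda>y. f (h *\<^sub>R (y + a))))"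

text \<open>
  The series converges in $\mathcal{S}'$: under (BP) the pairings of $\varphi(\cdot/h-n)$ with a fixed
  test function are Fourier coefficients of an $L^2(Q)$ function, hence square summable in $n$, so
  that the sum below is absolutely convergent for $U\in L^2(h\mathbb{Z}^d)$.
\<close>

definition T_op ::
    "real \<Rightarrow> (real ^ 'n::finite) distribution \<Rightarrow> (int ^ 'n \<Rightarrow> complex) \<Rightarrow> (real ^ 'n) distribution" where
  "T_op h \<phi> U = (\<lambda>f. \<Sum>\<^sub>\<infinity>n. U n * dist_rescale h (latt n) \<phi> f)"

end

theory Submission
  imports Defs "HOL-Probability.Probability"
begin

text \<open>
  Put \<open>q(\<xi>) = \<langle>\<xi>\<rangle>\<^sup>s \<phi>hat(\<xi>)\<close>. The Fourier transform of \<open>\<langle>hD\<rangle>\<^sup>s T\<^sub>\<phi> U\<close> is \<open>h\<^sup>d Uhat(h\<xi>) q(h\<xi>)\<close>.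
  As \<open>U\<close> oscillates at the scale \<open>\<epsilon>\<close>, which is much coarser than \<open>h\<close>, the mass of the periodic
  function \<open>Uhat\<close> concentrates at the points \<open>2\<pi>n\<close>, where \<open>q\<close> is continuous. If the tails of the
  series \<open>\<tau>\<close> are uniformly small near the origin, the density is therefore close in \<open>L\<^sup>2\<close> to the piecewise
  modulated function that equals \<open>U\<^sub>m \<Sum>\<^sub>n q(2\<pi>n) e(2\<pi>n\<cdot>x/h)\<close> (a finite sum over \<open>n\<close>) on the cell of \<open>hm\<close>,
  and by orthogonality the mass of the latter on each cell is \<open>h\<^sup>d \<bar>U\<^sub>m\<bar>\<^sup>2 \<Sum>\<^sub>n \<bar>q(2\<pi>n)\<bar>\<^sup>2\<close>.

  Condition (D) bounds the tails directly. Under (C), if \<open>\<nu> = 0\<close> then compactness at infinity sends the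
  total masses to zero. Otherwise \<open>\<nu>\<close> times the counting measure of the points \<open>2\<pi>n\<close> is a Wigner measure at scale
  \<open>h\<close>, so that (C) makes \<open>\<tau>\<close> continuous at the origin, and then the tails are small by comparison
  with finite partial sums.
\<close>

section \<open>Fourier analysis on Euclidean space, up to Fourier pairs in L2\<close>

subsection \<open>Schwartz functions\<close>

text \<open>Frequency estimates hold only in L2 and almost everywhere, while the limit constant
  reads values of q on the null set 2\<pi>Z^d; continuity of finite partial sums links the two. The
  comparison function must reproduce these values and keep the periodised error small near the
  origin. Cutting along cells achieves this: the transform \<open>chi\<close> of a box is 1 at 0 and
  0 at all other points 2\<pi>n, and Bessel's inequality bounds its periodised square by 1, so the
  terms off the origin sum to at most 1 - |\<open>chi\<close>|^2, which is small nearby. What (C)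
  has to yield is continuity of \<tau> at 0. The Wigner measure found charges R^d x {0} with a copy
  of \<nu>, so 0 cannot lie in the closure of the discontinuity set. Identifying that measure takes
  Poisson summation for Schwartz functions, which the sequence itself supplies: it varies slowly on
  the lattice, hence one and the same correlation has a limit computed in physical space and another
  computed in frequency, and nonvanishing masses force the two constants to agree. Plancherel enters
  as an inequality with twice the sharp constant, which is harmless because it only multiplies
  errors that tend to 0.\<close>

definition dirderiv :: "'a::euclidean_space \<Rightarrow> ('a \<Rightarrow> complex) \<Rightarrow> 'a \<Rightarrow> complex" where
  "dirderiv b f = (\<lambda>x. frechet_derivative f (at x) b)"

lemma iter_deriv_append: "iter_deriv (vs @ ws) f = iter_deriv vs (iter_deriv ws f)"
  by (induction vs) auto

lemma iter_deriv_snoc: "iter_deriv (vs @ [b]) f = iter_deriv vs (dirderiv b f)"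
  by (simp add: iter_deriv_append dirderiv_def)

text \<open>All iterated derivatives of a member of \<open>C\<close> are again members, so
  zeroth-order decay of the class controls every seminorm. Each closure property of the Schwartz
  space then reduces to exhibiting a class that is stable under partial differentiation, and no
  higher derivative is ever expanded.\<close>

lemma schwartz_coinduct [consumes 1, case_names decay step]:
  fixes f :: "'a::euclidean_space \<Rightarrow> complex"
  assumes fC: "f \<in> C"
    and bd: "\<And>f N. f \<in> C \<Longrightarrow> \<exists>K. \<forall>x. (1 + norm x) ^ N * norm (f x) \<le> K"
    and st: "\<And>f. f \<in> C \<Longrightarrow>
      \<exists>D. (\<forall>x. (f has_derivative D x) (at x)) \<and> (\<forall>b\<in>Basis. (\<lambda>x. D x b) \<in> C)"
  shows "f \<in> schwartz"
proof -
  have it: "iter_deriv vs f \<in> C" if "set vs \<subseteq> Basis" for vs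
    using that
  proof (induction vs)
    case Nil
    then show ?case using fC by simp
  next
    case (Cons b vs)
    then have "iter_deriv vs f \<in> C" and b: "b \<in> Basis" by auto
    then obtain D where D: "\<forall>x. (iter_deriv vs f has_derivative D x) (at x)"
      and DC: "(\<lambda>x. D x b) \<in> C"
      using st by blast
    have "frechet_derivative (iter_deriv vs f) (at x) = D x" for x
      using D frechet_derivative_at by metis
    then show ?case using DC by simp
  qed
  have "smooth f"
    unfolding smooth_def using it st differentiable_def by metis
  moreover have "bdd_above (schwartz_values N f)" for N
  proof -
    let ?L = "{vs. set vs \<subseteq> (Basis :: 'a set) \<and> length vs \<le> N}"
    have fin: "finite ?L" by (rule finite_lists_length_le) simp
    have "\<forall>vs\<in>?L. \<exists>K. \<forall>x. (1 + norm x) ^ N * norm (iter_deriv vs f x) \<le> K"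
      using bd it by blast
    then obtain K where K: "\<And>vs x. vs \<in> ?L \<Longrightarrow> (1 + norm x) ^ N * norm (iter_deriv vs f x) \<le> K vs"
      by metis
    have K0: "0 \<le> K vs" if "vs \<in> ?L" for vs
      by (rule order_trans[OF _ K[OF that, of 0]]) simp
    show ?thesis
    proof (rule bdd_aboveI)
      fix y assume "y \<in> schwartz_values N f"
      then obtain vs x where y: "y = (1 + norm x) ^ N * norm (iter_deriv vs f x)" and vs: "vs \<in> ?L"
        by (auto simp: schwartz_values_def)
      have "K vs \<le> (\<Sum>vs\<in>?L. K vs)"
        by (rule member_le_sum) (use vs K0 fin in auto)
      then show "y \<le> (\<Sum>vs\<in>?L. K vs)"
        using K[OF vs, of x] y by linarith
    qed
  qed
  ultimately show ?thesis by (simp add: schwartz_def)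
qed

lemma schwartz_decay:
  assumes "f \<in> schwartz"
  shows "\<exists>K. \<forall>x. (1 + norm x) ^ N * norm (f x) \<le> K"
proof -
  have "bdd_above (schwartz_values N f)" using assms by (simp add: schwartz_def)
  then obtain K where K: "\<And>y. y \<in> schwartz_values N f \<Longrightarrow> y \<le> K" by (auto simp: bdd_above_def)
  have "(1 + norm x) ^ N * norm (f x) \<in> schwartz_values N f" for x
    unfolding schwartz_values_def by (intro CollectI exI[of _ "[]"] exI[of _ x]) simp
  then show ?thesis using K by blast
qed

lemma schwartz_decay':
  assumes "f \<in> schwartz"
  obtains K where "K > 0" "\<And>x. norm (f x) \<le> K / (1 + norm x) ^ N"
proof -
  obtain K where K: "\<And>x. (1 + norm x) ^ N * norm (f x) \<le> K" using schwartz_decay[OF assms] by blast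
  have p: "(1 + norm x) ^ N > 0" for x :: 'a
    by (rule zero_less_power) (use norm_ge_zero[of x] in linarith)
  have "norm (f x) \<le> (\<bar>K\<bar> + 1) / (1 + norm x) ^ N" for x
    using K[of x] p[of x] by (simp add: pos_le_divide_eq mult.commute) 
  then show ?thesis using that[of "\<bar>K\<bar> + 1"] by auto
qed

lemma schwartz_has_derivative:
  assumes "f \<in> schwartz"
  shows "(f has_derivative frechet_derivative f (at x)) (at x)"
proof -
  have "smooth f" using assms by (simp add: schwartz_def)
  then have "iter_deriv [] f differentiable (at x)" unfolding smooth_def by (metis empty_subsetI list.set(1))
  then show ?thesis using frechet_derivative_works by auto
qed

text \<open>Differentiating beforehand appends a direction at the inner end of the list, so the
  seminorm of index \<open>N\<close> of the derivative lies below the one of index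
  \<open>Suc N\<close> of \<open>f\<close>, which allows both a longer list and a larger
  weight.\<close>

lemma schwartz_dirderiv:
  assumes f: "f \<in> schwartz" and b: "b \<in> Basis"
  shows "dirderiv b f \<in> schwartz"
proof -
  have sm: "smooth f" using f by (simp add: schwartz_def)
  have "smooth (dirderiv b f)"
    unfolding smooth_def
  proof (intro allI impI)
    fix vs x assume "set vs \<subseteq> (Basis :: 'a set)"
    then have "set (vs @ [b]) \<subseteq> Basis" using b by auto
    then show "iter_deriv vs (dirderiv b f) differentiable (at x)"
      using sm unfolding smooth_def iter_deriv_snoc[symmetric] by blast
  qed
  moreover have "bdd_above (schwartz_values N (dirderiv b f))" for N
  proof -
    have "bdd_above (schwartz_values (Suc N) f)" using f by (simp add: schwartz_def)
    then obtain K where K: "\<And>y. y \<in> schwartz_values (Suc N) f \<Longrightarrow> y \<le> K" by (auto simp: bdd_above_def)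
    show ?thesis
    proof (rule bdd_aboveI)
      fix y assume "y \<in> schwartz_values N (dirderiv b f)"
      then obtain vs x where y: "y = (1 + norm x) ^ N * norm (iter_deriv (vs @ [b]) f x)"
        and vs: "set vs \<subseteq> Basis" "length vs \<le> N"
        by (auto simp: schwartz_values_def iter_deriv_snoc)
      have "(1 + norm x) ^ Suc N * norm (iter_deriv (vs @ [b]) f x) \<in> schwartz_values (Suc N) f"
        unfolding schwartz_values_def using vs b
        by (intro CollectI exI[of _ "vs @ [b]"] exI[of _ x]) simp
      then have "(1 + norm x) ^ Suc N * norm (iter_deriv (vs @ [b]) f x) \<le> K" by (rule K)
      moreover have "(1 + norm x) ^ N \<le> (1 + norm x) ^ Suc N"
        by (rule power_increasing) auto
      then have "y \<le> (1 + norm x) ^ Suc N * norm (iter_deriv (vs @ [b]) f x)"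
        unfolding y by (rule mult_right_mono) simp
      ultimately show "y \<le> K" by linarith
    qed
  qed
  ultimately show ?thesis by (simp add: schwartz_def)
qed

lemma schwartz_derivative:
  assumes "f \<in> schwartz"
  shows "\<exists>D. (\<forall>x. (f has_derivative D x) (at x)) \<and> (\<forall>b\<in>Basis. (\<lambda>x. D x b) \<in> schwartz)"
  using schwartz_has_derivative[OF assms] schwartz_dirderiv[OF assms, unfolded dirderiv_def]
  by (intro exI[of _ "\<lambda>x. frechet_derivative f (at x)"]) auto

lemma schwartz_continuous:
  assumes "f \<in> schwartz"
  shows "continuous_on UNIV f"
  by (meson assms continuous_at_imp_continuous_on has_derivative_continuous schwartz_has_derivative)

lemma schwartz_measurable:
  assumes "f \<in> schwartz"
  shows "f \<in> borel_measurable borel"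
  by (rule borel_measurable_continuous_onI[OF schwartz_continuous[OF assms]])

subsection \<open>Smooth multipliers of polynomial growth\<close>

text \<open>An inductively generated class of multipliers: characters, coordinates and powers of the
  Japanese bracket are the ones that occur, and closure under sums and products makes the class
  stable under partial differentiation.\<close>

inductive_set symbols :: "('a::euclidean_space \<Rightarrow> complex) set" where
  const: "(\<lambda>x. c) \<in> symbols"
| inner: "(\<lambda>x. complex_of_real (x \<bullet> a)) \<in> symbols"
| cis: "(\<lambda>x. cis (x \<bullet> a)) \<in> symbols"
| jap: "(\<lambda>x. complex_of_real (japanese x powr r)) \<in> symbols"
| add: "f \<in> symbols \<Longrightarrow> g \<in> symbols \<Longrightarrow> (\<lambda>x. f x + g x) \<in> symbols"
| mult: "f \<in> symbols \<Longrightarrow> g \<in> symbols \<Longrightarrow> (\<lambda>x. f x * g x) \<in> symbols"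

lemma japanese_ge_1: "1 \<le> japanese x"
  by (simp add: japanese_def)

lemma japanese_pos: "0 < japanese x"
  using japanese_ge_1[of x] by linarith

lemma japanese_le: "japanese x \<le> 1 + norm x"
  unfolding japanese_def by (rule real_le_lsqrt) (auto simp: power2_eq_square algebra_simps)

lemma japanese_powr_eq: "japanese x powr r = (1 + x \<bullet> x) powr (r / 2)"
proof -
  have "0 \<le> 1 + x \<bullet> x" by (simp add: add_nonneg_nonneg)
  then show ?thesis
    by (simp add: japanese_def power2_norm_eq_inner powr_half_sqrt[symmetric] powr_powr)
qed

text \<open>Written as a power of the positive polynomial 1 + x \<bullet> x, the bracket is
  differentiated without touching the norm, which is not smooth at 0. The result is a linear
  function times a bracket power of exponent r - 2, hence again a symbol.\<close>

lemma japanese_powr_has_derivative: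
  fixes x :: "'a::euclidean_space"
  shows "((\<lambda>x. japanese x powr r) has_derivative (\<lambda>v. r * (x \<bullet> v) * japanese x powr (r - 2))) (at x)"
proof -
  have p: "1 + x \<bullet> x > 0"
    by (rule add_pos_nonneg) auto
  have "((\<lambda>x. (1 + x \<bullet> x) powr (r / 2)) has_derivative
      (\<lambda>v. r * (x \<bullet> v) * (1 + x \<bullet> x) powr ((r - 2) / 2))) (at x)"
  proof (rule has_derivative_eq_rhs)
    show "((\<lambda>x. (1 + x \<bullet> x) powr (r / 2)) has_derivative
       (\<lambda>v. (1 + x \<bullet> x) powr (r / 2) * (0 * ln (1 + x \<bullet> x) + (x \<bullet> v + v \<bullet> x) * (r / 2) / (1 + x \<bullet> x)))) (at x)"
      by (rule has_derivative_powr[OF _ has_derivative_const]) (use p in \<open>auto intro!: derivative_eq_intros\<close>)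
    show "(\<lambda>v. (1 + x \<bullet> x) powr (r / 2) * (0 * ln (1 + x \<bullet> x) + (x \<bullet> v + v \<bullet> x) * (r / 2) / (1 + x \<bullet> x))) =
        (\<lambda>v. r * (x \<bullet> v) * (1 + x \<bullet> x) powr ((r - 2) / 2))"
    proof -
      have "(1 + x \<bullet> x) powr ((r - 2) / 2) = (1 + x \<bullet> x) powr (r / 2) / (1 + x \<bullet> x)"
        using p by (simp add: diff_divide_distrib powr_diff)
      then show ?thesis using p by (auto simp: fun_eq_iff inner_commute field_simps)
    qed
  qed
  then show ?thesis by (simp only: japanese_powr_eq)
qed

lemma symbols_derivative:
  assumes "m \<in> symbols"
  shows "\<exists>D. (\<forall>x. (m has_derivative D x) (at x)) \<and> (\<forall>b. (\<lambda>x. D x b) \<in> symbols)"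
  using assms
proof induction
  case (const c)
  show ?case by (rule exI[of _ "\<lambda>x v. 0"]) (auto intro: symbols.const)
next
  case (inner a)
  show ?case
    by (rule exI[of _ "\<lambda>x v. complex_of_real (v \<bullet> a)"])
       (auto intro!: symbols.const derivative_eq_intros)
next
  case (cis a)
  have "((\<lambda>x. cis (x \<bullet> a)) has_derivative (\<lambda>v. (\<i> * complex_of_real (v \<bullet> a)) * cis (x \<bullet> a))) (at x)" for x :: 'a
  proof -
    have "((\<lambda>x. exp (\<i> * complex_of_real (x \<bullet> a))) has_derivative
        (\<lambda>v. exp (\<i> * complex_of_real (x \<bullet> a)) * (\<i> * complex_of_real (v \<bullet> a)))) (at x)"
      by (rule has_derivative_compose[OF _ DERIV_exp[unfolded has_field_derivative_def]])
         (auto intro!: derivative_eq_intros)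
    then show ?thesis by (simp add: cis_conv_exp mult.commute)
  qed
  then show ?case
    by (intro exI[of _ "\<lambda>x v. (\<i> * complex_of_real (v \<bullet> a)) * cis (x \<bullet> a)"])
       (auto intro: symbols.intros)
next
  case (jap r)
  have "((\<lambda>x. complex_of_real (japanese x powr r)) has_derivative
      (\<lambda>v. complex_of_real r * complex_of_real (x \<bullet> v) * complex_of_real (japanese x powr (r - 2)))) (at x)" for x :: 'a
    using has_derivative_of_real[OF japanese_powr_has_derivative[of r x]] by simp
  moreover have "(\<lambda>x. complex_of_real r * complex_of_real (x \<bullet> b) * complex_of_real (japanese x powr (r - 2))) \<in> symbols" for b :: 'a
    by (intro symbols.mult symbols.const symbols.inner symbols.jap)
  ultimately show ?case
    by (intro exI[of _ "\<lambda>x v. complex_of_real r * complex_of_real (x \<bullet> v) * complex_of_real (japanese x powr (r - 2))"])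
       auto
next
  case (add f g)
  then obtain D E where D: "\<forall>x. (f has_derivative D x) (at x)" "\<forall>b. (\<lambda>x. D x b) \<in> symbols"
    and E: "\<forall>x. (g has_derivative E x) (at x)" "\<forall>b. (\<lambda>x. E x b) \<in> symbols" by blast
  show ?case
    by (rule exI[of _ "\<lambda>x v. D x v + E x v"]) (use D E in \<open>auto intro!: symbols.add has_derivative_add\<close>)
next
  case (mult f g)
  then obtain D E where D: "\<forall>x. (f has_derivative D x) (at x)" "\<forall>b. (\<lambda>x. D x b) \<in> symbols"
    and E: "\<forall>x. (g has_derivative E x) (at x)" "\<forall>b. (\<lambda>x. E x b) \<in> symbols" by blast
  show ?case
    by (rule exI[of _ "\<lambda>x v. f x * E x v + D x v * g x"])
       (use D E mult.hyps in \<open>auto intro!: symbols.add symbols.mult has_derivative_mult\<close>)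
qed

lemma symbols_bound:
  assumes "m \<in> symbols"
  shows "\<exists>K N. \<forall>x. norm (m x) \<le> K * (1 + norm x) ^ N"
  using assms
proof induction
  case (const c)
  show ?case by (rule exI[of _ "norm c"], rule exI[of _ 0]) auto
next
  case (inner a)
  have "norm (x \<bullet> a) \<le> norm a * (1 + norm x) ^ 1" for x
  proof -
    have "\<bar>x \<bullet> a\<bar> \<le> norm a * norm x" using Cauchy_Schwarz_ineq2[of x a] by (simp add: mult.commute)
    then show ?thesis
      using norm_ge_zero[of a] unfolding distrib_left power_one_right mult_1_right real_norm_def by linarith
  qed
  then show ?case by (metis norm_of_real real_norm_def)
next
  case (cis a)
  show ?case by (rule exI[of _ 1], rule exI[of _ 0]) auto
next
  case (jap r)
  have "japanese x powr r \<le> 1 * (1 + norm x) ^ nat \<lceil>\<bar>r\<bar>\<rceil>" for x :: 'a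
  proof -
    \<comment> \<open>The bracket is at least 1, so the exponent may be raised to the integer above
      |r|; this covers negative r too.\<close>
    have "japanese x powr r \<le> japanese x powr real (nat \<lceil>\<bar>r\<bar>\<rceil>)"
      by (rule powr_mono) (use japanese_ge_1[of x] in linarith)+
    also have "\<dots> = japanese x ^ nat \<lceil>\<bar>r\<bar>\<rceil>"
      by (rule powr_realpow[OF japanese_pos])
    also have "\<dots> \<le> (1 + norm x) ^ nat \<lceil>\<bar>r\<bar>\<rceil>"
      by (rule power_mono[OF japanese_le]) (use japanese_ge_1[of x] in linarith)
    finally show ?thesis by simp
  qed
  then show ?case
    by (intro exI[of _ 1] exI[of _ "nat \<lceil>\<bar>r\<bar>\<rceil>"]) (auto simp del: mult_1)
next
  case (add f g)
  then obtain K N L M where K: "\<And>x. norm (f x) \<le> K * (1 + norm x) ^ N"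
    and L: "\<And>x. norm (g x) \<le> L * (1 + norm x) ^ M" by blast
  have "norm (f x + g x) \<le> (\<bar>K\<bar> + \<bar>L\<bar>) * (1 + norm x) ^ max N M" for x
  proof -
    have "(1 + norm x) ^ N \<le> (1 + norm x) ^ max N M" "(1 + norm x) ^ M \<le> (1 + norm x) ^ max N M"
      by (rule power_increasing; simp)+
    then have "K * (1 + norm x) ^ N \<le> \<bar>K\<bar> * (1 + norm x) ^ max N M" "L * (1 + norm x) ^ M \<le> \<bar>L\<bar> * (1 + norm x) ^ max N M"
      by (intro mult_mono; simp)+
    then show ?thesis
      using K[of x] L[of x] norm_triangle_ineq[of "f x" "g x"] by (simp add: distrib_right)
  qed
  then show ?case by blast
next
  case (mult f g)
  then obtain K N L M where K: "\<And>x. norm (f x) \<le> K * (1 + norm x) ^ N"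
    and L: "\<And>x. norm (g x) \<le> L * (1 + norm x) ^ M" by blast
  have "norm (f x * g x) \<le> (K * L) * (1 + norm x) ^ (N + M)" for x
    using mult_mono[OF K[of x] L[of x] order_trans[OF norm_ge_zero K[of x]]]
    by (simp add: norm_mult power_add algebra_simps)
  then show ?case by blast
qed

text \<open>Single products of a symbol and a Schwartz function are not stable under
  differentiation, since the Leibniz rule produces a sum of two; finite sums of them are.\<close>

inductive_set symspan :: "('a::euclidean_space \<Rightarrow> complex) set" where
  prod: "m \<in> symbols \<Longrightarrow> f \<in> schwartz \<Longrightarrow> (\<lambda>x. m x * f x) \<in> symspan"
| add: "f \<in> symspan \<Longrightarrow> g \<in> symspan \<Longrightarrow> (\<lambda>x. f x + g x) \<in> symspan"

lemma symspan_schwartz: "f \<in> symspan \<Longrightarrow> f \<in> schwartz"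
proof (induction rule: schwartz_coinduct[where C = symspan])
  case (decay f N)
  then show ?case
  proof induction
    case (prod m f)
    obtain K M where K: "\<And>x. norm (m x) \<le> K * (1 + norm x) ^ M" using symbols_bound[OF prod(1)] by blast
    obtain L where L: "\<And>x. (1 + norm x) ^ (N + M) * norm (f x) \<le> L" using schwartz_decay[OF prod(2)] by blast
    have K0: "0 \<le> K" using order_trans[OF norm_ge_zero K[of 0]] by simp
    have "(1 + norm x) ^ N * norm (m x * f x) \<le> K * L" for x
    proof -
      have "(1 + norm x) ^ N * norm (m x * f x) = norm (m x) * ((1 + norm x) ^ N * norm (f x))"
        by (simp add: norm_mult)
      also have "\<dots> \<le> (K * (1 + norm x) ^ M) * ((1 + norm x) ^ N * norm (f x))"
        by (rule mult_right_mono[OF K]) simp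
      also have "\<dots> = K * ((1 + norm x) ^ (N + M) * norm (f x))" by (simp add: power_add)
      also have "\<dots> \<le> K * L" by (rule mult_left_mono[OF L K0])
      finally show ?thesis .
    qed
    then show ?case by blast
  next
    case (add f g)
    then obtain K L where "\<And>x. (1 + norm x) ^ N * norm (f x) \<le> K" "\<And>x. (1 + norm x) ^ N * norm (g x) \<le> L" by blast
    moreover have "(1 + norm x) ^ N * norm (f x + g x) \<le> (1 + norm x) ^ N * norm (f x) + (1 + norm x) ^ N * norm (g x)" for x
      by (simp add: distrib_left[symmetric] mult_left_mono norm_triangle_ineq)
    ultimately have "(1 + norm x) ^ N * norm (f x + g x) \<le> K + L" for x by (smt (verit, best))
    then show ?case by blast
  qed
next
  case (step f)
  then show ?case
  proof induction
    case (prod m f)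
    obtain D where D: "\<forall>x. (m has_derivative D x) (at x)" "\<forall>b. (\<lambda>x. D x b) \<in> symbols"
      using symbols_derivative[OF prod(1)] by blast
    obtain E where E: "\<forall>x. (f has_derivative E x) (at x)" "\<forall>b\<in>Basis. (\<lambda>x. E x b) \<in> schwartz"
      using schwartz_derivative[OF prod(2)] by blast
    show ?case
      by (rule exI[of _ "\<lambda>x v. m x * E x v + D x v * f x"])
         (use D E prod in \<open>auto intro!: symspan.add symspan.prod has_derivative_mult\<close>)
  next
    case (add f g)
    then obtain D E where D: "\<forall>x. (f has_derivative D x) (at x)" "\<forall>b\<in>Basis. (\<lambda>x. D x b) \<in> symspan"
      and E: "\<forall>x. (g has_derivative E x) (at x)" "\<forall>b\<in>Basis. (\<lambda>x. E x b) \<in> symspan" by blast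
    show ?case
      by (rule exI[of _ "\<lambda>x v. D x v + E x v"]) (use D E in \<open>auto intro!: symspan.add has_derivative_add\<close>)
  qed
qed

lemma schwartz_symbol_mult: "m \<in> symbols \<Longrightarrow> f \<in> schwartz \<Longrightarrow> (\<lambda>x. m x * f x) \<in> schwartz"
  by (rule symspan_schwartz[OF symspan.prod])

lemma schwartz_cmult: "f \<in> schwartz \<Longrightarrow> (\<lambda>x. c * f x) \<in> schwartz"
  by (rule schwartz_symbol_mult[OF symbols.const])

lemma schwartz_add:
  assumes "f \<in> schwartz" "g \<in> schwartz"
  shows "(\<lambda>x. f x + g x) \<in> schwartz"
proof -
  have "(\<lambda>x. 1 * f x + 1 * g x) \<in> symspan"
    by (intro symspan.add symspan.prod symbols.const assms)
  then show ?thesis using symspan_schwartz by force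
qed

lemma schwartz_0: "(\<lambda>x. 0) \<in> schwartz"
  by (rule schwartz_coinduct[where C = "{\<lambda>x. 0}"]) (auto intro!: exI[of _ "\<lambda>x v. 0"])

lemma schwartz_sum:
  "(\<And>i. i \<in> I \<Longrightarrow> f i \<in> schwartz) \<Longrightarrow> (\<lambda>x. \<Sum>i\<in>I. f i x) \<in> schwartz"
  by (induction I rule: infinite_finite_induct) (auto intro: schwartz_0 schwartz_add)

text \<open>All dilates by the same c form a class stable under differentiation, because the inner
  factor c is absorbed into the function being dilated. The weights compare through 1 + |x| \<le>
  max(1, 1/|c|) (1 + |cx|).\<close>

lemma schwartz_scale:
  assumes f: "f \<in> schwartz" and c: "c \<noteq> 0"
  shows "(\<lambda>x. f (c *\<^sub>R x)) \<in> schwartz"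
proof -
  have "(\<lambda>x. f (c *\<^sub>R x)) \<in> {\<lambda>x. f (c *\<^sub>R x) | f. f \<in> schwartz}" using f by blast
  then show ?thesis
  proof (induction rule: schwartz_coinduct)
    case (decay g N)
    then obtain f where g: "g = (\<lambda>x. f (c *\<^sub>R x))" and f: "f \<in> schwartz" by blast
    obtain K where K: "\<And>x. (1 + norm x) ^ N * norm (f x) \<le> K" using schwartz_decay[OF f] by blast
    let ?m = "max 1 (1 / \<bar>c\<bar>)"
    have "(1 + norm x) ^ N * norm (g x) \<le> ?m ^ N * K" for x
    proof -
      have "norm x = (1 / \<bar>c\<bar>) * norm (c *\<^sub>R x)" using c by simp
      also have "\<dots> \<le> ?m * norm (c *\<^sub>R x)" by (rule mult_right_mono) auto
      finally have "1 + norm x \<le> ?m * (1 + norm (c *\<^sub>R x))" by (simp add: distrib_left add_mono)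
      then have "(1 + norm x) ^ N \<le> ?m ^ N * (1 + norm (c *\<^sub>R x)) ^ N"
        using power_mono[of "1 + norm x" _ N] by (fastforce simp: power_mult_distrib)
      then have "(1 + norm x) ^ N * norm (g x) \<le> ?m ^ N * ((1 + norm (c *\<^sub>R x)) ^ N * norm (f (c *\<^sub>R x)))"
        unfolding g mult.assoc[symmetric] by (rule mult_right_mono) simp
      also have "\<dots> \<le> ?m ^ N * K" by (rule mult_left_mono[OF K]) simp
      finally show ?thesis .
    qed
    then show ?case by blast
  next
    case (step g)
    then obtain f where g: "g = (\<lambda>x. f (c *\<^sub>R x))" and f: "f \<in> schwartz" by blast
    obtain E where E: "\<And>x. (f has_derivative E x) (at x)" "\<forall>b\<in>Basis. (\<lambda>x. E x b) \<in> schwartz"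
      using schwartz_derivative[OF f] by blast
    have "(g has_derivative (\<lambda>v. c * E (c *\<^sub>R x) v)) (at x)" for x
    proof -
      have "((\<lambda>x. f (c *\<^sub>R x)) has_derivative (\<lambda>v. E (c *\<^sub>R x) (c *\<^sub>R v))) (at x)"
        by (rule has_derivative_compose[OF _ E(1)]) (auto intro!: derivative_eq_intros)
      moreover have "E (c *\<^sub>R x) (c *\<^sub>R v) = c * E (c *\<^sub>R x) v" for v
        using linear_scale[OF has_derivative_linear[OF E(1)], of "c *\<^sub>R x" c v] by (simp add: scaleR_conv_of_real)
      ultimately show ?thesis by (simp add: g)
    qed
    moreover have "(\<lambda>x. c * E (c *\<^sub>R x) b) \<in> {\<lambda>x. f (c *\<^sub>R x) | f. f \<in> schwartz}" if "b \<in> Basis" for b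
    proof -
      have "(\<lambda>x. c * E x b) \<in> schwartz" using E that schwartz_cmult by blast
      then show ?thesis by (intro CollectI exI[of _ "\<lambda>x. c * E x b"]) simp
    qed
    ultimately show ?case by (intro exI[of _ "\<lambda>x v. c * E (c *\<^sub>R x) v"]) blast
  qed
qed

section \<open>The Gaussian as a Schwartz function\<close>

definition gauss :: "'a::euclidean_space \<Rightarrow> complex" where
  "gauss x = complex_of_real (exp (- (x \<bullet> x) / 2))"

text \<open>With r = |x|, one term of the exponential series gives (1 + r)^N \<le> N! exp(1 + r),
  and 1 + r - r^2/2 \<le> 3/2 by completing the square at r = 1.\<close>

lemma gauss_decay: "\<exists>K. \<forall>x::'a::euclidean_space. (1 + norm x) ^ N * norm (gauss x) \<le> K"
proof -
  have "(1 + norm x) ^ N * norm (gauss x) \<le> fact N * exp (3 / 2)" for x :: 'a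
  proof -
    have "(1 + norm x) ^ N / fact N \<le> exp (1 + norm x)"
    proof -
      have "(\<Sum>k\<in>{N}. (1 + norm x) ^ k /\<^sub>R fact k) \<le> (\<Sum>k. (1 + norm x) ^ k /\<^sub>R fact k)"
        by (rule sum_le_suminf[OF summable_exp_generic]) auto
      then show ?thesis by (simp add: exp_def field_simps)
    qed
    then have "(1 + norm x) ^ N \<le> fact N * exp (1 + norm x)" by (simp add: field_simps)
    then have "(1 + norm x) ^ N * norm (gauss x) \<le> fact N * exp (1 + norm x) * exp (- (x \<bullet> x) / 2)"
      unfolding gauss_def by (simp add: mult_right_mono)
    also have "\<dots> = fact N * exp (1 + norm x - (x \<bullet> x) / 2)" by (simp add: exp_add[symmetric])
    also have "1 + norm x - (x \<bullet> x) / 2 \<le> 3 / 2"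
      using zero_le_power2[of "norm x - 1"] unfolding power2_norm_eq_inner[symmetric]
      by (simp add: power2_eq_square algebra_simps)
    then have "fact N * exp (1 + norm x - (x \<bullet> x) / 2) \<le> fact N * exp (3 / 2)" by simp
    finally show ?thesis .
  qed
  then show ?thesis by blast
qed

text \<open>The stable class consists of all symbols times the Gaussian: a derivative falling on the
  Gaussian only produces a linear factor.\<close>

lemma gauss_schwartz: "gauss \<in> schwartz"
proof -
  have "gauss \<in> {\<lambda>x. m x * gauss x | m. m \<in> symbols}"
    using symbols.const[of 1] by force
  then show ?thesis
  proof (induction rule: schwartz_coinduct)
    case (decay f N)
    then obtain m where f: "f = (\<lambda>x. m x * gauss x)" and m: "m \<in> symbols" by blast
    obtain K M where K: "\<And>x. norm (m x) \<le> K * (1 + norm x) ^ M" using symbols_bound[OF m] by blast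
    obtain L where L: "\<And>x :: 'a. (1 + norm x) ^ (N + M) * norm (gauss x) \<le> L" using gauss_decay by blast
    have K0: "0 \<le> K" using order_trans[OF norm_ge_zero K[of 0]] by simp
    have "(1 + norm x) ^ N * norm (f x) \<le> K * L" for x
    proof -
      have "(1 + norm x) ^ N * norm (f x) = norm (m x) * ((1 + norm x) ^ N * norm (gauss x))"
        by (simp add: f norm_mult)
      also have "\<dots> \<le> (K * (1 + norm x) ^ M) * ((1 + norm x) ^ N * norm (gauss x))"
        by (rule mult_right_mono[OF K]) simp
      also have "\<dots> = K * ((1 + norm x) ^ (N + M) * norm (gauss x))" by (simp add: power_add)
      also have "\<dots> \<le> K * L" by (rule mult_left_mono[OF L K0])
      finally show ?thesis .
    qed
    then show ?case by blast
  next
    case (step f)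
    then obtain m where f: "f = (\<lambda>x. m x * gauss x)" and m: "m \<in> symbols" by blast
    obtain D where D: "\<And>x. (m has_derivative D x) (at x)" "\<And>b. (\<lambda>x. D x b) \<in> symbols"
      using symbols_derivative[OF m] by blast
    have g: "(gauss has_derivative (\<lambda>v. - complex_of_real (x \<bullet> v) * gauss x)) (at x)" for x :: 'a
    proof -
      have "((\<lambda>x. exp (- (x \<bullet> x) / 2)) has_derivative (\<lambda>v. - (x \<bullet> v) * exp (- (x \<bullet> x) / 2))) (at x)"
        by (auto intro!: derivative_eq_intros simp: inner_commute)
      from has_derivative_of_real[OF this] show ?thesis
        unfolding gauss_def[abs_def] by simp
    qed
    have "(f has_derivative (\<lambda>v. (m x * (- complex_of_real (x \<bullet> v)) + D x v) * gauss x)) (at x)" for x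
      unfolding f
      by (rule has_derivative_eq_rhs[OF has_derivative_mult[OF D(1) g]]) (auto simp: fun_eq_iff algebra_simps)
    moreover have "(\<lambda>x. m x * (- complex_of_real (x \<bullet> b)) + D x b) \<in> symbols" for b
    proof -
      have "(\<lambda>x. m x * ((-1) * complex_of_real (x \<bullet> b)) + D x b) \<in> symbols"
        by (intro symbols.intros m D)
      then show ?thesis by simp
    qed
    then have "(\<lambda>x. (m x * (- complex_of_real (x \<bullet> b)) + D x b) * gauss x) \<in> {\<lambda>x. m x * gauss x | m. m \<in> symbols}" for b
      by (intro CollectI exI[of _ "\<lambda>x. m x * (- complex_of_real (x \<bullet> b)) + D x b"]) simp
    ultimately show ?case
      by (intro exI[of _ "\<lambda>x v. (m x * (- complex_of_real (x \<bullet> v)) + D x v) * gauss x"]) blast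
  qed
qed

subsection \<open>Integrability\<close>

text \<open>Each 1 + (x \<bullet> b)^2 is at most (1 + |x|)^2, so the product over the d basis
  vectors lies below (1 + |x|)^(2d) and the integral factors into one-dimensional arctangent
  integrals. This is the origin of the exponent 2d used for decay throughout.\<close>

lemma integrable_decay:
  "integrable lborel (\<lambda>x::'a::euclidean_space. 1 / (1 + norm x) ^ (2 * DIM('a)))"
proof (rule integrableI_bounded)
  have "(\<integral>\<^sup>+ x. ennreal (norm (1 / (1 + norm x) ^ (2 * DIM('a)))) \<partial>(lborel :: 'a measure))
      \<le> (\<integral>\<^sup>+ x. (\<Prod>b\<in>Basis. ennreal (inverse (1 + (x \<bullet> b)\<^sup>2))) \<partial>(lborel :: 'a measure))"
  proof (rule nn_integral_mono)
    fix x :: 'a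
    have 1: "1 + (x \<bullet> b)\<^sup>2 \<le> (1 + norm x)\<^sup>2" if "b \<in> Basis" for b
    proof -
      have "(x \<bullet> b)\<^sup>2 \<le> (norm x)\<^sup>2" using power_mono[OF Basis_le_norm[OF that, of x], of 2] by simp
      moreover have "(1 + norm x)\<^sup>2 = 1 + 2 * norm x + (norm x)\<^sup>2" by (simp add: power2_sum)
      ultimately show ?thesis using norm_ge_zero[of x] by linarith
    qed
    have pos: "0 < 1 + (x \<bullet> b)\<^sup>2" for b by (simp add: add_pos_nonneg)
    have "norm (1 / (1 + norm x) ^ (2 * DIM('a))) = (\<Prod>b\<in>(Basis::'a set). inverse ((1 + norm x)\<^sup>2))"
      by (simp add: power_mult power_inverse[symmetric] inverse_eq_divide power_one_over)
    also have "\<dots> \<le> (\<Prod>b\<in>Basis. inverse (1 + (x \<bullet> b)\<^sup>2))"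
      by (rule prod_mono) (use 1 pos in \<open>auto intro!: le_imp_inverse_le\<close>)
    finally have "ennreal (norm (1 / (1 + norm x) ^ (2 * DIM('a)))) \<le> ennreal (\<Prod>b\<in>Basis. inverse (1 + (x \<bullet> b)\<^sup>2))"
      by (rule ennreal_leI)
    also have "\<dots> = (\<Prod>b\<in>Basis. ennreal (inverse (1 + (x \<bullet> b)\<^sup>2)))"
      by (rule prod_ennreal[symmetric]) (use pos in \<open>auto simp: less_imp_le\<close>)
    finally show "ennreal (norm (1 / (1 + norm x) ^ (2 * DIM('a)))) \<le> (\<Prod>b\<in>Basis. ennreal (inverse (1 + (x \<bullet> b)\<^sup>2)))" .
  qed
  also have "\<dots> = (\<Prod>b\<in>(Basis::'a set). (\<integral>\<^sup>+ t. ennreal (inverse (1 + t\<^sup>2)) \<partial>lborel))"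
    by (rule nn_integral_lborel_prod) auto
  also have "\<dots> < \<infinity>"
  proof -
    have "integrable lborel (\<lambda>x::real. inverse (1 + x\<^sup>2))"
      using integrable_inverse_1_plus_square by (simp add: set_integrable_def)
    then have "(\<integral>\<^sup>+ t. ennreal (norm (inverse (1 + t\<^sup>2))) \<partial>(lborel::real measure)) < \<infinity>"
      by (simp add: integrable_iff_bounded)
    then have "(\<integral>\<^sup>+ t. ennreal (inverse (1 + t\<^sup>2)) \<partial>(lborel::real measure)) < \<infinity>"
      by (simp add: add_nonneg_nonneg)
    then show ?thesis by (auto simp: ennreal_prod_eq_top less_top[symmetric] power_eq_top_ennreal)
  qed
  finally show "(\<integral>\<^sup>+ x. ennreal (norm (1 / (1 + norm x) ^ (2 * DIM('a)))) \<partial>(lborel :: 'a measure)) < \<infinity>" .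
qed auto

lemma integrable_decay_bound:
  fixes f :: "'a::euclidean_space \<Rightarrow> 'b::{banach,second_countable_topology}"
  assumes "f \<in> borel_measurable borel" "\<And>x. norm (f x) \<le> K / (1 + norm x) ^ (2 * DIM('a))"
  shows "integrable lborel f"
proof (rule Bochner_Integration.integrable_bound)
  show "integrable lborel (\<lambda>x::'a. K * (1 / (1 + norm x) ^ (2 * DIM('a))))"
    by (rule integrable_mult_right) (rule integrable_decay)
  have "norm (f x) \<le> norm (K * (1 / (1 + norm x) ^ (2 * DIM('a))))" for x
    using order_trans[OF assms(2)[of x] abs_ge_self] by simp
  then show "AE x in lborel. norm (f x) \<le> norm (K * (1 / (1 + norm x) ^ (2 * DIM('a))))" by simp
qed (use assms in auto)

lemma schwartz_integrable:
  assumes "f \<in> schwartz"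
  shows "integrable lborel f"
proof -
  obtain K where "\<And>x. norm (f x) \<le> K / (1 + norm x) ^ (2 * DIM('a))"
    using schwartz_decay'[OF assms] by metis
  then show ?thesis by (rule integrable_decay_bound[OF schwartz_measurable[OF assms]])
qed

lemma schwartz_bounded:
  assumes "f \<in> schwartz"
  obtains K where "K > 0" "\<And>x. norm (f x) \<le> K"
  using schwartz_decay'[OF assms, of 0] by auto

lemma schwartz_square_integrable:
  assumes "f \<in> schwartz"
  shows "integrable lborel (\<lambda>x. (norm (f x))\<^sup>2)"
proof -
  have [measurable]: "f \<in> borel_measurable borel" by (rule schwartz_measurable[OF assms])
  obtain K where K: "K > 0" "\<And>x. norm (f x) \<le> K" using schwartz_bounded[OF assms] by blast
  have "integrable lborel (\<lambda>x. K * norm (f x))"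
    using schwartz_integrable[OF assms] by simp
  then show ?thesis
    by (rule Bochner_Integration.integrable_bound)
       (use K in \<open>auto intro!: AE_I2 mult_right_mono simp: power2_eq_square\<close>)
qed

subsection \<open>Change of variables and Fubini\<close>

lemma nn_integral_lborel_affine:
  fixes f :: "'a::euclidean_space \<Rightarrow> ennreal"
  assumes [measurable]: "f \<in> borel_measurable borel" and c: "c \<noteq> 0"
  shows "(\<integral>\<^sup>+ x. f x \<partial>lborel) = ennreal (\<bar>c\<bar> ^ DIM('a)) * (\<integral>\<^sup>+ x. f (t + c *\<^sub>R x) \<partial>lborel)"
  by (subst lborel_affine[OF c, of t]) (simp add: nn_integral_density nn_integral_distr nn_integral_cmult)

lemma lborel_integral_affine:
  fixes f :: "'a::euclidean_space \<Rightarrow> 'b::{banach,second_countable_topology}"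
  assumes [measurable]: "f \<in> borel_measurable borel" and c: "c \<noteq> 0"
  shows "(LINT x|lborel. f x) = \<bar>c\<bar> ^ DIM('a) *\<^sub>R (LINT x|lborel. f (t + c *\<^sub>R x))"
  by (subst lborel_affine[OF c, of t]) (simp add: integral_density integral_distr)

lemma lborel_integrable_affine:
  fixes f :: "'a::euclidean_space \<Rightarrow> 'b::{banach,second_countable_topology}"
  assumes "integrable lborel f" and c: "c \<noteq> 0"
  shows "integrable lborel (\<lambda>x. f (t + c *\<^sub>R x))"
proof -
  have [measurable]: "f \<in> borel_measurable borel" using borel_measurable_integrable[OF assms(1)] by simp
  have "integrable (density (distr lborel borel (\<lambda>x. t + c *\<^sub>R x)) (\<lambda>_. \<bar>c\<bar> ^ DIM('a))) f"
    using assms(1) lborel_affine[OF c, of t] by simp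
  then have "integrable lborel (\<lambda>x. \<bar>c\<bar> ^ DIM('a) *\<^sub>R f (t + c *\<^sub>R x))"
    by (simp add: integrable_density integrable_distr_eq)
  then have "integrable lborel (\<lambda>x. (1 / \<bar>c\<bar> ^ DIM('a)) *\<^sub>R \<bar>c\<bar> ^ DIM('a) *\<^sub>R f (t + c *\<^sub>R x))"
    by (rule integrable_scaleR_right)
  moreover have "(1 / \<bar>c\<bar> ^ DIM('a)) *\<^sub>R \<bar>c\<bar> ^ DIM('a) *\<^sub>R z = z" for z :: 'b
    using c by (simp add: scaleR_scaleR)
  ultimately show ?thesis by simp
qed

lemma norm_integral_le:
  fixes f :: "'a \<Rightarrow> 'b::{banach,second_countable_topology}"
  assumes "integrable M f" "integrable M g" "\<And>x. norm (f x) \<le> g x"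
  shows "norm (integral\<^sup>L M f) \<le> integral\<^sup>L M g"
  by (rule order_trans[OF integral_norm_bound integral_mono]) (use assms in auto)

text \<open>The common form of the exchanges of integrals below: two integrable functions coupled by
  a kernel of modulus at most 1, either a character or a Gaussian. The bound on the kernel makes the
  double integrand absolutely integrable.\<close>

lemma fubini_kernel:
  fixes f :: "'a::euclidean_space \<Rightarrow> complex" and g :: "'b::euclidean_space \<Rightarrow> complex"
  assumes f: "integrable lborel f" and g: "integrable lborel g"
    and k[measurable]: "(\<lambda>(x, y). k x y) \<in> borel_measurable (borel \<Otimes>\<^sub>M borel)"
    and k1: "\<And>x y. norm (k x y) \<le> 1"
  shows "(LINT x|lborel. f x * (LINT y|lborel. g y * k x y)) = (LINT y|lborel. g y * (LINT x|lborel. f x * k x y))"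
proof -
  have [measurable]: "f \<in> borel_measurable borel" "g \<in> borel_measurable borel"
    using borel_measurable_integrable[OF f] borel_measurable_integrable[OF g] by auto
  have [measurable]: "(\<lambda>y. k x y) \<in> borel_measurable borel" for x
    using measurable_compose_Pair1[of x borel "(\<lambda>(x, y). k x y)" borel borel] k by simp
  have i: "integrable lborel (\<lambda>y. g y * k x y)" for x
    by (rule Bochner_Integration.integrable_bound[OF g])
       (auto simp: norm_mult intro!: AE_I2 mult_left_le k1)
  have int: "integrable (lborel \<Otimes>\<^sub>M lborel) (\<lambda>(x, y). f x * (g y * k x y))"
  proof (rule lborel_pair.Fubini_integrable)
    have "integrable lborel (\<lambda>x. norm (f x) * (LINT y|lborel. norm (g y)))"
      using f by (intro integrable_mult_left integrable_norm)
    then show "integrable lborel (\<lambda>x. LINT y|lborel. norm (case (x, y) of (x, y) \<Rightarrow> f x * (g y * k x y)))"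
    proof (rule Bochner_Integration.integrable_bound)
      have "norm (LINT y|lborel. norm (f x) * (norm (g y) * norm (k x y))) \<le> norm (norm (f x) * (LINT y|lborel. norm (g y)))" for x
      proof -
        have "0 \<le> (LINT y|lborel. norm (g y) * norm (k x y))" by simp
        moreover have "(LINT y|lborel. norm (g y) * norm (k x y)) \<le> (LINT y|lborel. norm (g y))"
          by (rule integral_mono) (use i[of x] g in \<open>auto simp: norm_mult[symmetric] intro!: mult_left_le k1\<close>, simp add: norm_mult mult_left_le k1)
        ultimately show ?thesis by (simp add: mult_left_mono abs_mult)
      qed
      then show "AE x in lborel. norm (LINT y|lborel. norm (case (x, y) of (x, y) \<Rightarrow> f x * (g y * k x y)))
          \<le> norm (norm (f x) * (LINT y|lborel. norm (g y)))"
        by (simp add: norm_mult)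
    qed simp
    show "AE x in lborel. integrable lborel (\<lambda>y. case (x, y) of (x, y) \<Rightarrow> f x * (g y * k x y))"
      using i by simp
  qed simp
  have "(LINT x|lborel. f x * (LINT y|lborel. g y * k x y)) = (LINT x|lborel. (LINT y|lborel. f x * (g y * k x y)))"
    using i by simp
  also have "\<dots> = (LINT y|lborel. (LINT x|lborel. f x * (g y * k x y)))"
    using lborel_pair.Fubini_integral[OF int] by simp
  also have "\<dots> = (LINT y|lborel. (LINT x|lborel. g y * (f x * k x y)))"
    by (simp add: algebra_simps)
  also have "\<dots> = (LINT y|lborel. g y * (LINT x|lborel. f x * k x y))"
    by simp
  finally show ?thesis .
qed

subsection \<open>The Fourier transform on Schwartz functions\<close>

lemma integrable_cis_mult:
  fixes f :: "'a::euclidean_space \<Rightarrow> complex"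
  assumes "integrable lborel f" and [measurable]: "c \<in> borel_measurable borel"
  shows "integrable lborel (\<lambda>x. f x * cis (c x))"
proof (rule Bochner_Integration.integrable_bound[OF assms(1)])
  have [measurable]: "f \<in> borel_measurable borel" using borel_measurable_integrable[OF assms(1)] by simp
  have [measurable]: "(\<lambda>x. cis (c x)) \<in> borel_measurable borel"
    unfolding cis_conv_exp by measurable
  show "(\<lambda>x. f x * cis (c x)) \<in> borel_measurable lborel" by simp
qed (simp add: norm_mult)

lemma cis_measurable[measurable]: "cis \<in> borel_measurable borel"
  unfolding cis_conv_exp[abs_def] by measurable

lemma cis_second_order: "norm (cis t - 1 - \<i> * t) \<le> t\<^sup>2"
proof -
  have "cmod (iexp t - (\<Sum>k\<le>1. (\<i> * t)^k / fact k)) \<le> \<bar>t\<bar>^(Suc 1) / fact (Suc 1)"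
    by (rule iexp_approx1)
  then have "norm (cis t - (1 + \<i> * t)) \<le> t\<^sup>2 / 2" by (simp add: cis_conv_exp power2_eq_square)
  then have "norm (cis t - 1 - \<i> * t) \<le> t\<^sup>2 / 2" by (simp add: diff_diff_eq)
  then show ?thesis using zero_le_power2[of t] by linarith
qed

text \<open>The inequality |e^(it) - 1 - it| \<le> t^2 with t = - x \<bullet> (y - \<xi>) bounds the
  remainder by |y - \<xi>|^2 times the second moment of |f|. The derivative is thus obtained with an
  explicit quadratic error instead of a limit under the integral.\<close>

lemma fourier_has_derivative:
  assumes f: "f \<in> schwartz"
  shows "(fourier f has_derivative (\<lambda>v. fourier (\<lambda>x. - \<i> * complex_of_real (x \<bullet> v) * f x) \<xi>)) (at \<xi>)"
proof -
  have [measurable]: "f \<in> borel_measurable borel" by (rule schwartz_measurable[OF f])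
  have sv: "(\<lambda>x. - \<i> * complex_of_real (x \<bullet> v) * f x) \<in> schwartz" for v
    by (intro schwartz_symbol_mult symbols.mult symbols.const symbols.inner f)
  have ifx: "integrable lborel (\<lambda>x. f x * cis (- (x \<bullet> \<xi>)))" for \<xi>
    by (intro integrable_cis_mult schwartz_integrable f) simp
  have iv: "integrable lborel (\<lambda>x. - \<i> * complex_of_real (x \<bullet> v) * f x * cis (- (x \<bullet> \<xi>)))" for v \<xi>
    by (intro integrable_cis_mult schwartz_integrable sv) simp
  let ?D = "\<lambda>v. fourier (\<lambda>x. - \<i> * complex_of_real (x \<bullet> v) * f x) \<xi>"
  have lin: "linear ?D"
  proof
    fix v w :: 'a and r :: real
    have "?D (v + w) = (LINT x|lborel. - \<i> * complex_of_real (x \<bullet> v) * f x * cis (- (x \<bullet> \<xi>)) +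
        - \<i> * complex_of_real (x \<bullet> w) * f x * cis (- (x \<bullet> \<xi>)))"
      unfolding fourier_def by (rule Bochner_Integration.integral_cong) (auto simp: inner_add_right algebra_simps)
    then show "?D (v + w) = ?D v + ?D w"
      unfolding fourier_def by (subst (asm) Bochner_Integration.integral_add[OF iv iv])
    have "?D (r *\<^sub>R v) = (LINT x|lborel. r *\<^sub>R (- \<i> * complex_of_real (x \<bullet> v) * f x * cis (- (x \<bullet> \<xi>))))"
      unfolding fourier_def by (rule Bochner_Integration.integral_cong) (auto simp: scaleR_conv_of_real algebra_simps)
    then show "?D (r *\<^sub>R v) = r *\<^sub>R ?D v"
      unfolding fourier_def by simp
  qed
  \<comment> \<open>The two extra powers of decay pay for the factor |x|^2 in the second
    moment.\<close>
  obtain K where K: "K > 0" "\<And>x. norm (f x) \<le> K / (1 + norm x) ^ (2 * DIM('a) + 2)"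
    using schwartz_decay'[OF f] by metis
  have K2: "norm ((norm x)\<^sup>2 * norm (f x)) \<le> K / (1 + norm x) ^ (2 * DIM('a))" for x
  proof -
    have p: "0 < 1 + norm x" using norm_ge_zero[of x] by linarith
    have "(norm x)\<^sup>2 * norm (f x) \<le> (1 + norm x)\<^sup>2 * (K / (1 + norm x) ^ (2 * DIM('a) + 2))"
      by (rule mult_mono[OF _ K(2)]) (auto intro!: power_mono)
    also have "\<dots> = K / (1 + norm x) ^ (2 * DIM('a))"
      using p by (simp add: power_add power2_eq_square)
    finally show ?thesis by simp
  qed
  have i2: "integrable lborel (\<lambda>x. (norm x)\<^sup>2 * norm (f x))"
    by (rule integrable_decay_bound[OF _ K2]) simp
  let ?C = "LINT x|lborel. (norm x)\<^sup>2 * norm (f x)"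
  have main: "norm (fourier f y - fourier f \<xi> - ?D (y - \<xi>)) \<le> ?C * (norm (y - \<xi>))\<^sup>2" for y
  proof -
    have "fourier f y - fourier f \<xi> - ?D (y - \<xi>) =
      (LINT x|lborel. f x * cis (- (x \<bullet> y)) - f x * cis (- (x \<bullet> \<xi>)) - - \<i> * complex_of_real (x \<bullet> (y - \<xi>)) * f x * cis (- (x \<bullet> \<xi>)))"
      unfolding fourier_def
      by (subst Bochner_Integration.integral_diff[OF Bochner_Integration.integrable_diff[OF ifx ifx] iv])
         (subst Bochner_Integration.integral_diff[OF ifx ifx], simp)
    also have "norm \<dots> \<le> (LINT x|lborel. (norm x)\<^sup>2 * norm (f x) * (norm (y - \<xi>))\<^sup>2)"
    proof (rule norm_integral_le)
      fix x :: 'a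
      let ?t = "- (x \<bullet> (y - \<xi>))"
      have c: "cis (- (x \<bullet> y)) = cis ?t * cis (- (x \<bullet> \<xi>))"
        by (simp add: cis_mult inner_diff_right)
      have "f x * cis (- (x \<bullet> y)) - f x * cis (- (x \<bullet> \<xi>)) - - \<i> * complex_of_real (x \<bullet> (y - \<xi>)) * f x * cis (- (x \<bullet> \<xi>))
        = f x * cis (- (x \<bullet> \<xi>)) * (cis ?t - 1 - \<i> * ?t)"
        unfolding c by (simp add: algebra_simps)
      also have "norm \<dots> \<le> norm (f x) * ?t\<^sup>2"
        using cis_second_order[of ?t] by (simp add: norm_mult mult_left_mono)
      also have "?t\<^sup>2 \<le> (norm x * norm (y - \<xi>))\<^sup>2"
        using power_mono[OF Cauchy_Schwarz_ineq2[of x "y - \<xi>"], of 2] by simp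
      then have "norm (f x) * ?t\<^sup>2 \<le> norm (f x) * (norm x * norm (y - \<xi>))\<^sup>2"
        by (rule mult_left_mono) simp
      also have "\<dots> = (norm x)\<^sup>2 * norm (f x) * (norm (y - \<xi>))\<^sup>2" by (simp add: power_mult_distrib)
      finally show "norm (f x * cis (- (x \<bullet> y)) - f x * cis (- (x \<bullet> \<xi>)) - - \<i> * complex_of_real (x \<bullet> (y - \<xi>)) * f x * cis (- (x \<bullet> \<xi>)))
        \<le> (norm x)\<^sup>2 * norm (f x) * (norm (y - \<xi>))\<^sup>2" .
    qed (intro Bochner_Integration.integrable_diff ifx iv integrable_mult_left i2)+
    also have "\<dots> = ?C * (norm (y - \<xi>))\<^sup>2" by simp
    finally show ?thesis .
  qed
  show ?thesis
  proof (rule has_derivativeI_sandwich[of 1])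
    show "bounded_linear ?D" using lin linear_conv_bounded_linear by blast
    show "norm (fourier f y - fourier f \<xi> - ?D (y - \<xi>)) / norm (y - \<xi>) \<le> ?C * norm (y - \<xi>)"
      if "y \<noteq> \<xi>" for y
      using main[of y] that by (simp add: divide_le_eq power2_eq_square algebra_simps)
    have "((\<lambda>y. ?C * norm (y - \<xi>)) \<longlongrightarrow> ?C * norm (\<xi> - \<xi>)) (at \<xi>)"
      by (intro tendsto_intros)
    then show "((\<lambda>y. ?C * norm (y - \<xi>)) \<longlongrightarrow> 0) (at \<xi>)" by simp
  qed simp
qed

text \<open>Difference quotients have integral 0 by translation invariance, and they converge to the
  derivative under a majorant supplied by the mean value theorem.\<close>

lemma integral_dirderiv_eq_0:
  fixes f :: "'a::euclidean_space \<Rightarrow> complex"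
  assumes f: "f \<in> schwartz" and b: "b \<in> Basis"
  shows "(LINT x|lborel. dirderiv b f x) = 0"
proof -
  have [measurable]: "f \<in> borel_measurable borel" by (rule schwartz_measurable[OF f])
  let ?t = "\<lambda>n. 1 / real (Suc n)"
  let ?s = "\<lambda>n x. real (Suc n) * (f (x + ?t n *\<^sub>R b) - f x)"
  have fd: "(f has_derivative frechet_derivative f (at x)) (at x)" for x
    by (rule schwartz_has_derivative[OF f])
  have path: "((\<lambda>t. f (x + t *\<^sub>R b)) has_derivative (\<lambda>r. r *\<^sub>R dirderiv b f (x + t *\<^sub>R b))) (at t)" for x t
  proof -
    have "((\<lambda>t. f (x + t *\<^sub>R b)) has_derivative (\<lambda>r. frechet_derivative f (at (x + t *\<^sub>R b)) (r *\<^sub>R b))) (at t)"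
      by (rule has_derivative_compose[OF _ fd]) (auto intro!: derivative_eq_intros)
    then show ?thesis
      unfolding dirderiv_def using linear_scale[OF has_derivative_linear[OF fd]] by simp
  qed
  have z: "(LINT x|lborel. ?s n x) = 0" for n
  proof -
    have "integrable lborel (\<lambda>x. f (?t n *\<^sub>R b + 1 *\<^sub>R x))"
      by (rule lborel_integrable_affine[OF schwartz_integrable[OF f]]) simp
    moreover have "(LINT x|lborel. f x) = (LINT x|lborel. f (?t n *\<^sub>R b + 1 *\<^sub>R x))"
      by (subst lborel_integral_affine[of f 1 "?t n *\<^sub>R b"]) simp_all
    ultimately show ?thesis using schwartz_integrable[OF f] by (simp add: add.commute)
  qed
  obtain K where K: "K > 0" "\<And>x. norm (dirderiv b f x) \<le> K / (1 + norm x) ^ (2 * DIM('a))"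
    using schwartz_decay'[OF schwartz_dirderiv[OF f b]] by metis
  have "(\<lambda>n. LINT x|lborel. ?s n x) \<longlonglongrightarrow> (LINT x|lborel. dirderiv b f x)"
  proof (rule integral_dominated_convergence)
    show "integrable lborel (\<lambda>x::'a. (K * 2 ^ (2 * DIM('a))) * (1 / (1 + norm x) ^ (2 * DIM('a))))"
      by (rule integrable_mult_right) (rule integrable_decay)
    show "dirderiv b f \<in> borel_measurable lborel"
      using schwartz_measurable[OF schwartz_dirderiv[OF f b]] by simp
    show "AE x in lborel. (\<lambda>n. ?s n x) \<longlonglongrightarrow> dirderiv b f x"
    proof (rule AE_I2)
      fix x
      have lim: "((\<lambda>h. norm (f (x + h *\<^sub>R b) - f x - h *\<^sub>R dirderiv b f x) / norm h) \<longlongrightarrow> 0) (at 0)"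
        using path[of x 0] unfolding has_derivative_at by simp
      have "?t \<longlonglongrightarrow> 0"
        using LIMSEQ_inverse_real_of_nat by (simp only: inverse_eq_divide)
      then have "filterlim ?t (at 0) sequentially"
        by (simp add: filterlim_at del: of_nat_Suc)
      then have "(\<lambda>n. norm (f (x + ?t n *\<^sub>R b) - f x - ?t n *\<^sub>R dirderiv b f x) / norm (?t n)) \<longlonglongrightarrow> 0"
        by (rule filterlim_compose[OF lim])
      moreover have "norm (f (x + ?t n *\<^sub>R b) - f x - ?t n *\<^sub>R dirderiv b f x) / norm (?t n) = norm (?s n x - dirderiv b f x)" for n
      proof -
        have "?s n x - dirderiv b f x = complex_of_real (real (Suc n)) * (f (x + ?t n *\<^sub>R b) - f x - ?t n *\<^sub>R dirderiv b f x)"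
          by (simp add: scaleR_conv_of_real right_diff_distrib del: of_nat_Suc)
        then show ?thesis by (simp only: norm_mult norm_of_real) (simp del: of_nat_Suc add: mult.commute)
      qed
      ultimately have "(\<lambda>n. norm (?s n x - dirderiv b f x)) \<longlonglongrightarrow> 0" by simp
      then show "(\<lambda>n. ?s n x) \<longlonglongrightarrow> dirderiv b f x"
        using tendsto_norm_zero_iff LIM_zero_iff by blast
    qed
    show "AE x in lborel. norm (?s n x) \<le> (K * 2 ^ (2 * DIM('a))) * (1 / (1 + norm x) ^ (2 * DIM('a)))" for n
    proof (rule AE_I2)
      fix x :: 'a
      have t: "0 < ?t n" "?t n \<le> 1" by auto
      have "\<exists>s\<in>{0<..<?t n}. norm (f (x + ?t n *\<^sub>R b) - f (x + 0 *\<^sub>R b)) \<le> norm ((?t n - 0) *\<^sub>R dirderiv b f (x + s *\<^sub>R b))"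
        by (rule mvt_general[OF t(1)]) (auto intro!: path continuous_at_imp_continuous_on has_derivative_continuous[OF path])
      then obtain s where s: "0 < s" "s < ?t n" and le: "norm (f (x + ?t n *\<^sub>R b) - f x) \<le> ?t n * norm (dirderiv b f (x + s *\<^sub>R b))"
        by auto
      \<comment> \<open>The intermediate point is at distance at most 1 from x, so the weights 1 +
        |x| and 1 + |x + sb| compare up to a factor 2; this is the origin of 2^(2d) in the
        majorant.\<close>
      have "norm x \<le> norm (x + s *\<^sub>R b) + norm (s *\<^sub>R b)"
        using norm_triangle_ineq4[of "x + s *\<^sub>R b" "s *\<^sub>R b"] by simp
      moreover have "norm (s *\<^sub>R b) \<le> 1" using s(1) order.strict_trans2[OF s(2) t(2)] b by simp
      ultimately have "1 + norm x \<le> 2 * (1 + norm (x + s *\<^sub>R b))" using norm_ge_zero[of "x + s *\<^sub>R b"] unfolding distrib_left by linarith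
      then have "(1 + norm x) ^ (2 * DIM('a)) \<le> 2 ^ (2 * DIM('a)) * (1 + norm (x + s *\<^sub>R b)) ^ (2 * DIM('a))"
        unfolding power_mult_distrib[symmetric] by (rule power_mono) simp
      moreover have pos: "0 < 1 + norm y" for y :: 'a using norm_ge_zero[of y] by linarith
      ultimately have "K / (1 + norm (x + s *\<^sub>R b)) ^ (2 * DIM('a)) \<le> K * 2 ^ (2 * DIM('a)) / (1 + norm x) ^ (2 * DIM('a))"
        using K(1) by (simp add: field_simps)
      with K(2)[of "x + s *\<^sub>R b"] have "norm (dirderiv b f (x + s *\<^sub>R b)) \<le> K * 2 ^ (2 * DIM('a)) / (1 + norm x) ^ (2 * DIM('a))"
        by linarith
      moreover have "norm (?s n x) \<le> norm (dirderiv b f (x + s *\<^sub>R b))"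
      proof -
        have "norm (?s n x) = real (Suc n) * norm (f (x + ?t n *\<^sub>R b) - f x)" by (simp only: norm_mult norm_of_real abs_of_nat)
        also have "\<dots> \<le> real (Suc n) * (?t n * norm (dirderiv b f (x + s *\<^sub>R b)))"
          by (rule mult_left_mono[OF le]) simp
        finally show ?thesis by simp
      qed
      ultimately show "norm (?s n x) \<le> (K * 2 ^ (2 * DIM('a))) * (1 / (1 + norm x) ^ (2 * DIM('a)))"
        by simp
    qed
  qed simp
  then have "(\<lambda>n. 0) \<longlonglongrightarrow> (LINT x|lborel. dirderiv b f x)" by (simp only: z)
  then show ?thesis using LIMSEQ_unique tendsto_const by blast
qed

text \<open>Integration by parts: the derivative of the Schwartz function e^(-ix\<bullet>\<xi>) f
  has integral 0, and the product rule splits it into the two sides.\<close>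

lemma fourier_dirderiv:
  fixes f :: "'a::euclidean_space \<Rightarrow> complex"
  assumes f: "f \<in> schwartz" and b: "b \<in> Basis"
  shows "fourier (dirderiv b f) \<xi> = \<i> * complex_of_real (\<xi> \<bullet> b) * fourier f \<xi>"
proof -
  let ?c = "\<lambda>x. cis (x \<bullet> (- \<xi>))"
  let ?g = "\<lambda>x. ?c x * f x"
  have g: "?g \<in> schwartz" by (intro schwartz_symbol_mult symbols.cis f)
  have cd: "(?c has_derivative (\<lambda>v. - \<i> * complex_of_real (v \<bullet> \<xi>) * ?c x)) (at x)" for x
  proof -
    have "((\<lambda>x. exp (\<i> * complex_of_real (x \<bullet> - \<xi>))) has_derivative
        (\<lambda>v. exp (\<i> * complex_of_real (x \<bullet> - \<xi>)) * (\<i> * complex_of_real (v \<bullet> - \<xi>)))) (at x)"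
      by (rule has_derivative_compose[OF _ DERIV_exp[unfolded has_field_derivative_def]])
         (auto intro!: derivative_eq_intros)
    then show ?thesis by (simp add: cis_conv_exp algebra_simps)
  qed
  have "(?g has_derivative (\<lambda>v. ?c x * frechet_derivative f (at x) v + - \<i> * complex_of_real (v \<bullet> \<xi>) * ?c x * f x)) (at x)" for x
    by (rule has_derivative_mult[OF cd schwartz_has_derivative[OF f]])
  from frechet_derivative_at[OF this]
  have "frechet_derivative ?g (at x) = (\<lambda>v. ?c x * frechet_derivative f (at x) v + - \<i> * complex_of_real (v \<bullet> \<xi>) * ?c x * f x)" for x
    by (rule sym)
  then have dg: "dirderiv b ?g x = dirderiv b f x * cis (- (x \<bullet> \<xi>)) - \<i> * complex_of_real (\<xi> \<bullet> b) * (f x * cis (- (x \<bullet> \<xi>)))" for x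
    unfolding dirderiv_def by (simp add: inner_commute algebra_simps)
  have "0 = (LINT x|lborel. dirderiv b f x * cis (- (x \<bullet> \<xi>)) - \<i> * complex_of_real (\<xi> \<bullet> b) * (f x * cis (- (x \<bullet> \<xi>))))"
    unfolding dg[symmetric] by (rule integral_dirderiv_eq_0[OF g b, symmetric])
  also have "\<dots> = fourier (dirderiv b f) \<xi> - \<i> * complex_of_real (\<xi> \<bullet> b) * fourier f \<xi>"
    unfolding fourier_def
    by (subst Bochner_Integration.integral_diff)
       (use integrable_cis_mult[OF schwartz_integrable[OF f]]
          integrable_cis_mult[OF schwartz_integrable[OF schwartz_dirderiv[OF f b]]] in auto)
  finally show ?thesis by simp
qed

text \<open>The operator 1 - \<Delta>, with Fourier multiplier 1 + |\<xi>|^2; its powers convert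
  smoothness of f into decay of the transform.\<close>

definition helmholtz :: "('a::euclidean_space \<Rightarrow> complex) \<Rightarrow> 'a \<Rightarrow> complex" where
  "helmholtz f = (\<lambda>x. f x + (-1) * (\<Sum>b\<in>Basis. dirderiv b (dirderiv b f) x))"

lemma helmholtz_schwartz: "f \<in> schwartz \<Longrightarrow> helmholtz f \<in> schwartz"
  unfolding helmholtz_def by (intro schwartz_add schwartz_cmult schwartz_sum schwartz_dirderiv)

lemma fourier_helmholtz:
  fixes f :: "'a::euclidean_space \<Rightarrow> complex"
  assumes f: "f \<in> schwartz"
  shows "fourier (helmholtz f) \<xi> = complex_of_real (1 + (norm \<xi>)\<^sup>2) * fourier f \<xi>"
proof -
  have i: "g \<in> schwartz \<Longrightarrow> integrable lborel (\<lambda>x. g x * cis (- (x \<bullet> \<xi>)))" for g :: "'a \<Rightarrow> complex"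
    by (intro integrable_cis_mult schwartz_integrable) auto
  have "fourier (helmholtz f) \<xi> = (LINT x|lborel. f x * cis (- (x \<bullet> \<xi>)) - (\<Sum>b\<in>Basis. dirderiv b (dirderiv b f) x * cis (- (x \<bullet> \<xi>))))"
    unfolding fourier_def helmholtz_def by (simp add: sum_distrib_left sum_negf algebra_simps)
  also have "\<dots> = fourier f \<xi> - (\<Sum>b\<in>Basis. fourier (dirderiv b (dirderiv b f)) \<xi>)"
    unfolding fourier_def
    by (subst Bochner_Integration.integral_diff)
       (auto intro!: i f Bochner_Integration.integrable_sum Bochner_Integration.integral_sum schwartz_dirderiv)
  also have "(\<Sum>b\<in>Basis. fourier (dirderiv b (dirderiv b f)) \<xi>) = (\<Sum>b\<in>Basis. - complex_of_real ((\<xi> \<bullet> b)\<^sup>2) * fourier f \<xi>)"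
    by (rule sum.cong) (auto simp: fourier_dirderiv schwartz_dirderiv f power2_eq_square algebra_simps)
  also have "\<dots> = - complex_of_real ((norm \<xi>)\<^sup>2) * fourier f \<xi>"
    unfolding power2_norm_eq_inner euclidean_inner[of \<xi> \<xi>]
    by (simp add: sum_distrib_right sum_negf power2_eq_square)
  finally show ?thesis by (simp add: algebra_simps)
qed

lemma fourier_norm_le:
  assumes "integrable lborel f"
  shows "norm (fourier f \<xi>) \<le> (LINT x|lborel. norm (f x))"
proof -
  have "norm (fourier f \<xi>) \<le> (LINT x|lborel. norm (f x * cis (- (x \<bullet> \<xi>))))"
    unfolding fourier_def by (rule integral_norm_bound)
  then show ?thesis by (simp add: norm_mult)
qed

lemma fourier_decay:
  fixes f :: "'a::euclidean_space \<Rightarrow> complex"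
  assumes "f \<in> schwartz"
  shows "(1 + (norm \<xi>)\<^sup>2) ^ N * norm (fourier f \<xi>) \<le> (LINT x|lborel. norm ((helmholtz ^^ N) f x))"
  using assms
proof (induction N arbitrary: f)
  case 0
  then show ?case using fourier_norm_le[OF schwartz_integrable] by simp
next
  case (Suc N)
  have "norm (complex_of_real (1 + (norm \<xi>)\<^sup>2)) = 1 + (norm \<xi>)\<^sup>2"
    unfolding norm_of_real by (simp add: add_nonneg_nonneg)
  then have "(1 + (norm \<xi>)\<^sup>2) ^ Suc N * norm (fourier f \<xi>) = (1 + (norm \<xi>)\<^sup>2) ^ N * norm (fourier (helmholtz f) \<xi>)"
    unfolding fourier_helmholtz[OF Suc.prems] norm_mult by simp
  also have "\<dots> \<le> (LINT x|lborel. norm ((helmholtz ^^ N) (helmholtz f) x))"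
    by (rule Suc.IH[OF helmholtz_schwartz[OF Suc.prems]])
  finally show ?case by (simp only: funpow_Suc_right o_apply)
qed

lemma one_plus_norm_power_le: "(1 + norm (x::'a::real_normed_vector)) ^ N \<le> 2 ^ N * (1 + (norm x)\<^sup>2) ^ N"
proof -
  have "1 + n \<le> 2 * (1 + n\<^sup>2)" for n :: real
    using zero_le_power2[of "n - 1 / 4"] by (simp add: power2_eq_square algebra_simps)
  then have "1 + norm x \<le> 2 * (1 + (norm x)\<^sup>2)" .
  then show ?thesis unfolding power_mult_distrib[symmetric] by (rule power_mono) simp
qed

text \<open>The stable class is the image of the Schwartz space under \<open>fourier\<close>:
  derivatives of a transform are transforms of linear functions times f, and decay of any order
  comes from powers of 1 - \<Delta>.\<close>

lemma fourier_schwartz: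
  fixes f :: "'a::euclidean_space \<Rightarrow> complex"
  assumes f: "f \<in> schwartz"
  shows "fourier f \<in> schwartz"
proof -
  have "fourier f \<in> fourier ` (schwartz :: ('a \<Rightarrow> complex) set)" using f by blast
  then show ?thesis
  proof (induction rule: schwartz_coinduct)
    case (decay g N)
    then obtain f :: "'a \<Rightarrow> complex" where g: "g = fourier f" and f: "f \<in> schwartz" by blast
    have "(1 + norm \<xi>) ^ N * norm (g \<xi>) \<le> 2 ^ N * (LINT x|lborel. norm ((helmholtz ^^ N) f x))" for \<xi>
    proof -
      have "(1 + norm \<xi>) ^ N * norm (g \<xi>) \<le> 2 ^ N * (1 + (norm \<xi>)\<^sup>2) ^ N * norm (g \<xi>)"
        by (rule mult_right_mono[OF one_plus_norm_power_le]) simp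
      also have "\<dots> \<le> 2 ^ N * (LINT x|lborel. norm ((helmholtz ^^ N) f x))"
        unfolding g mult.assoc by (rule mult_left_mono[OF fourier_decay[OF f]]) simp
      finally show ?thesis .
    qed
    then show ?case by blast
  next
    case (step g)
    then obtain f :: "'a \<Rightarrow> complex" where g: "g = fourier f" and f: "f \<in> schwartz" by blast
    have "(\<lambda>x. - \<i> * complex_of_real (x \<bullet> v) * f x) \<in> schwartz" for v
      by (intro schwartz_symbol_mult symbols.mult symbols.const symbols.inner f)
    then have "(\<lambda>\<xi>. fourier (\<lambda>x. - \<i> * complex_of_real (x \<bullet> v) * f x) \<xi>) \<in> fourier ` schwartz" for v
      by blast
    then show ?case unfolding g
      by (intro exI[of _ "\<lambda>\<xi> v. fourier (\<lambda>x. - \<i> * complex_of_real (x \<bullet> v) * f x) \<xi>"])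
         (use fourier_has_derivative[OF f] in blast)
  qed
qed

lemma inv_fourier_eq: "inv_fourier f x = (1 / (2 * pi) ^ DIM('a)) * fourier f ((-1) *\<^sub>R (x :: 'a::euclidean_space))"
  unfolding inv_fourier_def fourier_def by (simp add: inner_commute)

lemma inv_fourier_schwartz:
  fixes f :: "'a::euclidean_space \<Rightarrow> complex"
  assumes f: "f \<in> schwartz"
  shows "inv_fourier f \<in> schwartz"
  unfolding inv_fourier_eq[abs_def] by (intro schwartz_cmult schwartz_scale fourier_schwartz f) simp

subsection \<open>Gaussians and Fourier inversion\<close>

lemma integral_lborel_prod:
  fixes f :: "'a::euclidean_space \<Rightarrow> real \<Rightarrow> complex"
  assumes "\<And>b. b \<in> Basis \<Longrightarrow> integrable lborel (f b)"
  shows "(LINT x|(lborel :: 'a measure). (\<Prod>b\<in>Basis. f b (x \<bullet> b))) = (\<Prod>b\<in>Basis. LINT t|lborel. f b t)"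
proof -
  interpret product_sigma_finite "\<lambda>_. lborel :: real measure" ..
  have [measurable]: "b \<in> Basis \<Longrightarrow> f b \<in> borel_measurable borel" for b
    using borel_measurable_integrable[OF assms] by simp
  have "(LINT x|(lborel :: 'a measure). (\<Prod>b\<in>Basis. f b (x \<bullet> b)))
      = (LINT x|(\<Pi>\<^sub>M b\<in>Basis. lborel). (\<Prod>b\<in>Basis. f b ((\<Sum>b\<in>Basis. x b *\<^sub>R b) \<bullet> b)))"
    by (subst lborel_eq, subst integral_distr) auto
  also have "\<dots> = (LINT x|(\<Pi>\<^sub>M b\<in>(Basis::'a set). lborel). (\<Prod>b\<in>Basis. f b (x b)))"
    by (intro Bochner_Integration.integral_cong prod.cong) (auto simp: inner_sum_left_Basis)
  also have "\<dots> = (\<Prod>b\<in>Basis. LINT t|lborel. f b t)"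
    by (rule product_integral_prod) (use assms in auto)
  finally show ?thesis .
qed

text \<open>Read off from the characteristic function of the standard normal distribution.\<close>

lemma gauss_fourier_1d:
  "(LINT t|lborel. complex_of_real (exp (- t\<^sup>2 / 2)) * cis (t * u)) = complex_of_real (sqrt (2 * pi) * exp (- u\<^sup>2 / 2))"
proof -
  have "char std_normal_distribution u = (LINT t|lborel. std_normal_density t *\<^sub>R iexp (u * t))"
    unfolding char_def by (subst integral_density) auto
  also have "\<dots> = (LINT t|lborel. complex_of_real (1 / sqrt (2 * pi)) * (complex_of_real (exp (- t\<^sup>2 / 2)) * cis (t * u)))"
    by (intro Bochner_Integration.integral_cong) (auto simp: std_normal_density_def scaleR_conv_of_real cis_conv_exp mult.commute)
  also have "\<dots> = complex_of_real (1 / sqrt (2 * pi)) * (LINT t|lborel. complex_of_real (exp (- t\<^sup>2 / 2)) * cis (t * u))"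
    by simp
  finally have "complex_of_real (sqrt (2 * pi)) * complex_of_real (exp (- u\<^sup>2 / 2)) =
     complex_of_real (sqrt (2 * pi)) * (complex_of_real (1 / sqrt (2 * pi)) * (LINT t|lborel. complex_of_real (exp (- t\<^sup>2 / 2)) * cis (t * u)))"
    by (simp add: char_std_normal_distribution)
  then show ?thesis by simp
qed

lemma gauss_fourier_1d_integrable:
  "integrable lborel (\<lambda>t. complex_of_real (exp (- t\<^sup>2 / 2)) * cis (t * u))"
proof (rule integrable_cis_mult)
  have "integrable lborel (gauss :: real \<Rightarrow> complex)" by (rule schwartz_integrable[OF gauss_schwartz])
  then show "integrable lborel (\<lambda>t. complex_of_real (exp (- t\<^sup>2 / 2)))"
    by (simp add: gauss_def[abs_def] power2_eq_square)
qed simp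

text \<open>The total integral (2\<pi>)^(d/2) of the Gaussian. It always occurs twice, and its
  square is the normalisation (2\<pi>)^d of the inversion formula.\<close>

definition gauss_mass :: "'a::euclidean_space itself \<Rightarrow> real" where
  "gauss_mass _ = sqrt (2 * pi) ^ DIM('a)"

lemma gauss_mass_sq: "gauss_mass TYPE('a::euclidean_space) * gauss_mass TYPE('a) = (2 * pi) ^ DIM('a)"
  unfolding gauss_mass_def power_mult_distrib[symmetric] by simp

lemma gauss_mass_pos: "gauss_mass TYPE('a::euclidean_space) > 0"
  by (simp add: gauss_mass_def)

lemma gauss_prod: "gauss (x :: 'a::euclidean_space) = (\<Prod>b\<in>Basis. complex_of_real (exp (- (x \<bullet> b)\<^sup>2 / 2)))"
proof -
  have "- (x \<bullet> x) / 2 = (\<Sum>b\<in>Basis. - (x \<bullet> b)\<^sup>2 / 2)"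
    by (subst euclidean_inner) (simp add: sum_negf sum_divide_distrib power2_eq_square)
  then show ?thesis unfolding gauss_def by (simp add: exp_sum)
qed

lemma gauss_fourier:
  "(LINT x|lborel. gauss x * cis (x \<bullet> y)) = complex_of_real (gauss_mass TYPE('a)) * gauss (y :: 'a::euclidean_space)"
proof -
  have "(LINT x|lborel. gauss x * cis (x \<bullet> y)) =
     (LINT x|lborel. (\<Prod>b\<in>Basis. complex_of_real (exp (- (x \<bullet> b)\<^sup>2 / 2)) * cis ((x \<bullet> b) * (y \<bullet> b))))"
  proof (rule Bochner_Integration.integral_cong)
    fix x :: 'a
    have "cis (x \<bullet> y) = (\<Prod>b\<in>Basis. cis ((x \<bullet> b) * (y \<bullet> b)))"
      unfolding cis_conv_exp by (subst euclidean_inner) (simp add: exp_sum[symmetric] sum_distrib_left)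
    then show "gauss x * cis (x \<bullet> y) = (\<Prod>b\<in>Basis. complex_of_real (exp (- (x \<bullet> b)\<^sup>2 / 2)) * cis ((x \<bullet> b) * (y \<bullet> b)))"
      by (simp add: gauss_prod prod.distrib)
  qed simp
  also have "\<dots> = (\<Prod>b\<in>Basis. complex_of_real (sqrt (2 * pi) * exp (- (y \<bullet> b)\<^sup>2 / 2)))"
    by (subst integral_lborel_prod[OF gauss_fourier_1d_integrable]) (simp only: gauss_fourier_1d)
  finally show ?thesis by (simp add: prod.distrib gauss_prod gauss_mass_def)
qed

lemma gauss_measurable[measurable]: "gauss \<in> borel_measurable borel"
  by (rule schwartz_measurable[OF gauss_schwartz])

lemma gauss_integrable: "integrable lborel gauss"
  by (rule schwartz_integrable[OF gauss_schwartz])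

lemma gauss_scale_integrable: "t > 0 \<Longrightarrow> integrable lborel (\<lambda>x. gauss (t *\<^sub>R x))"
  using lborel_integrable_affine[OF gauss_integrable, of t 0] by simp

lemma integral_gauss: "(LINT x|lborel. gauss (x::'a::euclidean_space)) = complex_of_real (gauss_mass TYPE('a))"
  using gauss_fourier[of "0 :: 'a"] by (simp add: gauss_def)

lemma gauss_norm: "norm (gauss x) = exp (- (x \<bullet> x) / 2)"
  unfolding gauss_def norm_of_real by simp

lemma gauss_norm_le: "norm (gauss x) \<le> 1"
  unfolding gauss_norm by simp

lemma gauss_scale_fourier:
  fixes y :: "'a::euclidean_space"
  assumes t: "t > 0"
  shows "(LINT x|lborel. gauss (t *\<^sub>R x) * cis (x \<bullet> y)) = complex_of_real (gauss_mass TYPE('a) / t ^ DIM('a)) * gauss ((1 / t) *\<^sub>R y)"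
proof -
  have "complex_of_real (gauss_mass TYPE('a)) * gauss ((1 / t) *\<^sub>R y) = (LINT x|lborel. gauss x * cis (x \<bullet> ((1 / t) *\<^sub>R y)))"
    by (rule gauss_fourier[symmetric])
  also have "\<dots> = t ^ DIM('a) *\<^sub>R (LINT x|lborel. gauss (0 + t *\<^sub>R x) * cis ((0 + t *\<^sub>R x) \<bullet> ((1 / t) *\<^sub>R y)))"
    using t by (subst lborel_integral_affine[of _ t 0]) simp_all
  also have "\<dots> = t ^ DIM('a) *\<^sub>R (LINT x|lborel. gauss (t *\<^sub>R x) * cis (x \<bullet> y))"
    using t by simp
  finally show ?thesis using t by (simp add: scaleR_conv_of_real)
qed

text \<open>A Gaussian damping of width 1/t in frequency becomes a Gaussian average of W of width t
  around x. This identity underlies the Plancherel bound, the inversion formula and the uniqueness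
  of transforms.\<close>

lemma gauss_convolution:
  fixes W :: "'a::euclidean_space \<Rightarrow> complex"
  assumes W: "integrable lborel W" and t: "t > 0"
  shows "(LINT \<xi>|lborel. gauss (t *\<^sub>R \<xi>) * cis (- (\<xi> \<bullet> x)) * (LINT y|lborel. W y * cis (\<xi> \<bullet> y)))
    = complex_of_real (gauss_mass TYPE('a) / t ^ DIM('a)) * (LINT y|lborel. W y * gauss ((1 / t) *\<^sub>R (y - x)))"
proof -
  have "(LINT \<xi>|lborel. (gauss (t *\<^sub>R \<xi>) * cis (- (\<xi> \<bullet> x))) * (LINT y|lborel. W y * cis (\<xi> \<bullet> y)))
    = (LINT y|lborel. W y * (LINT \<xi>|lborel. (gauss (t *\<^sub>R \<xi>) * cis (- (\<xi> \<bullet> x))) * cis (\<xi> \<bullet> y)))"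
    by (rule fubini_kernel[OF integrable_cis_mult[OF gauss_scale_integrable[OF t]] W]) simp_all
  also have "\<dots> = (LINT y|lborel. W y * (LINT \<xi>|lborel. gauss (t *\<^sub>R \<xi>) * cis (\<xi> \<bullet> (y - x))))"
    by (simp add: mult.assoc cis_mult inner_diff_right)
  also have "\<dots> = (LINT y|lborel. complex_of_real (gauss_mass TYPE('a) / t ^ DIM('a)) * (W y * gauss ((1 / t) *\<^sub>R (y - x))))"
    by (intro Bochner_Integration.integral_cong) (simp_all only: gauss_scale_fourier[OF t] mult_ac)
  also have "\<dots> = complex_of_real (gauss_mass TYPE('a) / t ^ DIM('a)) * (LINT y|lborel. W y * gauss ((1 / t) *\<^sub>R (y - x)))"
    by (rule integral_mult_right_zero)
  finally show ?thesis .
qed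

subsection \<open>Square integrable functions\<close>

abbreviation (input) nsq :: "'a::real_normed_vector \<Rightarrow> ennreal" where
  "nsq z \<equiv> ennreal ((norm z)\<^sup>2)"

text \<open>The squared L2 norm takes values in \<open>ennreal\<close>, so that estimates can be
  chained before anything is known to be finite.\<close>

definition L2sq :: "'a measure \<Rightarrow> ('a \<Rightarrow> complex) \<Rightarrow> ennreal" where
  "L2sq M f = (\<integral>\<^sup>+ x. nsq (f x) \<partial>M)"

text \<open>Young's inequality. A small t keeps the factor of the main term close to 1, which the
  final comparison of densities uses; t = 1 gives the crude triangle inequality with factor
  2.\<close>

lemma norm_add_sq_le:
  fixes a b :: "'a::real_normed_vector"
  assumes "t > 0"
  shows "(norm (a + b))\<^sup>2 \<le> (1 + t) * (norm a)\<^sup>2 + (1 + 1 / t) * (norm b)\<^sup>2"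
proof -
  have "(norm (a + b))\<^sup>2 \<le> (norm a + norm b)\<^sup>2"
    by (rule power_mono[OF norm_triangle_ineq]) simp
  moreover have "2 * norm a * norm b \<le> t * (norm a)\<^sup>2 + (norm b)\<^sup>2 / t"
  proof -
    have "0 \<le> (t * norm a - norm b)\<^sup>2 / t" using assms by simp
    also have "\<dots> = t * (norm a)\<^sup>2 + (norm b)\<^sup>2 / t - 2 * norm a * norm b"
      using assms by (simp add: power2_eq_square field_simps)
    finally show ?thesis by simp
  qed
  ultimately show ?thesis by (simp add: power2_sum algebra_simps)
qed

lemma L2sq_young:
  assumes [measurable]: "f \<in> borel_measurable M" "g \<in> borel_measurable M" and t: "t > 0"
  shows "L2sq M (\<lambda>x. f x + g x) \<le> ennreal (1 + t) * L2sq M f + ennreal (1 + 1 / t) * L2sq M g"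
proof -
  have "L2sq M (\<lambda>x. f x + g x) \<le> (\<integral>\<^sup>+ x. ennreal (1 + t) * nsq (f x) + ennreal (1 + 1 / t) * nsq (g x) \<partial>M)"
    unfolding L2sq_def
  proof (rule nn_integral_mono)
    fix x
    have "nsq (f x + g x) \<le> ennreal ((1 + t) * (norm (f x))\<^sup>2 + (1 + 1 / t) * (norm (g x))\<^sup>2)"
      by (rule ennreal_leI[OF norm_add_sq_le[OF t]])
    then show "nsq (f x + g x) \<le> ennreal (1 + t) * nsq (f x) + ennreal (1 + 1 / t) * nsq (g x)"
      using t by (simp add: ennreal_plus ennreal_mult del: ennreal_plus)
        (simp add: ennreal_mult[symmetric] ennreal_plus[symmetric] del: ennreal_plus)
  qed
  also have "\<dots> = ennreal (1 + t) * L2sq M f + ennreal (1 + 1 / t) * L2sq M g"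
    unfolding L2sq_def by (simp add: nn_integral_add nn_integral_cmult)
  finally show ?thesis .
qed

lemma L2sq_add_le:
  assumes [measurable]: "f \<in> borel_measurable M" "g \<in> borel_measurable M"
  shows "L2sq M (\<lambda>x. f x + g x) \<le> 2 * L2sq M f + 2 * L2sq M g"
  using L2sq_young[OF assms, of 1] by simp

lemma L2sq_cmult:
  assumes [measurable]: "f \<in> borel_measurable M"
  shows "L2sq M (\<lambda>x. c * f x) = nsq c * L2sq M f"
  unfolding L2sq_def by (simp add: norm_mult power_mult_distrib ennreal_mult nn_integral_cmult)

lemma L2sq_minus_commute: "L2sq M (\<lambda>x. f x - g x) = L2sq M (\<lambda>x. g x - f x)"
  by (simp add: L2sq_def norm_minus_commute)

lemma L2sq_diff_le:
  assumes [measurable]: "f \<in> borel_measurable M" "g \<in> borel_measurable M"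
  shows "L2sq M (\<lambda>x. f x - g x) \<le> 2 * L2sq M f + 2 * L2sq M g"
  using L2sq_add_le[of f M "\<lambda>x. - g x"] by (simp add: L2sq_def)

lemma L2sq_diff_finite:
  assumes "f \<in> borel_measurable M" "g \<in> borel_measurable M" "L2sq M f < \<infinity>" "L2sq M g < \<infinity>"
  shows "L2sq M (\<lambda>x. f x - g x) < \<infinity>"
  using L2sq_diff_le[OF assms(1,2)] assms(3,4)
  by (auto simp: ennreal_mult_less_top ennreal_add_less_top intro: le_less_trans)

lemma L2sq_restrict_le:
  "L2sq M (\<lambda>x. f x * indicator A x) \<le> L2sq M f"
  unfolding L2sq_def by (rule nn_integral_mono) (auto split: split_indicator)

lemma integrable_L2_mult:
  fixes f g :: "'a \<Rightarrow> complex"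
  assumes [measurable]: "f \<in> borel_measurable M" "g \<in> borel_measurable M"
    and "L2sq M f < \<infinity>" "L2sq M g < \<infinity>"
  shows "integrable M (\<lambda>x. f x * g x)"
proof (rule integrableI_bounded)
  have "(\<integral>\<^sup>+ x. ennreal (norm (f x * g x)) \<partial>M) \<le> (\<integral>\<^sup>+ x. nsq (f x) + nsq (g x) \<partial>M)"
  proof (rule nn_integral_mono)
    fix x
    have "norm (f x * g x) \<le> (norm (f x))\<^sup>2 + (norm (g x))\<^sup>2"
      using sum_squares_bound[of "norm (f x)" "norm (g x)"] mult_nonneg_nonneg[of "norm (f x)" "norm (g x)"]
      unfolding norm_mult by (simp add: mult.assoc del: mult_nonneg_nonneg zero_le_mult_iff)
    then show "ennreal (norm (f x * g x)) \<le> nsq (f x) + nsq (g x)"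
      by (simp add: ennreal_plus[symmetric] del: ennreal_plus)
  qed
  also have "\<dots> = L2sq M f + L2sq M g"
    unfolding L2sq_def by (rule nn_integral_add) auto
  also have "\<dots> < \<infinity>" using assms by simp
  finally show "(\<integral>\<^sup>+ x. ennreal (norm (f x * g x)) \<partial>M) < \<infinity>" .
qed simp

lemma norm_integral_le_nn:
  fixes f :: "'a \<Rightarrow> 'b::{banach,second_countable_topology}"
  shows "ennreal (norm (integral\<^sup>L M f)) \<le> (\<integral>\<^sup>+ x. ennreal (norm (f x)) \<partial>M)"
  by (cases "integrable M f") (auto intro: integral_norm_bound_ennreal simp: not_integrable_integral_eq)

lemma L2_Cauchy_Schwarz:
  fixes f g :: "'a \<Rightarrow> complex"
  assumes [measurable]: "f \<in> borel_measurable M" "g \<in> borel_measurable M"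
  shows "nsq (LINT x|M. f x * g x) \<le> L2sq M f * L2sq M g"
proof -
  have "ennreal (norm (LINT x|M. f x * g x)) \<le> (\<integral>\<^sup>+ x. ennreal (norm (f x)) * ennreal (norm (g x)) \<partial>M)"
    using integral_norm_bound_ennreal[of M "\<lambda>x. f x * g x"] not_integrable_integral_eq[of M "\<lambda>x. f x * g x"]
    by (cases "integrable M (\<lambda>x. f x * g x)") (auto simp: norm_mult ennreal_mult)
  then have "(ennreal (norm (LINT x|M. f x * g x)))\<^sup>2 \<le> (\<integral>\<^sup>+ x. ennreal (norm (f x)) * ennreal (norm (g x)) \<partial>M)\<^sup>2"
    by (rule power_mono) simp
  also have "\<dots> \<le> (\<integral>\<^sup>+ x. (ennreal (norm (f x)))\<^sup>2 \<partial>M) * (\<integral>\<^sup>+ x. (ennreal (norm (g x)))\<^sup>2 \<partial>M)"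
    by (rule Cauchy_Schwarz_nn_integral) auto
  finally show ?thesis by (simp add: L2sq_def ennreal_power)
qed

lemma ennreal_tendsto_0_le:
  fixes f :: "'a \<Rightarrow> ennreal"
  assumes "(g \<longlongrightarrow> 0) F" "\<And>x. f x \<le> g x"
  shows "(f \<longlongrightarrow> 0) F"
  by (rule tendsto_sandwich[OF _ _ tendsto_const assms(1)]) (use assms in auto)

lemma L2_pairing_tendsto:
  fixes g :: "'i \<Rightarrow> 'a \<Rightarrow> complex"
  assumes [measurable]: "\<And>n. g n \<in> borel_measurable M" "h \<in> borel_measurable M" "f \<in> borel_measurable M"
    and fin: "\<And>n. L2sq M (g n) < \<infinity>" "L2sq M h < \<infinity>" "L2sq M f < \<infinity>"
    and lim: "((\<lambda>n. L2sq M (\<lambda>x. g n x - h x)) \<longlongrightarrow> 0) F"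
  shows "((\<lambda>n. LINT x|M. g n x * f x) \<longlongrightarrow> (LINT x|M. h x * f x)) F"
proof -
  have "((\<lambda>n. L2sq M f * L2sq M (\<lambda>x. g n x - h x)) \<longlongrightarrow> L2sq M f * 0) F"
    by (rule ennreal_tendsto_cmult) (use fin lim in auto)
  then have l0: "((\<lambda>n. L2sq M f * L2sq M (\<lambda>x. g n x - h x)) \<longlongrightarrow> 0) F" by simp
  have eq: "(LINT x|M. g n x * f x) - (LINT x|M. h x * f x) = (LINT x|M. (g n x - h x) * f x)" for n
    unfolding left_diff_distrib
    by (rule Bochner_Integration.integral_diff[symmetric]) (auto intro!: integrable_L2_mult fin)
  have "((\<lambda>n. nsq ((LINT x|M. g n x * f x) - (LINT x|M. h x * f x))) \<longlongrightarrow> 0) F"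
    by (rule ennreal_tendsto_0_le[OF l0]) (unfold eq, subst mult.commute, rule L2_Cauchy_Schwarz, auto)
  then have "((\<lambda>n. (norm ((LINT x|M. g n x * f x) - (LINT x|M. h x * f x)))\<^sup>2) \<longlongrightarrow> 0) F"
    by (subst (asm) ennreal_0[symmetric], subst (asm) tendsto_ennreal_iff) auto
  then have "((\<lambda>n. sqrt ((norm ((LINT x|M. g n x * f x) - (LINT x|M. h x * f x)))\<^sup>2)) \<longlongrightarrow> sqrt 0) F"
    by (rule tendsto_real_sqrt)
  then show ?thesis
    by (simp add: tendsto_norm_zero_iff LIM_zero_iff)
qed

text \<open>Along a subsequence with squared increments at most 4^(-k), the weights 2^k still leave
  a convergent sum of integrals, so the weighted squares are summable almost everywhere and the
  subsequence converges there. Fatou's lemma carries the Cauchy bound over to the limit.\<close>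

lemma L2_complete:
  fixes f :: "nat \<Rightarrow> 'a \<Rightarrow> complex"
  assumes [measurable]: "\<And>n. f n \<in> borel_measurable M"
    and cauchy: "\<And>e. e > 0 \<Longrightarrow> \<exists>N. \<forall>m\<ge>N. \<forall>n\<ge>N. L2sq M (\<lambda>x. f m x - f n x) \<le> ennreal e"
  shows "\<exists>h. h \<in> borel_measurable M \<and> (\<lambda>n. L2sq M (\<lambda>x. f n x - h x)) \<longlonglongrightarrow> 0"
proof -
  have "\<forall>k. \<exists>N. \<forall>m\<ge>N. \<forall>n\<ge>N. L2sq M (\<lambda>x. f m x - f n x) \<le> ennreal ((1/4) ^ k)"
    using cauchy by simp
  then obtain N where N: "\<And>k m n. m \<ge> N k \<Longrightarrow> n \<ge> N k \<Longrightarrow> L2sq M (\<lambda>x. f m x - f n x) \<le> ennreal ((1/4) ^ k)"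
    by metis
  \<comment> \<open>The partial sums make r monotone with r k \<ge> N k; the extra summand k gives r
    k \<ge> k, so that shifted indices pass every threshold.\<close>
  define r where "r k = k + (\<Sum>i\<le>k. N i)" for k
  have rN: "N k \<le> r k" "r k \<le> r (Suc k)" for k
    unfolding r_def by (auto intro: member_le_sum trans_le_add2)
  have incr: "incseq r" using rN by (auto intro: incseq_SucI)
  let ?d = "\<lambda>k x. f (r (Suc k)) x - f (r k) x"
  have d: "L2sq M (?d k) \<le> ennreal ((1/4) ^ k)" for k
    by (rule N) (use rN[of k] in auto)
  have "(\<integral>\<^sup>+ x. (\<Sum>k. ennreal (2 ^ k) * nsq (?d k x)) \<partial>M) = (\<Sum>k. ennreal (2 ^ k) * L2sq M (?d k))"
    unfolding L2sq_def by (subst nn_integral_suminf) (auto simp: nn_integral_cmult)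
  also have "\<dots> \<le> (\<Sum>k. ennreal ((1/2) ^ k))"
  proof (rule suminf_le)
    fix k
    have "ennreal (2 ^ k) * L2sq M (?d k) \<le> ennreal (2 ^ k) * ennreal ((1/4) ^ k)"
      by (rule mult_left_mono[OF d]) simp
    also have "\<dots> = ennreal ((1/2) ^ k)"
      by (simp add: ennreal_mult[symmetric] power_mult_distrib[symmetric])
    finally show "ennreal (2 ^ k) * L2sq M (?d k) \<le> ennreal ((1/2) ^ k)" .
  qed auto
  also have "\<dots> = ennreal (\<Sum>k. (1/2) ^ k)"
    by (rule suminf_ennreal2) auto
  also have "\<dots> < \<infinity>" by simp
  finally have fin: "(\<integral>\<^sup>+ x. (\<Sum>k. ennreal (2 ^ k) * nsq (?d k x)) \<partial>M) < \<infinity>" .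
  have "AE x in M. (\<Sum>k. ennreal (2 ^ k) * nsq (?d k x)) \<noteq> \<infinity>"
    by (rule nn_integral_PInf_AE) (use fin in auto)
  then have conv: "AE x in M. convergent (\<lambda>k. f (r k) x)"
  proof eventually_elim
    case (elim x)
    have "summable (\<lambda>k. 2 ^ k * (norm (?d k x))\<^sup>2)"
    proof (rule summable_suminf_not_top)
      show "(\<Sum>k. ennreal (2 ^ k * (norm (?d k x))\<^sup>2)) \<noteq> top"
        using elim by (simp add: ennreal_mult)
    qed simp
    then have s: "summable (\<lambda>k. (1/2) ^ k + 2 ^ k * (norm (?d k x))\<^sup>2)"
      by (intro summable_add summable_geometric) auto
    have "summable (\<lambda>k. ?d k x)"
    proof (rule summable_comparison_test'[OF s])
      fix k
      \<comment> \<open>The square yields 2|d| \<le> 2^(-k) + 2^k |d|^2, which turns summability of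
        the weighted squares into absolute summability of the increments.\<close>
      have "0 \<le> 2 ^ k * (norm (?d k x) - (1/2) ^ k)\<^sup>2" by simp
      also have "\<dots> = 2 ^ k * (norm (?d k x))\<^sup>2 - 2 * (2 ^ k * (1/2) ^ k) * norm (?d k x) + (2 ^ k * (1/2) ^ k) * (1/2) ^ k"
        by (simp only: power2_diff) (simp add: power2_eq_square algebra_simps)
      also have "2 ^ k * (1/2) ^ k = (1::real)" by (simp add: power_one_over)
      finally have "2 * norm (?d k x) \<le> (1/2) ^ k + 2 ^ k * (norm (?d k x))\<^sup>2" by simp
      then show "norm (?d k x) \<le> (1/2) ^ k + 2 ^ k * (norm (?d k x))\<^sup>2"
        using norm_ge_zero[of "?d k x"] by linarith
    qed
    then have "convergent (\<lambda>n. \<Sum>k<n. ?d k x)" by (simp add: summable_iff_convergent)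
    then have "convergent (\<lambda>n. f (r n) x - f (r 0) x)"
      by (simp only: sum_lessThan_telescope[where f = "\<lambda>k. f (r k) x"])
    then show ?case by (simp only: convergent_diff_const_right_iff)
  qed
  define h where "h x = lim (\<lambda>k. f (r k) x)" for x
  have hm[measurable]: "h \<in> borel_measurable M"
    unfolding h_def by (rule borel_measurable_lim_metric) simp
  have "(\<lambda>n. L2sq M (\<lambda>x. f n x - h x)) \<longlonglongrightarrow> 0"
  proof (rule order_tendstoI)
    fix e :: ennreal assume "0 < e"
    then obtain e' where e': "0 < e'" "ennreal e' < e"
      by (metis dense ennreal_cases ennreal_less_zero_iff less_le_not_le not_gr_zero top_greatest ennreal_0)
    obtain N' where N': "\<And>m n. m \<ge> N' \<Longrightarrow> n \<ge> N' \<Longrightarrow> L2sq M (\<lambda>x. f m x - f n x) \<le> ennreal e'"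
      using cauchy[OF e'(1)] by blast
    have "L2sq M (\<lambda>x. f n x - h x) \<le> ennreal e'" if n: "n \<ge> N'" for n
    proof -
      have "L2sq M (\<lambda>x. f n x - h x) = (\<integral>\<^sup>+ x. liminf (\<lambda>k. nsq (f n x - f (r (k + N')) x)) \<partial>M)"
        unfolding L2sq_def
      proof (rule nn_integral_cong_AE, use conv in eventually_elim)
        fix x assume "convergent (\<lambda>k. f (r k) x)"
        then have "(\<lambda>k. f (r k) x) \<longlonglongrightarrow> h x" by (simp add: h_def convergent_LIMSEQ_iff)
        then have "(\<lambda>k. f (r (k + N')) x) \<longlonglongrightarrow> h x" by (rule LIMSEQ_ignore_initial_segment)
        then have "(\<lambda>k. nsq (f n x - f (r (k + N')) x)) \<longlonglongrightarrow> nsq (f n x - h x)"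
          by (intro tendsto_intros)
        then show "nsq (f n x - h x) = liminf (\<lambda>k. nsq (f n x - f (r (k + N')) x))"
          using lim_imp_Liminf[OF sequentially_bot] by metis
      qed
      also have "\<dots> \<le> liminf (\<lambda>k. L2sq M (\<lambda>x. f n x - f (r (k + N')) x))"
        unfolding L2sq_def by (rule nn_integral_liminf) simp
      also have "\<dots> \<le> ennreal e'"
      proof (rule Liminf_le)
        show "\<forall>\<^sub>F k in sequentially. L2sq M (\<lambda>x. f n x - f (r (k + N')) x) \<le> ennreal e'"
          by (rule always_eventually) (auto intro!: N' n simp: r_def)
      qed simp
      finally show ?thesis .
    qed
    then show "\<forall>\<^sub>F n in sequentially. L2sq M (\<lambda>x. f n x - h x) < e"
      using e' unfolding eventually_sequentially by (meson le_less_trans)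
  qed simp
  then show ?thesis using hm by blast
qed

subsection \<open>Plancherel theory\<close>

lemma complex_indicator_measurable[measurable]:
  assumes [measurable]: "A \<in> sets M"
  shows "(indicator A :: 'a \<Rightarrow> complex) \<in> borel_measurable M"
proof -
  have "(\<lambda>x. complex_of_real (indicator A x)) \<in> borel_measurable M" by measurable
  moreover have "(\<lambda>x. complex_of_real (indicator A x)) = indicator A" by (auto split: split_indicator)
  ultimately show ?thesis by simp
qed

lemma inv_fourier_measurable[measurable]:
  fixes W :: "'a::euclidean_space \<Rightarrow> complex"
  assumes [measurable]: "W \<in> borel_measurable borel"
  shows "inv_fourier W \<in> borel_measurable borel"
proof -
  have "(\<lambda>x. LINT \<xi>|lborel. W \<xi> * cis (x \<bullet> \<xi>)) \<in> borel_measurable borel"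
    by (rule lborel.borel_measurable_lebesgue_integral) simp
  then show ?thesis unfolding inv_fourier_def[abs_def] by simp
qed

lemma gauss_minus_commute: "gauss (a *\<^sub>R (x - y)) = gauss (a *\<^sub>R (y - x))"
  unfolding gauss_def by (simp add: inner_diff_left inner_diff_right inner_commute algebra_simps)

lemma nn_integral_gauss_scale:
  fixes x :: "'a::euclidean_space"
  assumes t: "t > 0"
  shows "(\<integral>\<^sup>+ y. ennreal (norm (gauss ((1 / t) *\<^sub>R (y - x)))) \<partial>lborel) = ennreal (t ^ DIM('a) * gauss_mass TYPE('a))"
proof -
  have "(\<integral>\<^sup>+ y. ennreal (norm (gauss ((1 / t) *\<^sub>R (y - x)))) \<partial>lborel)
    = ennreal (\<bar>t\<bar> ^ DIM('a)) * (\<integral>\<^sup>+ y. ennreal (norm (gauss ((1 / t) *\<^sub>R (x + t *\<^sub>R y - x)))) \<partial>lborel)"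
    by (rule nn_integral_lborel_affine) (use t in auto)
  also have "(\<integral>\<^sup>+ y. ennreal (norm (gauss ((1 / t) *\<^sub>R (x + t *\<^sub>R y - x)))) \<partial>lborel) = (\<integral>\<^sup>+ y. ennreal (norm (gauss (y::'a))) \<partial>lborel)"
    using t by simp
  also have "\<dots> = ennreal (LINT y|lborel. norm (gauss (y::'a)))"
    by (rule nn_integral_eq_integral) (auto intro: integrable_norm gauss_integrable)
  also have "(LINT y|lborel. norm (gauss (y::'a))) = gauss_mass TYPE('a)"
  proof -
    have "complex_of_real (LINT y|lborel. norm (gauss (y::'a))) = (LINT y|lborel. gauss (y::'a))"
      unfolding gauss_norm unfolding gauss_def integral_complex_of_real ..
    then show ?thesis unfolding integral_gauss of_real_eq_iff .
  qed
  finally show ?thesis using t by (simp add: ennreal_mult less_imp_le gauss_mass_pos)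
qed

text \<open>With a Gaussian damping, Fubini and \<open>gauss_convolution\<close> turn the integral
  of |F|^2 into a double integral of cnj (W \<eta>) W(y) against a Gaussian in y - \<eta>. Bounding
  the product by the mean of the squares leaves the mass of the Gaussian, in which the powers of t
  cancel, and Fatou's lemma removes the damping.\<close>

lemma inv_fourier_L2_bound:
  fixes W :: "'a::euclidean_space \<Rightarrow> complex"
  assumes W: "integrable lborel W"
  shows "L2sq lborel (inv_fourier W) \<le> ennreal (1 / (2 * pi) ^ DIM('a)) * L2sq lborel W"
proof -
  have [measurable]: "W \<in> borel_measurable borel" using borel_measurable_integrable[OF W] by simp
  let ?d = "DIM('a)" and ?G = "gauss_mass TYPE('a)"
  define F where "F x = (LINT y|lborel. W y * cis (x \<bullet> y))" for x
  have [measurable]: "F \<in> borel_measurable borel"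
    unfolding F_def by (rule lborel.borel_measurable_lebesgue_integral) simp
  obtain KF where KF: "\<And>x. norm (F x) \<le> KF"
  proof
    fix x show "norm (F x) \<le> (LINT y|lborel. norm (W y))"
      unfolding F_def using integral_norm_bound[of lborel "\<lambda>y. W y * cis (x \<bullet> y)"] by (simp add: norm_mult)
  qed
  have cnjF: "cnj (F x) = (LINT y|lborel. cnj (W y) * cis (- (x \<bullet> y)))" for x
    unfolding F_def by (simp add: Bochner_Integration.integral_cnj[symmetric] cis_cnj)
  have key: "(\<integral>\<^sup>+ x. ennreal ((norm (F x))\<^sup>2 * norm (gauss (t *\<^sub>R x))) \<partial>lborel) \<le> ennreal ((2 * pi) ^ ?d) * L2sq lborel W"
    if t: "t > 0" for t
  proof -
    let ?g = "\<lambda>y \<eta>. gauss ((1 / t) *\<^sub>R (y - \<eta>)) :: complex"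
    have iFg: "integrable lborel (\<lambda>x. gauss (t *\<^sub>R x) * F x)"
    proof (rule Bochner_Integration.integrable_bound)
      show "integrable lborel (\<lambda>x::'a. KF * norm (gauss (t *\<^sub>R x)))"
        by (intro integrable_mult_right integrable_norm gauss_scale_integrable t)
      show "AE x in lborel. norm (gauss (t *\<^sub>R x) * F x) \<le> norm (KF * norm (gauss (t *\<^sub>R x)))"
        using KF by (intro AE_I2) (simp add: norm_mult mult.commute mult_right_mono order_trans[OF KF abs_ge_self] abs_mult)
    qed simp
    have iFF: "integrable lborel (\<lambda>x. (norm (F x))\<^sup>2 * norm (gauss (t *\<^sub>R x)))"
    proof (rule Bochner_Integration.integrable_bound[OF integrable_mult_right[OF integrable_norm[OF iFg], of KF]])
      show "AE x in lborel. norm ((norm (F x))\<^sup>2 * norm (gauss (t *\<^sub>R x))) \<le> norm (KF * norm (gauss (t *\<^sub>R x) * F x))"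
      proof (rule AE_I2)
        fix x
        have "norm (F x) * (norm (F x) * norm (gauss (t *\<^sub>R x))) \<le> \<bar>KF\<bar> * (norm (F x) * norm (gauss (t *\<^sub>R x)))"
          by (rule mult_right_mono[OF order_trans[OF KF abs_ge_self]]) simp
        then show "norm ((norm (F x))\<^sup>2 * norm (gauss (t *\<^sub>R x))) \<le> norm (KF * norm (gauss (t *\<^sub>R x) * F x))"
          by (simp add: norm_mult abs_mult power2_eq_square mult_ac)
      qed
    qed simp
    have ge: "gauss (t *\<^sub>R x) = complex_of_real (norm (gauss (t *\<^sub>R x)))" for x :: 'a
      unfolding gauss_norm by (simp add: gauss_def)
    \<comment> \<open>One factor of |F|^2 = F cnj F is written out as an integral; Fubini then moves
      the other one, together with the damping, inside.\<close>
    have "complex_of_real (LINT x|lborel. (norm (F x))\<^sup>2 * norm (gauss (t *\<^sub>R x)))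
      = (LINT x|lborel. (gauss (t *\<^sub>R x) * F x) * (LINT \<eta>|lborel. cnj (W \<eta>) * cis (- (x \<bullet> \<eta>))))"
      unfolding integral_complex_of_real[symmetric] cnjF[symmetric]
      by (rule Bochner_Integration.integral_cong) (simp_all only: of_real_mult complex_norm_square ge[symmetric] mult_ac)
    also have "\<dots> = (LINT \<eta>|lborel. cnj (W \<eta>) * (LINT x|lborel. (gauss (t *\<^sub>R x) * F x) * cis (- (x \<bullet> \<eta>))))"
      by (rule fubini_kernel) (use iFg W in auto)
    also have "\<dots> = (LINT \<eta>|lborel. cnj (W \<eta>) * (complex_of_real (?G / t ^ ?d) * (LINT y|lborel. W y * ?g y \<eta>)))"
      using gauss_convolution[OF W t] by (simp add: F_def mult_ac)
    finally have eq: "complex_of_real (LINT x|lborel. (norm (F x))\<^sup>2 * norm (gauss (t *\<^sub>R x))) =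
        (LINT \<eta>|lborel. cnj (W \<eta>) * (complex_of_real (?G / t ^ ?d) * (LINT y|lborel. W y * ?g y \<eta>)))" .
    have "(\<integral>\<^sup>+ x. ennreal ((norm (F x))\<^sup>2 * norm (gauss (t *\<^sub>R x))) \<partial>lborel) = ennreal (LINT x|lborel. (norm (F x))\<^sup>2 * norm (gauss (t *\<^sub>R x)))"
      by (rule nn_integral_eq_integral[OF iFF]) simp
    also have "\<dots> = ennreal (norm (complex_of_real (LINT x|lborel. (norm (F x))\<^sup>2 * norm (gauss (t *\<^sub>R x)))))"
      by (simp add: abs_of_nonneg)
    also have "\<dots> \<le> (\<integral>\<^sup>+ \<eta>. ennreal (norm (cnj (W \<eta>) * (complex_of_real (?G / t ^ ?d) * (LINT y|lborel. W y * ?g y \<eta>)))) \<partial>lborel)"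
      unfolding eq by (rule norm_integral_le_nn)
    also have "\<dots> \<le> (\<integral>\<^sup>+ \<eta>. ennreal (?G / t ^ ?d) * (\<integral>\<^sup>+ y. ennreal (norm (W \<eta>)) * ennreal (norm (W y)) * ennreal (norm (?g y \<eta>)) \<partial>lborel) \<partial>lborel)"
    proof (rule nn_integral_mono)
      fix \<eta>
      have "ennreal (norm (LINT y|lborel. W y * ?g y \<eta>)) \<le> (\<integral>\<^sup>+ y. ennreal (norm (W y * ?g y \<eta>)) \<partial>lborel)"
        by (rule norm_integral_le_nn)
      then have "ennreal (?G / t ^ ?d) * (ennreal (norm (W \<eta>)) * ennreal (norm (LINT y|lborel. W y * ?g y \<eta>))) \<le>
        ennreal (?G / t ^ ?d) * (ennreal (norm (W \<eta>)) * (\<integral>\<^sup>+ y. ennreal (norm (W y * ?g y \<eta>)) \<partial>lborel))"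
        by (intro mult_left_mono) auto
      also have "ennreal (norm (W \<eta>)) * (\<integral>\<^sup>+ y. ennreal (norm (W y * ?g y \<eta>)) \<partial>lborel) =
         (\<integral>\<^sup>+ y. ennreal (norm (W \<eta>)) * ennreal (norm (W y)) * ennreal (norm (?g y \<eta>)) \<partial>lborel)"
        by (subst nn_integral_cmult[symmetric]) (auto simp: norm_mult ennreal_mult mult.assoc)
      finally show "ennreal (norm (cnj (W \<eta>) * (complex_of_real (?G / t ^ ?d) * (LINT y|lborel. W y * ?g y \<eta>)))) \<le>
        ennreal (?G / t ^ ?d) * (\<integral>\<^sup>+ y. ennreal (norm (W \<eta>)) * ennreal (norm (W y)) * ennreal (norm (?g y \<eta>)) \<partial>lborel)"
        using t gauss_mass_pos[where 'a='a]
        by (simp add: norm_mult norm_divide norm_power ennreal_mult[symmetric] mult_ac less_imp_le)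
    qed
    \<comment> \<open>The product |W \<eta>| |W y| is replaced by the half sum of squares. The
      kernel is symmetric in y and \<eta>, so both halves integrate to the same multiple of the
      squared norm of W.\<close>
    also have "\<dots> \<le> (\<integral>\<^sup>+ \<eta>. ennreal (?G / t ^ ?d) * (\<integral>\<^sup>+ y. (ennreal (1/2) * nsq (W \<eta>) + ennreal (1/2) * nsq (W y)) * ennreal (norm (?g y \<eta>)) \<partial>lborel) \<partial>lborel)"
    proof (intro nn_integral_mono mult_left_mono mult_right_mono)
      fix \<eta> y
      have "norm (W \<eta>) * norm (W y) \<le> 1/2 * (norm (W \<eta>))\<^sup>2 + 1/2 * (norm (W y))\<^sup>2"
        using sum_squares_bound[of "norm (W \<eta>)" "norm (W y)"] by simp
      then have "ennreal (norm (W \<eta>) * norm (W y)) \<le> ennreal (1/2 * (norm (W \<eta>))\<^sup>2 + 1/2 * (norm (W y))\<^sup>2)"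
        by (rule ennreal_leI)
      moreover have "ennreal (norm (W \<eta>) * norm (W y)) = ennreal (norm (W \<eta>)) * ennreal (norm (W y))"
        by (rule ennreal_mult) auto
      moreover have "ennreal (1/2 * (norm (W \<eta>))\<^sup>2 + 1/2 * (norm (W y))\<^sup>2) = ennreal (1/2 * (norm (W \<eta>))\<^sup>2) + ennreal (1/2 * (norm (W y))\<^sup>2)"
        by (rule ennreal_plus) auto
      moreover have "ennreal (1/2 * a\<^sup>2) = ennreal (1/2) * ennreal (a\<^sup>2)" for a
        by (rule ennreal_mult) auto
      ultimately show "ennreal (norm (W \<eta>)) * ennreal (norm (W y)) \<le> ennreal (1/2) * nsq (W \<eta>) + ennreal (1/2) * nsq (W y)"
        by simp
    qed auto
    also have "\<dots> = ennreal (?G / t ^ ?d) * (\<integral>\<^sup>+ \<eta>. (\<integral>\<^sup>+ y. ennreal (1/2) * nsq (W \<eta>) * ennreal (norm (?g y \<eta>)) \<partial>lborel)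
         + (\<integral>\<^sup>+ y. ennreal (1/2) * nsq (W y) * ennreal (norm (?g y \<eta>)) \<partial>lborel) \<partial>lborel)"
      by (subst nn_integral_cmult, simp) (simp add: distrib_right nn_integral_add)
    also have "\<dots> = ennreal (?G / t ^ ?d) * ((\<integral>\<^sup>+ \<eta>. (\<integral>\<^sup>+ y. ennreal (1/2) * nsq (W \<eta>) * ennreal (norm (?g y \<eta>)) \<partial>lborel) \<partial>lborel)
         + (\<integral>\<^sup>+ \<eta>. (\<integral>\<^sup>+ y. ennreal (1/2) * nsq (W y) * ennreal (norm (?g y \<eta>)) \<partial>lborel) \<partial>lborel))"
      by (subst nn_integral_add) auto
    also have "(\<integral>\<^sup>+ \<eta>. (\<integral>\<^sup>+ y. ennreal (1/2) * nsq (W \<eta>) * ennreal (norm (?g y \<eta>)) \<partial>lborel) \<partial>lborel)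
      = ennreal (1/2) * ennreal (t ^ ?d * ?G) * L2sq lborel W"
      unfolding L2sq_def
      by (simp add: nn_integral_cmult nn_integral_gauss_scale[OF t] nn_integral_multc mult_ac)
    also have "(\<integral>\<^sup>+ \<eta>. (\<integral>\<^sup>+ y. ennreal (1/2) * nsq (W y) * ennreal (norm (?g y \<eta>)) \<partial>lborel) \<partial>lborel)
      = (\<integral>\<^sup>+ y. (\<integral>\<^sup>+ \<eta>. ennreal (1/2) * nsq (W y) * ennreal (norm (?g y \<eta>)) \<partial>lborel) \<partial>lborel)"
      by (rule lborel_pair.Fubini') simp
    also have "\<dots> = ennreal (1/2) * ennreal (t ^ ?d * ?G) * L2sq lborel W"
    proof -
      have "(\<integral>\<^sup>+ \<eta>. ennreal (norm (?g y \<eta>)) \<partial>lborel) = ennreal (t ^ ?d * ?G)" for y :: 'a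
        by (subst gauss_minus_commute) (rule nn_integral_gauss_scale[OF t])
      then show ?thesis unfolding L2sq_def
        by (simp add: nn_integral_cmult nn_integral_multc mult_ac)
    qed
    also have "ennreal (?G / t ^ ?d) * (ennreal (1/2) * ennreal (t ^ ?d * ?G) * L2sq lborel W + ennreal (1/2) * ennreal (t ^ ?d * ?G) * L2sq lborel W)
       = (ennreal (?G / t ^ ?d) * ennreal (t ^ ?d * ?G) * (ennreal (1/2) + ennreal (1/2))) * L2sq lborel W"
      by (simp only: distrib_left distrib_right mult_ac)
    also have "ennreal (?G / t ^ ?d) * ennreal (t ^ ?d * ?G) * (ennreal (1/2) + ennreal (1/2)) = ennreal ((2 * pi) ^ ?d)"
    proof -
      have "ennreal (1/2) + ennreal (1/2) = 1"
        by (subst ennreal_plus[symmetric]) auto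
      then have "ennreal (?G / t ^ ?d) * ennreal (t ^ ?d * ?G) * (ennreal (1/2) + ennreal (1/2)) = ennreal ((?G / t ^ ?d) * (t ^ ?d * ?G))"
        using t gauss_mass_pos[where 'a='a] by (simp add: ennreal_mult[symmetric] less_imp_le)
      also have "(?G / t ^ ?d) * (t ^ ?d * ?G) = ?G * ?G" using t by simp
      finally show ?thesis by (simp only: gauss_mass_sq)
    qed
    finally show ?thesis .
  qed
  have "L2sq lborel F \<le> ennreal ((2 * pi) ^ ?d) * L2sq lborel W"
  proof -
    let ?t = "\<lambda>n. 1 / real (Suc n)"
    \<comment> \<open>The Gaussian factor tends to 1 pointwise as the damping parameter 1/(n + 1)
      tends to 0.\<close>
    have "L2sq lborel F = (\<integral>\<^sup>+ x. liminf (\<lambda>n. ennreal ((norm (F x))\<^sup>2 * norm (gauss (?t n *\<^sub>R x)))) \<partial>lborel)"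
      unfolding L2sq_def
    proof (rule nn_integral_cong)
      fix x
      have "?t \<longlonglongrightarrow> 0" using LIMSEQ_inverse_real_of_nat by (simp only: inverse_eq_divide)
      then have "(\<lambda>n. ennreal ((norm (F x))\<^sup>2 * norm (gauss (?t n *\<^sub>R x)))) \<longlonglongrightarrow> ennreal ((norm (F x))\<^sup>2 * exp (- ((0 *\<^sub>R x) \<bullet> (0 *\<^sub>R x)) / 2))"
        unfolding gauss_norm by (intro tendsto_intros) simp_all
      then show "nsq (F x) = liminf (\<lambda>n. ennreal ((norm (F x))\<^sup>2 * norm (gauss (?t n *\<^sub>R x))))"
        using lim_imp_Liminf[OF sequentially_bot] by fastforce
    qed
    also have "\<dots> \<le> liminf (\<lambda>n. \<integral>\<^sup>+ x. ennreal ((norm (F x))\<^sup>2 * norm (gauss (?t n *\<^sub>R x))) \<partial>lborel)"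
      by (rule nn_integral_liminf) simp
    also have "\<dots> \<le> ennreal ((2 * pi) ^ ?d) * L2sq lborel W"
    proof (rule Liminf_le)
      show "\<forall>\<^sub>F n in sequentially. (\<integral>\<^sup>+ x. ennreal ((norm (F x))\<^sup>2 * norm (gauss (?t n *\<^sub>R x))) \<partial>lborel) \<le> ennreal ((2 * pi) ^ ?d) * L2sq lborel W"
        by (rule always_eventually) (intro allI key, simp)
    qed simp
    finally show ?thesis .
  qed
  then have "nsq (1 / (2 * pi) ^ ?d :: complex) * L2sq lborel F \<le> nsq (1 / (2 * pi) ^ ?d :: complex) * (ennreal ((2 * pi) ^ ?d) * L2sq lborel W)"
    by (rule mult_left_mono) simp
  also have "\<dots> = ennreal (1 / (2 * pi) ^ ?d) * L2sq lborel W"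
    unfolding mult.assoc[symmetric]
    by (subst ennreal_mult[symmetric]) (auto simp: norm_divide norm_power norm_mult power2_eq_square)
  finally have fin: "nsq (1 / (2 * pi) ^ ?d :: complex) * L2sq lborel F \<le> ennreal (1 / (2 * pi) ^ ?d) * L2sq lborel W" .
  show ?thesis
  proof -
    have "inv_fourier W = (\<lambda>x. (1 / (2 * pi) ^ ?d) * F x)"
      by (simp add: inv_fourier_def[abs_def] F_def[symmetric])
    then have "L2sq lborel (inv_fourier W) = nsq (1 / (2 * pi) ^ ?d :: complex) * L2sq lborel F"
      using L2sq_cmult[of F lborel "1 / (2 * pi) ^ ?d"] by simp
    then show ?thesis using fin by simp
  qed
qed

lemma inverse_Suc_tendsto_0: "(\<lambda>n. 1 / real (Suc n)) \<longlonglongrightarrow> 0"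
  using LIMSEQ_inverse_real_of_nat by (simp only: inverse_eq_divide)

lemma gauss_approximation:
  fixes c :: "'a::euclidean_space \<Rightarrow> complex"
  assumes [measurable]: "c \<in> borel_measurable borel" and c: "continuous_on UNIV c" and K: "\<And>x. norm (c x) \<le> K"
  shows "(\<lambda>n. LINT z|lborel. c (y + (1 / real (Suc n)) *\<^sub>R z) * gauss z) \<longlonglongrightarrow> complex_of_real (gauss_mass TYPE('a)) * c y"
proof -
  have "(\<lambda>n. LINT z|lborel. c (y + (1 / real (Suc n)) *\<^sub>R z) * gauss z) \<longlonglongrightarrow> (LINT (z::'a)|lborel. c y * gauss z)"
  proof (rule integral_dominated_convergence[where w = "\<lambda>z. K * norm (gauss z :: complex)"])
    show "integrable lborel (\<lambda>z::'a. K * norm (gauss z))"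
      by (intro integrable_mult_right integrable_norm gauss_integrable)
    show "AE z in lborel. (\<lambda>n. c (y + (1 / real (Suc n)) *\<^sub>R z) * gauss z) \<longlonglongrightarrow> c y * gauss z"
    proof (rule AE_I2)
      fix z
      have "(\<lambda>n. y + (1 / real (Suc n)) *\<^sub>R z) \<longlonglongrightarrow> y + 0 *\<^sub>R z"
        by (intro tendsto_intros inverse_Suc_tendsto_0)
      then have "(\<lambda>n. c (y + (1 / real (Suc n)) *\<^sub>R z)) \<longlonglongrightarrow> c y"
        using c by (intro continuous_on_tendsto_compose[OF c]) auto
      then show "(\<lambda>n. c (y + (1 / real (Suc n)) *\<^sub>R z) * gauss z) \<longlonglongrightarrow> c y * gauss z"
        by (intro tendsto_intros)
    qed
    show "AE z in lborel. norm (c (y + (1 / real (Suc n)) *\<^sub>R z) * gauss z) \<le> K * norm (gauss z)" for n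
      by (simp add: norm_mult mult_right_mono K)
  qed simp_all
  then show ?thesis by (simp add: integral_gauss mult.commute)
qed

lemma gauss_convolution_rescale:
  fixes c :: "'a::euclidean_space \<Rightarrow> complex"
  assumes [measurable]: "c \<in> borel_measurable borel" and t: "t > 0"
  shows "(LINT x|lborel. c x * gauss ((1 / t) *\<^sub>R (x - y))) = t ^ DIM('a) *\<^sub>R (LINT z|lborel. c (y + t *\<^sub>R z) * gauss z)"
  using t by (subst lborel_integral_affine[of _ t y]) simp_all

text \<open>Both sides of \<open>gauss_convolution\<close> are followed as the width tends to 0:
  dominated convergence removes the damping on the left, and on the right the Gaussian averages
  converge to the value of f. The two Gaussian masses multiply to (2\<pi>)^d.\<close>

lemma fourier_inversion:
  fixes f :: "'a::euclidean_space \<Rightarrow> complex"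
  assumes f: "f \<in> schwartz"
  shows "fourier (inv_fourier f) = f"
proof
  fix x
  have [measurable]: "f \<in> borel_measurable borel" by (rule schwartz_measurable[OF f])
  let ?t = "\<lambda>n. 1 / real (Suc n)" and ?G = "complex_of_real (gauss_mass TYPE('a))"
  let ?P = "(2 * complex_of_real pi) ^ DIM('a)"
  have GG: "?G * ?G = ?P"
    unfolding of_real_mult[symmetric] gauss_mass_sq by simp
  define u where "u \<xi> = (LINT y|lborel. f y * cis (\<xi> \<bullet> y))" for \<xi>
  have u: "u = (\<lambda>\<xi>. ?P * inv_fourier f \<xi>)"
    unfolding u_def inv_fourier_def by simp
  have us: "u \<in> schwartz" unfolding u by (intro schwartz_cmult inv_fourier_schwartz f)
  have [measurable]: "u \<in> borel_measurable borel" by (rule schwartz_measurable[OF us])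
  obtain K where K: "\<And>x. norm (f x) \<le> K" using schwartz_bounded[OF f] by blast
  have 1: "(\<lambda>n. LINT \<xi>|lborel. gauss (?t n *\<^sub>R \<xi>) * cis (- (\<xi> \<bullet> x)) * u \<xi>) \<longlonglongrightarrow> (LINT \<xi>|lborel. cis (- (\<xi> \<bullet> x)) * u \<xi>)"
  proof (rule integral_dominated_convergence)
    show "integrable lborel (\<lambda>\<xi>. norm (u \<xi>))" by (intro integrable_norm schwartz_integrable us)
    show "AE \<xi> in lborel. (\<lambda>n. gauss (?t n *\<^sub>R \<xi>) * cis (- (\<xi> \<bullet> x)) * u \<xi>) \<longlonglongrightarrow> cis (- (\<xi> \<bullet> x)) * u \<xi>"
    proof (rule AE_I2)
      fix \<xi> :: 'a
      have "(\<lambda>n. gauss (?t n *\<^sub>R \<xi>) * cis (- (\<xi> \<bullet> x)) * u \<xi>) \<longlonglongrightarrow> gauss (0 *\<^sub>R \<xi>) * cis (- (\<xi> \<bullet> x)) * u \<xi>"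
        by (intro tendsto_intros continuous_on_tendsto_compose[OF schwartz_continuous[OF gauss_schwartz]] inverse_Suc_tendsto_0) auto
      then show "(\<lambda>n. gauss (?t n *\<^sub>R \<xi>) * cis (- (\<xi> \<bullet> x)) * u \<xi>) \<longlonglongrightarrow> cis (- (\<xi> \<bullet> x)) * u \<xi>"
        by (simp add: gauss_def)
    qed
    show "AE \<xi> in lborel. norm (gauss (?t n *\<^sub>R \<xi>) * cis (- (\<xi> \<bullet> x)) * u \<xi>) \<le> norm (u \<xi>)" for n
      using mult_right_mono[OF gauss_norm_le norm_ge_zero] by (intro AE_I2) (simp add: norm_mult del: of_nat_Suc)
  qed simp_all
  have 2: "(LINT \<xi>|lborel. gauss (?t n *\<^sub>R \<xi>) * cis (- (\<xi> \<bullet> x)) * u \<xi>) = ?G * (LINT z|lborel. f (x + ?t n *\<^sub>R z) * gauss z)" for n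
  proof -
    have "?t n > 0" by simp
    from gauss_convolution[OF schwartz_integrable[OF f] this, of x, folded u_def]
      gauss_convolution_rescale[OF _ this, of f x]
    show ?thesis by (simp add: scaleR_conv_of_real del: of_nat_Suc)
  qed
  have "(\<lambda>n. ?G * (LINT z|lborel. f (x + ?t n *\<^sub>R z) * gauss z)) \<longlonglongrightarrow> ?G * (?G * f x)"
    by (intro tendsto_intros gauss_approximation[where K = K] schwartz_continuous f K) simp
  with 1 have "?G * (?G * f x) = (LINT \<xi>|lborel. cis (- (\<xi> \<bullet> x)) * u \<xi>)"
    unfolding 2 using LIMSEQ_unique by blast
  also have "\<dots> = ?P * fourier (inv_fourier f) x"
    unfolding u fourier_def by (subst integral_mult_right_zero[symmetric]) (simp add: mult_ac)
  finally show "fourier (inv_fourier f) x = f x"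
    unfolding mult.assoc[symmetric] GG by simp
qed

section \<open>Fourier pairs of square integrable functions\<close>

lemma schwartz_L2: "f \<in> schwartz \<Longrightarrow> L2sq lborel f < \<infinity>"
  using schwartz_square_integrable[of f] unfolding L2sq_def integrable_iff_bounded by simp

text \<open>Here g is the inverse Fourier transform of W, tested bilinearly against Schwartz
  functions. This matches the way \<open>represents\<close> tests the distribution of the theorem,
  and makes linearity and stability under L2 limits immediate.\<close>

definition FT :: "('a::euclidean_space \<Rightarrow> complex) \<Rightarrow> ('a \<Rightarrow> complex) \<Rightarrow> bool" where
  "FT g W \<longleftrightarrow> g \<in> borel_measurable borel \<and> W \<in> borel_measurable borel \<and>
     L2sq lborel g < \<infinity> \<and> L2sq lborel W < \<infinity> \<and>
     (\<forall>f\<in>schwartz. (LINT x|lborel. g x * f x) = (LINT \<xi>|lborel. W \<xi> * inv_fourier f \<xi>))"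

lemma FT_integrable:
  assumes "FT g W" and f: "f \<in> schwartz"
  shows "integrable lborel (\<lambda>x. g x * f x)" "integrable lborel (\<lambda>x. W x * inv_fourier f x)"
  using assms schwartz_L2[OF f] schwartz_L2[OF inv_fourier_schwartz[OF f]]
    schwartz_measurable[OF f] schwartz_measurable[OF inv_fourier_schwartz[OF f]]
  by (auto intro!: integrable_L2_mult simp: FT_def)

lemma FT_diff:
  assumes a: "FT g W" and b: "FT g' W'"
  shows "FT (\<lambda>x. g x - g' x) (\<lambda>x. W x - W' x)"
  using assms FT_integrable[OF a] FT_integrable[OF b]
  unfolding FT_def by (auto intro!: L2sq_diff_finite[unfolded infinity_ennreal_def] simp: left_diff_distrib)

text \<open>Both pairings are continuous in L2. The filter is left general because the lemma is
  applied along sequences and along finite subsets of the lattice.\<close>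

lemma FT_limit:
  assumes ft: "\<And>n. FT (g n) (W n)" and F: "F \<noteq> bot"
    and [measurable]: "g' \<in> borel_measurable borel" "W' \<in> borel_measurable borel"
    and fin: "L2sq lborel g' < \<infinity>" "L2sq lborel W' < \<infinity>"
    and lim: "((\<lambda>n. L2sq lborel (\<lambda>x. g n x - g' x)) \<longlongrightarrow> 0) F" "((\<lambda>n. L2sq lborel (\<lambda>x. W n x - W' x)) \<longlongrightarrow> 0) F"
  shows "FT g' W'"
proof -
  have [measurable]: "g n \<in> borel_measurable borel" "W n \<in> borel_measurable borel" for n
    using ft by (auto simp: FT_def)
  have "(LINT x|lborel. g' x * f x) = (LINT \<xi>|lborel. W' \<xi> * inv_fourier f \<xi>)" if f: "f \<in> schwartz" for f
  proof (rule tendsto_unique[OF F])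
    note fi = inv_fourier_schwartz[OF f]
    have [measurable]: "f \<in> borel_measurable borel" "inv_fourier f \<in> borel_measurable borel"
      using schwartz_measurable f fi by auto
    show "((\<lambda>n. LINT x|lborel. g n x * f x) \<longlongrightarrow> (LINT x|lborel. g' x * f x)) F"
      by (rule L2_pairing_tendsto) (use ft fin lim schwartz_L2[OF f] in \<open>auto simp: FT_def\<close>)
    have "((\<lambda>n. LINT x|lborel. W n x * inv_fourier f x) \<longlongrightarrow> (LINT x|lborel. W' x * inv_fourier f x)) F"
      by (rule L2_pairing_tendsto) (use ft fin lim schwartz_L2[OF fi] in \<open>auto simp: FT_def\<close>)
    then show "((\<lambda>n. LINT x|lborel. g n x * f x) \<longlongrightarrow> (LINT x|lborel. W' x * inv_fourier f x)) F"
      using ft f by (simp add: FT_def)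
  qed
  then show ?thesis using fin by (auto simp: FT_def)
qed

lemma FT_inv_fourier:
  assumes W: "integrable lborel W" and W2: "L2sq lborel W < \<infinity>"
  shows "FT (inv_fourier W) W"
proof -
  have [measurable]: "W \<in> borel_measurable borel" using borel_measurable_integrable[OF W] by simp
  have "L2sq lborel (inv_fourier W) < \<infinity>"
    using inv_fourier_L2_bound[OF W] W2 by (auto intro: le_less_trans simp: ennreal_mult_less_top)
  moreover have "(LINT x|lborel. inv_fourier W x * f x) = (LINT \<xi>|lborel. W \<xi> * inv_fourier f \<xi>)" if f: "f \<in> schwartz" for f
  proof -
    have "(LINT x|lborel. f x * (LINT \<xi>|lborel. W \<xi> * cis (x \<bullet> \<xi>))) = (LINT \<xi>|lborel. W \<xi> * (LINT x|lborel. f x * cis (x \<bullet> \<xi>)))"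
      by (rule fubini_kernel[OF schwartz_integrable[OF f] W]) simp_all
    then show ?thesis
      unfolding inv_fourier_def by (simp add: inner_commute mult.commute)
  qed
  ultimately show ?thesis using W2 by (auto simp: FT_def)
qed

text \<open>Inversion is applied to the test function, so that an explicitly computed forward
  transform of g suffices. This is how the transform of the comparison function is obtained.\<close>

lemma FT_fourier:
  assumes g: "integrable lborel g" and g2: "L2sq lborel g < \<infinity>"
    and W: "W \<in> borel_measurable borel" "L2sq lborel W < \<infinity>" "\<And>\<xi>. W \<xi> = fourier g \<xi>"
  shows "FT g W"
proof -
  have [measurable]: "g \<in> borel_measurable borel" using borel_measurable_integrable[OF g] by simp
  have "(LINT x|lborel. g x * f x) = (LINT \<xi>|lborel. W \<xi> * inv_fourier f \<xi>)" if f: "f \<in> schwartz" for f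
  proof -
    note fi = inv_fourier_schwartz[OF f]
    have "(LINT x|lborel. g x * f x) = (LINT x|lborel. g x * (LINT \<xi>|lborel. inv_fourier f \<xi> * cis (- (\<xi> \<bullet> x))))"
      using fourier_inversion[OF f] by (metis fourier_def)
    also have "\<dots> = (LINT \<xi>|lborel. inv_fourier f \<xi> * (LINT x|lborel. g x * cis (- (\<xi> \<bullet> x))))"
      by (rule fubini_kernel[OF g schwartz_integrable[OF fi]]) simp_all
    finally show ?thesis by (simp add: W(3) fourier_def inner_commute mult.commute)
  qed
  then show ?thesis using g2 W by (auto simp: FT_def)
qed

lemma L2_truncate_tendsto:
  fixes W :: "'a::euclidean_space \<Rightarrow> complex"
  assumes [measurable]: "W \<in> borel_measurable borel" and W2: "L2sq lborel W < \<infinity>"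
  shows "(\<lambda>n. L2sq lborel (\<lambda>x. W x * indicator (ball 0 (real n)) x - W x)) \<longlonglongrightarrow> 0"
proof -
  have "(\<lambda>n. \<integral>\<^sup>+ x. nsq (W x * indicator (ball 0 (real n)) x - W x) \<partial>lborel) \<longlonglongrightarrow> (\<integral>\<^sup>+ x. 0 \<partial>(lborel :: 'a measure))"
  proof (rule nn_integral_dominated_convergence[where w = "\<lambda>x. nsq (W x)"])
    show "AE x in lborel. (\<lambda>n. nsq (W x * indicator (ball 0 (real n)) x - W x)) \<longlonglongrightarrow> 0"
    proof (rule AE_I2, rule tendsto_eventually)
      fix x :: 'a
      obtain N where "norm x < real N" using reals_Archimedean2 by blast
      then show "\<forall>\<^sub>F n in sequentially. nsq (W x * indicator (ball 0 (real n)) x - W x) = 0"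
        unfolding eventually_sequentially by (intro exI[of _ N]) auto
    qed
    show "(\<integral>\<^sup>+ x. nsq (W x) \<partial>lborel) < \<infinity>" using W2 by (simp add: L2sq_def)
    show "AE x in lborel. nsq (W x * indicator (ball 0 (real n)) x - W x) \<le> nsq (W x)" for n
      by (auto split: split_indicator)
  qed simp_all
  then show ?thesis by (simp add: L2sq_def)
qed

lemma L2_ball_integrable:
  fixes W :: "'a::euclidean_space \<Rightarrow> complex"
  assumes [measurable]: "W \<in> borel_measurable borel" and W2: "L2sq lborel W < \<infinity>"
  shows "integrable lborel (\<lambda>x. W x * indicator (ball 0 r) x)"
proof (rule integrable_L2_mult)
  have "L2sq lborel (indicator (ball 0 r) :: 'a \<Rightarrow> complex) = (\<integral>\<^sup>+ x. indicator (ball 0 r) x \<partial>(lborel :: 'a measure))"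
    unfolding L2sq_def by (rule nn_integral_cong) (auto split: split_indicator)
  also have "\<dots> < \<infinity>" using emeasure_lborel_ball_finite[of "0 :: 'a" r] by simp
  finally show "L2sq lborel (indicator (ball 0 r) :: 'a \<Rightarrow> complex) < \<infinity>" .
qed (use W2 in auto)

text \<open>Truncations of W to balls are integrable, and their inverse transforms form a Cauchy
  sequence by \<open>inv_fourier_L2_bound\<close>. The factor 2 comes from passing the norm bound to
  the limit by the crude triangle inequality.\<close>

lemma FT_exists:
  fixes W :: "'a::euclidean_space \<Rightarrow> complex"
  assumes [measurable]: "W \<in> borel_measurable borel" and W2: "L2sq lborel W < \<infinity>"
  shows "\<exists>g. FT g W \<and> L2sq lborel g \<le> ennreal (2 / (2 * pi) ^ DIM('a)) * L2sq lborel W"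
proof -
  let ?c = "ennreal (1 / (2 * pi) ^ DIM('a))"
  define Wn where "Wn n x = W x * indicator (ball 0 (real n)) x" for n x
  have [measurable]: "Wn n \<in> borel_measurable borel" for n unfolding Wn_def by simp
  define gn where "gn n = inv_fourier (Wn n)" for n
  have [measurable]: "gn n \<in> borel_measurable borel" for n unfolding gn_def by simp
  have Wi: "integrable lborel (Wn n)" for n
    unfolding Wn_def by (rule L2_ball_integrable[OF assms])
  have Wn2: "L2sq lborel (Wn n) \<le> L2sq lborel W" for n
    unfolding Wn_def by (rule L2sq_restrict_le)
  have ftn: "FT (gn n) (Wn n)" for n
    unfolding gn_def using FT_inv_fourier[OF Wi le_less_trans[OF Wn2 W2]] .
  have Wlim: "(\<lambda>n. L2sq lborel (\<lambda>x. Wn n x - W x)) \<longlonglongrightarrow> 0"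
    unfolding Wn_def by (rule L2_truncate_tendsto[OF assms])
  have gdiff: "L2sq lborel (\<lambda>x. gn m x - gn n x) \<le> ?c * L2sq lborel (\<lambda>x. Wn m x - Wn n x)" for m n
  proof -
    have "(\<lambda>x. gn m x - gn n x) = inv_fourier (\<lambda>x. Wn m x - Wn n x)"
      unfolding gn_def inv_fourier_def[abs_def] left_diff_distrib
      by (subst Bochner_Integration.integral_diff) (auto intro!: integrable_cis_mult Wi simp: diff_divide_distrib)
    then show ?thesis
      using inv_fourier_L2_bound[OF Bochner_Integration.integrable_diff[OF Wi Wi]] by simp
  qed
  have "\<exists>h. h \<in> borel_measurable lborel \<and> (\<lambda>n. L2sq lborel (\<lambda>x. gn n x - h x)) \<longlonglongrightarrow> 0"
  proof (rule L2_complete)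
    fix e :: real assume e: "e > 0"
    have "(\<lambda>n. (?c * 4) * L2sq lborel (\<lambda>x. Wn n x - W x)) \<longlonglongrightarrow> (?c * 4) * 0"
      by (rule ennreal_tendsto_cmult[OF _ Wlim]) (simp add: ennreal_mult_less_top)
    then have "\<forall>\<^sub>F n in sequentially. (?c * 4) * L2sq lborel (\<lambda>x. Wn n x - W x) < ennreal e"
      using e by (intro order_tendstoD(2)) auto
    then obtain N where N: "\<And>n. n \<ge> N \<Longrightarrow> (?c * 4) * L2sq lborel (\<lambda>x. Wn n x - W x) \<le> ennreal e"
      unfolding eventually_sequentially using less_imp_le by blast
    have "L2sq lborel (\<lambda>x. gn m x - gn n x) \<le> ennreal e" if mn: "m \<ge> N" "n \<ge> N" for m n
    proof -
      let ?a = "L2sq lborel (\<lambda>x. Wn m x - W x)" and ?b = "L2sq lborel (\<lambda>x. Wn n x - W x)"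
      have "L2sq lborel (\<lambda>x. Wn m x - Wn n x) = L2sq lborel (\<lambda>x. (Wn m x - W x) - (Wn n x - W x))" by simp
      also have "\<dots> \<le> 2 * ?a + 2 * ?b" by (rule L2sq_diff_le) simp_all
      also have "\<dots> \<le> 4 * max ?a ?b"
      proof -
        have "2 * ?a + 2 * ?b \<le> 2 * max ?a ?b + 2 * max ?a ?b" by (intro add_mono mult_left_mono) auto
        then show ?thesis by (simp add: mult_2[symmetric] mult.assoc[symmetric])
      qed
      finally have "?c * L2sq lborel (\<lambda>x. Wn m x - Wn n x) \<le> ?c * (4 * max ?a ?b)"
        by (rule mult_left_mono) simp
      then have "L2sq lborel (\<lambda>x. gn m x - gn n x) \<le> ?c * (4 * max ?a ?b)"
        by (rule order_trans[OF gdiff])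
      then show ?thesis using N[OF mn(1)] N[OF mn(2)] by (auto simp: max_def mult.assoc split: if_splits)
    qed
    then show "\<exists>N. \<forall>m\<ge>N. \<forall>n\<ge>N. L2sq lborel (\<lambda>x. gn m x - gn n x) \<le> ennreal e" by blast
  qed simp
  then obtain g where gm[measurable]: "g \<in> borel_measurable borel" and glim: "(\<lambda>n. L2sq lborel (\<lambda>x. gn n x - g x)) \<longlonglongrightarrow> 0"
    by auto
  have gle: "L2sq lborel g \<le> 2 * (?c * L2sq lborel W)"
  proof -
    have "L2sq lborel g \<le> 2 * (?c * L2sq lborel W) + 2 * L2sq lborel (\<lambda>x. gn n x - g x)" for n
    proof -
      have "L2sq lborel g = L2sq lborel (\<lambda>x. gn n x - (gn n x - g x))" by simp
      also have "\<dots> \<le> 2 * L2sq lborel (gn n) + 2 * L2sq lborel (\<lambda>x. gn n x - g x)" by (rule L2sq_diff_le) simp_all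
      also have "L2sq lborel (gn n) \<le> ?c * L2sq lborel W"
        unfolding gn_def by (rule order_trans[OF inv_fourier_L2_bound[OF Wi] mult_left_mono[OF Wn2]]) simp
      finally show ?thesis by (simp add: mult_left_mono)
    qed
    moreover have "(\<lambda>n. 2 * (?c * L2sq lborel W) + 2 * L2sq lborel (\<lambda>x. gn n x - g x)) \<longlonglongrightarrow> 2 * (?c * L2sq lborel W) + 2 * 0"
      by (intro tendsto_add tendsto_const ennreal_tendsto_cmult glim) simp
    ultimately show ?thesis
      using LIMSEQ_le_const[of _ "2 * (?c * L2sq lborel W)" "L2sq lborel g"] by auto
  qed
  have "L2sq lborel g < \<infinity>"
    by (rule le_less_trans[OF gle]) (use W2 in \<open>simp add: ennreal_mult_less_top\<close>)
  then have "FT g W"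
    by (intro FT_limit[OF ftn sequentially_bot _ _ _ W2 glim Wlim]) simp_all
  moreover have "2 * ?c = ennreal (2 / (2 * pi) ^ DIM('a))"
    by (subst ennreal_numeral[symmetric], subst ennreal_mult[symmetric]) auto
  ultimately show ?thesis using gle by (auto simp: mult.assoc[symmetric])
qed

text \<open>The positive and the negative part of h define measures that agree on closed sets, an
  intersection-stable generator of the Borel sets, and are finite. They coincide, hence so do their
  densities, which forces h = 0 almost everywhere.\<close>

lemma AE_zero_if_closed:
  fixes h :: "'a::euclidean_space \<Rightarrow> real"
  assumes h: "integrable lborel h"
    and z: "\<And>C. closed C \<Longrightarrow> (LINT x|lborel. indicator C x * h x) = 0"
  shows "AE x in lborel. h x = 0"
proof -
  have [measurable]: "h \<in> borel_measurable borel" using borel_measurable_integrable[OF h] by simp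
  let ?p = "density lborel (\<lambda>x. ennreal (h x))" and ?m = "density lborel (\<lambda>x. ennreal (- h x))"
  have eq: "emeasure ?p C = emeasure ?m C" if C: "closed C" for C
  proof -
    have [measurable]: "C \<in> sets borel" using C by simp
    have i: "integrable lborel (\<lambda>x. indicator C x * h x)"
      using integrable_mult_indicator[OF _ h, of C] by simp
    have p: "emeasure ?p C = (\<integral>\<^sup>+ x. ennreal (indicator C x * h x) \<partial>lborel)"
      by (simp add: emeasure_density) (rule nn_integral_cong, auto split: split_indicator)
    have m: "emeasure ?m C = (\<integral>\<^sup>+ x. ennreal (- (indicator C x * h x)) \<partial>lborel)"
      by (simp add: emeasure_density) (rule nn_integral_cong, auto split: split_indicator)
    have "0 = enn2real (emeasure ?p C) - enn2real (emeasure ?m C)"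
      using real_lebesgue_integral_def[OF i] z[OF C] by (simp add: p m)
    moreover have "emeasure ?p C < \<infinity>" "emeasure ?m C < \<infinity>"
      using i unfolding real_integrable_def p m by (auto simp: less_top)
    ultimately show ?thesis
      by (metis diff_eq_diff_eq ennreal_enn2real eq_iff_diff_eq_0 infinity_ennreal_def)
  qed
  have "?p = ?m"
  proof (rule measure_eqI_generator_eq[where E = "Collect closed" and \<Omega> = UNIV and A = "\<lambda>_. UNIV"])
    show "Int_stable (Collect closed :: 'a set set)" by (auto simp: Int_stable_def)
    show "sets ?p = sigma_sets UNIV (Collect closed)" "sets ?m = sigma_sets UNIV (Collect closed)"
      by (simp_all add: borel_eq_closed)
    have "emeasure ?p UNIV = (\<integral>\<^sup>+ x. ennreal (h x) \<partial>lborel)" by (simp add: emeasure_density)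
    also have "\<dots> < \<infinity>" using h unfolding real_integrable_def by (auto simp: less_top)
    finally show "emeasure ?p UNIV \<noteq> \<infinity>" by simp
  qed (auto simp: eq)
  then have "AE x in lborel. ennreal (h x) = ennreal (- h x)"
    by (intro sigma_finite_measure.density_unique[OF sigma_finite_lborel]) auto
  then show ?thesis
  proof eventually_elim
    case (elim x)
    then show ?case by (cases "h x \<ge> 0") (auto simp: ennreal_neg ennreal_eq_0_iff)
  qed
qed

lemma continuous_approx_closed:
  fixes C :: "'a::euclidean_space set"
  assumes "closed C" "C \<noteq> {}"
  shows "(\<lambda>n. max 0 (1 - real n * infdist x C)) \<longlonglongrightarrow> indicator C x"
proof (cases "x \<in> C")
  case True
  then show ?thesis by simp
next
  case False
  then have "infdist x C > 0"
    using assms in_closed_iff_infdist_zero[of C x] infdist_nonneg[of x C] by (auto simp: less_le)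
  moreover obtain N where "1 / infdist x C < real N" using reals_Archimedean2 by blast
  ultimately have "1 < real N * infdist x C" by (simp add: divide_less_eq)
  then have "\<forall>n\<ge>N. max 0 (1 - real n * infdist x C) = 0"
    using \<open>infdist x C > 0\<close> by (smt (verit) mult_right_mono of_nat_mono)
  then show ?thesis using False
    by (intro tendsto_eventually) (auto simp: eventually_sequentially)
qed

text \<open>Multiplication by the Gaussian makes g integrable. Testing against characters times the
  Gaussian says that the transform of the product H vanishes, hence by
  \<open>gauss_convolution\<close> all its Gaussian averages do; small widths give orthogonality to
  bounded continuous integrable functions, and from these to closed sets.\<close>

lemma L2_zero_if_orthogonal_schwartz:
  fixes g :: "'a::euclidean_space \<Rightarrow> complex"
  assumes [measurable]: "g \<in> borel_measurable borel" and g2: "L2sq lborel g < \<infinity>"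
    and orth: "\<And>f. f \<in> schwartz \<Longrightarrow> (LINT x|lborel. g x * f x) = 0"
  shows "AE x in lborel. g x = 0"
proof -
  define H where "H x = g x * gauss x" for x
  have Hm[measurable]: "H \<in> borel_measurable borel" unfolding H_def by simp
  have H: "integrable lborel H"
    unfolding H_def by (rule integrable_L2_mult) (use g2 schwartz_L2[OF gauss_schwartz] in auto)
  have "(LINT y|lborel. H y * cis (\<xi> \<bullet> y)) = 0" for \<xi>
    using orth[OF schwartz_symbol_mult[OF symbols.cis gauss_schwartz, of \<xi>]]
    by (simp add: H_def mult_ac inner_commute)
  then have conv0: "(LINT y|lborel. H y * gauss ((1 / t) *\<^sub>R (y - x))) = 0" if t: "t > 0" for t x
    using gauss_convolution[OF H t, of x] t gauss_mass_pos[where 'a='a] by simp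
  have cont: "(LINT y|lborel. H y * c y) = 0"
    if c: "continuous_on UNIV c" and ci: "integrable lborel c" and K: "\<And>x. norm (c x) \<le> K" for c :: "'a \<Rightarrow> complex" and K
  proof -
    have [measurable]: "c \<in> borel_measurable borel" using borel_measurable_integrable[OF ci] by simp
    let ?t = "\<lambda>n. 1 / real (Suc n)" and ?G = "complex_of_real (gauss_mass TYPE('a))"
    define A where "A n y = (LINT z|lborel. c (y + ?t n *\<^sub>R z) * gauss z)" for n y
    have [measurable]: "A n \<in> borel_measurable borel" for n
      unfolding A_def by (rule lborel.borel_measurable_lebesgue_integral) simp
    have K0: "0 \<le> K" using order_trans[OF norm_ge_zero K] .
    have A: "norm (A n y) \<le> K * (LINT z|lborel. norm (gauss (z::'a)))" for n y
    proof -
      have "norm (A n y) \<le> (LINT z|lborel. K * norm (gauss (z::'a)))"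
        unfolding A_def
      proof (rule norm_integral_le)
        show iK: "integrable lborel (\<lambda>z::'a. K * norm (gauss z))"
          by (intro integrable_mult_right integrable_norm gauss_integrable)
        show "norm (c (y + ?t n *\<^sub>R x) * gauss x) \<le> K * norm (gauss x)" for x
          by (simp add: norm_mult mult_right_mono K)
        then show "integrable lborel (\<lambda>z. c (y + ?t n *\<^sub>R z) * gauss z)"
          by (intro Bochner_Integration.integrable_bound[OF iK]) (auto simp: K0 abs_mult simp del: of_nat_Suc)
      qed
      then show ?thesis by simp
    qed
    have "(LINT y|lborel. H y * A n y) = 0" for n
    proof -
      have t: "?t n > 0" by simp
      have "(LINT y|lborel. H y * ((?t n) ^ DIM('a) *\<^sub>R A n y)) = (LINT y|lborel. H y * (LINT x|lborel. c x * gauss ((1 / ?t n) *\<^sub>R (x - y))))"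
        unfolding A_def by (subst gauss_convolution_rescale[OF _ t]) simp_all
      also have "\<dots> = (LINT x|lborel. c x * (LINT y|lborel. H y * gauss ((1 / ?t n) *\<^sub>R (x - y))))"
        by (rule fubini_kernel[OF H ci]) (auto intro: gauss_norm_le simp del: of_nat_Suc)
      also have "\<dots> = 0"
        by (subst gauss_minus_commute) (simp only: conv0[OF t] mult_zero_right Bochner_Integration.integral_zero)
      finally have "(LINT y|lborel. (?t n) ^ DIM('a) *\<^sub>R (H y * A n y)) = 0"
        by (simp only: mult_scaleR_right)
      then show ?thesis using t by (simp del: of_nat_Suc)
    qed
    moreover have "(\<lambda>n. LINT y|lborel. H y * A n y) \<longlonglongrightarrow> (LINT y|lborel. H y * (?G * c y))"
    proof (rule integral_dominated_convergence[where w = "\<lambda>y. norm (H y) * (K * (LINT z|lborel. norm (gauss (z::'a))))"])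
      show "integrable lborel (\<lambda>y. norm (H y) * (K * (LINT z|lborel. norm (gauss (z::'a)))))"
        by (intro integrable_mult_left integrable_norm H)
      show "AE y in lborel. (\<lambda>n. H y * A n y) \<longlonglongrightarrow> H y * (?G * c y)"
        unfolding A_def by (intro AE_I2 tendsto_intros gauss_approximation[where K = K] c K) simp
      show "AE y in lborel. norm (H y * A n y) \<le> norm (H y) * (K * (LINT z|lborel. norm (gauss (z::'a))))" for n
        by (simp add: norm_mult mult_left_mono A)
    qed simp_all
    ultimately have "(\<lambda>n. 0) \<longlonglongrightarrow> (LINT y|lborel. H y * (?G * c y))"
      by (simp only:)
    then have "(LINT y|lborel. H y * (?G * c y)) = 0"
      by (simp only: LIMSEQ_const_iff)
    moreover have "H y * (?G * c y) = ?G * (H y * c y)" for y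
      by (rule mult.left_commute)
    ultimately have "?G * (LINT y|lborel. H y * c y) = 0"
      by (simp only: integral_mult_right_zero)
    then show ?thesis using gauss_mass_pos[where 'a='a] by simp
  qed
  have cl: "(LINT x|lborel. indicator C x *\<^sub>R (H x * gauss x)) = 0" if C: "closed C" for C
  proof (cases "C = {}")
    case False
    \<comment> \<open>Continuous approximations of the indicator of a closed set need not be
      integrable; another Gaussian factor makes them so. It is positive and can be divided out at
      the end.\<close>
    let ?c = "\<lambda>n x. complex_of_real (max 0 (1 - real n * infdist x C)) * gauss x"
    have c1: "norm (complex_of_real (max 0 (1 - real n * infdist x C))) \<le> 1" for n x
      by (simp add: infdist_nonneg)
    have ci: "continuous_on UNIV (?c n)" for n
      by (intro continuous_intros schwartz_continuous gauss_schwartz)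
    then have [measurable]: "?c n \<in> borel_measurable borel" for n
      by (rule borel_measurable_continuous_onI)
    have b: "norm (?c n x) \<le> norm (gauss x)" for n x
      using mult_right_mono[OF c1 norm_ge_zero] by (simp only: norm_mult mult_1_left) 
    have z: "(LINT x|lborel. H x * ?c n x) = 0" for n
    proof (rule cont[OF ci])
      show "integrable lborel (?c n)"
        by (rule Bochner_Integration.integrable_bound[OF gauss_integrable]) (use b in simp_all)
      show "norm (?c n x) \<le> 1" for x using b gauss_norm_le order_trans by blast
    qed
    have "(\<lambda>n. LINT x|lborel. H x * ?c n x) \<longlonglongrightarrow> (LINT x|lborel. indicator C x *\<^sub>R (H x * gauss x))"
    proof (rule integral_dominated_convergence[where w = "\<lambda>x. norm (H x)"])
      show "AE x in lborel. (\<lambda>n. H x * ?c n x) \<longlonglongrightarrow> indicator C x *\<^sub>R (H x * gauss x)"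
      proof (rule AE_I2)
        fix x
        have "(\<lambda>n. H x * (complex_of_real (max 0 (1 - real n * infdist x C)) * gauss x)) \<longlonglongrightarrow> H x * (complex_of_real (indicator C x) * gauss x)"
          by (intro tendsto_mult tendsto_const tendsto_of_real continuous_approx_closed C False)
        then show "(\<lambda>n. H x * ?c n x) \<longlonglongrightarrow> indicator C x *\<^sub>R (H x * gauss x)"
          by (simp add: scaleR_conv_of_real mult_ac)
      qed
      show "AE x in lborel. norm (H x * ?c n x) \<le> norm (H x)" for n
        using mult_left_mono[OF order_trans[OF b gauss_norm_le] norm_ge_zero] by (intro AE_I2) (simp only: norm_mult mult_1_right)
      show "(\<lambda>x. indicator C x *\<^sub>R (H x * gauss x)) \<in> borel_measurable lborel"
      proof -
        have [measurable]: "C \<in> sets borel" using C by simp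
        show ?thesis by simp
      qed
    qed (use H in simp_all)
    then show ?thesis unfolding z using LIMSEQ_unique tendsto_const by blast
  qed simp
  have Hg: "integrable lborel (\<lambda>x. H x * gauss x)"
    by (rule Bochner_Integration.integrable_bound[OF H]) (auto intro!: AE_I2 simp: norm_mult mult_left_le gauss_norm_le)
  have ind: "integrable lborel (\<lambda>x. indicator C x *\<^sub>R (H x * gauss x))" if "closed C" for C
    using integrable_mult_indicator[OF _ Hg, of C] that by simp
  have "AE x in lborel. Re (H x * gauss x) = 0"
  proof (rule AE_zero_if_closed)
    show "(LINT x|lborel. indicator C x * Re (H x * gauss x)) = 0" if "closed C" for C
      using integral_Re[OF ind[OF that]] cl[OF that] by simp
  qed (rule integrable_Re[OF Hg])
  moreover have "AE x in lborel. Im (H x * gauss x) = 0"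
  proof (rule AE_zero_if_closed)
    show "(LINT x|lborel. indicator C x * Im (H x * gauss x)) = 0" if "closed C" for C
      using integral_Im[OF ind[OF that]] cl[OF that] by simp
  qed (rule integrable_Im[OF Hg])
  ultimately show ?thesis
  proof eventually_elim
    case (elim x)
    then have "H x * gauss x = 0" by (simp add: complex_eq_iff del: Re_complex_of_real)
    then show ?case by (simp add: H_def gauss_def)
  qed
qed

text \<open>By uniqueness, any g paired with W agrees almost everywhere with the one constructed in
  \<open>FT_exists\<close>, and so inherits its constant.\<close>

lemma FT_norm:
  fixes g W :: "'a::euclidean_space \<Rightarrow> complex"
  assumes ft: "FT g W"
  shows "L2sq lborel g \<le> ennreal (2 / (2 * pi) ^ DIM('a)) * L2sq lborel W"
proof -
  obtain g' where g': "FT g' W" "L2sq lborel g' \<le> ennreal (2 / (2 * pi) ^ DIM('a)) * L2sq lborel W"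
    using FT_exists ft by (metis FT_def)
  have "AE x in lborel. g x - g' x = 0"
    using FT_diff[OF ft g'(1)] by (intro L2_zero_if_orthogonal_schwartz) (auto simp: FT_def)
  then have "L2sq lborel g = L2sq lborel g'"
    unfolding L2sq_def by (intro nn_integral_cong_AE) auto
  then show ?thesis using g'(2) by simp
qed

section \<open>Fourier series on the lattice\<close>

subsection \<open>Countable sums in the extended nonnegative reals\<close>

text \<open>The bridge through which infinite lattice sums inherit additivity and Tonelli's theorem,
  free of summability conditions.\<close>

lemma infsum_ennreal_eq_nn_integral:
  fixes f :: "'a::countable \<Rightarrow> ennreal"
  shows "infsum f A = (\<integral>\<^sup>+ x. f x \<partial>count_space A)"
proof (rule antisym)
  have "infsum f A = (SUP F\<in>{F. finite F \<and> F \<subseteq> A}. sum f F)"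
    by (rule nonneg_infsum_complete) simp
  also have "\<dots> \<le> (\<integral>\<^sup>+ x. f x \<partial>count_space A)"
  proof (rule SUP_least)
    fix F assume F: "F \<in> {F. finite F \<and> F \<subseteq> A}"
    then have "sum f F = (\<integral>\<^sup>+ x. f x \<partial>count_space F)" by (simp add: nn_integral_count_space_finite)
    also have "\<dots> \<le> (\<integral>\<^sup>+ x. f x \<partial>count_space A)"
      unfolding nn_integral_count_space_indicator using F
      by (subst (1 2) nn_integral_count_space_indicator) (auto intro!: nn_integral_mono split: split_indicator)
    finally show "sum f F \<le> (\<integral>\<^sup>+ x. f x \<partial>count_space A)" .
  qed
  finally show "infsum f A \<le> (\<integral>\<^sup>+ x. f x \<partial>count_space A)" .
next
  let ?F = "\<lambda>n. {x \<in> A. to_nat x < n}"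
  have fin: "finite (?F n)" for n
    by (rule finite_subset[of _ "from_nat ` {..<n}"]) (auto intro!: image_eqI[where x = "to_nat _"])
  have "(\<integral>\<^sup>+ x. f x \<partial>count_space A) = (\<integral>\<^sup>+ x. (SUP n. f x * indicator (?F n) x) \<partial>count_space A)"
  proof (rule nn_integral_cong)
    fix x assume "x \<in> space (count_space A)"
    then have "f x = f x * indicator (?F (Suc (to_nat x))) x" by simp
    also have "\<dots> \<le> (SUP n. f x * indicator (?F n) x)" by (rule SUP_upper) simp
    finally have "f x \<le> (SUP n. f x * indicator (?F n) x)" .
    moreover have "(SUP n. f x * indicator (?F n) x) \<le> f x"
      by (rule SUP_least) (auto split: split_indicator)
    ultimately show "f x = (SUP n. f x * indicator (?F n) x)" by (rule antisym)
  qed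
  also have "\<dots> = (SUP n. \<integral>\<^sup>+ x. f x * indicator (?F n) x \<partial>count_space A)"
    by (rule nn_integral_monotone_convergence_SUP) (auto simp: incseq_def le_fun_def split: split_indicator)
  also have "\<dots> \<le> infsum f A"
  proof (rule SUP_least)
    fix n
    have "(\<integral>\<^sup>+ x. f x * indicator (?F n) x \<partial>count_space A) = sum f (?F n)"
      by (subst nn_integral_count_space'[of "?F n"]) (auto simp: fin split: split_indicator)
    also have "\<dots> \<le> infsum f A"
      by (subst nonneg_infsum_complete) (auto intro!: SUP_upper fin)
    finally show "(\<integral>\<^sup>+ x. f x * indicator (?F n) x \<partial>count_space A) \<le> infsum f A" .
  qed
  finally show "(\<integral>\<^sup>+ x. f x \<partial>count_space A) \<le> infsum f A" .
qed

lemma infsum_ennreal_measurable[measurable]: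
  fixes f :: "'b \<Rightarrow> 'a::countable \<Rightarrow> ennreal"
  assumes [measurable]: "\<And>k. (\<lambda>x. f x k) \<in> borel_measurable M"
  shows "(\<lambda>x. infsum (f x) A) \<in> borel_measurable M"
proof -
  let ?F = "\<lambda>n. {x \<in> A. to_nat x < n}"
  have fin: "finite (?F n)" for n
    by (rule finite_subset[of _ "from_nat ` {..<n}"]) (auto intro!: image_eqI[where x = "to_nat _"])
  have "infsum g A = (SUP n. sum g (?F n))" for g :: "'a \<Rightarrow> ennreal"
  proof (rule antisym)
    show "infsum g A \<le> (SUP n. sum g (?F n))"
    proof (subst nonneg_infsum_complete, simp, rule SUP_least)
      fix F assume F: "F \<in> {F. finite F \<and> F \<subseteq> A}"
      then have "F \<subseteq> ?F (Suc (Max (insert 0 (to_nat ` F))))" by (auto simp: less_Suc_eq_le)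
      then have "sum g F \<le> sum g (?F (Suc (Max (insert 0 (to_nat ` F)))))"
        by (intro sum_mono2 fin) auto
      also have "\<dots> \<le> (SUP n. sum g (?F n))" by (rule SUP_upper) simp
      finally show "sum g F \<le> (SUP n. sum g (?F n))" .
    qed
    show "(SUP n. sum g (?F n)) \<le> infsum g A"
      by (rule SUP_least, subst nonneg_infsum_complete) (auto intro!: SUP_upper fin)
  qed
  then show ?thesis by simp
qed

lemma nn_integral_infsum:
  fixes f :: "'a::countable \<Rightarrow> 'b \<Rightarrow> ennreal"
  assumes [measurable]: "\<And>k. f k \<in> borel_measurable M"
  shows "(\<integral>\<^sup>+ x. (\<Sum>\<^sub>\<infinity>k. f k x) \<partial>M) = (\<Sum>\<^sub>\<infinity>k. \<integral>\<^sup>+ x. f k x \<partial>M)"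
  unfolding infsum_ennreal_eq_nn_integral by (rule nn_integral_count_space_nn_integral) auto

lemma infsum_ennreal_cmult:
  fixes f :: "'a::countable \<Rightarrow> ennreal"
  shows "(\<Sum>\<^sub>\<infinity>k\<in>A. c * f k) = c * (\<Sum>\<^sub>\<infinity>k\<in>A. f k)"
  unfolding infsum_ennreal_eq_nn_integral by (rule nn_integral_cmult) simp

lemma infsum_ennreal_add:
  fixes f :: "'a::countable \<Rightarrow> ennreal"
  shows "(\<Sum>\<^sub>\<infinity>k\<in>A. f k + g k) = (\<Sum>\<^sub>\<infinity>k\<in>A. f k) + (\<Sum>\<^sub>\<infinity>k\<in>A. g k)"
  unfolding infsum_ennreal_eq_nn_integral by (rule nn_integral_add) auto

lemma infsum_ennreal_mono:
  fixes f :: "'a::countable \<Rightarrow> ennreal"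
  shows "(\<And>k. k \<in> A \<Longrightarrow> f k \<le> g k) \<Longrightarrow> (\<Sum>\<^sub>\<infinity>k\<in>A. f k) \<le> (\<Sum>\<^sub>\<infinity>k\<in>A. g k)"
  unfolding infsum_ennreal_eq_nn_integral by (rule nn_integral_mono) auto

lemma sum_le_infsum_ennreal:
  fixes f :: "'a::countable \<Rightarrow> ennreal"
  shows "finite F \<Longrightarrow> F \<subseteq> A \<Longrightarrow> sum f F \<le> infsum f A"
  by (subst nonneg_infsum_complete) (auto intro!: SUP_upper)

lemma infsum_ennreal_split:
  fixes f :: "'a::countable \<Rightarrow> ennreal"
  assumes "finite F"
  shows "(\<Sum>\<^sub>\<infinity>k. f k) = sum f F + (\<Sum>\<^sub>\<infinity>k\<in>-F. f k)"
proof -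
  have "(\<Sum>\<^sub>\<infinity>k\<in>F \<union> -F. f k) = infsum f F + infsum f (-F)"
    by (rule infsum_Un_disjoint) (auto intro!: nonneg_summable_on_complete)
  then show ?thesis using assms by simp
qed

lemma infsum_ennreal_of_real:
  fixes f :: "'a::countable \<Rightarrow> real"
  assumes "f summable_on A" "\<And>x. x \<in> A \<Longrightarrow> f x \<ge> 0"
  shows "(\<Sum>\<^sub>\<infinity>k\<in>A. ennreal (f k)) = ennreal (\<Sum>\<^sub>\<infinity>k\<in>A. f k)"
proof -
  have "(\<Sum>\<^sub>\<infinity>k\<in>A. ennreal (f k)) = (SUP F\<in>{F. finite F \<and> F\<subseteq>A}. sum (\<lambda>k. ennreal (f k)) F)"
    by (rule nonneg_infsum_complete) simp
  also have "\<dots> = (SUP F\<in>{F. finite F \<and> F\<subseteq>A}. ennreal (sum f F))"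
    by (rule SUP_cong) (use assms in \<open>auto intro!: sum_ennreal\<close>)
  finally show ?thesis using infsum_nonneg_is_SUPREMUM_ennreal[OF assms] by simp
qed

lemma summable_on_tail:
  fixes f :: "'a \<Rightarrow> real"
  assumes "f summable_on UNIV" "e > 0"
  shows "\<exists>A. finite A \<and> (\<forall>B. finite B \<and> B \<inter> A = {} \<longrightarrow> \<bar>sum f B\<bar> < e)"
proof -
  have "(sum f \<longlongrightarrow> infsum f UNIV) (finite_subsets_at_top UNIV)"
    using has_sum_infsum[OF assms(1)] by (simp add: has_sum_def)
  then have "\<forall>\<^sub>F A in finite_subsets_at_top UNIV. dist (sum f A) (infsum f UNIV) < e / 2"
    using assms(2) by (intro tendstoD) auto
  then obtain A where A: "finite A" "\<And>B. finite B \<Longrightarrow> A \<subseteq> B \<Longrightarrow> dist (sum f B) (infsum f UNIV) < e / 2"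
    unfolding eventually_finite_subsets_at_top by auto
  have "\<bar>sum f B\<bar> < e" if "finite B" "B \<inter> A = {}" for B
  proof -
    have "sum f (A \<union> B) = sum f A + sum f B"
      using that A by (intro sum.union_disjoint) auto
    moreover have "dist (sum f A) (infsum f UNIV) < e / 2" "dist (sum f (A \<union> B)) (infsum f UNIV) < e / 2"
      using A that by auto
    ultimately show ?thesis unfolding dist_real_def by linarith
  qed
  then show ?thesis using A(1) by blast
qed

subsection \<open>The lattice and its fundamental cell\<close>

abbreviation (input) dual :: "int ^ 'n::finite \<Rightarrow> real ^ 'n" where
  "dual n \<equiv> (2 * pi) *\<^sub>R latt n"

text \<open>The index of the translate of the cell that contains y; half-open cells make it
  unique.\<close>

definition cidx :: "real ^ 'n::finite \<Rightarrow> int ^ 'n" where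
  "cidx y = (\<chi> i. \<lfloor>(y $ i + pi) / (2 * pi)\<rfloor>)"

lemma latt_add: "latt (m + n) = latt m + latt n"
  and latt_diff: "latt (m - n) = latt m - latt n"
  and latt_0: "latt 0 = 0"
  and latt_minus: "latt (- n) = - latt n"
  by (simp_all add: latt_def vec_eq_iff)

lemma latt_nth: "latt n $ i = real_of_int (n $ i)"
  by (simp add: latt_def)

lemma latt_inner: "latt n \<bullet> latt m = real_of_int (\<Sum>i\<in>UNIV. n $ i * m $ i)"
  by (simp add: inner_vec_def latt_def)

lemma cis_latt_period: "cis (latt n \<bullet> (\<xi> + dual k)) = cis (latt n \<bullet> \<xi>)"
  by (simp add: inner_add_right latt_inner cis_mult[symmetric] del: of_int_sum)

lemma cis_latt_period': "cis (- (latt n \<bullet> (\<xi> + dual k))) = cis (- (latt n \<bullet> \<xi>))"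
  unfolding cis_cnj[symmetric] cis_latt_period ..

lemma cidx_iff: "cidx y = n \<longleftrightarrow> y - dual n \<in> cellQ"
proof -
  have "\<lfloor>(y $ i + pi) / (2 * pi)\<rfloor> = n $ i \<longleftrightarrow> - pi \<le> y $ i - 2 * pi * real_of_int (n $ i) \<and> y $ i - 2 * pi * real_of_int (n $ i) < pi" for i
    unfolding floor_eq_iff by (simp add: field_simps)
  then show ?thesis by (simp add: cidx_def cellQ_def vec_eq_iff latt_nth)
qed

lemma cellQ_measurable[measurable]: "cellQ \<in> sets borel"
proof -
  have "cellQ = (\<Inter>i. {\<xi>. - pi \<le> \<xi> $ i \<and> \<xi> $ i < pi})"
    by (auto simp: cellQ_def)
  also have "\<dots> \<in> sets borel"
  proof (rule sets.countable_INT'')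
    show "{\<xi> :: real ^ 'n. - pi \<le> \<xi> $ i \<and> \<xi> $ i < pi} \<in> sets borel" for i
      by measurable
  qed auto
  finally show ?thesis .
qed

lemma cidx_measurable[measurable]: "cidx \<in> measurable borel (count_space UNIV)"
proof (rule measurable_count_space_eq_countable[THEN iffD2])
  show "cidx \<in> space borel \<rightarrow> UNIV \<and> (\<forall>a\<in>UNIV. cidx -` {a} \<inter> space borel \<in> sets borel)"
  proof safe
    fix a :: "int ^ 'n"
    have "cidx -` {a} \<inter> space borel = (\<lambda>y. y - dual a) -` cellQ \<inter> space borel"
      by (auto simp flip: cidx_iff)
    also have "\<dots> \<in> sets borel" by (rule measurable_sets[OF _ cellQ_measurable]) simp
    finally show "cidx -` {a} \<inter> space borel \<in> sets borel" .
  qed auto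
qed simp

definition MQ :: "(real ^ 'n::finite) measure" where
  "MQ = restrict_space lborel cellQ"

lemma nn_integral_MQ: "(\<integral>\<^sup>+ x. f x \<partial>MQ) = (\<integral>\<^sup>+ x. f x * indicator cellQ x \<partial>lborel)"
  unfolding MQ_def by (rule nn_integral_restrict_space) simp

lemma integral_MQ:
  fixes f :: "real ^ 'n::finite \<Rightarrow> 'b::{banach,second_countable_topology}"
  shows "(LINT x|MQ. f x) = (LINT x|lborel. indicator cellQ x *\<^sub>R f x)"
  unfolding MQ_def by (rule integral_restrict_space) simp

lemma measurable_MQ[measurable (raw)]: "f \<in> measurable borel N \<Longrightarrow> f \<in> measurable MQ N"
  unfolding MQ_def by (rule measurable_restrict_space1) simp

lemma AE_MQ: "(AE x in lborel. P x) \<Longrightarrow> (AE x in MQ. P x)"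
  unfolding MQ_def by (subst AE_restrict_space_iff) auto

lemma emeasure_cellQ: "emeasure lborel (cellQ :: (real ^ 'n::finite) set) = ennreal ((2 * pi) ^ CARD('n))"
proof -
  have "emeasure lborel (cellQ :: (real ^ 'n) set) = (\<integral>\<^sup>+ x. (\<Prod>b\<in>Basis. indicator {-pi..<pi} (x \<bullet> b)) \<partial>(lborel :: (real ^ 'n) measure))"
  proof (subst nn_integral_indicator[symmetric], simp, rule nn_integral_cong)
    fix x :: "real ^ 'n"
    have "(x \<in> cellQ) = (\<forall>b\<in>Basis. x \<bullet> b \<in> {-pi..<pi})"
      by (auto simp: cellQ_def Basis_vec_def inner_axis)
    then show "indicator cellQ x = (\<Prod>b\<in>Basis. indicator {-pi..<pi} (x \<bullet> b) :: ennreal)"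
      by (auto simp: indicator_def prod_eq_1_iff intro!: prod_zero)
  qed
  also have "\<dots> = (\<Prod>b\<in>(Basis :: (real ^ 'n) set). \<integral>\<^sup>+ t. indicator {-pi..<pi} t \<partial>lborel)"
    by (rule nn_integral_lborel_prod) auto
  finally show ?thesis by (simp add: ennreal_power)
qed

lemma cnj_measurable[measurable]: "cnj \<in> borel_measurable borel"
  by (intro borel_measurable_continuous_onI continuous_on_cnj continuous_on_id)

lemma emeasure_MQ: "emeasure MQ (space (MQ :: (real ^ 'n::finite) measure)) = ennreal ((2 * pi) ^ CARD('n))"
  by (simp add: MQ_def space_restrict_space emeasure_restrict_space emeasure_cellQ)

lemma L2sq_MQ_bounded:
  fixes f :: "real ^ 'n::finite \<Rightarrow> complex"
  assumes "\<And>x. norm (f x) \<le> B"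
  shows "L2sq MQ f < \<infinity>"
proof -
  have "L2sq MQ f \<le> (\<integral>\<^sup>+ x. ennreal (B\<^sup>2) \<partial>(MQ :: (real ^ 'n) measure))"
    unfolding L2sq_def by (intro nn_integral_mono ennreal_leI power_mono assms) simp
  also have "\<dots> < \<infinity>" by (simp add: emeasure_MQ ennreal_mult_less_top)
  finally show ?thesis .
qed

lemma finite_measure_MQ: "finite_measure (MQ :: (real ^ 'n::finite) measure)"
  by (rule finite_measureI) (simp add: MQ_def space_restrict_space emeasure_restrict_space emeasure_cellQ)

lemma nn_integral_tiling:
  fixes f :: "real ^ 'n::finite \<Rightarrow> ennreal"
  assumes [measurable]: "f \<in> borel_measurable borel"
  shows "(\<integral>\<^sup>+ x. f x \<partial>lborel) = (\<integral>\<^sup>+ \<eta>. (\<Sum>\<^sub>\<infinity>k. f (\<eta> + dual k)) \<partial>MQ)"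
proof -
  have "f x = (\<Sum>\<^sub>\<infinity>k. f x * indicator cellQ (x - dual k))" for x
  proof -
    have "(\<Sum>\<^sub>\<infinity>k. f x * indicator cellQ (x - dual k)) = (\<Sum>\<^sub>\<infinity>k\<in>{cidx x}. f x * indicator cellQ (x - dual k))"
    proof (rule infsum_cong_neutral)
      fix k assume "k \<in> UNIV - {cidx x}"
      then show "f x * indicator cellQ (x - dual k) = 0" using cidx_iff[of x k] by auto
    qed auto
    also have "\<dots> = f x" using cidx_iff[of x "cidx x"] by simp
    finally show ?thesis by simp
  qed
  then have "(\<integral>\<^sup>+ x. f x \<partial>lborel) = (\<integral>\<^sup>+ x. (\<Sum>\<^sub>\<infinity>k. f x * indicator cellQ (x - dual k)) \<partial>lborel)"
    by simp
  also have "\<dots> = (\<Sum>\<^sub>\<infinity>k. \<integral>\<^sup>+ x. f x * indicator cellQ (x - dual k) \<partial>lborel)"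
    by (rule nn_integral_infsum) measurable
  also have "\<dots> = (\<Sum>\<^sub>\<infinity>k. \<integral>\<^sup>+ x. f (x + dual k) * indicator cellQ x \<partial>lborel)"
  proof (rule infsum_cong)
    fix k :: "int ^ 'n"
    show "(\<integral>\<^sup>+ x. f x * indicator cellQ (x - dual k) \<partial>lborel) = (\<integral>\<^sup>+ x. f (x + dual k) * indicator cellQ x \<partial>lborel)"
      by (subst nn_integral_lborel_affine[of _ 1 "dual k"]) (simp_all add: add.commute)
  qed
  also have "\<dots> = (\<integral>\<^sup>+ x. (\<Sum>\<^sub>\<infinity>k. f (x + dual k) * indicator cellQ x) \<partial>lborel)"
    by (rule nn_integral_infsum[symmetric]) measurable
  also have "\<dots> = (\<integral>\<^sup>+ \<eta>. (\<Sum>\<^sub>\<infinity>k. f (\<eta> + dual k)) \<partial>MQ)"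
    unfolding nn_integral_MQ mult.commute[of _ "indicator _ _"] infsum_ennreal_cmult ..
  finally show ?thesis .
qed

text \<open>The periodised square of Z. For Z = q it is \<tau>.\<close>

definition perT :: "(real ^ 'n::finite \<Rightarrow> complex) \<Rightarrow> real ^ 'n \<Rightarrow> ennreal" where
  "perT Z \<eta> = (\<Sum>\<^sub>\<infinity>k. nsq (Z (\<eta> + dual k)))"

lemma perT_measurable[measurable]:
  assumes [measurable]: "Z \<in> borel_measurable borel"
  shows "perT Z \<in> borel_measurable borel"
  unfolding perT_def[abs_def] by measurable

text \<open>Folding the integral onto one cell leaves the periodic factor unchanged and collects the
  translates of Z into \<open>perT\<close>. Through this identity the bound in (BP) becomes
  boundedness of multiplication by q from L2(Q) to L2(R^d).\<close>

lemma L2sq_periodic_mult: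
  assumes [measurable]: "F \<in> borel_measurable borel" "Z \<in> borel_measurable borel"
    and per: "\<And>\<xi> k. F (\<xi> + dual k) = F \<xi>"
  shows "L2sq lborel (\<lambda>\<eta>. F \<eta> * Z \<eta>) = (\<integral>\<^sup>+ \<eta>. nsq (F \<eta>) * perT Z \<eta> \<partial>MQ)"
  unfolding L2sq_def perT_def infsum_ennreal_cmult[symmetric]
  by (subst nn_integral_tiling) (simp_all add: per norm_mult power_mult_distrib ennreal_mult)

lemma L2sq_periodic_le:
  assumes [measurable]: "F \<in> borel_measurable borel" "Z \<in> borel_measurable borel"
    and per: "\<And>\<xi> k. F (\<xi> + dual k) = F \<xi>"
    and B: "AE \<eta> in lborel. perT Z \<eta> \<le> B"
  shows "L2sq lborel (\<lambda>\<eta>. F \<eta> * Z \<eta>) \<le> B * L2sq MQ F"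
proof -
  have "L2sq lborel (\<lambda>\<eta>. F \<eta> * Z \<eta>) \<le> (\<integral>\<^sup>+ \<eta>. B * nsq (F \<eta>) \<partial>MQ)"
    unfolding L2sq_periodic_mult[OF assms(1-3)]
    by (rule nn_integral_mono_AE) (use AE_MQ[OF B] in eventually_elim, subst mult.commute, rule mult_right_mono, auto)
  then show ?thesis unfolding L2sq_def by (simp add: nn_integral_cmult)
qed

subsection \<open>Trigonometric polynomials and Fourier series\<close>

lemma integral_cis_interval:
  "(LINT t|lborel. complex_of_real (indicator {-pi..<pi} t) * cis (real_of_int m * t)) = (if m = 0 then 2 * pi else 0)"
proof -
  have ae: "(LINT t|lborel. complex_of_real (indicator {-pi..<pi} t) * cis (real_of_int m * t)) = (LINT t|lborel. indicator {-pi..pi} t *\<^sub>R cis (real_of_int m * t))"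
  proof (rule integral_cong_AE)
    show "AE t in lborel. complex_of_real (indicator {-pi..<pi} t) * cis (real_of_int m * t) = indicator {-pi..pi} t *\<^sub>R cis (real_of_int m * t)"
      using AE_lborel_singleton[of pi] by eventually_elim (auto split: split_indicator simp: scaleR_conv_of_real)
  qed measurable
  show ?thesis
  proof (cases "m = 0")
    case True
    then show ?thesis unfolding ae by (simp add: scaleR_conv_of_real)
  next
    case False
    let ?F = "\<lambda>t. cis (real_of_int m * t) / (\<i> * of_int m)"
    have "(LINT t|lborel. indicator {-pi..pi} t *\<^sub>R cis (real_of_int m * t)) = ?F pi - ?F (- pi)"
    proof (rule integral_FTC_Icc)
      fix t :: real
      have "((\<lambda>t. exp (\<i> * complex_of_real (real_of_int m * t))) has_vector_derivative (\<i> * of_int m) * exp (\<i> * complex_of_real (real_of_int m * t))) (at t within {-pi..pi})"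
        by (rule has_vector_derivative_eq_rhs, rule field_vector_diff_chain_within[unfolded o_def])
           (auto intro!: derivative_eq_intros)
      from has_vector_derivative_divide[OF this, of "\<i> * of_int m"] show "(?F has_vector_derivative cis (real_of_int m * t)) (at t within {-pi..pi})"
        using False by (simp add: cis_conv_exp)
    qed (auto intro!: continuous_intros)
    also have "?F pi - ?F (- pi) = 0"
    proof -
      have "cis (real_of_int m * pi) = cis (- (real_of_int m * pi))"
        by (rule complex_eqI) (simp_all add: mult.commute[of _ pi] sin_integer_2pi sin_npi_int)
      then show ?thesis by simp
    qed
    finally show ?thesis using False ae by simp
  qed
qed

lemma integral_cis_MQ:
  fixes n :: "int ^ 'n::finite"
  shows "(LINT \<xi>|MQ. cis (latt n \<bullet> \<xi>)) = (if n = 0 then complex_of_real ((2 * pi) ^ CARD('n)) else 0)"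
proof -
  let ?g = "\<lambda>b t. complex_of_real (indicator {-pi..<pi} t) * cis ((latt n \<bullet> b) * t)"
  have "(LINT \<xi>|MQ. cis (latt n \<bullet> \<xi>)) = (LINT \<xi>|lborel. (\<Prod>b\<in>Basis. ?g b (\<xi> \<bullet> b)))"
    unfolding integral_MQ
  proof (rule Bochner_Integration.integral_cong)
    fix x :: "real ^ 'n"
    have "(x \<in> cellQ) = (\<forall>b\<in>Basis. x \<bullet> b \<in> {-pi..<pi})"
      by (auto simp: cellQ_def Basis_vec_def inner_axis)
    then have "complex_of_real (indicator cellQ x) = (\<Prod>b\<in>Basis. complex_of_real (indicator {-pi..<pi} (x \<bullet> b)))"
      by (auto simp: indicator_def prod_eq_1_iff intro!: prod_zero)
    moreover have "cis (latt n \<bullet> x) = (\<Prod>b\<in>Basis. cis ((latt n \<bullet> b) * (x \<bullet> b)))"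
      unfolding cis_conv_exp by (subst euclidean_inner) (simp add: exp_sum[symmetric] sum_distrib_left)
    ultimately show "indicator cellQ x *\<^sub>R cis (latt n \<bullet> x) = (\<Prod>b\<in>Basis. ?g b (x \<bullet> b))"
      by (simp add: scaleR_conv_of_real prod.distrib)
  qed simp
  also have "\<dots> = (\<Prod>b\<in>Basis. (LINT t|lborel. ?g b t))"
  proof (rule integral_lborel_prod)
    fix b :: "real ^ 'n"
    show "integrable lborel (?g b)"
      by (rule integrable_cis_mult) auto
  qed
  also have "\<dots> = (\<Prod>i\<in>UNIV. (LINT t|lborel. ?g (axis i 1) t))"
  proof (rule prod.reindex_bij_betw[symmetric, of "\<lambda>i. axis i 1"])
    show "bij_betw (\<lambda>i. axis i 1) UNIV (Basis :: (real ^ 'n) set)"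
      by (auto simp: bij_betw_def inj_on_def axis_eq_axis Basis_vec_def)
  qed
  also have "\<dots> = (\<Prod>i\<in>UNIV. if n $ i = 0 then complex_of_real (2 * pi) else 0)"
    using integral_cis_interval by (intro prod.cong) (auto simp: inner_axis latt_nth)
  also have "\<dots> = (if n = 0 then complex_of_real ((2 * pi) ^ CARD('n)) else 0)"
    by (auto simp: vec_eq_iff intro!: prod_zero)
  finally show ?thesis .
qed

definition trig :: "(int ^ 'n::finite \<Rightarrow> complex) \<Rightarrow> (int ^ 'n) set \<Rightarrow> real ^ 'n \<Rightarrow> complex" where
  "trig U A \<xi> = (\<Sum>n\<in>A. U n * cis (- (latt n \<bullet> \<xi>)))"

lemma trig_measurable[measurable]: "trig U A \<in> borel_measurable borel"
  unfolding trig_def[abs_def] by measurable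

lemma trig_periodic: "trig U A (\<xi> + dual k) = trig U A \<xi>"
  unfolding trig_def cis_latt_period' ..

lemma integrable_MQ_bounded:
  fixes f :: "real ^ 'n::finite \<Rightarrow> complex"
  assumes "f \<in> borel_measurable borel" "\<And>x. norm (f x) \<le> B"
  shows "integrable MQ f"
  by (rule finite_measure.integrable_const_bound[OF finite_measure_MQ, where B = B]) (use assms in auto)

lemma L2sq_trig:
  fixes U :: "int ^ 'n::finite \<Rightarrow> complex"
  assumes A: "finite A"
  shows "L2sq MQ (trig U A) = ennreal ((2 * pi) ^ CARD('n) * (\<Sum>n\<in>A. (norm (U n))\<^sup>2))"
proof -
  have i: "integrable MQ (\<lambda>\<xi> :: real ^ 'n. c * cis (latt k \<bullet> \<xi>))" for c k
    by (rule integrable_MQ_bounded[where B = "norm c"]) (auto simp: norm_mult)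
  have sq: "complex_of_real ((norm (trig U A \<xi>))\<^sup>2) = (\<Sum>n\<in>A. \<Sum>m\<in>A. (U n * cnj (U m)) * cis (latt (m - n) \<bullet> \<xi>))" for \<xi>
    unfolding complex_norm_square trig_def cnj_sum sum_product complex_cnj_mult cis_cnj
    by (intro sum.cong refl) (simp add: cis_mult[symmetric] latt_diff inner_diff_left field_simps cis_divide[symmetric] cis_inverse[symmetric])
  have int: "integrable MQ (\<lambda>\<xi>. (norm (trig U A \<xi>))\<^sup>2)"
  proof -
    have "integrable MQ (\<lambda>\<xi>. complex_of_real ((norm (trig U A \<xi>))\<^sup>2))"
      unfolding sq by (intro Bochner_Integration.integrable_sum i)
    from integrable_Re[OF this] show ?thesis by simp
  qed
  have "complex_of_real (LINT \<xi>|MQ. (norm (trig U A \<xi>))\<^sup>2) = (\<Sum>n\<in>A. \<Sum>m\<in>A. (U n * cnj (U m)) * (LINT \<xi>|MQ. cis (latt (m - n) \<bullet> \<xi>)))"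
    unfolding integral_complex_of_real[symmetric] sq by (simp add: Bochner_Integration.integral_sum i)
  also have "\<dots> = (\<Sum>n\<in>A. \<Sum>m\<in>A. if m = n then (U n * cnj (U m)) * complex_of_real ((2 * pi) ^ CARD('n)) else 0)"
    unfolding integral_cis_MQ by (intro sum.cong refl) auto
  also have "\<dots> = (\<Sum>n\<in>A. (U n * cnj (U n)) * complex_of_real ((2 * pi) ^ CARD('n)))"
    by (simp add: A)
  also have "\<dots> = complex_of_real ((2 * pi) ^ CARD('n) * (\<Sum>n\<in>A. (norm (U n))\<^sup>2))"
    by (simp only: complex_norm_square[symmetric] of_real_mult[symmetric] of_real_sum[symmetric] sum_distrib_right[symmetric] mult.commute)
  finally have "(LINT \<xi>|MQ. (norm (trig U A \<xi>))\<^sup>2) = (2 * pi) ^ CARD('n) * (\<Sum>n\<in>A. (norm (U n))\<^sup>2)"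
    by (simp only: of_real_eq_iff)
  then show ?thesis
    unfolding L2sq_def by (subst nn_integral_eq_integral[OF int]) auto
qed

lemma L2sq_trig_finite: "L2sq MQ (trig U A) < \<infinity>"
proof (cases "finite A")
  case True
  then show ?thesis by (simp add: L2sq_trig)
next
  case False
  then have "trig U A = (\<lambda>\<xi>. 0)" by (simp add: trig_def fun_eq_iff)
  then show ?thesis by (simp add: L2sq_def)
qed

lemma L2sq_trig_diff:
  fixes U :: "int ^ 'n::finite \<Rightarrow> complex"
  assumes A: "finite A" "finite A'"
  shows "L2sq MQ (\<lambda>\<xi>. trig U A \<xi> - trig U A' \<xi>) = ennreal ((2 * pi) ^ CARD('n) * (\<Sum>n\<in>(A - A') \<union> (A' - A). (norm (U n))\<^sup>2))"
proof -
  define V where "V n = (if n \<in> A then U n else 0) - (if n \<in> A' then U n else 0)" for n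
  have "trig U A \<xi> - trig U A' \<xi> = trig V (A \<union> A') \<xi>" for \<xi>
  proof -
    have *: "(\<Sum>n\<in>X. U n * cis (- (latt n \<bullet> \<xi>))) = (\<Sum>n\<in>A \<union> A'. (if n \<in> X then U n else 0) * cis (- (latt n \<bullet> \<xi>)))"
      if "X \<subseteq> A \<union> A'" for X
      using that A by (intro sum.mono_neutral_cong_left) auto
    show ?thesis
      unfolding trig_def V_def left_diff_distrib sum_subtractf
      using *[of A] *[of A'] by simp
  qed
  then have "L2sq MQ (\<lambda>\<xi>. trig U A \<xi> - trig U A' \<xi>) = ennreal ((2 * pi) ^ CARD('n) * (\<Sum>n\<in>A \<union> A'. (norm (V n))\<^sup>2))"
    using L2sq_trig[of "A \<union> A'" V] A by simp
  also have "(\<Sum>n\<in>A \<union> A'. (norm (V n))\<^sup>2) = (\<Sum>n\<in>(A - A') \<union> (A' - A). (norm (U n))\<^sup>2)"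
    using A by (intro sum.mono_neutral_cong_right) (auto simp: V_def)
  finally show ?thesis .
qed

text \<open>Orthogonality makes the finite partial sums a Cauchy net in L2(Q). Completeness is
  available for sequences, so a limit is taken along an enumeration of the lattice, and the tail
  bound then extends the convergence to all finite subsets. Existence is what lets the choice in
  \<open>lattice_fourier\<close> be used.\<close>

lemma is_lattice_fourier_exists:
  fixes U :: "int ^ 'n::finite \<Rightarrow> complex"
  assumes U: "U \<in> lattice_L2"
  shows "\<exists>F. is_lattice_fourier U F"
proof -
  let ?P = "(2 * pi) ^ CARD('n)"
  have sm: "(\<lambda>n. (norm (U n))\<^sup>2) summable_on UNIV" using U by (simp add: lattice_L2_def)
  have tail: "\<exists>A0. finite A0 \<and> (\<forall>A A'. finite A \<and> finite A' \<and> A0 \<subseteq> A \<and> A0 \<subseteq> A' \<longrightarrow> L2sq MQ (\<lambda>\<xi>. trig U A \<xi> - trig U A' \<xi>) \<le> ennreal e)"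
    if e: "e > 0" for e
  proof -
    obtain A0 where A0: "finite A0" "\<And>B. finite B \<Longrightarrow> B \<inter> A0 = {} \<Longrightarrow> \<bar>\<Sum>n\<in>B. (norm (U n))\<^sup>2\<bar> < e / ?P"
      using summable_on_tail[OF sm, of "e / ?P"] e by auto
    have "L2sq MQ (\<lambda>\<xi>. trig U A \<xi> - trig U A' \<xi>) \<le> ennreal e"
      if A: "finite A" "finite A'" "A0 \<subseteq> A" "A0 \<subseteq> A'" for A A'
    proof -
      have "\<bar>\<Sum>n\<in>(A - A') \<union> (A' - A). (norm (U n))\<^sup>2\<bar> < e / ?P"
        by (rule A0(2)) (use A in auto)
      then have "(\<Sum>n\<in>(A - A') \<union> (A' - A). (norm (U n))\<^sup>2) \<le> e / ?P" by linarith
      then have "?P * (\<Sum>n\<in>(A - A') \<union> (A' - A). (norm (U n))\<^sup>2) \<le> e" by (simp add: pos_le_divide_eq mult.commute)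
      then show ?thesis unfolding L2sq_trig_diff[OF A(1,2)] by (rule ennreal_leI)
    qed
    then show ?thesis using A0(1) by blast
  qed
  let ?F = "\<lambda>N::nat. {x :: int ^ 'n. to_nat x < N}"
  have fin: "finite (?F N)" for N
    by (rule finite_subset[of _ "from_nat ` {..<N}"]) (auto intro!: image_eqI[where x = "to_nat _"])
  have exh: "\<exists>N. \<forall>M\<ge>N. A \<subseteq> ?F M" if "finite A" for A
  proof (intro exI allI impI subsetI CollectI)
    fix M x assume M: "Suc (Max (insert 0 (to_nat ` A))) \<le> M" and "x \<in> A"
    then have "to_nat x \<le> Max (insert 0 (to_nat ` A))" using that by (intro Max_ge) auto
    then show "to_nat x < M" using M by linarith
  qed
  have "\<exists>h. h \<in> borel_measurable MQ \<and> (\<lambda>N. L2sq MQ (\<lambda>x. trig U (?F N) x - h x)) \<longlonglongrightarrow> 0"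
  proof (rule L2_complete)
    fix e :: real assume e: "e > 0"
    obtain A0 where A0: "finite A0" "\<And>A A'. finite A \<Longrightarrow> finite A' \<Longrightarrow> A0 \<subseteq> A \<Longrightarrow> A0 \<subseteq> A' \<Longrightarrow> L2sq MQ (\<lambda>\<xi>. trig U A \<xi> - trig U A' \<xi>) \<le> ennreal e"
      using tail[OF e] by auto
    obtain N where N: "\<And>M. M \<ge> N \<Longrightarrow> A0 \<subseteq> ?F M" using exh[OF A0(1)] by blast
    show "\<exists>N. \<forall>m\<ge>N. \<forall>n\<ge>N. L2sq MQ (\<lambda>x. trig U (?F m) x - trig U (?F n) x) \<le> ennreal e"
      by (intro exI[of _ N] allI impI A0(2)[OF fin fin] N)
  qed simp
  then obtain h where hm: "h \<in> borel_measurable MQ" and hl: "(\<lambda>N. L2sq MQ (\<lambda>x. trig U (?F N) x - h x)) \<longlonglongrightarrow> 0"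
    by blast
  define F0 where "F0 x = indicator cellQ x *\<^sub>R h x" for x
  have [measurable]: "F0 \<in> borel_measurable borel"
    unfolding F0_def using hm unfolding MQ_def by (subst (asm) borel_measurable_restrict_space_iff) auto
  \<comment> \<open>The limit lives on the cell; moving x back by its cell index extends it to a
    periodic Borel function on all of space.\<close>
  define F where "F x = (\<Sum>\<^sub>\<infinity>k\<in>{cidx x}. F0 (x - dual k))" for x
  have F: "F x = F0 (x - dual (cidx x))" for x unfolding F_def by simp
  have [measurable]: "F \<in> borel_measurable borel"
  proof -
    have "(\<lambda>x. (\<lambda>k x. F0 (x - dual k)) (cidx x) x) \<in> borel_measurable borel"
      by (rule measurable_compose_countable) measurable
    then show ?thesis unfolding F[abs_def] by simp
  qed
  have per: "F (\<xi> + dual k) = F \<xi>" for \<xi> k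
  proof -
    have "cidx (\<xi> + dual k) = cidx \<xi> + k"
      using cidx_iff[of \<xi> "cidx \<xi>"] by (subst cidx_iff) (simp add: latt_add scaleR_add_right)
    then show ?thesis by (simp add: F latt_add scaleR_add_right)
  qed
  have Fh: "F x = h x" if "x \<in> cellQ" for x
  proof -
    have "cidx x = 0" using that by (simp add: cidx_iff latt_0)
    then show ?thesis using that by (simp add: F F0_def latt_0)
  qed
  have MQeq: "(\<integral>\<^sup>+ \<xi>\<in>cellQ. nsq (F \<xi> - g \<xi>) \<partial>lborel) = L2sq MQ (\<lambda>x. F x - g x)" for g
    by (simp add: L2sq_def nn_integral_MQ)
  have "L2sq MQ (\<lambda>x. trig U (?F N) x - h x) = L2sq MQ (\<lambda>x. trig U (?F N) x - F x)" for N
    unfolding L2sq_def by (rule nn_integral_cong) (simp add: MQ_def space_restrict_space Fh)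
  then have Fl: "(\<lambda>N. L2sq MQ (\<lambda>x. trig U (?F N) x - F x)) \<longlonglongrightarrow> 0" using hl by simp
  have "((\<lambda>A. L2sq MQ (\<lambda>x. F x - trig U A x)) \<longlongrightarrow> 0) (finite_subsets_at_top UNIV)"
  proof (rule order_tendstoI)
    fix e :: ennreal assume "0 < e"
    then obtain e' where e': "0 < e'" "ennreal e' < e"
      by (metis dense ennreal_cases ennreal_less_zero_iff less_le_not_le not_gr_zero top_greatest ennreal_0)
    obtain A0 where A0: "finite A0" "\<And>A A'. finite A \<Longrightarrow> finite A' \<Longrightarrow> A0 \<subseteq> A \<Longrightarrow> A0 \<subseteq> A' \<Longrightarrow> L2sq MQ (\<lambda>\<xi>. trig U A \<xi> - trig U A' \<xi>) \<le> ennreal (e' / 4)"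
      using tail[of "e' / 4"] e' by auto
    obtain N1 where N1: "\<And>M. M \<ge> N1 \<Longrightarrow> A0 \<subseteq> ?F M" using exh[OF A0(1)] by blast
    have "\<forall>\<^sub>F N in sequentially. L2sq MQ (\<lambda>x. trig U (?F N) x - F x) < ennreal (e' / 4)"
      using Fl e' by (intro order_tendstoD(2)) auto
    then obtain N2 where N2: "\<And>M. M \<ge> N2 \<Longrightarrow> L2sq MQ (\<lambda>x. trig U (?F M) x - F x) < ennreal (e' / 4)"
      unfolding eventually_sequentially by blast
    let ?N = "max N1 N2"
    have "L2sq MQ (\<lambda>x. F x - trig U A x) < e" if A: "finite A" "A0 \<subseteq> A" for A
    proof -
      have "L2sq MQ (\<lambda>x. F x - trig U A x) = L2sq MQ (\<lambda>x. (trig U (?F ?N) x - trig U A x) - (trig U (?F ?N) x - F x))" by simp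
      also have "\<dots> \<le> 2 * L2sq MQ (\<lambda>x. trig U (?F ?N) x - trig U A x) + 2 * L2sq MQ (\<lambda>x. trig U (?F ?N) x - F x)"
        by (rule L2sq_diff_le) simp_all
      also have "\<dots> \<le> 2 * ennreal (e' / 4) + 2 * ennreal (e' / 4)"
        by (intro add_mono mult_left_mono A0(2) fin A N1 less_imp_le[OF N2]) auto
      also have "\<dots> = ennreal e'"
        using e'(1) by (simp add: ennreal_mult[symmetric] ennreal_plus[symmetric] flip: ennreal_numeral del: ennreal_plus)
      finally show ?thesis using e'(2) by simp
    qed
    then show "\<forall>\<^sub>F A in finite_subsets_at_top UNIV. L2sq MQ (\<lambda>x. F x - trig U A x) < e"
      unfolding eventually_finite_subsets_at_top using A0(1) by blast
  qed simp
  then have "is_lattice_fourier U F"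
    unfolding is_lattice_fourier_def trig_def[symmetric] MQeq by (simp add: per)
  then show ?thesis by blast
qed

lemma lattice_fourier:
  assumes "U \<in> lattice_L2"
  shows lattice_fourier_measurable: "lattice_fourier U \<in> borel_measurable borel"
    and lattice_fourier_periodic: "\<And>\<xi> k. lattice_fourier U (\<xi> + dual k) = lattice_fourier U \<xi>"
    and lattice_fourier_tendsto: "((\<lambda>A. L2sq MQ (\<lambda>x. trig U A x - lattice_fourier U x)) \<longlongrightarrow> 0) (finite_subsets_at_top UNIV)"
proof -
  have ilf: "is_lattice_fourier U (lattice_fourier U)"
    unfolding lattice_fourier_def using is_lattice_fourier_exists[OF assms] by (rule someI_ex)
  have MQeq: "(\<integral>\<^sup>+ \<xi>\<in>cellQ. nsq (F \<xi> - g \<xi>) \<partial>lborel) = L2sq MQ (\<lambda>x. g x - F x)" for F g :: "real ^ 'n \<Rightarrow> complex"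
    by (simp add: L2sq_def nn_integral_MQ norm_minus_commute)
  show "lattice_fourier U \<in> borel_measurable borel"
    "\<And>\<xi> k. lattice_fourier U (\<xi> + dual k) = lattice_fourier U \<xi>"
    "((\<lambda>A. L2sq MQ (\<lambda>x. trig U A x - lattice_fourier U x)) \<longlongrightarrow> 0) (finite_subsets_at_top UNIV)"
    using ilf unfolding is_lattice_fourier_def trig_def[symmetric] MQeq by auto
qed

lemma lattice_fourier_L2:
  assumes U: "U \<in> lattice_L2"
  shows "L2sq MQ (lattice_fourier U) < \<infinity>"
proof -
  note [measurable] = lattice_fourier_measurable[OF U]
  have "\<forall>\<^sub>F A in finite_subsets_at_top UNIV. L2sq MQ (\<lambda>x. trig U A x - lattice_fourier U x) < 1"
    by (rule order_tendstoD(2)[OF lattice_fourier_tendsto[OF U]]) simp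
  then obtain A where A: "L2sq MQ (\<lambda>x. trig U A x - lattice_fourier U x) < 1"
    unfolding eventually_finite_subsets_at_top by blast
  have "L2sq MQ (\<lambda>x. trig U A x - (trig U A x - lattice_fourier U x)) < \<infinity>"
    by (rule L2sq_diff_finite) (use A L2sq_trig_finite in \<open>auto intro: less_trans\<close>)
  then show ?thesis by simp
qed

text \<open>Termwise integration of the Fourier series under an L2 pairing. The weight is split as Z
  \<psi> because the series converges in L2 only after multiplication by a suitable Z, while \<psi>
  is an arbitrary L2 partner; the cell and the whole space are two instances.\<close>

lemma lattice_fourier_pairing_gen:
  fixes U :: "int ^ 'n::finite \<Rightarrow> complex" and Z \<psi> :: "real ^ 'n \<Rightarrow> complex"
  assumes lim: "((\<lambda>A. L2sq M (\<lambda>x. trig U A x * Z x - H x * Z x)) \<longlongrightarrow> 0) (finite_subsets_at_top UNIV)"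
    and [measurable]: "\<And>A. trig U A \<in> borel_measurable M" "Z \<in> borel_measurable M" "H \<in> borel_measurable M" "\<psi> \<in> borel_measurable M"
      "\<And>n. (\<lambda>\<xi>. cis (- (latt n \<bullet> \<xi>))) \<in> borel_measurable M"
    and fin: "\<And>A. L2sq M (\<lambda>x. trig U A x * Z x) < \<infinity>" "L2sq M (\<lambda>x. H x * Z x) < \<infinity>" "L2sq M \<psi> < \<infinity>" "integrable M (\<lambda>x. Z x * \<psi> x)"
  shows "((\<lambda>n. U n * (LINT \<xi>|M. cis (- (latt n \<bullet> \<xi>)) * (Z \<xi> * \<psi> \<xi>))) has_sum (LINT \<xi>|M. H \<xi> * (Z \<xi> * \<psi> \<xi>))) UNIV"
  unfolding has_sum_def
proof (rule tendsto_cong[THEN iffD1])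
  have i: "integrable M (\<lambda>\<xi>. cis (- (latt n \<bullet> \<xi>)) * (Z \<xi> * \<psi> \<xi>))" for n
    by (rule Bochner_Integration.integrable_bound[OF fin(4)]) (simp_all add: norm_mult)
  show "\<forall>\<^sub>F A in finite_subsets_at_top UNIV. (LINT \<xi>|M. (trig U A \<xi> * Z \<xi>) * \<psi> \<xi>) = (\<Sum>n\<in>A. U n * (LINT \<xi>|M. cis (- (latt n \<bullet> \<xi>)) * (Z \<xi> * \<psi> \<xi>)))"
  proof (rule eventually_finite_subsets_at_top_weakI)
    fix A assume "finite (A :: (int ^ 'n) set)"
    have "(LINT \<xi>|M. (trig U A \<xi> * Z \<xi>) * \<psi> \<xi>) = (LINT \<xi>|M. (\<Sum>n\<in>A. U n * (cis (- (latt n \<bullet> \<xi>)) * (Z \<xi> * \<psi> \<xi>))))"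
      by (simp add: trig_def sum_distrib_right sum_distrib_left mult_ac)
    also have "\<dots> = (\<Sum>n\<in>A. U n * (LINT \<xi>|M. cis (- (latt n \<bullet> \<xi>)) * (Z \<xi> * \<psi> \<xi>)))"
      by (simp add: Bochner_Integration.integral_sum i)
    finally show "(LINT \<xi>|M. (trig U A \<xi> * Z \<xi>) * \<psi> \<xi>) = (\<Sum>n\<in>A. U n * (LINT \<xi>|M. cis (- (latt n \<bullet> \<xi>)) * (Z \<xi> * \<psi> \<xi>)))" .
  qed
  have "((\<lambda>A. LINT \<xi>|M. (trig U A \<xi> * Z \<xi>) * \<psi> \<xi>) \<longlongrightarrow> (LINT \<xi>|M. (H \<xi> * Z \<xi>) * \<psi> \<xi>)) (finite_subsets_at_top UNIV)"
    by (rule L2_pairing_tendsto[OF _ _ _ fin(1-3) lim]) simp_all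
  then show "((\<lambda>A. LINT \<xi>|M. (trig U A \<xi> * Z \<xi>) * \<psi> \<xi>) \<longlongrightarrow> (LINT \<xi>|M. H \<xi> * (Z \<xi> * \<psi> \<xi>))) (finite_subsets_at_top UNIV)"
    by (simp add: mult.assoc)
qed

lemma lattice_fourier_pairing_MQ:
  fixes U :: "int ^ 'n::finite \<Rightarrow> complex"
  assumes U: "U \<in> lattice_L2" and [measurable]: "Y \<in> borel_measurable borel" and Y: "L2sq MQ Y < \<infinity>"
  shows "((\<lambda>n. U n * (LINT \<xi>|MQ. cis (- (latt n \<bullet> \<xi>)) * Y \<xi>)) has_sum (LINT \<xi>|MQ. lattice_fourier U \<xi> * Y \<xi>)) UNIV"
proof -
  note [measurable] = lattice_fourier_measurable[OF U]
  have one: "L2sq MQ (\<lambda>x :: real ^ 'n. 1) < \<infinity>"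
    by (rule L2sq_MQ_bounded[where B = 1]) simp
  have "integrable MQ (\<lambda>x. 1 * Y x)"
    by (rule integrable_L2_mult[OF _ _ one Y]) simp_all
  then have "((\<lambda>n. U n * (LINT \<xi>|MQ. cis (- (latt n \<bullet> \<xi>)) * (1 * Y \<xi>))) has_sum (LINT \<xi>|MQ. lattice_fourier U \<xi> * (1 * Y \<xi>))) UNIV"
    by (intro lattice_fourier_pairing_gen)
       (use lattice_fourier_tendsto[OF U] L2sq_trig_finite lattice_fourier_L2[OF U] Y in auto)
  then show ?thesis by simp
qed

text \<open>The bounded periodisation of Z turns convergence of the partial sums in L2(Q) into
  convergence of their products with Z in L2(R^d).\<close>

lemma lattice_fourier_pairing:
  fixes U :: "int ^ 'n::finite \<Rightarrow> complex"
  assumes U: "U \<in> lattice_L2" and [measurable]: "Z \<in> borel_measurable borel" "\<psi> \<in> borel_measurable borel"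
    and B: "AE \<eta> in lborel. perT Z \<eta> \<le> ennreal B" and \<psi>: "L2sq lborel \<psi> < \<infinity>" and i: "integrable lborel (\<lambda>x. Z x * \<psi> x)"
  shows "((\<lambda>n. U n * (LINT \<xi>|lborel. cis (- (latt n \<bullet> \<xi>)) * (Z \<xi> * \<psi> \<xi>))) has_sum (LINT \<xi>|lborel. lattice_fourier U \<xi> * (Z \<xi> * \<psi> \<xi>))) UNIV"
proof (rule lattice_fourier_pairing_gen[OF _ _ _ _ _ _ _ _ \<psi> i])
  note [measurable] = lattice_fourier_measurable[OF U]
  note per = lattice_fourier_periodic[OF U]
  show "L2sq lborel (\<lambda>x. trig U A x * Z x) < \<infinity>" for A
    by (rule le_less_trans[OF L2sq_periodic_le[OF _ _ trig_periodic B]])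
       (use L2sq_trig_finite in \<open>auto simp: ennreal_mult_less_top\<close>)
  show "L2sq lborel (\<lambda>x. lattice_fourier U x * Z x) < \<infinity>"
    by (rule le_less_trans[OF L2sq_periodic_le[OF _ _ per B]])
       (use lattice_fourier_L2[OF U] in \<open>auto simp: ennreal_mult_less_top\<close>)
  have "L2sq lborel (\<lambda>x. (trig U A x - lattice_fourier U x) * Z x) \<le> ennreal B * L2sq MQ (\<lambda>x. trig U A x - lattice_fourier U x)" for A
    by (rule L2sq_periodic_le[OF _ _ _ B]) (simp_all add: trig_periodic per)
  moreover have "((\<lambda>A. ennreal B * L2sq MQ (\<lambda>x. trig U A x - lattice_fourier U x)) \<longlongrightarrow> ennreal B * 0) (finite_subsets_at_top UNIV)"
    by (rule ennreal_tendsto_cmult[OF _ lattice_fourier_tendsto[OF U]]) simp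
  ultimately show "((\<lambda>A. L2sq lborel (\<lambda>x. trig U A x * Z x - lattice_fourier U x * Z x)) \<longlongrightarrow> 0) (finite_subsets_at_top UNIV)"
    unfolding left_diff_distrib[symmetric] using ennreal_tendsto_0_le by fastforce
qed (use lattice_fourier_measurable[OF U] in simp_all)

lemma lattice_fourier_coeff:
  fixes U :: "int ^ 'n::finite \<Rightarrow> complex"
  assumes U: "U \<in> lattice_L2"
  shows "(LINT \<xi>|MQ. lattice_fourier U \<xi> * cis (latt n \<bullet> \<xi>)) = complex_of_real ((2 * pi) ^ CARD('n)) * U n"
proof -
  have "L2sq MQ (\<lambda>\<xi> :: real ^ 'n. cis (latt n \<bullet> \<xi>)) < \<infinity>"
    by (rule L2sq_MQ_bounded[where B = 1]) simp
  from lattice_fourier_pairing_MQ[OF U _ this]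
  have "((\<lambda>m. U m * (LINT \<xi>|MQ. cis (- (latt m \<bullet> \<xi>)) * cis (latt n \<bullet> \<xi>))) has_sum (LINT \<xi>|MQ. lattice_fourier U \<xi> * cis (latt n \<bullet> \<xi>))) UNIV"
    by simp
  moreover have "U m * (LINT \<xi>|MQ. cis (- (latt m \<bullet> \<xi>)) * cis (latt n \<bullet> \<xi>)) = (if m = n then complex_of_real ((2 * pi) ^ CARD('n)) * U n else 0)" for m
    using integral_cis_MQ[of "n - m"] by (auto simp: cis_mult latt_diff inner_diff_left)
  ultimately have s: "((\<lambda>m. if m = n then complex_of_real ((2 * pi) ^ CARD('n)) * U n else 0) has_sum (LINT \<xi>|MQ. lattice_fourier U \<xi> * cis (latt n \<bullet> \<xi>))) UNIV"
    by simp
  have "((\<lambda>m. if m = n then complex_of_real ((2 * pi) ^ CARD('n)) * U n else 0) has_sum (complex_of_real ((2 * pi) ^ CARD('n)) * U n)) {n}"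
    using has_sum_finite[of "{n}" "\<lambda>m. if m = n then complex_of_real ((2 * pi) ^ CARD('n)) * U n else 0"] by simp
  then have "((\<lambda>m. if m = n then complex_of_real ((2 * pi) ^ CARD('n)) * U n else 0) has_sum (complex_of_real ((2 * pi) ^ CARD('n)) * U n)) UNIV"
    by (rule has_sum_cong_neutral[THEN iffD1, rotated -1]) auto
  then show ?thesis using has_sum_unique[OF s] by blast
qed

text \<open>The series is paired with the conjugate of its own sum, whose coefficients are known
  from \<open>lattice_fourier_coeff\<close>.\<close>

lemma Parseval:
  fixes U :: "int ^ 'n::finite \<Rightarrow> complex"
  assumes U: "U \<in> lattice_L2"
  shows "L2sq MQ (lattice_fourier U) = ennreal ((2 * pi) ^ CARD('n) * (\<Sum>\<^sub>\<infinity>n. (norm (U n))\<^sup>2))"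
proof -
  note [measurable] = lattice_fourier_measurable[OF U]
  let ?F = "lattice_fourier U" and ?P = "(2 * pi) ^ CARD('n)"
  have sm: "(\<lambda>n. (norm (U n))\<^sup>2) summable_on UNIV" using U by (simp add: lattice_L2_def)
  have L2: "L2sq MQ (\<lambda>x. cnj (?F x)) < \<infinity>" using lattice_fourier_L2[OF U] by (simp add: L2sq_def)
  have "((\<lambda>n. U n * (LINT \<xi>|MQ. cis (- (latt n \<bullet> \<xi>)) * cnj (?F \<xi>))) has_sum (LINT \<xi>|MQ. ?F \<xi> * cnj (?F \<xi>))) UNIV"
    by (rule lattice_fourier_pairing_MQ[OF U _ L2]) simp
  moreover have "(LINT \<xi>|MQ. cis (- (latt n \<bullet> \<xi>)) * cnj (?F \<xi>)) = complex_of_real ?P * cnj (U n)" for n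
  proof -
    have "(LINT \<xi>|MQ. cis (- (latt n \<bullet> \<xi>)) * cnj (?F \<xi>)) = (LINT \<xi>|MQ. cnj (?F \<xi> * cis (latt n \<bullet> \<xi>)))"
      by (simp add: cis_cnj mult.commute)
    also have "\<dots> = cnj (complex_of_real ?P * U n)"
      unfolding Bochner_Integration.integral_cnj lattice_fourier_coeff[OF U] ..
    finally show ?thesis by simp
  qed
  moreover have "U n * (complex_of_real ?P * cnj (U n)) = complex_of_real (?P * (norm (U n))\<^sup>2)" for n
    unfolding of_real_mult complex_norm_square by (simp add: mult_ac)
  moreover have "(LINT \<xi>|MQ. ?F \<xi> * cnj (?F \<xi>)) = complex_of_real (LINT \<xi>|MQ. (norm (?F \<xi>))\<^sup>2)"
    unfolding complex_norm_square[symmetric] by (rule integral_complex_of_real)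
  ultimately have "((\<lambda>n. complex_of_real (?P * (norm (U n))\<^sup>2)) has_sum complex_of_real (LINT \<xi>|MQ. (norm (?F \<xi>))\<^sup>2)) UNIV"
    by (simp only:)
  then have "((\<lambda>n. ?P * (norm (U n))\<^sup>2) has_sum (LINT \<xi>|MQ. (norm (?F \<xi>))\<^sup>2)) UNIV"
    by (simp only: has_sum_of_real_iff)
  moreover have "((\<lambda>n. ?P * (norm (U n))\<^sup>2) has_sum (?P * (\<Sum>\<^sub>\<infinity>n. (norm (U n))\<^sup>2))) UNIV"
    by (intro has_sum_cmult_right has_sum_infsum sm)
  ultimately have eq: "(LINT \<xi>|MQ. (norm (?F \<xi>))\<^sup>2) = ?P * (\<Sum>\<^sub>\<infinity>n. (norm (U n))\<^sup>2)"
    using has_sum_unique by blast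
  have "integrable MQ (\<lambda>\<xi>. (norm (?F \<xi>))\<^sup>2)"
    by (rule integrableI_bounded) (use lattice_fourier_L2[OF U] in \<open>simp_all add: L2sq_def\<close>)
  then have "L2sq MQ ?F = ennreal (LINT \<xi>|MQ. (norm (?F \<xi>))\<^sup>2)"
    unfolding L2sq_def by (rule nn_integral_eq_integral) simp
  then show ?thesis by (simp only: eq)
qed

text \<open>Let T be the trigonometric polynomial with coefficients c on A. The pairing of G with
  the conjugate of T and the squared norm of T are the same number, so Cauchy-Schwarz yields the
  bound after cancelling one factor.\<close>

lemma Bessel_inequality:
  fixes G :: "real ^ 'n::finite \<Rightarrow> complex"
  assumes [measurable]: "G \<in> borel_measurable borel" and G: "L2sq MQ G < \<infinity>" and A: "finite A"
    and c: "\<And>n. n \<in> A \<Longrightarrow> (LINT \<xi>|MQ. G \<xi> * cis (latt n \<bullet> \<xi>)) = complex_of_real ((2 * pi) ^ CARD('n)) * c n"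
  shows "ennreal ((2 * pi) ^ CARD('n) * (\<Sum>n\<in>A. (norm (c n))\<^sup>2)) \<le> L2sq MQ G"
proof -
  let ?P = "(2 * pi) ^ CARD('n)" and ?S = "\<Sum>n\<in>A. (norm (c n))\<^sup>2"
  let ?T = "\<lambda>\<xi>. cnj (trig c A \<xi>)"
  have [measurable]: "?T \<in> borel_measurable borel" by measurable
  have T2: "L2sq MQ ?T = ennreal (?P * ?S)"
    using L2sq_trig[OF A, of c] by (simp add: L2sq_def)
  have one: "L2sq MQ (\<lambda>x::real ^ 'n. cis (latt n \<bullet> x)) < \<infinity>" for n
    by (rule L2sq_MQ_bounded[where B = 1]) simp
  have i: "integrable MQ (\<lambda>\<xi>. G \<xi> * cis (latt n \<bullet> \<xi>))" for n
    by (rule integrable_L2_mult[OF _ _ G one]) simp_all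
  have "(LINT \<xi>|MQ. G \<xi> * ?T \<xi>) = (LINT \<xi>|MQ. (\<Sum>n\<in>A. cnj (c n) * (G \<xi> * cis (latt n \<bullet> \<xi>))))"
    by (simp add: trig_def sum_distrib_left cis_cnj mult_ac)
  also have "\<dots> = (\<Sum>n\<in>A. cnj (c n) * (complex_of_real ?P * c n))"
    by (simp add: Bochner_Integration.integral_sum i c)
  also have "\<dots> = complex_of_real (?P * ?S)"
    unfolding of_real_mult of_real_sum complex_norm_square sum_distrib_left by (simp add: mult_ac)
  finally have eq: "(LINT \<xi>|MQ. G \<xi> * ?T \<xi>) = complex_of_real (?P * ?S)" .
  have PS: "0 \<le> ?P * ?S" by (intro mult_nonneg_nonneg sum_nonneg) auto
  have "nsq (LINT \<xi>|MQ. G \<xi> * ?T \<xi>) \<le> L2sq MQ G * L2sq MQ ?T"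
    by (rule L2_Cauchy_Schwarz) simp_all
  then have le: "ennreal ((?P * ?S)\<^sup>2) \<le> L2sq MQ G * ennreal (?P * ?S)"
    unfolding T2 eq norm_of_real power2_abs .
  show ?thesis
  proof (cases "?P * ?S = 0")
    case True
    then show ?thesis by (simp only: True) simp
  next
    case False
    obtain g where g: "L2sq MQ G = ennreal g" "g \<ge> 0" using G by (cases "L2sq MQ G") auto
    have "ennreal ((?P * ?S)\<^sup>2) \<le> ennreal (g * (?P * ?S))"
      using le PS g by (simp add: ennreal_mult)
    then have "(?P * ?S) * (?P * ?S) \<le> g * (?P * ?S)"
      using PS g by (subst (asm) ennreal_le_iff) (auto simp: power2_eq_square)
    then have "?P * ?S \<le> g" using False PS by (simp only: mult_le_cancel_right)
    then show ?thesis using g by (simp add: ennreal_leI)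
  qed
qed

section \<open>The interpolated function and its comparison function\<close>

subsection \<open>The Fourier transform of the interpolated function\<close>

text \<open>The amplitude h^d Uhat(h\<xi>) Z(h\<xi>), kept general in Z: the choice Z = q belongs to
  the function of the theorem and Z = \<open>chisum\<close> to the comparison function.\<close>

definition amp :: "real \<Rightarrow> (int ^ 'n::finite \<Rightarrow> complex) \<Rightarrow> (real ^ 'n \<Rightarrow> complex) \<Rightarrow> real ^ 'n \<Rightarrow> complex" where
  "amp h U Z \<xi> = complex_of_real (h ^ CARD('n)) * (lattice_fourier U (h *\<^sub>R \<xi>) * Z (h *\<^sub>R \<xi>))"

definition sym :: "real \<Rightarrow> (real ^ 'n::finite \<Rightarrow> complex) \<Rightarrow> real ^ 'n \<Rightarrow> complex" where
  "sym s p \<xi> = complex_of_real (japanese \<xi> powr s) * p \<xi>"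

lemma japanese_measurable[measurable]: "japanese \<in> borel_measurable borel"
  unfolding japanese_def[abs_def] by measurable

lemma sym_measurable: "p \<in> borel_measurable borel \<Longrightarrow> sym s p \<in> borel_measurable borel"
  unfolding sym_def[abs_def] by measurable

lemma tau_term_eq: "tau_term s p \<xi> n = nsq (sym s p (\<xi> + dual n))"
  by (simp add: tau_term_def sym_def norm_mult)

lemma tau_eq: "tau s p = perT (sym s p)"
  by (simp add: fun_eq_iff tau_def perT_def tau_term_eq)

lemma perT_L2:
  fixes Z :: "real ^ 'n::finite \<Rightarrow> complex"
  assumes [measurable]: "Z \<in> borel_measurable borel" and B: "AE \<eta> in lborel. perT Z \<eta> \<le> ennreal B"
  shows "L2sq lborel Z < \<infinity>"
proof -
  have "L2sq lborel (\<lambda>\<eta>. 1 * Z \<eta>) \<le> ennreal B * L2sq MQ (\<lambda>\<eta> :: real ^ 'n. 1)"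
    by (rule L2sq_periodic_le[OF _ _ _ B]) auto
  also have "\<dots> < \<infinity>"
    using L2sq_MQ_bounded[of "\<lambda>_ :: real ^ 'n. 1" 1] by (simp add: ennreal_mult_less_top)
  finally show ?thesis by simp
qed

lemma amp_measurable:
  assumes "U \<in> lattice_L2" and [measurable]: "Z \<in> borel_measurable borel"
  shows "amp h U Z \<in> borel_measurable borel"
proof -
  note [measurable] = lattice_fourier_measurable[OF assms(1)]
  show ?thesis unfolding amp_def[abs_def] by measurable
qed

lemma L2sq_rescale:
  fixes g :: "'a::euclidean_space \<Rightarrow> complex"
  assumes [measurable]: "g \<in> borel_measurable borel" and h: "h > 0"
  shows "L2sq lborel g = ennreal (h ^ DIM('a)) * L2sq lborel (\<lambda>x. g (h *\<^sub>R x))"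
  unfolding L2sq_def using h by (subst nn_integral_lborel_affine[of _ h 0]) simp_all

text \<open>Of the factor h^(2d) produced by squaring, the dilation \<eta> = h\<xi> absorbs h^d; the
  rest is folding onto the cell.\<close>

lemma L2sq_amp:
  fixes U :: "int ^ 'n::finite \<Rightarrow> complex"
  assumes U: "U \<in> lattice_L2" and [measurable]: "Z \<in> borel_measurable borel" and h: "h > 0"
  shows "L2sq lborel (amp h U Z) = ennreal (h ^ CARD('n)) * (\<integral>\<^sup>+ \<eta>. nsq (lattice_fourier U \<eta>) * perT Z \<eta> \<partial>MQ)"
proof -
  note [measurable] = lattice_fourier_measurable[OF U]
  let ?G = "\<lambda>\<eta>. lattice_fourier U \<eta> * Z \<eta>"
  have "L2sq lborel (amp h U Z) = nsq (complex_of_real (h ^ CARD('n))) * L2sq lborel (\<lambda>\<xi>. ?G (h *\<^sub>R \<xi>))"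
    unfolding amp_def[abs_def] by (rule L2sq_cmult) simp
  also have "\<dots> = ennreal (h ^ CARD('n)) * (ennreal (h ^ CARD('n)) * L2sq lborel (\<lambda>\<xi>. ?G (h *\<^sub>R \<xi>)))"
  proof -
    have "norm (complex_of_real (h ^ CARD('n))) = h ^ CARD('n)" unfolding norm_of_real using h by simp
    then show ?thesis
      using h by (simp only: ennreal_mult[symmetric] mult.assoc[symmetric] power2_eq_square zero_le_power less_imp_le)
  qed
  also have "ennreal (h ^ CARD('n)) * L2sq lborel (\<lambda>\<xi>. ?G (h *\<^sub>R \<xi>)) = L2sq lborel ?G"
    using L2sq_rescale[of ?G h] h by simp
  also have "\<dots> = (\<integral>\<^sup>+ \<eta>. nsq (lattice_fourier U \<eta>) * perT Z \<eta> \<partial>MQ)"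
    by (rule L2sq_periodic_mult) (simp_all add: lattice_fourier_periodic[OF U])
  finally show ?thesis .
qed

lemma L2sq_amp_finite:
  assumes U: "U \<in> lattice_L2" and Z[measurable]: "Z \<in> borel_measurable borel" and h: "h > 0"
    and B: "AE \<eta> in lborel. perT Z \<eta> \<le> ennreal B"
  shows "L2sq lborel (amp h U Z) < \<infinity>"
proof -
  note [measurable] = lattice_fourier_measurable[OF U]
  have "(\<integral>\<^sup>+ \<eta>. nsq (lattice_fourier U \<eta>) * perT Z \<eta> \<partial>MQ) \<le> ennreal B * L2sq MQ (lattice_fourier U)"
    unfolding L2sq_periodic_mult[OF lattice_fourier_measurable[OF U] Z lattice_fourier_periodic[OF U], symmetric]
    by (rule L2sq_periodic_le[OF _ _ _ B]) (simp_all add: lattice_fourier_periodic[OF U])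
  then have "(\<integral>\<^sup>+ \<eta>. nsq (lattice_fourier U \<eta>) * perT Z \<eta> \<partial>MQ) < \<infinity>"
    using lattice_fourier_L2[OF U] by (auto simp: ennreal_mult_less_top intro: le_less_trans)
  then show ?thesis
    unfolding L2sq_amp[OF U Z h] by (simp add: ennreal_mult_less_top)
qed

text \<open>Unfolding the multiplier leaves the series applied to a function \<open>G\<close>, whose
  rescaled translates are Fourier transforms of explicit Schwartz functions. Each term of the series
  thereby becomes a Fourier coefficient of q \<psi>, the sum is evaluated by
  \<open>lattice_fourier_pairing\<close>, and a dilation returns to the scale h.\<close>

lemma bessel_T_op_pairing:
  fixes \<phi> :: "(real ^ 'n::finite) distribution" and U :: "int ^ 'n \<Rightarrow> complex"
  assumes h: "h > 0" and U: "U \<in> lattice_L2" and p: "represents (dist_fourier \<phi>) p"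
    and B: "AE \<xi> in lborel. perT (sym s p) \<xi> \<le> ennreal B" and f: "f \<in> schwartz"
  shows "bessel_potential h s (T_op h \<phi> U) f = (LINT \<xi>|lborel. amp h U (sym s p) \<xi> * inv_fourier f \<xi>)"
proof -
  let ?d = "CARD('n)" and ?F = "lattice_fourier U"
  have [measurable]: "p \<in> borel_measurable borel" using p by (simp add: represents_def)
  note [measurable] = sym_measurable[OF this, of s] lattice_fourier_measurable[OF U]
  note fi = inv_fourier_schwartz[OF f]
  define \<psi> where "\<psi> \<eta> = inv_fourier f ((1 / h) *\<^sub>R \<eta>)" for \<eta>
  have \<psi>: "\<psi> \<in> schwartz" unfolding \<psi>_def using h by (intro schwartz_scale fi) simp
  have [measurable]: "\<psi> \<in> borel_measurable borel" "inv_fourier f \<in> borel_measurable borel"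
    using schwartz_measurable \<psi> fi by auto
  define G where "G = fourier (\<lambda>x. complex_of_real (japanese (h *\<^sub>R x) powr s) * inv_fourier f x)"
  \<comment> \<open>Translation by n becomes a character. The factor 1/h^d is the Jacobian of the
    dilation and cancels the h^d in \<open>dist_rescale\<close>.\<close>
  let ?\<psi>n = "\<lambda>n \<eta>. complex_of_real (1 / h ^ ?d) * (cis (\<eta> \<bullet> (- latt n)) * (complex_of_real (japanese \<eta> powr s) * \<psi> \<eta>))"
  have \<psi>n: "?\<psi>n n \<in> schwartz" for n
    by (intro schwartz_symbol_mult[OF symbols.const] schwartz_symbol_mult[OF symbols.cis] schwartz_symbol_mult[OF symbols.jap] \<psi>)
  have Gn: "(\<lambda>y. G (h *\<^sub>R (y + latt n))) = fourier (?\<psi>n n)" for n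
  proof
    fix y
    have "G (h *\<^sub>R (y + latt n)) = \<bar>1 / h\<bar> ^ DIM(real ^ 'n) *\<^sub>R (LINT \<eta>|lborel. complex_of_real (japanese (h *\<^sub>R (0 + (1 / h) *\<^sub>R \<eta>)) powr s) * inv_fourier f (0 + (1 / h) *\<^sub>R \<eta>) * cis (- ((0 + (1 / h) *\<^sub>R \<eta>) \<bullet> (h *\<^sub>R (y + latt n)))))"
      unfolding G_def fourier_def using h by (intro lborel_integral_affine) auto
    also have "\<dots> = complex_of_real (1 / h ^ ?d) * (LINT \<eta>|lborel. complex_of_real (japanese \<eta> powr s) * \<psi> \<eta> * cis (- (\<eta> \<bullet> (y + latt n))))"
      using h by (simp add: \<psi>_def scaleR_conv_of_real[where 'a = complex] power_one_over)
    also have "\<dots> = fourier (?\<psi>n n) y"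
    proof -
      have "cis (- (\<eta> \<bullet> (y + latt n))) = cis (\<eta> \<bullet> (- latt n)) * cis (- (\<eta> \<bullet> y))" for \<eta>
      proof -
        have "- (\<eta> \<bullet> (y + latt n)) = \<eta> \<bullet> (- latt n) + - (\<eta> \<bullet> y)" by (simp add: inner_add_right)
        then show ?thesis by (simp only: cis_mult)
      qed
      then show ?thesis
        unfolding fourier_def integral_mult_right_zero[symmetric]
        by (intro Bochner_Integration.integral_cong) (simp_all only: mult_ac)
    qed
    finally show "G (h *\<^sub>R (y + latt n)) = fourier (?\<psi>n n) y" .
  qed
  have c: "dist_rescale h (latt n) \<phi> G = (LINT \<eta>|lborel. cis (- (latt n \<bullet> \<eta>)) * (sym s p \<eta> * \<psi> \<eta>))" for n
  proof -
    have "dist_rescale h (latt n) \<phi> G = complex_of_real (h ^ ?d) * dist_fourier \<phi> (?\<psi>n n)"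
      unfolding dist_rescale_def Gn dist_fourier_def by simp
    also have "\<dots> = complex_of_real (h ^ ?d) * (LINT \<eta>|lborel. p \<eta> * ?\<psi>n n \<eta>)"
      using p \<psi>n[of n] by (simp add: represents_def)
    also have "\<dots> = (LINT \<eta>|lborel. cis (- (latt n \<bullet> \<eta>)) * (sym s p \<eta> * \<psi> \<eta>))"
      unfolding integral_mult_right_zero[symmetric]
      by (intro Bochner_Integration.integral_cong) (use h in \<open>auto simp: sym_def inner_commute mult_ac\<close>)
    finally show ?thesis .
  qed
  have sL2: "L2sq lborel (sym s p) < \<infinity>" by (rule perT_L2[OF _ B]) simp
  have "((\<lambda>n. U n * (LINT \<xi>|lborel. cis (- (latt n \<bullet> \<xi>)) * (sym s p \<xi> * \<psi> \<xi>))) has_sum (LINT \<xi>|lborel. ?F \<xi> * (sym s p \<xi> * \<psi> \<xi>))) UNIV"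
    by (rule lattice_fourier_pairing[OF U _ _ B schwartz_L2[OF \<psi>] integrable_L2_mult[OF _ _ sL2 schwartz_L2[OF \<psi>]]]) simp_all
  then have "T_op h \<phi> U G = (LINT \<xi>|lborel. ?F \<xi> * (sym s p \<xi> * \<psi> \<xi>))"
    unfolding T_op_def c by (rule infsumI)
  also have "\<dots> = \<bar>h\<bar> ^ DIM(real ^ 'n) *\<^sub>R (LINT \<xi>|lborel. ?F (0 + h *\<^sub>R \<xi>) * (sym s p (0 + h *\<^sub>R \<xi>) * \<psi> (0 + h *\<^sub>R \<xi>)))"
    using h by (intro lborel_integral_affine) auto
  also have "\<dots> = complex_of_real (h ^ ?d) * (LINT \<xi>|lborel. ?F (h *\<^sub>R \<xi>) * (sym s p (h *\<^sub>R \<xi>) * inv_fourier f \<xi>))"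
    using h by (simp add: \<psi>_def scaleR_conv_of_real[where 'a = complex])
  also have "\<dots> = (LINT \<xi>|lborel. amp h U (sym s p) \<xi> * inv_fourier f \<xi>)"
    unfolding integral_mult_right_zero[symmetric] amp_def by (simp only: mult.assoc)
  finally show ?thesis
    by (simp add: bessel_potential_def fourier_multiplier_def dist_inv_fourier_def dist_mult_def dist_fourier_def G_def)
qed

text \<open>After this equivalence the densities are treated as squares of L2 functions through
  \<open>FT\<close> alone.\<close>

lemma represents_bessel_T_op_iff:
  fixes \<phi> :: "(real ^ 'n::finite) distribution" and U :: "int ^ 'n \<Rightarrow> complex"
  assumes h: "h > 0" and U: "U \<in> lattice_L2" and p: "represents (dist_fourier \<phi>) p"
    and B: "AE \<xi> in lborel. perT (sym s p) \<xi> \<le> ennreal B"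
  shows "represents (bessel_potential h s (T_op h \<phi> U)) g \<and> square_integrable g \<longleftrightarrow> FT g (amp h U (sym s p))"
proof -
  have [measurable]: "sym s p \<in> borel_measurable borel" using p by (intro sym_measurable) (simp add: represents_def)
  have "integrable lborel (\<lambda>x. (norm (g x))\<^sup>2) \<longleftrightarrow> L2sq lborel g < \<infinity>" if [measurable]: "g \<in> borel_measurable borel"
    by (simp add: integrable_iff_bounded L2sq_def)
  moreover have "FT g (amp h U (sym s p)) \<Longrightarrow> f \<in> schwartz \<Longrightarrow> integrable lborel (\<lambda>x. g x * f x)" for f
    by (rule FT_integrable)
  ultimately show ?thesis
    unfolding represents_def square_integrable_def
    using bessel_T_op_pairing[OF h U p B] L2sq_amp_finite[OF U _ h B] amp_measurable[OF U, of "sym s p" h]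
    by (auto simp: FT_def)
qed

subsection \<open>The box window\<close>

text \<open>The Fourier transform of the indicator of the unit cube centred at 0, after the
  substitution y = 2\<pi>x, which allows integration over the cell Q.\<close>

definition chi :: "real ^ 'n::finite \<Rightarrow> complex" where
  "chi \<xi> = (LINT y|MQ. cis (- (y \<bullet> \<xi>) / (2 * pi))) / complex_of_real ((2 * pi) ^ CARD('n))"

lemma chi_isCont: "isCont (chi :: real ^ 'n::finite \<Rightarrow> complex) \<xi>"
proof -
  have "(\<lambda>n. LINT y|MQ. cis (- (y \<bullet> X n) / (2 * pi))) \<longlonglongrightarrow> (LINT y|MQ. cis (- (y \<bullet> \<xi>) / (2 * pi)))"
    if X: "X \<longlonglongrightarrow> \<xi>" for X :: "nat \<Rightarrow> real ^ 'n"
  proof (rule integral_dominated_convergence[where w = "\<lambda>_. 1"])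
    show "AE y in MQ. (\<lambda>n. cis (- (y \<bullet> X n) / (2 * pi))) \<longlonglongrightarrow> cis (- (y \<bullet> \<xi>) / (2 * pi))"
      unfolding cis_conv_exp by (intro AE_I2 tendsto_intros X) auto
    show "integrable MQ (\<lambda>_ :: real ^ 'n. 1 :: real)"
      using finite_measure.integrable_const[OF finite_measure_MQ] .
  qed simp_all
  then show ?thesis
    unfolding continuous_at_sequentially chi_def o_def by (auto intro!: tendsto_divide)
qed

lemma chi_measurable[measurable]: "chi \<in> borel_measurable borel"
  by (intro borel_measurable_continuous_onI continuous_at_imp_continuous_on ballI chi_isCont)

lemma chi_latt: "chi (dual n) = (if n = 0 then 1 else 0)"
proof -
  have "chi (dual n) = (LINT y|MQ. cis (latt (- n) \<bullet> y)) / complex_of_real ((2 * pi) ^ CARD('a))"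
    unfolding chi_def by (simp add: latt_minus inner_commute)
  then show ?thesis unfolding integral_cis_MQ by auto
qed

text \<open>The conjugates of the values of \<open>chi\<close> at \<eta> + 2\<pi>k are the
  normalised Fourier coefficients on Q of a unimodular character, so Bessel's inequality applies.
  Near \<eta> = 0 the term k = 0 is close to 1 and leaves little room for the others.\<close>

lemma perT_chi: "perT chi (\<eta> :: real ^ 'n::finite) \<le> 1"
proof -
  let ?P = "(2 * pi) ^ CARD('n)"
  have "(\<Sum>k\<in>A. (norm (chi (\<eta> + dual k)))\<^sup>2) \<le> 1" if A: "finite A" for A :: "(int ^ 'n) set"
  proof -
    let ?G = "\<lambda>y. cis ((y \<bullet> \<eta>) / (2 * pi))"
    have L: "L2sq MQ ?G = ennreal ?P" unfolding L2sq_def by (simp add: emeasure_MQ)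
    have "(LINT y|MQ. ?G y * cis (latt n \<bullet> y)) = complex_of_real ?P * cnj (chi (\<eta> + dual n))" for n
    proof -
      have "complex_of_real ?P * cnj (chi (\<eta> + dual n)) = (LINT y|MQ. cnj (cis (- (y \<bullet> (\<eta> + dual n)) / (2 * pi))))"
        unfolding chi_def Bochner_Integration.integral_cnj by simp
      also have "\<dots> = (LINT y|MQ. ?G y * cis (latt n \<bullet> y))"
      proof -
        have "- (- (y \<bullet> (\<eta> + dual n)) / (2 * pi)) = (y \<bullet> \<eta>) / (2 * pi) + latt n \<bullet> y" for y
          by (simp add: inner_add_right inner_commute field_simps)
        then show ?thesis by (simp only: cis_cnj cis_mult)
      qed
      finally show ?thesis ..
    qed
    then have "ennreal (?P * (\<Sum>n\<in>A. (norm (cnj (chi (\<eta> + dual n))))\<^sup>2)) \<le> L2sq MQ ?G"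
      by (intro Bessel_inequality A) (simp_all add: L)
    then show ?thesis unfolding L by (subst (asm) ennreal_le_iff) simp_all
  qed
  then have "(\<Sum>k\<in>A. nsq (chi (\<eta> + dual k))) \<le> 1" if "finite A" for A
    using that by (subst sum_ennreal) (auto simp: ennreal_le_1)
  then show ?thesis
    unfolding perT_def by (subst nonneg_infsum_complete) (auto intro!: SUP_least)
qed

text \<open>An interpolant with the prescribed values a n at the points 2\<pi>n, n in A. It is the
  transform of one modulated box, and as the weight in \<open>amp\<close> it gives the transform of
  the comparison function.\<close>

definition chisum :: "(int ^ 'n::finite \<Rightarrow> complex) \<Rightarrow> (int ^ 'n) set \<Rightarrow> real ^ 'n \<Rightarrow> complex" where
  "chisum a A \<xi> = (\<Sum>n\<in>A. a n * chi (\<xi> - dual n))"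

lemma chisum_measurable[measurable]: "chisum a A \<in> borel_measurable borel"
  unfolding chisum_def[abs_def] by measurable

lemma chisum_isCont: "isCont (chisum a A) \<xi>"
  unfolding chisum_def[abs_def]
  by (intro continuous_intros isCont_o2[OF _ chi_isCont])

lemma chisum_latt: "finite A \<Longrightarrow> k \<in> A \<Longrightarrow> chisum a A (dual k) = a k"
proof -
  assume A: "finite A" "k \<in> A"
  have "chisum a A (dual k) = (\<Sum>n\<in>A. if n = k then a n else 0)"
    unfolding chisum_def scaleR_diff_right[symmetric] latt_diff[symmetric] chi_latt
    by (rule sum.cong) auto
  then show ?thesis using A by simp
qed

lemma chisum_sq_le:
  "(norm (chisum a A (\<eta> + dual k)))\<^sup>2 \<le> (\<Sum>n\<in>A. (norm (a n))\<^sup>2) * (\<Sum>n\<in>A. (norm (chi (\<eta> + dual (k - n))))\<^sup>2)"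
proof -
  have "norm (chisum a A (\<eta> + dual k)) \<le> (\<Sum>n\<in>A. norm (a n) * norm (chi (\<eta> + dual (k - n))))"
    unfolding chisum_def by (rule order_trans[OF norm_sum]) (simp add: norm_mult latt_diff scaleR_diff_right algebra_simps)
  then have "(norm (chisum a A (\<eta> + dual k)))\<^sup>2 \<le> (\<Sum>n\<in>A. norm (a n) * norm (chi (\<eta> + dual (k - n))))\<^sup>2"
    by (rule power_mono) simp
  also have "\<dots> \<le> (\<Sum>n\<in>A. (norm (a n))\<^sup>2) * (\<Sum>n\<in>A. (norm (chi (\<eta> + dual (k - n))))\<^sup>2)"
    by (rule Cauchy_Schwarz_ineq_sum)
  finally show ?thesis .
qed

lemma infsum_shift_le:
  fixes f :: "int ^ 'n::finite \<Rightarrow> ennreal"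
  assumes "\<And>k. k \<in> K \<Longrightarrow> k - n \<in> J"
  shows "(\<Sum>\<^sub>\<infinity>k\<in>K. f (k - n)) \<le> (\<Sum>\<^sub>\<infinity>j\<in>J. f j)"
proof -
  have "(\<Sum>\<^sub>\<infinity>k\<in>K. f (k - n)) = (\<Sum>\<^sub>\<infinity>j\<in>(\<lambda>k. k - n) ` K. f j)"
    by (subst infsum_reindex) (auto simp: inj_on_def o_def)
  also have "\<dots> \<le> (\<Sum>\<^sub>\<infinity>j\<in>J. f j)"
    by (rule infsum_mono_neutral) (use assms in \<open>auto intro!: nonneg_summable_on_complete\<close>)
  finally show ?thesis .
qed

text \<open>Cauchy-Schwarz over the finite set A separates the coefficients, and shifting k by n
  moves the sum from K into J. The case of all indices gives a global bound; K = -A with J = -{0}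
  gives smallness near the origin.\<close>

lemma chisum_tail_le:
  fixes \<eta> :: "real ^ 'n::finite"
  assumes A: "finite A" and KJ: "\<And>k n. k \<in> K \<Longrightarrow> n \<in> A \<Longrightarrow> k - n \<in> J"
  shows "(\<Sum>\<^sub>\<infinity>k\<in>K. nsq (chisum a A (\<eta> + dual k)))
    \<le> ennreal ((\<Sum>n\<in>A. (norm (a n))\<^sup>2) * real (card A)) * (\<Sum>\<^sub>\<infinity>j\<in>J. nsq (chi (\<eta> + dual j)))"
proof -
  let ?S = "\<Sum>n\<in>A. (norm (a n))\<^sup>2" and ?c = "\<lambda>j. nsq (chi (\<eta> + dual j))"
  have S0: "0 \<le> ?S" by (rule sum_nonneg) simp
  have "(\<Sum>\<^sub>\<infinity>k\<in>K. nsq (chisum a A (\<eta> + dual k))) \<le> (\<Sum>\<^sub>\<infinity>k\<in>K. ennreal ?S * (\<Sum>n\<in>A. ?c (k - n)))"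
  proof (rule infsum_ennreal_mono)
    fix k
    show "nsq (chisum a A (\<eta> + dual k)) \<le> ennreal ?S * (\<Sum>n\<in>A. ?c (k - n))"
      using ennreal_leI[OF chisum_sq_le[of a A \<eta> k]] S0
      by (simp add: ennreal_mult sum_nonneg sum_ennreal)
  qed
  also have "\<dots> = ennreal ?S * (\<Sum>\<^sub>\<infinity>k\<in>K. \<Sum>n\<in>A. ?c (k - n))"
    by (rule infsum_ennreal_cmult)
  also have "(\<Sum>\<^sub>\<infinity>k\<in>K. \<Sum>n\<in>A. ?c (k - n)) = (\<Sum>n\<in>A. \<Sum>\<^sub>\<infinity>k\<in>K. ?c (k - n))"
    unfolding infsum_ennreal_eq_nn_integral by (rule nn_integral_sum) simp
  also have "\<dots> \<le> (\<Sum>n\<in>A. \<Sum>\<^sub>\<infinity>j\<in>J. ?c j)"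
    by (intro sum_mono infsum_shift_le) (use KJ in auto)
  also have "\<dots> = ennreal (real (card A)) * (\<Sum>\<^sub>\<infinity>j\<in>J. ?c j)"
    by (simp add: ennreal_of_nat_eq_real_of_nat)
  finally show ?thesis using S0 by (simp add: ennreal_mult mult.assoc mult_left_mono)
qed

lemma perT_diff_le:
  "(\<Sum>\<^sub>\<infinity>k\<in>K. nsq (X (\<eta> + dual k) - Y (\<eta> + dual k)))
    \<le> 2 * (\<Sum>\<^sub>\<infinity>k\<in>K. nsq (X (\<eta> + dual k))) + 2 * (\<Sum>\<^sub>\<infinity>k\<in>K. nsq (Y (\<eta> + dual k)))"
  for X Y :: "real ^ 'n::finite \<Rightarrow> complex"
  unfolding infsum_ennreal_cmult[symmetric] infsum_ennreal_add[symmetric]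
proof (rule infsum_ennreal_mono)
  fix k
  have "(norm (x - y))\<^sup>2 \<le> 2 * (norm x)\<^sup>2 + 2 * (norm y)\<^sup>2" for x y :: complex
    using norm_add_sq_le[of 1 x "- y"] by simp
  then have "nsq (x - y) \<le> ennreal (2 * (norm x)\<^sup>2 + 2 * (norm y)\<^sup>2)" for x y :: complex
    by (rule ennreal_leI)
  then show "nsq (X (\<eta> + dual k) - Y (\<eta> + dual k)) \<le>
    2 * nsq (X (\<eta> + dual k)) + 2 * nsq (Y (\<eta> + dual k))"
    by (simp add: ennreal_plus ennreal_mult)
qed

subsection \<open>A piecewise modulated comparison function\<close>

text \<open>The modulation factor with positive frequencies; it is expressed by \<open>trig\<close>
  with reflected indices in order to reuse periodicity and orthogonality.\<close>

definition osc :: "(int ^ 'n::finite \<Rightarrow> complex) \<Rightarrow> (int ^ 'n) set \<Rightarrow> real ^ 'n \<Rightarrow> complex" where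
  "osc a A = trig (\<lambda>n. a (- n)) (uminus ` A)"

lemma osc_eq: "osc a A y = (\<Sum>n\<in>A. a n * cis (latt n \<bullet> y))"
  unfolding osc_def trig_def by (subst sum.reindex) (auto simp: latt_minus inj_on_def)

lemma osc_measurable[measurable]: "osc a A \<in> borel_measurable borel"
  unfolding osc_def by simp

lemma osc_periodic: "osc a A (y + dual k) = osc a A y"
  unfolding osc_def by (rule trig_periodic)

lemma L2sq_osc:
  fixes a :: "int ^ 'n::finite \<Rightarrow> complex"
  assumes "finite A"
  shows "L2sq MQ (osc a A) = ennreal ((2 * pi) ^ CARD('n) * (\<Sum>n\<in>A. (norm (a n))\<^sup>2))"
  unfolding osc_def using assms
  by (subst L2sq_trig) (auto simp: sum.reindex inj_on_def)

lemma osc_bounded: "norm (osc a A y) \<le> (\<Sum>n\<in>A. norm (a n))"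
  unfolding osc_eq by (rule order_trans[OF norm_sum]) (simp add: norm_mult)

text \<open>In the variable (2\<pi>/h) x the cell of side h centred at hm becomes the translate of Q
  with index m, so one indexing function serves both physical and frequency space.\<close>

definition cellfun :: "real \<Rightarrow> (int ^ 'n::finite \<Rightarrow> complex) \<Rightarrow> (int ^ 'n \<Rightarrow> complex) \<Rightarrow> (int ^ 'n) set \<Rightarrow> real ^ 'n \<Rightarrow> complex" where
  "cellfun h U a A x = U (cidx ((2 * pi / h) *\<^sub>R x)) * osc a A ((2 * pi / h) *\<^sub>R x)"

lemma comp_cidx_measurable[measurable]:
  "(\<lambda>x. V (cidx x)) \<in> borel_measurable (borel :: (real ^ 'n::finite) measure)"
  by (rule measurable_compose[OF cidx_measurable]) simp

lemma cellfun_measurable[measurable]: "cellfun h U a A \<in> borel_measurable borel"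
proof -
  have "(\<lambda>x. (\<lambda>y. U (cidx y)) ((2 * pi / h) *\<^sub>R x) * osc a A ((2 * pi / h) *\<^sub>R x)) \<in> borel_measurable borel"
    by (intro borel_measurable_times measurable_compose[OF _ comp_cidx_measurable] measurable_compose[OF _ osc_measurable]) simp_all
  then show ?thesis unfolding cellfun_def[abs_def] by simp
qed

lemma cidx_shift: "\<eta> \<in> cellQ \<Longrightarrow> cidx (\<eta> + dual m) = m"
  by (simp add: cidx_iff)

text \<open>The modulation is periodic with respect to the cells and has the same L2 mass on each of
  them, so a weight that is constant on cells passes through exactly.\<close>

lemma nn_integral_cellfun:
  fixes b :: "real ^ 'n::finite \<Rightarrow> ennreal"
  assumes h: "h > 0" and A: "finite A" and [measurable]: "b \<in> borel_measurable borel"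
    and b: "\<And>x. b x = \<beta> (cidx ((2 * pi / h) *\<^sub>R x))"
  shows "(\<integral>\<^sup>+ x. nsq (cellfun h U a A x) * b x \<partial>lborel)
    = ennreal (\<Sum>n\<in>A. (norm (a n))\<^sup>2) * (\<Sum>\<^sub>\<infinity>m. ennreal (h ^ CARD('n) * (norm (U m))\<^sup>2) * \<beta> m)"
proof -
  let ?d = "CARD('n)" and ?S = "\<Sum>n\<in>A. (norm (a n))\<^sup>2"
  have S0: "0 \<le> ?S" by (rule sum_nonneg) simp
  have "(\<integral>\<^sup>+ x. nsq (cellfun h U a A x) * b x \<partial>lborel)
    = ennreal ((h / (2 * pi)) ^ ?d) * (\<integral>\<^sup>+ y. nsq (U (cidx y) * osc a A y) * \<beta> (cidx y) \<partial>lborel)"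
    using h by (subst nn_integral_lborel_affine[of _ "h / (2 * pi)" 0]) (simp_all add: b cellfun_def power_divide)
  also have "(\<integral>\<^sup>+ y. nsq (U (cidx y) * osc a A y) * \<beta> (cidx y) \<partial>lborel)
    = (\<integral>\<^sup>+ \<eta>. (\<Sum>\<^sub>\<infinity>m. nsq (osc a A \<eta>) * (nsq (U m) * \<beta> m)) \<partial>MQ)"
  proof (subst nn_integral_tiling, simp, rule nn_integral_cong, rule infsum_cong)
    fix \<eta> :: "real ^ 'n" and m :: "int ^ 'n"
    assume "\<eta> \<in> space MQ"
    then have "cidx (\<eta> + dual m) = m" by (simp add: MQ_def space_restrict_space cidx_shift)
    then show "nsq (U (cidx (\<eta> + dual m)) * osc a A (\<eta> + dual m)) * \<beta> (cidx (\<eta> + dual m))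
      = nsq (osc a A \<eta>) * (nsq (U m) * \<beta> m)"
      unfolding osc_periodic by (simp add: norm_mult power_mult_distrib ennreal_mult mult_ac)
  qed
  also have "\<dots> = L2sq MQ (osc a A) * (\<Sum>\<^sub>\<infinity>m. nsq (U m) * \<beta> m)"
    unfolding infsum_ennreal_cmult L2sq_def by (rule nn_integral_multc) simp
  also have "ennreal ((h / (2 * pi)) ^ ?d) * (L2sq MQ (osc a A) * (\<Sum>\<^sub>\<infinity>m. nsq (U m) * \<beta> m))
    = (ennreal ((h / (2 * pi)) ^ ?d) * L2sq MQ (osc a A)) * (\<Sum>\<^sub>\<infinity>m. nsq (U m) * \<beta> m)"
    by (simp only: mult.assoc)
  also have "ennreal ((h / (2 * pi)) ^ ?d) * L2sq MQ (osc a A) = ennreal ?S * ennreal (h ^ ?d)"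
    unfolding L2sq_osc[OF A] using h S0
    by (simp add: ennreal_mult[symmetric] power_divide mult.commute)
  also have "ennreal ?S * ennreal (h ^ ?d) * (\<Sum>\<^sub>\<infinity>m. nsq (U m) * \<beta> m)
    = ennreal ?S * (\<Sum>\<^sub>\<infinity>m. ennreal (h ^ ?d * (norm (U m))\<^sup>2) * \<beta> m)"
    using h by (simp add: infsum_ennreal_cmult[symmetric] mult.assoc ennreal_mult)
  finally show ?thesis .
qed

lemma L2sq_cellfun:
  fixes U :: "int ^ 'n::finite \<Rightarrow> complex"
  assumes h: "h > 0" and A: "finite A"
  shows "L2sq lborel (cellfun h U a A) = ennreal (\<Sum>n\<in>A. (norm (a n))\<^sup>2) * (\<Sum>\<^sub>\<infinity>m. ennreal (h ^ CARD('n) * (norm (U m))\<^sup>2))"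
  using nn_integral_cellfun[OF h A, of "\<lambda>_. 1" "\<lambda>_. 1" U a] by (simp add: L2sq_def)

lemma lattice_L2_infsum:
  fixes U :: "int ^ 'n::finite \<Rightarrow> complex"
  assumes U: "U \<in> lattice_L2" and h: "h > 0"
  shows "(\<Sum>\<^sub>\<infinity>m. ennreal (h ^ CARD('n) * (norm (U m))\<^sup>2)) = ennreal ((lattice_norm h U)\<^sup>2)"
proof -
  have sm: "(\<lambda>n. (norm (U n))\<^sup>2) summable_on UNIV" using U by (simp add: lattice_L2_def)
  have "(\<Sum>\<^sub>\<infinity>m. ennreal (h ^ CARD('n) * (norm (U m))\<^sup>2)) = ennreal (\<Sum>\<^sub>\<infinity>m. h ^ CARD('n) * (norm (U m))\<^sup>2)"
    by (rule infsum_ennreal_of_real) (use h sm in \<open>auto intro: summable_on_cmult_right\<close>)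
  also have "(\<Sum>\<^sub>\<infinity>m. h ^ CARD('n) * (norm (U m))\<^sup>2) = (lattice_norm h U)\<^sup>2"
    unfolding lattice_norm_def using h sm
    by (subst real_sqrt_pow2) (auto intro!: mult_nonneg_nonneg infsum_nonneg simp: infsum_cmult_right)
  finally show ?thesis .
qed

lemma perT_chisum:
  fixes \<eta> :: "real ^ 'n::finite"
  assumes A: "finite A"
  shows "perT (chisum a A) \<eta> \<le> ennreal ((\<Sum>n\<in>A. (norm (a n))\<^sup>2) * real (card A))"
proof -
  have "perT (chisum a A) \<eta> \<le> ennreal ((\<Sum>n\<in>A. (norm (a n))\<^sup>2) * real (card A)) * perT chi \<eta>"
    unfolding perT_def by (rule chisum_tail_le[OF A]) simp
  also have "\<dots> \<le> ennreal ((\<Sum>n\<in>A. (norm (a n))\<^sup>2) * real (card A)) * 1"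
    by (rule mult_left_mono[OF perT_chi]) simp
  finally show ?thesis by simp
qed

lemma integral_osc_chi:
  fixes \<eta> :: "real ^ 'n::finite"
  shows "(LINT y|MQ. osc a A y * cis (- (y \<bullet> \<eta>) / (2 * pi))) = complex_of_real ((2 * pi) ^ CARD('n)) * chisum a A \<eta>"
proof -
  have i: "integrable MQ (\<lambda>y :: real ^ 'n. cis (- (y \<bullet> \<zeta>) / (2 * pi)))" for \<zeta>
    by (rule integrable_MQ_bounded[where B = 1]) simp_all
  have "osc a A y * cis (- (y \<bullet> \<eta>) / (2 * pi)) = (\<Sum>n\<in>A. a n * cis (- (y \<bullet> (\<eta> - dual n)) / (2 * pi)))" for y
  proof -
    have "- (y \<bullet> (\<eta> - dual n)) / (2 * pi) = latt n \<bullet> y + - (y \<bullet> \<eta>) / (2 * pi)" for n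
      by (simp add: inner_diff_right inner_commute field_simps)
    then show ?thesis by (simp only: osc_eq sum_distrib_right mult.assoc cis_mult)
  qed
  then have "(LINT y|MQ. osc a A y * cis (- (y \<bullet> \<eta>) / (2 * pi))) = (\<Sum>n\<in>A. a n * (LINT y|MQ. cis (- (y \<bullet> (\<eta> - dual n)) / (2 * pi))))"
    using i by (simp add: Bochner_Integration.integral_sum)
  then show ?thesis by (simp add: chisum_def chi_def sum_distrib_left)
qed

text \<open>For finitely many cells the function is a finite sum of modulated boxes. The box at hm
  contributes the character of hm times the common factor h^d \<open>chisum\<close>, and summing the
  characters gives \<open>trig\<close>.\<close>

lemma FT_cellfun_finite:
  fixes U :: "int ^ 'n::finite \<Rightarrow> complex"
  assumes h: "h > 0" and A: "finite A" and B: "finite B"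
  shows "FT (cellfun h (\<lambda>m. if m \<in> B then U m else 0) a A)
    (\<lambda>\<xi>. complex_of_real (h ^ CARD('n)) * (trig U B (h *\<^sub>R \<xi>) * chisum a A (h *\<^sub>R \<xi>)))"
proof -
  let ?d = "CARD('n)" and ?V = "\<lambda>m. if m \<in> B then U m else 0" and ?c = "2 * pi / h"
  define E where "E y = indicator cellQ y *\<^sub>R osc a A y" for y
  have Em[measurable]: "E \<in> borel_measurable borel" unfolding E_def by measurable
  have Ei: "integrable lborel E"
    using integrable_MQ_bounded[OF osc_measurable osc_bounded, of a A]
    unfolding E_def MQ_def by (subst (asm) integrable_restrict_space) simp_all
  define pc where "pc m x = E (- dual m + ?c *\<^sub>R x)" for m x
  have pci: "integrable lborel (pc m)" for m
    unfolding pc_def by (rule lborel_integrable_affine[OF Ei]) (use h in simp)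
  have pc: "pc m x = (if cidx (?c *\<^sub>R x) = m then osc a A (?c *\<^sub>R x) else 0)" for m x
  proof -
    have "osc a A (?c *\<^sub>R x) = osc a A (?c *\<^sub>R x - dual m)"
      using osc_periodic[of a A "?c *\<^sub>R x - dual m" m] by simp
    then show ?thesis using cidx_iff[of "?c *\<^sub>R x" m] by (simp add: pc_def E_def add.commute)
  qed
  have eq: "cellfun h ?V a A x = (\<Sum>m\<in>B. U m * pc m x)" for x
    unfolding cellfun_def pc using B by (simp add: if_distrib[where f = "\<lambda>z. _ * z"] cong: if_cong)
  have fpc: "fourier (pc m) \<xi> = complex_of_real (h ^ ?d) * (cis (- (latt m \<bullet> (h *\<^sub>R \<xi>))) * chisum a A (h *\<^sub>R \<xi>))" for m \<xi>
  proof -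
    let ?g = "\<lambda>x. pc m x * cis (- (x \<bullet> \<xi>))"
    have [measurable]: "pc m \<in> borel_measurable borel" unfolding pc_def by measurable
    have "fourier (pc m) \<xi> = \<bar>h / (2 * pi)\<bar> ^ DIM(real ^ 'n) *\<^sub>R (LINT y|lborel. ?g (h *\<^sub>R latt m + (h / (2 * pi)) *\<^sub>R y))"
      unfolding fourier_def by (rule lborel_integral_affine) (use h in simp_all)
    also have "(LINT y|lborel. ?g (h *\<^sub>R latt m + (h / (2 * pi)) *\<^sub>R y))
      = (LINT y|lborel. cis (- (latt m \<bullet> (h *\<^sub>R \<xi>))) * (indicator cellQ y *\<^sub>R (osc a A y * cis (- (y \<bullet> (h *\<^sub>R \<xi>)) / (2 * pi)))))"
    proof (rule Bochner_Integration.integral_cong)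
      fix y
      have "pc m (h *\<^sub>R latt m + (h / (2 * pi)) *\<^sub>R y) = E y"
        unfolding pc_def using h by (simp add: scaleR_add_right)
      moreover have "- ((h *\<^sub>R latt m + (h / (2 * pi)) *\<^sub>R y) \<bullet> \<xi>) = - (latt m \<bullet> (h *\<^sub>R \<xi>)) + - (y \<bullet> (h *\<^sub>R \<xi>)) / (2 * pi)"
        by (simp add: inner_add_left)
      ultimately show "?g (h *\<^sub>R latt m + (h / (2 * pi)) *\<^sub>R y) = cis (- (latt m \<bullet> (h *\<^sub>R \<xi>))) * (indicator cellQ y *\<^sub>R (osc a A y * cis (- (y \<bullet> (h *\<^sub>R \<xi>)) / (2 * pi))))"
        by (simp only: cis_mult[symmetric] E_def) (simp add: mult_ac)
    qed simp
    also have "\<dots> = cis (- (latt m \<bullet> (h *\<^sub>R \<xi>))) * (complex_of_real ((2 * pi) ^ ?d) * chisum a A (h *\<^sub>R \<xi>))"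
      unfolding integral_mult_right_zero integral_MQ[symmetric] integral_osc_chi ..
    finally show ?thesis using h by (simp add: scaleR_conv_of_real[where 'a = complex] power_divide)
  qed
  have fin: "(\<Sum>\<^sub>\<infinity>m. ennreal (h ^ ?d * (norm (?V m))\<^sup>2)) < \<infinity>"
  proof -
    have "(\<Sum>\<^sub>\<infinity>m. ennreal (h ^ ?d * (norm (?V m))\<^sup>2)) = (\<Sum>\<^sub>\<infinity>m\<in>B. ennreal (h ^ ?d * (norm (?V m))\<^sup>2))"
      by (rule infsum_cong_neutral) auto
    then show ?thesis using B by (simp add: less_top[symmetric])
  qed
  show ?thesis
  proof (rule FT_fourier)
    show "integrable lborel (cellfun h ?V a A)"
      unfolding eq by (intro Bochner_Integration.integrable_sum integrable_mult_right pci)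
    show "L2sq lborel (cellfun h ?V a A) < \<infinity>"
      unfolding L2sq_cellfun[OF h A] using fin by (simp add: ennreal_mult_less_top)
    have "L2sq lborel (\<lambda>\<xi>. trig U B \<xi> * chisum a A \<xi>) < \<infinity>"
      by (rule le_less_trans[OF L2sq_periodic_le[OF _ _ trig_periodic AE_I2[OF perT_chisum[OF A]]]])
         (use L2sq_trig_finite in \<open>auto simp: ennreal_mult_less_top\<close>)
    moreover have "L2sq lborel (\<lambda>\<xi>. trig U B \<xi> * chisum a A \<xi>) = ennreal (h ^ ?d) * L2sq lborel (\<lambda>\<xi>. trig U B (h *\<^sub>R \<xi>) * chisum a A (h *\<^sub>R \<xi>))"
      using L2sq_rescale[of "\<lambda>\<xi>. trig U B \<xi> * chisum a A \<xi>" h] h by simp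
    ultimately have "L2sq lborel (\<lambda>\<xi>. trig U B (h *\<^sub>R \<xi>) * chisum a A (h *\<^sub>R \<xi>)) < \<infinity>"
      using h by (auto simp: ennreal_mult_less_top)
    then show "L2sq lborel (\<lambda>\<xi>. complex_of_real (h ^ ?d) * (trig U B (h *\<^sub>R \<xi>) * chisum a A (h *\<^sub>R \<xi>))) < \<infinity>"
      by (subst L2sq_cmult) (simp_all add: ennreal_mult_less_top)
    show "complex_of_real (h ^ ?d) * (trig U B (h *\<^sub>R \<xi>) * chisum a A (h *\<^sub>R \<xi>)) = fourier (cellfun h ?V a A) \<xi>" for \<xi>
    proof -
      have "fourier (cellfun h ?V a A) \<xi> = (LINT x|lborel. (\<Sum>m\<in>B. U m * (pc m x * cis (- (x \<bullet> \<xi>)))))"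
        unfolding fourier_def eq by (simp add: sum_distrib_right mult.assoc)
      also have "\<dots> = (\<Sum>m\<in>B. U m * fourier (pc m) \<xi>)"
        unfolding fourier_def by (subst Bochner_Integration.integral_sum) (auto intro!: integrable_cis_mult pci)
      finally show ?thesis unfolding fpc trig_def by (simp add: sum_distrib_left sum_distrib_right mult_ac)
    qed
  qed simp
qed

text \<open>Passage to the limit over finite sets of cells: in physical space by the summable tails
  of |U|^2, in frequency by L2 convergence of the Fourier series and the bounded periodisation of
  \<open>chisum\<close>.\<close>

lemma FT_cellfun:
  fixes U :: "int ^ 'n::finite \<Rightarrow> complex"
  assumes U: "U \<in> lattice_L2" and h: "h > 0" and A: "finite A"
  shows "FT (cellfun h U a A) (amp h U (chisum a A))"
proof -
  let ?d = "CARD('n)" and ?F = "lattice_fourier U" and ?S = "\<Sum>n\<in>A. (norm (a n))\<^sup>2"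
  note [measurable] = lattice_fourier_measurable[OF U]
  \<comment> \<open>The limit lemma asks for a Fourier pair at every index, including infinite sets.
    Sending these to the empty set leaves \<open>trig\<close> unchanged, since a sum over an
    infinite set is 0 by convention.\<close>
  define fB where "fB B = (if finite B then B else {})" for B :: "(int ^ 'n) set"
  have fB: "finite (fB B)" "trig U (fB B) = trig U B" for B by (auto simp: fB_def trig_def fun_eq_iff)
  let ?V = "\<lambda>B m. if m \<in> fB B then U m else 0"
  let ?W = "\<lambda>B \<xi>. complex_of_real (h ^ ?d) * (trig U (fB B) (h *\<^sub>R \<xi>) * chisum a A (h *\<^sub>R \<xi>))"
  note pB = AE_I2[OF perT_chisum[OF A]]
  show ?thesis
  proof (rule FT_limit[where g = "\<lambda>B. cellfun h (?V B) a A" and W = ?W and F = "finite_subsets_at_top UNIV"])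
    show "FT (cellfun h (?V B) a A) (?W B)" for B by (rule FT_cellfun_finite[OF h A fB(1)])
    show "amp h U (chisum a A) \<in> borel_measurable borel" by (rule amp_measurable[OF U]) simp
    show "L2sq lborel (cellfun h U a A) < \<infinity>"
      unfolding L2sq_cellfun[OF h A] lattice_L2_infsum[OF U h] by (simp add: ennreal_mult_less_top)
    show "L2sq lborel (amp h U (chisum a A)) < \<infinity>"
      by (rule L2sq_amp_finite[OF U _ h pB]) simp
    show "((\<lambda>B. L2sq lborel (\<lambda>x. ?W B x - amp h U (chisum a A) x)) \<longlongrightarrow> 0) (finite_subsets_at_top UNIV)"
    proof (rule ennreal_tendsto_0_le)
      let ?C = "ennreal (h ^ ?d * (?S * real (card A)))"
      show "((\<lambda>B. ?C * L2sq MQ (\<lambda>x. trig U B x - ?F x)) \<longlongrightarrow> 0) (finite_subsets_at_top UNIV)"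
        using ennreal_tendsto_cmult[OF _ lattice_fourier_tendsto[OF U], of ?C] by simp
      fix B
      let ?D = "\<lambda>\<xi>. (trig U B \<xi> - ?F \<xi>) * chisum a A \<xi>"
      have "L2sq lborel (\<lambda>x. ?W B x - amp h U (chisum a A) x) = nsq (complex_of_real (h ^ ?d)) * L2sq lborel (\<lambda>\<xi>. ?D (h *\<^sub>R \<xi>))"
        by (subst L2sq_cmult[symmetric]) (simp_all add: amp_def fB algebra_simps)
      also have "\<dots> = ennreal (h ^ ?d) * (ennreal (h ^ ?d) * L2sq lborel (\<lambda>\<xi>. ?D (h *\<^sub>R \<xi>)))"
      proof -
        have "norm (complex_of_real (h ^ ?d)) = h ^ ?d" unfolding norm_of_real using h by simp
        then show ?thesis
          using h by (simp only: ennreal_mult[symmetric] mult.assoc[symmetric] power2_eq_square zero_le_power less_imp_le)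
      qed
      also have "ennreal (h ^ ?d) * L2sq lborel (\<lambda>\<xi>. ?D (h *\<^sub>R \<xi>)) = L2sq lborel ?D"
        using L2sq_rescale[of ?D h] h by simp
      also have "L2sq lborel ?D \<le> ennreal (?S * real (card A)) * L2sq MQ (\<lambda>x. trig U B x - ?F x)"
        by (rule L2sq_periodic_le[OF _ _ _ pB]) (simp_all add: trig_periodic lattice_fourier_periodic[OF U])
      finally show "L2sq lborel (\<lambda>x. ?W B x - amp h U (chisum a A) x) \<le> ?C * L2sq MQ (\<lambda>x. trig U B x - ?F x)"
        using h by (simp add: ennreal_mult sum_nonneg mult.assoc mult_left_mono)
    qed
    show "((\<lambda>B. L2sq lborel (\<lambda>x. cellfun h (?V B) a A x - cellfun h U a A x)) \<longlongrightarrow> 0) (finite_subsets_at_top UNIV)"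
    proof (rule order_tendstoI)
      fix e :: ennreal assume "0 < e"
      then obtain e' where e': "0 < e'" "ennreal e' < e"
        by (metis dense ennreal_cases ennreal_less_zero_iff less_le_not_le not_gr_zero top_greatest ennreal_0)
      have hd: "0 < h ^ ?d" using h by simp
      have S0: "0 \<le> ?S" by (rule sum_nonneg) simp
      have sm: "(\<lambda>n. (norm (U n))\<^sup>2) summable_on UNIV" using U by (simp add: lattice_L2_def)
      \<comment> \<open>The summand 1 guards against a vanishing coefficient sum.\<close>
      let ?e = "e' / ((?S + 1) * h ^ ?d)"
      have "0 < ?e" using e' hd S0 by simp
      from summable_on_tail[OF sm this]
      obtain B0 where B0: "finite B0" "\<And>B. finite B \<Longrightarrow> B \<inter> B0 = {} \<Longrightarrow> \<bar>\<Sum>n\<in>B. (norm (U n))\<^sup>2\<bar> < ?e"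
        by auto
      have "L2sq lborel (\<lambda>x. cellfun h (?V B) a A x - cellfun h U a A x) < e" if B: "finite B" "B0 \<subseteq> B" for B
      proof -
        let ?D = "\<lambda>m. if m \<in> B then 0 else - U m"
        have "cellfun h (?V B) a A x - cellfun h U a A x = cellfun h ?D a A x" for x
          using B by (simp add: cellfun_def fB_def)
        then have "L2sq lborel (\<lambda>x. cellfun h (?V B) a A x - cellfun h U a A x) = ennreal ?S * (\<Sum>\<^sub>\<infinity>m. ennreal (h ^ ?d * (norm (?D m))\<^sup>2))"
          using L2sq_cellfun[OF h A, of ?D a] by simp
        also have "(\<Sum>\<^sub>\<infinity>m. ennreal (h ^ ?d * (norm (?D m))\<^sup>2)) \<le> ennreal (h ^ ?d * ?e)"
        proof (subst nonneg_infsum_complete, simp, rule SUP_least)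
          fix X assume "X \<in> {F. finite F \<and> F \<subseteq> (UNIV :: (int ^ 'n) set)}"
          then have X: "finite X" by simp
          have "(\<Sum>m\<in>X. ennreal (h ^ ?d * (norm (?D m))\<^sup>2)) = ennreal (\<Sum>m\<in>X. h ^ ?d * (norm (?D m))\<^sup>2)"
            using hd by (intro sum_ennreal) auto
          also have "(\<Sum>m\<in>X. h ^ ?d * (norm (?D m))\<^sup>2) = h ^ ?d * (\<Sum>m\<in>X - B. (norm (U m))\<^sup>2)"
            unfolding sum_distrib_left using X by (intro sum.mono_neutral_cong_right) auto
          also have "\<dots> \<le> h ^ ?d * ?e"
          proof (rule mult_left_mono)
            have "\<bar>\<Sum>m\<in>X - B. (norm (U m))\<^sup>2\<bar> < ?e" using X B by (intro B0(2)) auto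
            then show "(\<Sum>m\<in>X - B. (norm (U m))\<^sup>2) \<le> ?e" by linarith
          qed (use hd in simp)
          finally show "(\<Sum>m\<in>X. ennreal (h ^ ?d * (norm (?D m))\<^sup>2)) \<le> ennreal (h ^ ?d * ?e)"
            by (simp add: ennreal_leI)
        qed
        also have "ennreal ?S * ennreal (h ^ ?d * ?e) \<le> ennreal e'"
        proof -
          have "ennreal ?S * ennreal (h ^ ?d * ?e) = ennreal (?S * (h ^ ?d * ?e))"
            by (rule ennreal_mult[symmetric, OF S0]) (rule mult_nonneg_nonneg[OF less_imp_le[OF hd] less_imp_le[OF \<open>0 < ?e\<close>]])
          also have "?S * (h ^ ?d * ?e) = ?S / (?S + 1) * e'"
            using h hd by simp
          also have "\<dots> \<le> 1 * e'" using e'(1) S0 by (intro mult_right_mono) auto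
          finally show ?thesis by (simp add: ennreal_leI)
        qed
        finally show ?thesis using e'(2) by (meson le_less_trans mult_left_mono order_refl zero_le)
      qed
      then show "\<forall>\<^sub>F B in finite_subsets_at_top UNIV. L2sq lborel (\<lambda>x. cellfun h (?V B) a A x - cellfun h U a A x) < e"
        unfolding eventually_finite_subsets_at_top using B0(1) by blast
    qed simp
  qed simp_all
qed

subsection \<open>Energy densities of the comparison function\<close>

lemma small_multiple:
  fixes c e :: real
  assumes "c \<ge> 0" "e > 0"
  obtains t where "t > 0" "t * c \<le> e"
proof
  have c1: "0 < c + 1" using assms by simp
  show "e / (c + 1) > 0" using assms c1 by simp
  have "e / (c + 1) * c \<le> e / (c + 1) * (c + 1)" using assms by (intro mult_left_mono) auto
  then show "e / (c + 1) * c \<le> e" using c1 by simp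
qed

lemma tendsto_0_ennrealI:
  fixes f :: "'a \<Rightarrow> ennreal"
  assumes "\<And>e. e > 0 \<Longrightarrow> \<forall>\<^sub>F x in F. f x \<le> ennreal e"
  shows "(f \<longlongrightarrow> 0) F"
proof (rule order_tendstoI)
  fix e :: ennreal assume "0 < e"
  then obtain e' where e': "0 < e'" "ennreal e' < e"
    by (metis dense ennreal_cases ennreal_less_zero_iff less_le_not_le not_gr_zero top_greatest ennreal_0)
  from assms[OF e'(1)] show "\<forall>\<^sub>F x in F. f x < e"
    by eventually_elim (rule le_less_trans[OF _ e'(2)])
qed simp

lemma tendsto_0_norm_ennreal:
  fixes f :: "'a \<Rightarrow> 'b::real_normed_vector"
  assumes "(E \<longlongrightarrow> 0) F" "\<And>x. ennreal (norm (f x)) \<le> E x"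
  shows "(f \<longlongrightarrow> 0) F"
proof -
  have "((\<lambda>x. ennreal (norm (f x))) \<longlongrightarrow> ennreal 0) F" using ennreal_tendsto_0_le[OF assms] by simp
  then have "((\<lambda>x. norm (f x)) \<longlongrightarrow> 0) F" by (subst (asm) tendsto_ennreal_iff) auto
  then show ?thesis by (rule tendsto_norm_zero_cancel)
qed

lemma test_function_bounded:
  fixes f :: "'a::euclidean_space \<Rightarrow> real"
  assumes f: "continuous_on UNIV f" "compact (closure {x. f x \<noteq> 0})"
  obtains K where "K > 0" "\<And>x. \<bar>f x\<bar> \<le> K" "\<And>x. f x \<le> K"
proof -
  have "bounded (f ` closure {x. f x \<noteq> 0})"
    by (intro compact_imp_bounded compact_continuous_image continuous_on_subset[OF f(1)] f(2)) auto
  then obtain K where K: "\<And>x. x \<in> closure {x. f x \<noteq> 0} \<Longrightarrow> \<bar>f x\<bar> \<le> K" by (auto simp: bounded_iff)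
  have "\<bar>f x\<bar> \<le> max K 1" for x
    using K[of x] closure_subset[of "{x. f x \<noteq> 0}"] by (cases "f x = 0") auto
  then show ?thesis using that[of "max K 1"] abs_le_D1 by (metis less_max_iff_disj zero_less_one)
qed

lemma lattice_norm_sq_le:
  assumes "h > 0" "lattice_norm h U \<le> C"
  shows "(lattice_norm h U)\<^sup>2 \<le> C\<^sup>2"
  using assms by (intro power_mono) (auto simp: lattice_norm_def less_imp_le infsum_nonneg)

lemma cidx_dist:
  fixes x :: "real ^ 'n::finite"
  assumes h: "h > 0"
  shows "norm (x - h *\<^sub>R latt (cidx ((2 * pi / h) *\<^sub>R x))) \<le> h * real CARD('n)"
proof -
  let ?y = "(2 * pi / h) *\<^sub>R x"
  let ?z = "?y - dual (cidx ?y)"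
  have "?z \<in> cellQ" using cidx_iff by blast
  then have "\<bar>?z $ i\<bar> \<le> pi" for i by (simp add: cellQ_def abs_le_iff) (metis less_eq_real_def minus_le_iff minus_diff_eq)
  then have "norm ?z \<le> (\<Sum>i\<in>(UNIV :: 'n set). pi)"
    by (intro order_trans[OF norm_le_l1_cart] sum_mono)
  moreover have "x - h *\<^sub>R latt (cidx ?y) = (h / (2 * pi)) *\<^sub>R ?z"
    using h by (simp add: scaleR_diff_right)
  ultimately have "norm (x - h *\<^sub>R latt (cidx ?y)) \<le> (h / (2 * pi)) * (real CARD('n) * pi)"
    using h by (simp add: mult_left_mono del: times_divide_eq_left)
  also have "\<dots> \<le> h * real CARD('n)" using h by simp
  finally show ?thesis .
qed

lemma compact_support_uniform:
  fixes f :: "'a::euclidean_space \<Rightarrow> real"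
  assumes f: "continuous_on UNIV f" and K: "compact (closure {x. f x \<noteq> 0})" and e: "e > 0"
  shows "\<exists>d>0. \<forall>x y. norm (x - y) \<le> d \<longrightarrow> \<bar>f x - f y\<bar> \<le> e"
proof -
  obtain R where R: "\<And>x. x \<in> closure {x. f x \<noteq> 0} \<Longrightarrow> norm x \<le> R"
    using compact_imp_bounded[OF K] by (auto simp: bounded_iff)
  then have R': "norm x \<le> R" if "f x \<noteq> 0" for x using that closure_subset[of "{x. f x \<noteq> 0}"] by auto
  have "uniformly_continuous_on (cball 0 (R + 1)) f"
    by (intro compact_uniformly_continuous continuous_on_subset[OF f]) auto
  then obtain d where d: "d > 0" "\<And>x y. x \<in> cball 0 (R + 1) \<Longrightarrow> y \<in> cball 0 (R + 1) \<Longrightarrow> dist y x < d \<Longrightarrow> dist (f y) (f x) < e"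
    unfolding uniformly_continuous_on_def using e by metis
  have "\<bar>f x - f y\<bar> \<le> e" if xy: "norm (x - y) \<le> min 1 (d / 2)" for x y
  proof (cases "f x = 0 \<and> f y = 0")
    case True then show ?thesis using e by simp
  next
    case False
    then have "norm x \<le> R \<or> norm y \<le> R" using R' by blast
    moreover have "norm x \<le> norm y + norm (x - y)" "norm y \<le> norm x + norm (x - y)"
      using norm_triangle_sub[of x y] norm_triangle_sub[of y x] by (auto simp: norm_minus_commute)
    ultimately have "norm x \<le> R + 1" "norm y \<le> R + 1" using xy by auto
    then have "dist (f x) (f y) < e" by (intro d(2)) (use xy d(1) in \<open>auto simp: dist_norm\<close>)
    then show ?thesis by (simp add: dist_real_def)
  qed
  then show ?thesis using d(1) by (intro exI[of _ "min 1 (d / 2)"]) auto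
qed

lemma nn_integral_energy_measure:
  fixes U :: "int ^ 'n::finite \<Rightarrow> complex"
  assumes [measurable]: "f \<in> borel_measurable borel"
  shows "(\<integral>\<^sup>+ x. f x \<partial>energy_measure h U) = (\<Sum>\<^sub>\<infinity>m. ennreal (h ^ CARD('n) * (norm (U m))\<^sup>2) * f (h *\<^sub>R latt m))"
  unfolding energy_measure_def infsum_ennreal_eq_nn_integral
  by (subst nn_integral_distr) (simp_all add: nn_integral_density)

lemma cellfun_test:
  fixes U a :: "int ^ 'n::finite \<Rightarrow> complex" and f :: "real ^ 'n \<Rightarrow> real"
  assumes h: "h > 0" and U: "U \<in> lattice_L2" and A: "finite A"
    and fm[measurable]: "f \<in> borel_measurable borel" and f0: "\<And>x. 0 \<le> f x" and e: "e \<ge> 0"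
    and d: "\<And>x y. norm (x - y) \<le> h * real CARD('n) \<Longrightarrow> \<bar>f x - f y\<bar> \<le> e"
  defines "S \<equiv> ennreal (\<Sum>n\<in>A. (norm (a n))\<^sup>2)" and "N \<equiv> ennreal ((lattice_norm h U)\<^sup>2)"
  shows "(\<integral>\<^sup>+ x. nsq (cellfun h U a A x) * ennreal (f x) \<partial>lborel) \<le> S * (\<integral>\<^sup>+ x. ennreal (f x) \<partial>energy_measure h U) + ennreal e * (S * N)"
    and "S * (\<integral>\<^sup>+ x. ennreal (f x) \<partial>energy_measure h U) \<le> (\<integral>\<^sup>+ x. nsq (cellfun h U a A x) * ennreal (f x) \<partial>lborel) + ennreal e * (S * N)"
proof -
  let ?c = "\<lambda>x. cidx ((2 * pi / h) *\<^sub>R x)" and ?g = "\<lambda>x. nsq (cellfun h U a A x)"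
  have [measurable]: "(\<lambda>x. \<beta> (?c x)) \<in> borel_measurable borel" for \<beta> :: "int ^ 'n \<Rightarrow> ennreal"
    by (rule measurable_compose[OF _ comp_cidx_measurable]) simp
  have 1: "(\<integral>\<^sup>+ x. ?g x * ennreal (f (h *\<^sub>R latt (?c x))) \<partial>lborel) = S * (\<integral>\<^sup>+ x. ennreal (f x) \<partial>energy_measure h U)"
    unfolding S_def by (subst nn_integral_cellfun[OF h A, of _ "\<lambda>m. ennreal (f (h *\<^sub>R latt m))"]) (simp_all add: nn_integral_energy_measure)
  have "(\<integral>\<^sup>+ x. ?g x * ennreal e \<partial>lborel) = (\<integral>\<^sup>+ x. ?g x \<partial>lborel) * ennreal e"
    by (rule nn_integral_multc) simp
  then have 2: "(\<integral>\<^sup>+ x. ?g x * ennreal e \<partial>lborel) = ennreal e * (S * N)"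
    using L2sq_cellfun[OF h A, of U a] lattice_L2_infsum[OF U h]
    by (simp add: L2sq_def S_def N_def mult.commute)
  have le: "f x \<le> f (h *\<^sub>R latt (?c x)) + e" "f (h *\<^sub>R latt (?c x)) \<le> f x + e" for x
    using d[OF cidx_dist[OF h, of x]] by auto
  have "(\<integral>\<^sup>+ x. ?g x * ennreal (f x) \<partial>lborel) \<le> (\<integral>\<^sup>+ x. ?g x * ennreal (f (h *\<^sub>R latt (?c x))) + ?g x * ennreal e \<partial>lborel)"
    unfolding distrib_left[symmetric] using le(1) e f0
    by (intro nn_integral_mono mult_left_mono) (simp_all add: ennreal_plus[symmetric] del: ennreal_plus)
  also have "\<dots> = S * (\<integral>\<^sup>+ x. ennreal (f x) \<partial>energy_measure h U) + ennreal e * (S * N)"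
    unfolding 1[symmetric] 2[symmetric] by (rule nn_integral_add) simp_all
  finally show "(\<integral>\<^sup>+ x. ?g x * ennreal (f x) \<partial>lborel) \<le> S * (\<integral>\<^sup>+ x. ennreal (f x) \<partial>energy_measure h U) + ennreal e * (S * N)" .
  have "S * (\<integral>\<^sup>+ x. ennreal (f x) \<partial>energy_measure h U) \<le> (\<integral>\<^sup>+ x. ?g x * ennreal (f x) + ?g x * ennreal e \<partial>lborel)"
    unfolding distrib_left[symmetric] 1[symmetric] using le(2) e f0
    by (intro nn_integral_mono mult_left_mono) (simp_all add: ennreal_plus[symmetric] del: ennreal_plus)
  also have "\<dots> = (\<integral>\<^sup>+ x. ?g x * ennreal (f x) \<partial>lborel) + ennreal e * (S * N)"
    unfolding 2[symmetric] by (rule nn_integral_add) simp_all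
  finally show "S * (\<integral>\<^sup>+ x. ennreal (f x) \<partial>energy_measure h U) \<le> (\<integral>\<^sup>+ x. ?g x * ennreal (f x) \<partial>lborel) + ennreal e * (S * N)" .
qed

subsection \<open>Comparison near the origin\<close>

text \<open>The common target of the two alternatives: tails of \<tau> off finite index sets,
  uniformly small in a neighbourhood of the origin up to null sets.\<close>

definition uniform_tail :: "real \<Rightarrow> (real ^ 'n::finite \<Rightarrow> complex) \<Rightarrow> bool" where
  "uniform_tail s p \<longleftrightarrow> (\<forall>\<delta>>0. \<exists>A r. finite A \<and> r > 0 \<and>
     (AE \<xi> in lborel. norm \<xi> < r \<longrightarrow> (\<Sum>\<^sub>\<infinity>n\<in>-A. tau_term s p \<xi> n) \<le> ennreal \<delta>))"

definition coef :: "real \<Rightarrow> (real ^ 'n::finite \<Rightarrow> complex) \<Rightarrow> int ^ 'n \<Rightarrow> complex" where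
  "coef s p n = sym s p (dual n)"

lemma sym_isCont: "isCont p x \<Longrightarrow> isCont (sym s p) x"
proof -
  assume p: "isCont p x"
  have "isCont (\<lambda>x. japanese x powr s) x"
    by (rule has_derivative_continuous[OF japanese_powr_has_derivative])
  then show ?thesis unfolding sym_def[abs_def] using p by (intro continuous_mult continuous_of_real)
qed

lemma isCont_shift:
  fixes f :: "'a::real_normed_vector \<Rightarrow> 'b::topological_space"
  shows "isCont f v \<Longrightarrow> isCont (\<lambda>x. f (x + v)) 0"
  by (rule isCont_o2[of _ "\<lambda>x. x + v"]) auto

lemma isCont_le_near:
  fixes f :: "'a::real_normed_vector \<Rightarrow> real"
  assumes "isCont f 0" "f 0 < e"
  shows "\<exists>r>0. \<forall>x. norm x < r \<longrightarrow> f x \<le> e"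
proof -
  have "\<forall>\<^sub>F x in nhds 0. f x < e"
    using assms isCont_def tendsto_at_iff_tendsto_nhds order_tendstoD(2) by metis
  then obtain r where "r > 0" "\<And>x. dist x 0 < r \<Longrightarrow> f x < e"
    unfolding eventually_nhds_metric by blast
  then show ?thesis by (intro exI[of _ r]) (auto intro: less_imp_le)
qed

text \<open>The periodised error splits into three parts. For indices in A both functions are
  continuous and agree at 0; the tail of q is small by \<open>uniform_tail\<close>; the tail of the
  interpolant is controlled by 1 - |\<open>chi\<close>|^2. The set A0 is fixed by the tail of q,
  while the radius depends on the larger set A.\<close>

lemma perT_near_zero:
  fixes p :: "real ^ 'n::finite \<Rightarrow> complex"
  assumes ut: "uniform_tail s p" and cont: "\<And>n. isCont p (dual n)" and \<delta>: "\<delta> > 0"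
  shows "\<exists>A0. finite A0 \<and> (\<forall>A. finite A \<longrightarrow> A0 \<subseteq> A \<longrightarrow> (\<exists>r>0. AE \<xi> in lborel. norm \<xi> < r \<longrightarrow>
    perT (\<lambda>\<xi>. sym s p \<xi> - chisum (coef s p) A \<xi>) \<xi> \<le> ennreal \<delta>))"
proof -
  obtain A0 r0 where A0: "finite A0" and r0: "r0 > 0"
    and t0: "AE \<xi> in lborel. norm \<xi> < r0 \<longrightarrow> (\<Sum>\<^sub>\<infinity>n\<in>-A0. tau_term s p \<xi> n) \<le> ennreal (\<delta> / 8)"
    using ut \<delta> unfolding uniform_tail_def by (meson zero_less_divide_iff zero_less_numeral)
  have "\<exists>r>0. AE \<xi> in lborel. norm \<xi> < r \<longrightarrow> perT (\<lambda>\<xi>. sym s p \<xi> - chisum (coef s p) A \<xi>) \<xi> \<le> ennreal \<delta>"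
    if A: "finite A" "A0 \<subseteq> A" for A
  proof -
    let ?a = "coef s p"
    let ?C = "(\<Sum>n\<in>A. (norm (?a n))\<^sup>2) * real (card A)"
    let ?f = "\<lambda>\<xi>. \<Sum>k\<in>A. (norm (sym s p (\<xi> + dual k) - chisum ?a A (\<xi> + dual k)))\<^sup>2"
    \<comment> \<open>A continuous bound, vanishing at the origin, for the terms of the interpolant
      with indices outside A.\<close>
    let ?g = "\<lambda>\<xi> :: real ^ 'n. ?C * (1 - (norm (chi \<xi>))\<^sup>2)"
    have C0: "0 \<le> ?C" by (intro mult_nonneg_nonneg sum_nonneg) auto
    have "isCont ?f 0"
      by (intro continuous_intros isCont_shift sym_isCont cont chisum_isCont)
    moreover have "?f 0 = 0" using A by (intro sum.neutral) (auto simp: chisum_latt coef_def)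
    ultimately obtain r1 where r1: "r1 > 0" "\<And>\<xi>. norm \<xi> < r1 \<Longrightarrow> ?f \<xi> \<le> \<delta> / 4"
      using isCont_le_near[of ?f "\<delta> / 4"] \<delta> by auto
    have "isCont ?g 0" by (intro continuous_intros chi_isCont)
    moreover have "?g 0 = 0" using chi_latt[of "0 :: int ^ 'n"] by (simp add: latt_0)
    ultimately obtain r2 where r2: "r2 > 0" "\<And>\<xi>. norm \<xi> < r2 \<Longrightarrow> ?g \<xi> \<le> \<delta> / 8"
      using isCont_le_near[of ?g "\<delta> / 8"] \<delta> by auto
    have main: "perT (\<lambda>\<xi>. sym s p \<xi> - chisum ?a A \<xi>) \<xi> \<le> ennreal \<delta>"
      if x: "norm \<xi> < r1" "norm \<xi> < r2" and t: "(\<Sum>\<^sub>\<infinity>n\<in>-A0. tau_term s p \<xi> n) \<le> ennreal (\<delta> / 8)" for \<xi>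
    proof -
      let ?X = "\<lambda>k. sym s p (\<xi> + dual k)" and ?Y = "\<lambda>k. chisum ?a A (\<xi> + dual k)"
      let ?J = "\<Sum>\<^sub>\<infinity>j\<in>-{0}. nsq (chi (\<xi> + dual j))"
      have T1: "(\<Sum>\<^sub>\<infinity>k\<in>-A. nsq (?X k)) \<le> ennreal (\<delta> / 8)"
      proof (rule order_trans[OF _ t])
        show "(\<Sum>\<^sub>\<infinity>k\<in>-A. nsq (?X k)) \<le> (\<Sum>\<^sub>\<infinity>n\<in>-A0. tau_term s p \<xi> n)"
          unfolding tau_term_eq using A
          by (intro infsum_mono_neutral nonneg_summable_on_complete) auto
      qed
      have c1: "(norm (chi \<xi>))\<^sup>2 \<le> 1" and J: "?J \<le> ennreal (1 - (norm (chi \<xi>))\<^sup>2)"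
      proof -
        have s: "nsq (chi \<xi>) + ?J \<le> 1"
          using perT_chi[of \<xi>] unfolding perT_def by (subst (asm) infsum_ennreal_split[of "{0}"]) (simp_all add: latt_0)
        then have "nsq (chi \<xi>) \<le> 1" by (meson add_increasing2 order_trans order_refl zero_le le_add_same_cancel1)
        then show c1: "(norm (chi \<xi>))\<^sup>2 \<le> 1" by (simp only: ennreal_le_1)
        obtain j where j: "?J = ennreal j" "j \<ge> 0"
          using s by (cases ?J) (auto simp: top_unique)
        then have "(norm (chi \<xi>))\<^sup>2 + j \<le> 1"
          using s by (simp add: ennreal_plus[symmetric] ennreal_le_1 del: ennreal_plus)
        then show "?J \<le> ennreal (1 - (norm (chi \<xi>))\<^sup>2)" unfolding j(1) by (intro ennreal_leI) linarith
      qed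
      have "(\<Sum>\<^sub>\<infinity>k\<in>-A. nsq (?Y k)) \<le> ennreal ?C * ?J"
        by (rule chisum_tail_le[OF A(1)]) auto
      also have "\<dots> \<le> ennreal ?C * ennreal (1 - (norm (chi \<xi>))\<^sup>2)"
        by (rule mult_left_mono[OF J]) simp
      also have "\<dots> = ennreal (?g \<xi>)" using C0 c1 by (intro ennreal_mult[symmetric]) auto
      also have "\<dots> \<le> ennreal (\<delta> / 8)" by (rule ennreal_leI[OF r2(2)[OF x(2)]])
      finally have T2: "(\<Sum>\<^sub>\<infinity>k\<in>-A. nsq (?Y k)) \<le> ennreal (\<delta> / 8)" .
      have "perT (\<lambda>\<xi>. sym s p \<xi> - chisum ?a A \<xi>) \<xi> = (\<Sum>k\<in>A. nsq (?X k - ?Y k)) + (\<Sum>\<^sub>\<infinity>k\<in>-A. nsq (?X k - ?Y k))"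
        unfolding perT_def by (rule infsum_ennreal_split[OF A(1)])
      also have "(\<Sum>k\<in>A. nsq (?X k - ?Y k)) = ennreal (?f \<xi>)"
        by (rule sum_ennreal) simp
      also have "\<dots> \<le> ennreal (\<delta> / 4)" by (rule ennreal_leI[OF r1(2)[OF x(1)]])
      also have "(\<Sum>\<^sub>\<infinity>k\<in>-A. nsq (?X k - ?Y k)) \<le> 2 * ennreal (\<delta> / 8) + 2 * ennreal (\<delta> / 8)"
        by (rule order_trans[OF perT_diff_le]) (intro add_mono mult_left_mono T1 T2, auto)
      also have "2 * ennreal (\<delta> / 8) + 2 * ennreal (\<delta> / 8) = ennreal (\<delta> / 2)"
        using \<delta> by (simp add: ennreal_mult[symmetric] ennreal_plus[symmetric] flip: ennreal_numeral del: ennreal_plus)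
      finally have "perT (\<lambda>\<xi>. sym s p \<xi> - chisum ?a A \<xi>) \<xi> \<le> ennreal (\<delta> / 4) + ennreal (\<delta> / 2)"
        by (simp add: add_mono)
      also have "\<dots> \<le> ennreal \<delta>" using \<delta> by (simp add: ennreal_plus[symmetric] ennreal_leI del: ennreal_plus)
      finally show ?thesis .
    qed
    show ?thesis
    proof (intro exI[of _ "min r0 (min r1 r2)"] conjI)
      show "AE \<xi> in lborel. norm \<xi> < min r0 (min r1 r2) \<longrightarrow> perT (\<lambda>\<xi>. sym s p \<xi> - chisum ?a A \<xi>) \<xi> \<le> ennreal \<delta>"
        using t0 by eventually_elim (auto intro!: main)
    qed (use r0 r1 r2 in simp)
  qed
  then show ?thesis using A0 by blast
qed

text \<open>A strict violation at a continuity point would persist on a ball, which has positive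
  measure. This is how almost everywhere bounds reach the individual frequencies 2\<pi>n.\<close>

lemma AE_le_at_isCont:
  fixes F :: "'a::euclidean_space \<Rightarrow> real"
  assumes "isCont F 0" and ae: "AE x in lborel. F x \<le> B"
  shows "F 0 \<le> B"
proof (rule ccontr)
  assume "\<not> F 0 \<le> B"
  then have "isCont (\<lambda>x. - F x) 0" "- F 0 < - (F 0 + B) / 2" using assms by (auto intro!: continuous_intros)
  from isCont_le_near[OF this] obtain r where r: "r > 0" "\<And>x. norm x < r \<Longrightarrow> - F x \<le> - (F 0 + B) / 2" by blast
  have nb: "\<not> F x \<le> B" if "norm x < r" for x using r(2)[OF that] \<open>\<not> F 0 \<le> B\<close> by (simp add: field_simps)
  have "AE x in lborel. x \<notin> ball (0::'a) r"
    using ae by eventually_elim (use nb in auto)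
  then have "emeasure lborel (ball (0::'a) r) = 0"
    by (subst (asm) AE_iff_measurable[of "ball 0 r"]) auto
  then show False using content_ball_pos[OF r(1), of "0::'a"] by (simp add: measure_def)
qed

text \<open>Finite partial sums of \<tau> are continuous at 0, so the almost everywhere bound from
  (BP) holds for them at 0 itself. This makes the constant of the limit density finite.\<close>

lemma coef_sum_le:
  fixes p :: "real ^ 'n::finite \<Rightarrow> complex"
  assumes cont: "\<And>n. isCont p (dual n)" and B: "AE \<xi> in lborel. perT (sym s p) \<xi> \<le> ennreal B" and B0: "B \<ge> 0" and A: "finite A"
  shows "(\<Sum>n\<in>A. (norm (coef s p n))\<^sup>2) \<le> B"
proof -
  let ?F = "\<lambda>\<xi>. \<Sum>n\<in>A. (norm (sym s p (\<xi> + dual n)))\<^sup>2"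
  have "?F 0 \<le> B"
  proof (rule AE_le_at_isCont)
    show "isCont ?F 0" by (intro continuous_intros isCont_shift sym_isCont cont)
    show "AE \<xi> in lborel. ?F \<xi> \<le> B"
      using B
    proof eventually_elim
      case (elim \<xi>)
      have "ennreal (?F \<xi>) = (\<Sum>n\<in>A. nsq (sym s p (\<xi> + dual n)))"
        by (rule sum_ennreal[symmetric]) simp
      also have "\<dots> \<le> perT (sym s p) \<xi>" unfolding perT_def by (rule sum_le_infsum_ennreal[OF A]) simp
      finally have "ennreal (?F \<xi>) \<le> ennreal B" using elim by (rule order_trans)
      then show ?case using B0 by (simp add: ennreal_le_iff)
    qed
  qed
  then show ?thesis by (simp add: coef_def)
qed

subsection \<open>The comparison estimate\<close>

text \<open>Since h/\<epsilon> tends to 0, every ball of radius (h/\<epsilon>) R is eventually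
  contained in the fixed ball of radius r.\<close>

lemma oscillatory_tail:
  fixes U :: "nat \<Rightarrow> int ^ 'n::finite \<Rightarrow> complex"
  assumes o: "oscillatory h \<epsilon> U" and q: "(\<lambda>k. h k / \<epsilon> k) \<longlonglongrightarrow> 0" and r: "r > 0"
  shows "(\<lambda>k. ennreal (h k ^ CARD('n)) * (\<integral>\<^sup>+ \<xi>\<in>(cellQ - ball 0 r). nsq (lattice_fourier (U k) \<xi>) \<partial>lborel)) \<longlonglongrightarrow> 0"
proof (rule order_tendstoI)
  fix e :: ennreal assume e: "0 < e"
  let ?F = "\<lambda>\<rho> k. ennreal (h k ^ CARD('n)) * (\<integral>\<^sup>+ \<xi>\<in>(cellQ - ball 0 \<rho>). nsq (lattice_fourier (U k) \<xi>) \<partial>lborel)"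
  have "\<forall>\<^sub>F R in at_top. limsup (\<lambda>k. ?F (h k / \<epsilon> k * R) k) < e"
    using o e unfolding oscillatory_def by (rule order_tendstoD(2))
  then obtain R where "limsup (\<lambda>k. ?F (h k / \<epsilon> k * R) k) < e"
    unfolding eventually_at_top_linorder by blast
  then have 1: "\<forall>\<^sub>F k in sequentially. ?F (h k / \<epsilon> k * R) k < e" by (rule Limsup_lessD)
  have "(\<lambda>k. h k / \<epsilon> k * R) \<longlonglongrightarrow> 0 * R" by (intro tendsto_intros q)
  then have 2: "\<forall>\<^sub>F k in sequentially. h k / \<epsilon> k * R < r" using r by (intro order_tendstoD(2)) auto
  show "\<forall>\<^sub>F k in sequentially. ?F r k < e"
    using 1 2
  proof eventually_elim
    case (elim k)
    have "?F r k \<le> ?F (h k / \<epsilon> k * R) k"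
      by (intro mult_left_mono nn_integral_mono) (use elim(2) in \<open>auto split: split_indicator\<close>)
    then show ?case using elim(1) by (rule le_less_trans)
  qed
qed simp

lemma L2sq_MQ_lattice:
  fixes U :: "int ^ 'n::finite \<Rightarrow> complex"
  assumes U: "U \<in> lattice_L2" and h: "h > 0"
  shows "ennreal (h ^ CARD('n)) * L2sq MQ (lattice_fourier U) = ennreal ((2 * pi) ^ CARD('n) * (lattice_norm h U)\<^sup>2)"
proof -
  have i0: "0 \<le> (\<Sum>\<^sub>\<infinity>n. (norm (U n))\<^sup>2)" by (rule infsum_nonneg) simp
  then have "(lattice_norm h U)\<^sup>2 = h ^ CARD('n) * (\<Sum>\<^sub>\<infinity>n. (norm (U n))\<^sup>2)"
    unfolding lattice_norm_def using h by simp
  then show ?thesis unfolding Parseval[OF U] using h i0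
    by (subst ennreal_mult[symmetric]) (auto simp: mult_ac)
qed

locale oscillating_sequence =
  fixes h \<epsilon> :: "nat \<Rightarrow> real" and U :: "nat \<Rightarrow> int ^ 'n::finite \<Rightarrow> complex" and C :: real
  assumes h: "\<And>k. h k > 0" and o: "oscillatory h \<epsilon> U" and q: "(\<lambda>k. h k / \<epsilon> k) \<longlonglongrightarrow> 0"
    and U: "\<And>k. U k \<in> lattice_L2" and C: "\<And>k. lattice_norm (h k) (U k) \<le> C"

text \<open>Inside the ball the weight is at most \<delta>, and Parseval bounds the remaining mass
  by (2\<pi>)^d C^2; outside, the weight is at most W and the mass vanishes in the limit. The bounds
  on the weight are almost everywhere because the one on \<tau> is.\<close>

lemma (in oscillating_sequence) concentration_estimate:
  fixes w :: "real ^ 'n \<Rightarrow> ennreal"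
  assumes [measurable]: "w \<in> borel_measurable borel" and W: "AE \<xi> in lborel. w \<xi> \<le> ennreal W"
    and r: "r > 0" and near: "AE \<xi> in lborel. norm \<xi> < r \<longrightarrow> w \<xi> \<le> ennreal \<delta>" and \<delta>: "\<delta> \<ge> 0" and e: "e > 0"
  shows "\<forall>\<^sub>F k in sequentially. ennreal (h k ^ CARD('n)) * (\<integral>\<^sup>+ \<eta>. nsq (lattice_fourier (U k) \<eta>) * w \<eta> \<partial>MQ)
    \<le> ennreal (\<delta> * ((2 * pi) ^ CARD('n) * C\<^sup>2) + e)"
proof -
  let ?d = "CARD('n)"
  let ?P = "(2 * pi) ^ ?d"
  define T where "T k = ennreal (h k ^ ?d) * (\<integral>\<^sup>+ \<xi>\<in>(cellQ - ball 0 r). nsq (lattice_fourier (U k) \<xi>) \<partial>lborel)" for k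
  have "(\<lambda>k. ennreal W * T k) \<longlonglongrightarrow> ennreal W * 0"
    by (rule ennreal_tendsto_cmult) (simp_all add: T_def oscillatory_tail[OF o q r])
  then have "\<forall>\<^sub>F k in sequentially. ennreal W * T k < ennreal e"
    using e by (intro order_tendstoD(2)) auto
  then show ?thesis
  proof eventually_elim
    case (elim k)
    let ?F = "lattice_fourier (U k)"
    let ?f = "\<lambda>\<eta>. nsq (?F \<eta>)"
    note [measurable] = lattice_fourier_measurable[OF U[of k]]
    have "(\<integral>\<^sup>+ \<eta>. ?f \<eta> * w \<eta> \<partial>MQ) \<le> (\<integral>\<^sup>+ \<eta>. ennreal \<delta> * ?f \<eta> + ennreal W * (?f \<eta> * indicator (- ball 0 r) \<eta>) \<partial>MQ)"
    proof (rule nn_integral_mono_AE)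
      show "AE \<eta> in MQ. ?f \<eta> * w \<eta> \<le> ennreal \<delta> * ?f \<eta> + ennreal W * (?f \<eta> * indicator (- ball 0 r) \<eta>)"
        using AE_MQ[OF near] AE_MQ[OF W]
      proof eventually_elim
        case (elim \<eta>)
        show ?case
        proof (cases "norm \<eta> < r")
          case True
          then show ?thesis using mult_right_mono[OF elim(1)[rule_format, OF True], of "?f \<eta>"]
            by (simp add: mult.commute)
        next
          case False
          then have "?f \<eta> * w \<eta> \<le> ennreal W * (?f \<eta> * indicator (- ball 0 r) \<eta>)"
            using mult_right_mono[OF elim(2), of "?f \<eta>"] by (simp add: mult.commute)
          then show ?thesis by (rule order_trans) simp
        qed
      qed
    qed
    also have "\<dots> = ennreal \<delta> * L2sq MQ ?F + ennreal W * (\<integral>\<^sup>+ \<eta>. ?f \<eta> * indicator (- ball 0 r) \<eta> \<partial>MQ)"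
      unfolding L2sq_def by (simp add: nn_integral_add nn_integral_cmult)
    also have "(\<integral>\<^sup>+ \<eta>. ?f \<eta> * indicator (- ball 0 r) \<eta> \<partial>MQ) = (\<integral>\<^sup>+ \<xi>\<in>(cellQ - ball 0 r). ?f \<xi> \<partial>lborel)"
      unfolding nn_integral_MQ by (rule nn_integral_cong) (auto split: split_indicator)
    finally have "ennreal (h k ^ ?d) * (\<integral>\<^sup>+ \<eta>. ?f \<eta> * w \<eta> \<partial>MQ) \<le> ennreal (h k ^ ?d) * (ennreal \<delta> * L2sq MQ ?F + ennreal W * (\<integral>\<^sup>+ \<xi>\<in>(cellQ - ball 0 r). ?f \<xi> \<partial>lborel))"
      by (rule mult_left_mono) simp
    also have "\<dots> = ennreal \<delta> * (ennreal (h k ^ ?d) * L2sq MQ ?F) + ennreal W * T k"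
      by (simp only: T_def distrib_left mult_ac)
    also have "\<dots> \<le> ennreal \<delta> * ennreal (?P * C\<^sup>2) + ennreal e"
      unfolding L2sq_MQ_lattice[OF U h]
      by (intro add_mono mult_left_mono ennreal_leI lattice_norm_sq_le h C less_imp_le[OF elim]) auto
    also have "\<dots> = ennreal (\<delta> * (?P * C\<^sup>2) + e)"
      using \<delta> e by (subst ennreal_plus) (auto simp: ennreal_mult)
    finally show ?case .
  qed
qed

text \<open>The error of the approximation is again of the form \<open>amp\<close>, with weight q
  minus its interpolant. The periodised square of that weight is small near the origin, where the
  mass of Uhat concentrates, and bounded elsewhere by (BP) and the bound for
  \<open>chisum\<close>.\<close>

lemma (in oscillating_sequence) comparison_estimate:
  fixes p :: "real ^ 'n \<Rightarrow> complex"
  assumes pm: "p \<in> borel_measurable borel"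
    and ut: "uniform_tail s p" and cont: "\<And>n. isCont p (dual n)"
    and B: "AE \<xi> in lborel. perT (sym s p) \<xi> \<le> ennreal B"
    and g: "\<And>k. FT (g k) (amp (h k) (U k) (sym s p))" and \<delta>: "\<delta> > 0"
  shows "\<exists>A0. finite A0 \<and> (\<forall>A. finite A \<longrightarrow> A0 \<subseteq> A \<longrightarrow>
    (\<forall>\<^sub>F k in sequentially. L2sq lborel (\<lambda>x. g k x - cellfun (h k) (U k) (coef s p) A x) \<le> ennreal \<delta>))"
proof -
  let ?d = "CARD('n)"
  let ?P = "(2 * pi) ^ ?d"
  have [measurable]: "sym s p \<in> borel_measurable borel" by (rule sym_measurable[OF pm])
  \<comment> \<open>The smallness t serves both as the weight near the origin and as the error
    outside; the target carries the factor (2\<pi>)^d / 2 to compensate the constant of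
    \<open>FT_norm\<close>.\<close>
  have "0 \<le> ?P * C\<^sup>2 + 1" "0 < \<delta> * ?P / 2" using \<delta> by auto
  then obtain t where t: "t > 0" "t * (?P * C\<^sup>2 + 1) \<le> \<delta> * ?P / 2" by (rule small_multiple)
  obtain A0 where A0: "finite A0" and near: "\<And>A. finite A \<Longrightarrow> A0 \<subseteq> A \<Longrightarrow> (\<exists>r>0. AE \<xi> in lborel. norm \<xi> < r \<longrightarrow>
    perT (\<lambda>\<xi>. sym s p \<xi> - chisum (coef s p) A \<xi>) \<xi> \<le> ennreal t)"
    using perT_near_zero[OF ut cont t(1)] by auto
  have "\<forall>\<^sub>F k in sequentially. L2sq lborel (\<lambda>x. g k x - cellfun (h k) (U k) (coef s p) A x) \<le> ennreal \<delta>"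
    if A: "finite A" "A0 \<subseteq> A" for A
  proof -
    let ?Z = "\<lambda>\<xi>. sym s p \<xi> - chisum (coef s p) A \<xi>"
    obtain r where r: "r > 0" and rn: "AE \<xi> in lborel. norm \<xi> < r \<longrightarrow> perT ?Z \<xi> \<le> ennreal t"
      using near[OF A] by blast
    have [measurable]: "?Z \<in> borel_measurable borel" by measurable
    define CA where "CA = 2 * \<bar>B\<bar> + 2 * ((\<Sum>n\<in>A. (norm (coef s p n))\<^sup>2) * real (card A))"
    have glob: "AE \<xi> in lborel. perT ?Z \<xi> \<le> ennreal CA"
      using B
    proof eventually_elim
      case (elim \<xi>)
      have "perT ?Z \<xi> \<le> 2 * perT (sym s p) \<xi> + 2 * perT (chisum (coef s p) A) \<xi>"
        unfolding perT_def by (rule perT_diff_le)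
      also have "\<dots> \<le> 2 * ennreal \<bar>B\<bar> + 2 * ennreal ((\<Sum>n\<in>A. (norm (coef s p n))\<^sup>2) * real (card A))"
        by (intro add_mono mult_left_mono perT_chisum A order_trans[OF elim] ennreal_leI) auto
      also have "\<dots> = ennreal CA"
        unfolding CA_def by (subst ennreal_plus) (auto simp: ennreal_mult sum_nonneg intro!: mult_nonneg_nonneg sum_nonneg)
      finally show ?case .
    qed
    have "\<forall>\<^sub>F k in sequentially. ennreal (h k ^ ?d) * (\<integral>\<^sup>+ \<eta>. nsq (lattice_fourier (U k) \<eta>) * perT ?Z \<eta> \<partial>MQ) \<le> ennreal (t * (?P * C\<^sup>2) + t)"
      by (rule concentration_estimate[OF _ glob r rn less_imp_le[OF t(1)] t(1)]) measurable
    then show ?thesis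
    proof eventually_elim
      case (elim k)
      \<comment> \<open>Linearity of \<open>amp\<close> in its last argument identifies the
        transform of the difference.\<close>
      have "FT (\<lambda>x. g k x - cellfun (h k) (U k) (coef s p) A x) (\<lambda>x. amp (h k) (U k) (sym s p) x - amp (h k) (U k) (chisum (coef s p) A) x)"
        by (rule FT_diff[OF g FT_cellfun[OF U h A(1)]])
      then have "FT (\<lambda>x. g k x - cellfun (h k) (U k) (coef s p) A x) (amp (h k) (U k) ?Z)"
        unfolding amp_def[abs_def] by (simp add: algebra_simps)
      from FT_norm[OF this]
      have "L2sq lborel (\<lambda>x. g k x - cellfun (h k) (U k) (coef s p) A x) \<le> ennreal (2 / ?P) * L2sq lborel (amp (h k) (U k) ?Z)"
        by simp
      also have "\<dots> \<le> ennreal (2 / ?P) * ennreal (\<delta> * ?P / 2)"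
        using elim t(2) by (intro mult_left_mono) (simp_all add: L2sq_amp[OF U _ h] distrib_left order_trans[OF _ ennreal_leI])
      also have "\<dots> = ennreal (2 / ?P * (\<delta> * ?P / 2))" using \<delta> by (intro ennreal_mult[symmetric]) auto
      finally show ?case by simp
    qed
  qed
  then show ?thesis using A0 by blast
qed

section \<open>Passage to the limit in the densities\<close>

subsection \<open>Weak convergence\<close>

text \<open>The intermediate value z may change with both k and the tolerance, as the comparison
  function does. For tolerances at most 1 all errors are bounded by \<eta> times M = 2L + 8.\<close>

lemma approx_sandwich_tendsto:
  fixes x :: "nat \<Rightarrow> real"
  assumes L: "L \<ge> 0" and x0: "\<And>k. 0 \<le> x k"
    and ap: "\<And>\<eta>. 0 < \<eta> \<Longrightarrow> \<eta> \<le> 1 \<Longrightarrow> \<forall>\<^sub>F k in sequentially. \<exists>z\<ge>0. x k \<le> (1 + \<eta>) * z + \<eta> \<and> z \<le> (1 + \<eta>) * x k + \<eta> \<and> \<bar>z - L\<bar> \<le> \<eta>"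
  shows "x \<longlonglongrightarrow> L"
proof (rule tendstoI)
  fix e :: real assume e: "e > 0"
  define M where "M = 2 * L + 8"
  have M: "M > 0" using L by (simp add: M_def)
  define \<eta> where "\<eta> = min 1 (e / (2 * M))"
  have \<eta>: "0 < \<eta>" "\<eta> \<le> 1" "\<eta> * M < e"
  proof -
    show "0 < \<eta>" "\<eta> \<le> 1" using e M by (auto simp: \<eta>_def)
    have "\<eta> * M \<le> e / (2 * M) * M" using M by (intro mult_right_mono) (auto simp: \<eta>_def)
    also have "\<dots> = e / 2" using M by simp
    finally show "\<eta> * M < e" using e by simp
  qed
  show "\<forall>\<^sub>F k in sequentially. dist (x k) L < e"
    using ap[OF \<eta>(1,2)]
  proof eventually_elim
    case (elim k)
    then obtain z where z: "0 \<le> z" "x k \<le> (1 + \<eta>) * z + \<eta>" "z \<le> (1 + \<eta>) * x k + \<eta>" "\<bar>z - L\<bar> \<le> \<eta>" by blast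
    have "\<eta> * \<eta> \<le> \<eta> * 1" using \<eta> by (intro mult_left_mono) auto
    have "(1 + \<eta>) * z \<le> (1 + \<eta>) * (L + \<eta>)" using z(4) \<eta> by (intro mult_left_mono) linarith+
    also have "\<dots> = L + \<eta> * L + \<eta> + \<eta> * \<eta>" by (simp add: algebra_simps)
    finally have up: "x k \<le> L + \<eta> * L + 3 * \<eta>" using z(2) \<open>\<eta> * \<eta> \<le> \<eta> * 1\<close> by linarith
    have "\<eta> * L \<le> 1 * L" using \<eta> L by (intro mult_right_mono) auto
    then have "x k \<le> 2 * L + 3" using up \<eta> by linarith
    then have "\<eta> * x k \<le> \<eta> * (2 * L + 3)" using \<eta> by (intro mult_left_mono) auto
    then have lo: "L - \<eta> - \<eta> - \<eta> * (2 * L + 3) \<le> x k"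
      using z(3,4) unfolding distrib_right mult_1_left by linarith
    have "\<eta> * M = \<eta> * (2 * L) + 8 * \<eta>" "\<eta> * (2 * L + 3) = \<eta> * (2 * L) + 3 * \<eta>" "\<eta> * L \<le> \<eta> * (2 * L)"
      using \<eta> L by (auto simp: M_def algebra_simps)
    then show ?case using up lo \<eta> unfolding dist_real_def by linarith
  qed
qed

lemma nn_integral_sq_young:
  fixes f g :: "real ^ 'n::finite \<Rightarrow> complex"
  assumes [measurable]: "f \<in> borel_measurable borel" "g \<in> borel_measurable borel" "b \<in> borel_measurable borel"
    and t: "t > 0" and b: "\<And>x. b x \<le> K" "\<And>x. 0 \<le> b x"
  shows "(\<integral>\<^sup>+ x. nsq (f x) * ennreal (b x) \<partial>lborel) \<le>
    ennreal (1 + t) * (\<integral>\<^sup>+ x. nsq (g x) * ennreal (b x) \<partial>lborel) + ennreal ((1 + 1 / t) * K) * L2sq lborel (\<lambda>x. f x - g x)"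
proof -
  have K0: "0 \<le> K" using order_trans[OF b(2) b(1)] .
  have "(\<integral>\<^sup>+ x. nsq (f x) * ennreal (b x) \<partial>lborel) \<le>
    (\<integral>\<^sup>+ x. ennreal (1 + t) * (nsq (g x) * ennreal (b x)) + ennreal ((1 + 1 / t) * K) * nsq (f x - g x) \<partial>lborel)"
  proof (rule nn_integral_mono)
    fix x
    have "(norm (f x))\<^sup>2 * b x \<le> ((1 + t) * (norm (g x))\<^sup>2 + (1 + 1 / t) * (norm (f x - g x))\<^sup>2) * b x"
      using norm_add_sq_le[OF t, of "g x" "f x - g x"] b by (intro mult_right_mono) auto
    also have "\<dots> = (1 + t) * ((norm (g x))\<^sup>2 * b x) + ((1 + 1 / t) * (norm (f x - g x))\<^sup>2) * b x"
      by (simp add: algebra_simps)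
    also have "((1 + 1 / t) * (norm (f x - g x))\<^sup>2) * b x \<le> ((1 + 1 / t) * (norm (f x - g x))\<^sup>2) * K"
      using t b by (intro mult_left_mono) auto
    finally have "(norm (f x))\<^sup>2 * b x \<le> (1 + t) * ((norm (g x))\<^sup>2 * b x) + ((1 + 1 / t) * K) * (norm (f x - g x))\<^sup>2"
      by (simp add: mult_ac)
    then have le: "ennreal ((norm (f x))\<^sup>2 * b x) \<le> ennreal ((1 + t) * ((norm (g x))\<^sup>2 * b x) + ((1 + 1 / t) * K) * (norm (f x - g x))\<^sup>2)"
      by (rule ennreal_leI)
    have e: "ennreal ((1 + t) * ((norm (g x))\<^sup>2 * b x) + ((1 + 1 / t) * K) * (norm (f x - g x))\<^sup>2)
      = ennreal ((1 + t) * ((norm (g x))\<^sup>2 * b x)) + ennreal (((1 + 1 / t) * K) * (norm (f x - g x))\<^sup>2)"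
      using t b K0 by (intro ennreal_plus mult_nonneg_nonneg) auto
    have m1: "ennreal ((1 + t) * ((norm (g x))\<^sup>2 * b x)) = ennreal (1 + t) * ennreal ((norm (g x))\<^sup>2 * b x)"
      "ennreal (((1 + 1 / t) * K) * (norm (f x - g x))\<^sup>2) = ennreal ((1 + 1 / t) * K) * nsq (f x - g x)"
      by (rule ennreal_mult; use t b K0 in \<open>auto intro!: mult_nonneg_nonneg\<close>)+
    have m2: "ennreal ((norm z)\<^sup>2 * b x) = nsq z * ennreal (b x)" for z :: complex
      using b by (intro ennreal_mult) auto
    show "nsq (f x) * ennreal (b x) \<le> ennreal (1 + t) * (nsq (g x) * ennreal (b x)) + ennreal ((1 + 1 / t) * K) * nsq (f x - g x)"
      using le unfolding e m1 m2 .
  qed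
  also have "\<dots> = ennreal (1 + t) * (\<integral>\<^sup>+ x. nsq (g x) * ennreal (b x) \<partial>lborel) + ennreal ((1 + 1 / t) * K) * L2sq lborel (\<lambda>x. f x - g x)"
    unfolding L2sq_def by (simp add: nn_integral_add nn_integral_cmult)
  finally show ?thesis .
qed

lemma infsum_ennreal_approx:
  fixes a :: "'a::countable \<Rightarrow> complex"
  assumes bd: "\<And>A. finite A \<Longrightarrow> (\<Sum>n\<in>A. (norm (a n))\<^sup>2) \<le> B"
  obtains c where "c \<ge> 0" "(\<Sum>\<^sub>\<infinity>n. nsq (a n)) = ennreal c"
    "\<And>A. finite A \<Longrightarrow> (\<Sum>n\<in>A. (norm (a n))\<^sup>2) \<le> c"
    "\<And>e. e > 0 \<Longrightarrow> \<exists>A0. finite A0 \<and> (\<forall>A. finite A \<longrightarrow> A0 \<subseteq> A \<longrightarrow> c - (\<Sum>n\<in>A. (norm (a n))\<^sup>2) \<le> e)"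
proof -
  have sm: "(\<lambda>n. (norm (a n))\<^sup>2) summable_on UNIV"
    by (rule nonneg_bdd_above_summable_on) (auto intro!: bdd_aboveI[of _ B] bd)
  let ?c = "\<Sum>\<^sub>\<infinity>n. (norm (a n))\<^sup>2"
  have le: "(\<Sum>n\<in>A. (norm (a n))\<^sup>2) \<le> ?c" if "finite A" for A
    by (rule finite_sum_le_infsum[OF sm that]) auto
  have "\<exists>A0. finite A0 \<and> (\<forall>A. finite A \<longrightarrow> A0 \<subseteq> A \<longrightarrow> ?c - (\<Sum>n\<in>A. (norm (a n))\<^sup>2) \<le> e)" if e: "e > 0" for e
  proof -
    have "((\<lambda>A. \<Sum>n\<in>A. (norm (a n))\<^sup>2) \<longlongrightarrow> ?c) (finite_subsets_at_top UNIV)"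
      using has_sum_infsum[OF sm] by (simp add: has_sum_def)
    then have "\<forall>\<^sub>F A in finite_subsets_at_top UNIV. dist (\<Sum>n\<in>A. (norm (a n))\<^sup>2) ?c < e"
      using e by (intro tendstoD) auto
    then obtain A0 where "finite A0" "\<And>A. finite A \<Longrightarrow> A0 \<subseteq> A \<Longrightarrow> dist (\<Sum>n\<in>A. (norm (a n))\<^sup>2) ?c < e"
      unfolding eventually_finite_subsets_at_top by auto
    then show ?thesis by (intro exI[of _ A0]) (force simp: dist_real_def)
  qed
  moreover have "0 \<le> ?c" by (rule infsum_nonneg) simp
  moreover have "(\<Sum>\<^sub>\<infinity>n. nsq (a n)) = ennreal ?c"
    by (rule infsum_ennreal_of_real[OF sm]) simp
  ultimately show ?thesis using that le by blast
qed

text \<open>For a fixed tolerance a finite set A is chosen large enough for the L2 comparison and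
  for the coefficient sum to be close to c. The tested density is then compared with that of the
  comparison function by Young's inequality, and the latter with S times the tested energy by
  \<open>cellfun_test\<close>.\<close>

lemma density_test_tendsto:
  fixes U :: "nat \<Rightarrow> int ^ 'n::finite \<Rightarrow> complex" and p :: "real ^ 'n \<Rightarrow> complex" and f :: "real ^ 'n \<Rightarrow> real"
  assumes h: "\<And>k. h k > 0" and h0: "h \<longlonglongrightarrow> 0"
    and U: "\<And>k. U k \<in> lattice_L2" and C: "\<And>k. lattice_norm (h k) (U k) \<le> C"
    and est: "\<And>\<delta>. \<delta> > 0 \<Longrightarrow> \<exists>A0. finite A0 \<and> (\<forall>A. finite A \<longrightarrow> A0 \<subseteq> A \<longrightarrow>
      (\<forall>\<^sub>F k in sequentially. L2sq lborel (\<lambda>x. g k x - cellfun (h k) (U k) a A x) \<le> ennreal \<delta>))"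
    and gm: "\<And>k. g k \<in> borel_measurable borel" and g2: "\<And>k. L2sq lborel (g k) < \<infinity>"
    and c: "c \<ge> 0" "\<And>A. finite A \<Longrightarrow> (\<Sum>n\<in>A. (norm (a n))\<^sup>2) \<le> c"
      "\<And>e. e > 0 \<Longrightarrow> \<exists>A0. finite A0 \<and> (\<forall>A. finite A \<longrightarrow> A0 \<subseteq> A \<longrightarrow> c - (\<Sum>n\<in>A. (norm (a n))\<^sup>2) \<le> e)"
    and f: "continuous_on UNIV f" "compact (closure {x. f x \<noteq> 0})" "\<And>x. 0 \<le> f x"
    and I: "I \<ge> 0" "(\<lambda>k. \<integral>\<^sup>+ x. ennreal (f x) \<partial>energy_measure (h k) (U k)) \<longlonglongrightarrow> ennreal I"
  shows "(\<lambda>k. \<integral>\<^sup>+ x. nsq (g k x) * ennreal (f x) \<partial>lborel) \<longlonglongrightarrow> ennreal (c * I)"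
proof -
  have fm[measurable]: "f \<in> borel_measurable borel" by (rule borel_measurable_continuous_onI[OF f(1)])
  note [measurable] = gm
  obtain K where K: "K > 0" "\<And>x. f x \<le> K" using test_function_bounded[OF f(1,2)] by metis
  let ?X = "\<lambda>k. \<integral>\<^sup>+ x. nsq (g k x) * ennreal (f x) \<partial>lborel"
  let ?I = "\<lambda>k. \<integral>\<^sup>+ x. ennreal (f x) \<partial>energy_measure (h k) (U k)"
  define x where "x k = enn2real (?X k)" for k
  have Xfin: "?X k < \<infinity>" for k
  proof -
    have "?X k \<le> (\<integral>\<^sup>+ x. nsq (g k x) * ennreal K \<partial>lborel)"
      by (intro nn_integral_mono mult_left_mono ennreal_leI K) simp
    also have "\<dots> = L2sq lborel (g k) * ennreal K" unfolding L2sq_def by (rule nn_integral_multc) simp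
    also have "\<dots> < \<infinity>" using g2[of k] by (simp add: ennreal_mult_less_top)
    finally show ?thesis .
  qed
  then have Xx: "?X k = ennreal (x k)" for k by (simp add: x_def less_top)
  have "x \<longlonglongrightarrow> c * I"
  proof (rule approx_sandwich_tendsto)
    fix \<eta> :: real assume \<eta>: "0 < \<eta>" "\<eta> \<le> 1"
    \<comment> \<open>D dominates the factors of e in the three errors: c C^2 from the variation of
      f on cells, c from the convergence of the energies, and I from cutting the coefficient sum at
      A.\<close>
    define D where "D = c * (C\<^sup>2 + 1) + I + 1 + c + 1"
    have D: "D \<ge> 1" unfolding D_def using c(1) I(1) by (auto intro!: add_nonneg_nonneg mult_nonneg_nonneg)
    define e where "e = \<eta> / (3 * D)"
    have e: "e > 0" "e * D \<le> \<eta> / 3" "e \<le> 1"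
    proof -
      show "e > 0" using \<eta> D by (simp add: e_def)
      show "e * D \<le> \<eta> / 3" using D by (simp add: e_def)
      have "e * 1 \<le> e * D" using D \<open>e > 0\<close> by (intro mult_left_mono) auto
      then show "e \<le> 1" using \<open>e * D \<le> \<eta> / 3\<close> \<eta> by simp
    qed
    \<comment> \<open>Chosen so that the coefficient (1 + 1/\<eta>) K of the L2 error in Young's
      inequality, multiplied by \<delta>, is exactly \<eta>.\<close>
    define \<delta> where "\<delta> = \<eta> / ((1 + 1 / \<eta>) * K)"
    have \<delta>: "\<delta> > 0" unfolding \<delta>_def using \<eta> K by (auto intro!: divide_pos_pos mult_pos_pos add_pos_pos)
    obtain A1 where A1: "finite A1" "\<And>A. finite A \<Longrightarrow> A1 \<subseteq> A \<Longrightarrow>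
      (\<forall>\<^sub>F k in sequentially. L2sq lborel (\<lambda>x. g k x - cellfun (h k) (U k) a A x) \<le> ennreal \<delta>)"
      using est[OF \<delta>] by auto
    obtain A2 where A2: "finite A2" "\<And>A. finite A \<Longrightarrow> A2 \<subseteq> A \<Longrightarrow> c - (\<Sum>n\<in>A. (norm (a n))\<^sup>2) \<le> e"
      using c(3)[OF e(1)] by auto
    define A where "A = A1 \<union> A2"
    have A: "finite A" using A1 A2 by (simp add: A_def)
    define S where "S = (\<Sum>n\<in>A. (norm (a n))\<^sup>2)"
    have S: "0 \<le> S" "S \<le> c" "c - S \<le> e" using c(2)[OF A] A2(2)[OF A] by (auto simp: S_def A_def sum_nonneg)
    have ev1: "\<forall>\<^sub>F k in sequentially. L2sq lborel (\<lambda>x. g k x - cellfun (h k) (U k) a A x) \<le> ennreal \<delta>"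
      by (rule A1(2)[OF A]) (simp add: A_def)
    obtain d where d: "d > 0" "\<And>x y. norm (x - y) \<le> d \<Longrightarrow> \<bar>f x - f y\<bar> \<le> e"
      using compact_support_uniform[OF f(1,2) e(1)] by blast
    have "(\<lambda>k. h k * real CARD('n)) \<longlonglongrightarrow> 0 * real CARD('n)" by (intro tendsto_intros h0)
    then have ev2: "\<forall>\<^sub>F k in sequentially. h k * real CARD('n) < d" using d(1) by (intro order_tendstoD(2)) auto
    have "(\<lambda>k. enn2real (?I k)) \<longlonglongrightarrow> I"
      by (rule tendsto_enn2real[OF I(2) I(1)])
    then have ev3: "\<forall>\<^sub>F k in sequentially. dist (enn2real (?I k)) I < e" using e by (intro tendstoD) auto
    have ev4: "\<forall>\<^sub>F k in sequentially. ?I k < \<infinity>" using order_tendstoD(2)[OF I(2), of \<infinity>] by simp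
    show "\<forall>\<^sub>F k in sequentially. \<exists>z\<ge>0. x k \<le> (1 + \<eta>) * z + \<eta> \<and> z \<le> (1 + \<eta>) * x k + \<eta> \<and> \<bar>z - c * I\<bar> \<le> \<eta>"
      using ev1 ev2 ev3 ev4
    proof eventually_elim
      case (elim k)
      let ?Z = "\<integral>\<^sup>+ x. nsq (cellfun (h k) (U k) a A x) * ennreal (f x) \<partial>lborel"
      let ?N = "(lattice_norm (h k) (U k))\<^sup>2"
      define i where "i = enn2real (?I k)"
      have i: "?I k = ennreal i" "i \<ge> 0" using elim(4) by (simp_all add: i_def less_top)
      have N: "?N \<le> C\<^sup>2" by (rule lattice_norm_sq_le[OF h C])
      have t: "?Z \<le> ennreal S * ?I k + ennreal e * (ennreal S * ennreal ?N)" "ennreal S * ?I k \<le> ?Z + ennreal e * (ennreal S * ennreal ?N)"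
        unfolding S_def by (rule cellfun_test[OF h U A fm f(3)]; use d(2) elim(2) e in auto)+
      have eSN: "ennreal e * (ennreal S * ennreal ?N) = ennreal (e * (S * ?N))"
        using e S by (simp add: ennreal_mult)
      have SI: "ennreal S * ?I k = ennreal (S * i)" using S i by (simp add: ennreal_mult)
      have "?Z < \<infinity>" using t(1) unfolding eSN SI by (auto intro: le_less_trans simp: ennreal_add_less_top)
      then obtain z where z: "?Z = ennreal z" "z \<ge> 0" by (cases ?Z) auto
      have eSN0: "0 \<le> e * (S * ?N)" using e S by auto
      have z1: "z \<le> S * i + e * (S * ?N)" "S * i \<le> z + e * (S * ?N)"
        using t S i z eSN0 unfolding eSN SI z(1) by (simp_all add: ennreal_plus[symmetric] del: ennreal_plus)
      have Kd: "ennreal ((1 + 1 / \<eta>) * K) * L2sq lborel (\<lambda>x. g k x - cellfun (h k) (U k) a A x) \<le> ennreal \<eta>"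
      proof -
        have "ennreal ((1 + 1 / \<eta>) * K) * L2sq lborel (\<lambda>x. g k x - cellfun (h k) (U k) a A x) \<le> ennreal ((1 + 1 / \<eta>) * K) * ennreal \<delta>"
          by (rule mult_left_mono[OF elim(1)]) simp
        also have "\<dots> = ennreal ((1 + 1 / \<eta>) * K * \<delta>)"
          using \<eta> K \<delta> by (intro ennreal_mult[symmetric]) auto
        also have "(1 + 1 / \<eta>) * K * \<delta> = \<eta>"
        proof -
          have "(1 + 1 / \<eta>) * K > 0" using \<eta> K by (auto intro!: mult_pos_pos add_pos_pos)
          moreover have "m > 0 \<Longrightarrow> m * (\<eta> / m) = \<eta>" for m by simp
          ultimately show ?thesis unfolding \<delta>_def by blast
        qed
        finally show ?thesis .
      qed
      have "ennreal (x k) \<le> ennreal (1 + \<eta>) * ennreal z + ennreal \<eta>"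
        unfolding Xx[symmetric] z(1)[symmetric]
        by (rule order_trans[OF nn_integral_sq_young[OF _ _ _ \<eta>(1) K(2) f(3)] add_left_mono[OF Kd]]) simp_all
      then have y1: "x k \<le> (1 + \<eta>) * z + \<eta>"
        using \<eta> z by (simp add: ennreal_mult[symmetric] ennreal_plus[symmetric] del: ennreal_plus)
      have "ennreal z \<le> ennreal (1 + \<eta>) * ennreal (x k) + ennreal \<eta>"
        unfolding Xx[symmetric] z(1)[symmetric]
      proof (rule order_trans[OF nn_integral_sq_young[OF _ _ _ \<eta>(1) K(2) f(3)] add_left_mono])
        show "ennreal ((1 + 1 / \<eta>) * K) * L2sq lborel (\<lambda>x. cellfun (h k) (U k) a A x - g k x) \<le> ennreal \<eta>"
          using Kd by (subst L2sq_minus_commute)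
      qed simp_all
      moreover have "0 \<le> x k" by (simp add: x_def)
      ultimately have y2: "z \<le> (1 + \<eta>) * x k + \<eta>"
        using \<eta> by (simp add: ennreal_mult[symmetric] ennreal_plus[symmetric] del: ennreal_plus)
      have "\<bar>z - c * I\<bar> \<le> \<eta>"
      proof -
        have iI: "\<bar>i - I\<bar> \<le> e" using elim(3) by (simp add: i_def dist_real_def)
        have "S * ?N \<le> c * C\<^sup>2" using S N by (intro mult_mono) auto
        then have a1: "e * (S * ?N) \<le> e * (c * C\<^sup>2)" using e by (intro mult_left_mono) auto
        have a2: "\<bar>S * i - S * I\<bar> \<le> c * e"
        proof -
          have "\<bar>S * i - S * I\<bar> = S * \<bar>i - I\<bar>" using S(1) by (simp add: right_diff_distrib[symmetric] abs_mult)
          also have "\<dots> \<le> c * e" using S iI c(1) by (intro mult_mono) auto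
          finally show ?thesis .
        qed
        have a3: "\<bar>S * I - c * I\<bar> \<le> e * I"
        proof -
          have "\<bar>S * I - c * I\<bar> = (c - S) * I" using S(2) I(1) by (simp add: left_diff_distrib[symmetric] abs_mult)
          also have "\<dots> \<le> e * I" using S I by (intro mult_right_mono) auto
          finally show ?thesis .
        qed
        have "\<bar>z - c * I\<bar> \<le> e * (c * C\<^sup>2) + c * e + e * I" using z1 a1 a2 a3 by linarith
        also have "\<dots> \<le> e * D"
          using e(1) c(1) by (simp add: D_def algebra_simps)
        finally show ?thesis using e(2) \<eta> by linarith
      qed
      then show ?case using y1 y2 z(2) by blast
    qed
  qed (use c I in \<open>auto simp: x_def\<close>)
  then show ?thesis unfolding Xx by (rule tendsto_ennrealI)
qed

section \<open>Radon measures and reduction to nonnegative test functions\<close>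

lemma radon_integrable:
  fixes f :: "'a::euclidean_space \<Rightarrow> real"
  assumes M: "radon_measure M" and f: "continuous_on UNIV f" "compact (closure {x. f x \<noteq> 0})"
  shows "integrable M f"
proof (rule integrableI_bounded)
  have sM[measurable_cong]: "sets M = sets borel" using M by (simp add: radon_measure_def)
  have fm: "f \<in> borel_measurable borel" by (rule borel_measurable_continuous_onI[OF f(1)])
  then show "f \<in> borel_measurable M" by measurable
  let ?S = "closure {x. f x \<noteq> 0}"
  obtain K where K: "K > 0" "\<And>x. \<bar>f x\<bar> \<le> K" by (rule test_function_bounded[OF f]) blast
  have "(\<integral>\<^sup>+ x. ennreal (norm (f x)) \<partial>M) \<le> (\<integral>\<^sup>+ x. ennreal K * indicator ?S x \<partial>M)"
  proof (rule nn_integral_mono)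
    fix x
    show "ennreal (norm (f x)) \<le> ennreal K * indicator ?S x"
    proof (cases "x \<in> ?S")
      case True
      then show ?thesis using K(2)[of x] by (simp add: ennreal_leI)
    next
      case False
      then have "f x = 0" using closure_subset[of "{x. f x \<noteq> 0}"] by auto
      then show ?thesis by simp
    qed
  qed
  also have "\<dots> = ennreal K * emeasure M ?S" by (rule nn_integral_cmult_indicator) (simp add: sM)
  also have "\<dots> < \<infinity>" using M f(2) by (auto simp: radon_measure_def ennreal_mult_less_top)
  finally show "(\<integral>\<^sup>+ x. ennreal (norm (f x)) \<partial>M) < \<infinity>" .
qed

lemma test_function_pos_part:
  fixes f :: "'a::euclidean_space \<Rightarrow> real"
  assumes "continuous_on UNIV f" "compact (closure {x. f x \<noteq> 0})"
  shows "continuous_on UNIV (\<lambda>x. max 0 (f x))" "compact (closure {x. max 0 (f x) \<noteq> 0})"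
proof -
  show "continuous_on UNIV (\<lambda>x. max 0 (f x))" by (intro continuous_intros assms)
  have "closure {x. max 0 (f x) \<noteq> 0} \<subseteq> closure {x. f x \<noteq> 0}" by (rule closure_mono) auto
  then have "closure {x. f x \<noteq> 0} \<inter> closure {x. max 0 (f x) \<noteq> 0} = closure {x. max 0 (f x) \<noteq> 0}" by (rule Int_absorb1)
  then show "compact (closure {x. max 0 (f x) \<noteq> 0})"
    using compact_Int_closed[OF assms(2) closed_closure, of "{x. max 0 (f x) \<noteq> 0}"] by simp
qed

lemma radon_LINT:
  fixes f :: "'a::euclidean_space \<Rightarrow> real"
  assumes M: "radon_measure M" and f: "continuous_on UNIV f" "compact (closure {x. f x \<noteq> 0})"
  shows "(LINT x|M. f x) = enn2real (\<integral>\<^sup>+ x. ennreal (max 0 (f x)) \<partial>M) - enn2real (\<integral>\<^sup>+ x. ennreal (max 0 (- f x)) \<partial>M)"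
proof -
  have "ennreal (max 0 y) = ennreal y" for y by (cases "y \<ge> 0") (auto simp: ennreal_neg)
  then show ?thesis using real_lebesgue_integral_def[OF radon_integrable[OF assms]] by simp
qed

lemma weakly_converges_nonneg:
  fixes f :: "'a::euclidean_space \<Rightarrow> real"
  assumes w: "weakly_converges M N" and f: "continuous_on UNIV f" "compact (closure {x. f x \<noteq> 0})" "\<And>x. 0 \<le> f x"
  shows "(\<lambda>k. \<integral>\<^sup>+ x. ennreal (f x) \<partial>M k) \<longlonglongrightarrow> ennreal (LINT x|N. f x)"
    and "(\<integral>\<^sup>+ x. ennreal (f x) \<partial>N) = ennreal (LINT x|N. f x)"
proof -
  have r: "radon_measure (M k)" "radon_measure N" for k using w by (auto simp: weakly_converges_def)
  have e: "(\<integral>\<^sup>+ x. ennreal (f x) \<partial>X) = ennreal (LINT x|X. f x)" if "radon_measure X" for X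
    by (rule nn_integral_eq_integral[OF radon_integrable[OF that f(1,2)]]) (simp add: f(3))
  show "(\<integral>\<^sup>+ x. ennreal (f x) \<partial>N) = ennreal (LINT x|N. f x)" by (rule e[OF r(2)])
  have "(\<lambda>k. LINT x|M k. f x) \<longlonglongrightarrow> (LINT x|N. f x)" using w f by (simp add: weakly_converges_def)
  then show "(\<lambda>k. \<integral>\<^sup>+ x. ennreal (f x) \<partial>M k) \<longlonglongrightarrow> ennreal (LINT x|N. f x)"
    unfolding e[OF r(1)] by (rule tendsto_ennrealI)
qed

lemma radon_scale_measure:
  assumes "radon_measure N" "c < \<infinity>"
  shows "radon_measure (scale_measure c N)"
  using assms by (auto simp: radon_measure_def ennreal_mult_less_top)

lemma radon_density:
  fixes g :: "'a::euclidean_space \<Rightarrow> complex"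
  assumes [measurable]: "g \<in> borel_measurable borel" and g2: "L2sq lborel g < \<infinity>"
  shows "radon_measure (density lborel (\<lambda>x. nsq (g x)))"
  unfolding radon_measure_def
proof (intro conjI allI impI)
  fix K :: "'a set" assume "compact K"
  then have [measurable]: "K \<in> sets borel" by (intro borel_closed compact_imp_closed)
  have "emeasure (density lborel (\<lambda>x. nsq (g x))) K = (\<integral>\<^sup>+ x. nsq (g x) * indicator K x \<partial>lborel)"
    by (simp add: emeasure_density)
  also have "\<dots> \<le> L2sq lborel g" unfolding L2sq_def by (rule nn_integral_mono) (auto split: split_indicator)
  finally show "emeasure (density lborel (\<lambda>x. nsq (g x))) K < \<infinity>" using g2 by simp
qed simp

text \<open>It suffices to test against nonnegative functions, where everything takes place in the
  extended nonnegative reals.\<close>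

lemma weakly_converges_densityI:
  fixes g :: "nat \<Rightarrow> 'a::euclidean_space \<Rightarrow> complex"
  assumes N: "radon_measure N" and c: "c \<ge> 0"
    and gm: "\<And>k. g k \<in> borel_measurable borel" and g2: "\<And>k. L2sq lborel (g k) < \<infinity>"
    and lim: "\<And>f. continuous_on UNIV f \<Longrightarrow> compact (closure {x. f x \<noteq> 0}) \<Longrightarrow> (\<And>x. 0 \<le> f x) \<Longrightarrow>
      (\<lambda>k. \<integral>\<^sup>+ x. nsq (g k x) * ennreal (f x) \<partial>lborel) \<longlonglongrightarrow> ennreal (c * (LINT x|N. f x))"
  shows "weakly_converges (\<lambda>k. density lborel (\<lambda>x. nsq (g k x))) (scale_measure (ennreal c) N)"
  unfolding weakly_converges_def
proof (intro conjI allI impI)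
  note [measurable] = gm
  let ?M = "\<lambda>k. density lborel (\<lambda>x. nsq (g k x))"
  show rM: "radon_measure (?M k)" for k by (rule radon_density[OF gm g2])
  show rN: "radon_measure (scale_measure (ennreal c) N)" by (rule radon_scale_measure[OF N]) simp
  have sN[measurable_cong]: "sets N = sets borel" using N by (simp add: radon_measure_def)
  fix f :: "'a \<Rightarrow> real" assume f: "continuous_on UNIV f \<and> compact (closure {x. f x \<noteq> 0})"
  have part: "(\<lambda>k. enn2real (\<integral>\<^sup>+ x. ennreal (max 0 (u x)) \<partial>?M k)) \<longlonglongrightarrow> enn2real (\<integral>\<^sup>+ x. ennreal (max 0 (u x)) \<partial>scale_measure (ennreal c) N)"
    if u: "continuous_on UNIV u" "compact (closure {x. u x \<noteq> 0})" for u :: "'a \<Rightarrow> real"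
  proof -
    note p = test_function_pos_part[OF u]
    have [measurable]: "u \<in> borel_measurable borel" by (rule borel_measurable_continuous_onI[OF u(1)])
    have I0: "0 \<le> (LINT x|N. max 0 (u x))" by simp
    have "(\<integral>\<^sup>+ x. ennreal (max 0 (u x)) \<partial>?M k) = (\<integral>\<^sup>+ x. nsq (g k x) * ennreal (max 0 (u x)) \<partial>lborel)" for k
      by (simp add: nn_integral_density)
    then have "(\<lambda>k. enn2real (\<integral>\<^sup>+ x. ennreal (max 0 (u x)) \<partial>?M k)) \<longlonglongrightarrow> c * (LINT x|N. max 0 (u x))"
      using lim[OF p] c I0 by (intro tendsto_enn2real) auto
    moreover have "(\<integral>\<^sup>+ x. ennreal (max 0 (u x)) \<partial>scale_measure (ennreal c) N) = ennreal c * ennreal (LINT x|N. max 0 (u x))"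
      by (subst nn_integral_scale_measure, measurable)
         (subst nn_integral_eq_integral[OF radon_integrable[OF N p]], auto)
    ultimately show ?thesis using c I0 by (simp add: enn2real_mult)
  qed
  have m: "continuous_on UNIV (\<lambda>x. - f x)" "compact (closure {x. - f x \<noteq> 0})"
    using f by (auto intro: continuous_intros)
  have f': "continuous_on UNIV f" "compact (closure {x. f x \<noteq> 0})" using f by auto
  show "(\<lambda>k. LINT x|?M k. f x) \<longlonglongrightarrow> (LINT x|scale_measure (ennreal c) N. f x)"
    unfolding radon_LINT[OF rM f'] radon_LINT[OF rN f'] by (intro tendsto_diff part f' m)
qed

section \<open>Uniform tails from (D) and from continuity of \<tau>\<close>

lemma finite_latt_ball: "finite {n :: int ^ 'n::finite. norm (latt n) < R}"
proof (rule finite_subset)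
  let ?m = "\<lceil>\<bar>R\<bar>\<rceil>"
  show "{n :: int ^ 'n. norm (latt n) < R} \<subseteq> (\<lambda>f. \<chi> i. f i) ` (PiE UNIV (\<lambda>_. {- ?m..?m}))"
  proof
    fix n :: "int ^ 'n" assume "n \<in> {n. norm (latt n) < R}"
    then have "\<bar>real_of_int (n $ i)\<bar> < \<bar>R\<bar>" for i
      using component_le_norm_cart[of "latt n" i] by (simp add: latt_nth)
    then have "n $ i \<in> {- ?m..?m}" for i
      by (smt (verit, best) atLeastAtMost_iff le_of_int_ceiling of_int_le_iff of_int_minus)
    then show "n \<in> (\<lambda>f. \<chi> i. f i) ` (PiE UNIV (\<lambda>_. {- ?m..?m}))"
      by (intro image_eqI[of _ _ "\<lambda>i. n $ i"]) auto
  qed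
qed (intro finite_imageI finite_PiE, auto)

text \<open>The unit ball lies in Q, so an essential supremum over the cell controls the
  neighbourhood of radius 1; the finite set is a lattice ball, whose complement is the tail in
  (D).\<close>

lemma conditionD_uniform_tail:
  fixes p :: "real ^ 'n::finite \<Rightarrow> complex"
  assumes "conditionD s p"
  shows "uniform_tail s p"
  unfolding uniform_tail_def
proof (intro allI impI)
  fix \<delta> :: real assume "\<delta> > 0"
  then have "\<forall>\<^sub>F R in at_top. esssup (restrict_space lborel cellQ) (\<lambda>\<xi>. \<Sum>\<^sub>\<infinity>n\<in>{n. norm (latt n) \<ge> R}. tau_term s p \<xi> n) < ennreal \<delta>"
    using assms unfolding conditionD_def by (intro order_tendstoD(2)) auto
  then obtain R where R: "esssup (restrict_space lborel cellQ) (\<lambda>\<xi>. \<Sum>\<^sub>\<infinity>n\<in>{n. norm (latt n) \<ge> R}. tau_term s p \<xi> n) < ennreal \<delta>"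
    unfolding eventually_at_top_linorder by blast
  let ?A = "{n :: int ^ 'n. norm (latt n) < R}"
  have A: "- ?A = {n. norm (latt n) \<ge> R}" by auto
  have "AE \<xi> in restrict_space lborel cellQ. (\<Sum>\<^sub>\<infinity>n\<in>-?A. tau_term s p \<xi> n) \<le> ennreal \<delta>"
    using esssup_AE[where M = "restrict_space lborel cellQ" and f = "\<lambda>\<xi>. \<Sum>\<^sub>\<infinity>n\<in>-?A. tau_term s p \<xi> n"]
    by eventually_elim (use R in \<open>auto simp: A\<close>)
  then have ae: "AE \<xi> in lborel. \<xi> \<in> cellQ \<longrightarrow> (\<Sum>\<^sub>\<infinity>n\<in>-?A. tau_term s p \<xi> n) \<le> ennreal \<delta>"
    by (subst (asm) AE_restrict_space_iff) auto
  have Q: "\<xi> \<in> cellQ" if "norm \<xi> < 1" for \<xi> :: "real ^ 'n"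
  proof -
    have "\<bar>\<xi> $ i\<bar> < 1" for i using that component_le_norm_cart[of \<xi> i] by linarith
    then show ?thesis using pi_gt3 unfolding cellQ_def by (smt (verit, best) mem_Collect_eq)
  qed
  have "AE \<xi> in lborel. norm \<xi> < 1 \<longrightarrow> (\<Sum>\<^sub>\<infinity>n\<in>-?A. tau_term s p \<xi> n) \<le> ennreal \<delta>"
    using ae by eventually_elim (use Q in auto)
  then show "\<exists>A r. finite A \<and> r > 0 \<and> (AE \<xi> in lborel. norm \<xi> < r \<longrightarrow> (\<Sum>\<^sub>\<infinity>n\<in>-A. tau_term s p \<xi> n) \<le> ennreal \<delta>)"
    by (intro exI[of _ ?A] exI[of _ 1]) (use finite_latt_ball in auto)
qed

text \<open>Continuity of the full series at the origin makes the tails uniformly small near the origin,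
  because finite partial sums are continuous there.\<close>

lemma isCont_tau_uniform_tail:
  fixes p :: "real ^ 'n::finite \<Rightarrow> complex"
  assumes tau: "isCont (tau s p) 0" and cont: "\<And>n. isCont p (dual n)"
    and B: "AE \<xi> in lborel. perT (sym s p) \<xi> \<le> ennreal B" and B0: "B \<ge> 0"
  shows "uniform_tail s p"
  unfolding uniform_tail_def
proof (intro allI impI)
  fix \<delta> :: real assume \<delta>: "\<delta> > 0"
  have bd: "finite A \<Longrightarrow> (\<Sum>n\<in>A. (norm (coef s p n))\<^sup>2) \<le> B" for A by (rule coef_sum_le[OF cont B B0])
  obtain c where c: "c \<ge> 0" "(\<Sum>\<^sub>\<infinity>n. nsq (coef s p n)) = ennreal c"
    "\<And>e. e > 0 \<Longrightarrow> \<exists>A0. finite A0 \<and> (\<forall>A. finite A \<longrightarrow> A0 \<subseteq> A \<longrightarrow> c - (\<Sum>n\<in>A. (norm (coef s p n))\<^sup>2) \<le> e)"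
    using infsum_ennreal_approx[of "coef s p" B] bd by metis
  obtain A where A: "finite A" "c - (\<Sum>n\<in>A. (norm (coef s p n))\<^sup>2) \<le> \<delta> / 4"
    using c(3)[of "\<delta> / 4"] \<delta> by auto
  have t0: "tau s p 0 = ennreal c" using c(2) by (simp add: tau_def tau_term_eq coef_def)
  have "(tau s p \<longlongrightarrow> ennreal c) (nhds 0)"
    using tau t0 isCont_def tendsto_at_iff_tendsto_nhds by metis
  \<comment> \<open>The margins are c + \<delta>/4 from above for the full series and c - \<delta>/2
    from below for the partial sum, which leaves at most 3\<delta>/4 for the tail.\<close>
  then have "\<forall>\<^sub>F \<xi> in nhds 0. tau s p \<xi> < ennreal (c + \<delta> / 4)"
    using \<delta> c(1) by (intro order_tendstoD(2)) (auto simp: ennreal_lessI)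
  then obtain r1 where r1: "r1 > 0" "\<And>\<xi>. dist \<xi> 0 < r1 \<Longrightarrow> tau s p \<xi> < ennreal (c + \<delta> / 4)"
    unfolding eventually_nhds_metric by blast
  let ?F = "\<lambda>\<xi>. \<Sum>n\<in>A. (norm (sym s p (\<xi> + dual n)))\<^sup>2"
  have "isCont (\<lambda>\<xi>. - ?F \<xi>) 0" by (intro continuous_intros isCont_shift sym_isCont cont)
  moreover have "- ?F 0 < - c + \<delta> / 2" using A(2) \<delta> by (simp add: coef_def)
  ultimately obtain r2 where r2: "r2 > 0" "\<And>\<xi>. norm \<xi> < r2 \<Longrightarrow> - ?F \<xi> \<le> - c + \<delta> / 2"
    using isCont_le_near[of "\<lambda>\<xi>. - ?F \<xi>" "- c + \<delta> / 2"] by blast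
  have "(\<Sum>\<^sub>\<infinity>n\<in>-A. tau_term s p \<xi> n) \<le> ennreal \<delta>" if x: "norm \<xi> < min r1 r2" for \<xi>
  proof -
    have F0: "0 \<le> ?F \<xi>" by (rule sum_nonneg) simp
    have F: "c - \<delta> / 2 \<le> ?F \<xi>" using r2(2)[of \<xi>] x by simp
    have "tau s p \<xi> = ennreal (?F \<xi>) + (\<Sum>\<^sub>\<infinity>n\<in>-A. tau_term s p \<xi> n)"
      unfolding tau_def by (subst infsum_ennreal_split[OF A(1)]) (simp add: tau_term_eq sum_ennreal)
    then have le: "ennreal (?F \<xi>) + (\<Sum>\<^sub>\<infinity>n\<in>-A. tau_term s p \<xi> n) \<le> ennreal (c + \<delta> / 4)"
      using r1(2)[of \<xi>] x by simp
    then obtain T where T: "(\<Sum>\<^sub>\<infinity>n\<in>-A. tau_term s p \<xi> n) = ennreal T" "T \<ge> 0"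
      by (cases "\<Sum>\<^sub>\<infinity>n\<in>-A. tau_term s p \<xi> n") (auto simp: top_unique)
    then have "?F \<xi> + T \<le> c + \<delta> / 4"
      using le F0 c(1) \<delta> by (simp add: ennreal_plus[symmetric] del: ennreal_plus)
    then show ?thesis unfolding T(1) using F \<delta> by (intro ennreal_leI) linarith
  qed
  then show "\<exists>A r. finite A \<and> r > 0 \<and> (AE \<xi> in lborel. norm \<xi> < r \<longrightarrow> (\<Sum>\<^sub>\<infinity>n\<in>-A. tau_term s p \<xi> n) \<le> ennreal \<delta>)"
    by (intro exI[of _ A] exI[of _ "min r1 r2"]) (use A r1 r2 in auto)
qed

subsection \<open>The case of a vanishing limit\<close>

lemma cutoff:
  fixes R :: real
  defines "f \<equiv> \<lambda>x :: 'a::euclidean_space. max 0 (min 1 (R + 1 - norm x))"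
  shows "continuous_on UNIV f" "compact (closure {x. f x \<noteq> 0})" "\<And>x. 0 \<le> f x" "\<And>x. f x \<le> 1" "\<And>x. norm x \<le> R \<Longrightarrow> f x = 1"
proof -
  show "continuous_on UNIV f" unfolding f_def by (intro continuous_intros)
  have "{x. f x \<noteq> 0} \<subseteq> cball 0 (R + 1)" by (auto simp: f_def max_def min_def split: if_splits)
  then have "bounded {x. f x \<noteq> 0}" by (rule bounded_subset[rotated]) simp
  then show "compact (closure {x. f x \<noteq> 0})" by (simp add: compact_closure)
qed (auto simp: f_def)

text \<open>Weak convergence against compactly supported functions only sees bounded regions;
  compactness at infinity controls the mass outside a large ball. A cutoff equal to 1 on that ball
  splits the sum.\<close>

lemma mass_tendsto_0:
  fixes U :: "nat \<Rightarrow> int ^ 'n::finite \<Rightarrow> complex"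
  assumes h: "\<And>k. h k > 0" and w: "weakly_converges (\<lambda>k. energy_measure (h k) (U k)) \<nu>"
    and ci: "compact_at_infinity h U" and z: "emeasure \<nu> UNIV = 0"
  shows "(\<lambda>k. \<Sum>\<^sub>\<infinity>m. ennreal (h k ^ CARD('n) * (norm (U k m))\<^sup>2)) \<longlonglongrightarrow> 0"
proof (rule tendsto_0_ennrealI)
  fix e' :: real assume e': "e' > 0"
  let ?d = "CARD('n)"
  let ?T = "\<lambda>R k. ennreal (h k ^ ?d) * (\<Sum>\<^sub>\<infinity>n\<in>{n. norm (h k *\<^sub>R latt n) > R}. nsq (U k n))"
  have "\<forall>\<^sub>F R in at_top. limsup (\<lambda>k. ?T R k) < ennreal (e' / 2)"
    using ci e' unfolding compact_at_infinity_def by (intro order_tendstoD(2)) auto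
  then obtain R where "limsup (\<lambda>k. ?T R k) < ennreal (e' / 2)" unfolding eventually_at_top_linorder by blast
  then have 1: "\<forall>\<^sub>F k in sequentially. ?T R k < ennreal (e' / 2)" by (rule Limsup_lessD)
  let ?f = "\<lambda>x :: real ^ 'n. max 0 (min 1 (R + 1 - norm x))"
  note cf = cutoff[where R = R]
  have [measurable]: "?f \<in> borel_measurable borel" by (rule borel_measurable_continuous_onI[OF cf(1)])
  have sN: "sets \<nu> = sets borel" using w by (simp add: weakly_converges_def radon_measure_def)
  have "(\<integral>\<^sup>+ x. ennreal (?f x) \<partial>\<nu>) \<le> (\<integral>\<^sup>+ x. 1 \<partial>\<nu>)"
    using cf(4) by (intro nn_integral_mono) (simp add: ennreal_le_1)
  also have "\<dots> = 0" using z sets_eq_imp_space_eq[OF sN] by simp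
  finally have "ennreal (LINT x|\<nu>. ?f x) = 0"
    using weakly_converges_nonneg(2)[OF w cf(1-3)] by simp
  then have "(\<lambda>k. \<integral>\<^sup>+ x. ennreal (?f x) \<partial>energy_measure (h k) (U k)) \<longlonglongrightarrow> 0"
    using weakly_converges_nonneg(1)[OF w cf(1-3)] by simp
  then have 2: "\<forall>\<^sub>F k in sequentially. (\<integral>\<^sup>+ x. ennreal (?f x) \<partial>energy_measure (h k) (U k)) < ennreal (e' / 2)"
    using e' by (intro order_tendstoD(2)) auto
  show "\<forall>\<^sub>F k in sequentially. (\<Sum>\<^sub>\<infinity>m. ennreal (h k ^ ?d * (norm (U k m))\<^sup>2)) \<le> ennreal e'"
    using 1 2
  proof eventually_elim
    case (elim k)
    let ?w = "\<lambda>m. ennreal (h k ^ ?d * (norm (U k m))\<^sup>2)"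
    have "(\<Sum>\<^sub>\<infinity>m. ?w m) \<le> (\<Sum>\<^sub>\<infinity>m. ?w m * ennreal (?f (h k *\<^sub>R latt m)) + ?w m * indicator {n. norm (h k *\<^sub>R latt n) > R} m)"
    proof (rule infsum_ennreal_mono)
      fix m
      show "?w m \<le> ?w m * ennreal (?f (h k *\<^sub>R latt m)) + ?w m * indicator {n. norm (h k *\<^sub>R latt n) > R} m"
        using cf(5)[of "h k *\<^sub>R latt m"] by (cases "norm (h k *\<^sub>R latt m) \<le> R") (auto simp del: norm_scaleR)
    qed
    also have "\<dots> = (\<integral>\<^sup>+ x. ennreal (?f x) \<partial>energy_measure (h k) (U k)) + (\<Sum>\<^sub>\<infinity>m. ?w m * indicator {n. norm (h k *\<^sub>R latt n) > R} m)"
      by (simp add: infsum_ennreal_add nn_integral_energy_measure)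
    also have "(\<Sum>\<^sub>\<infinity>m. ?w m * indicator {n. norm (h k *\<^sub>R latt n) > R} m) = (\<Sum>\<^sub>\<infinity>m\<in>{n. norm (h k *\<^sub>R latt n) > R}. ?w m)"
      by (rule infsum_cong_neutral) auto
    also have "\<dots> = ?T R k"
      unfolding infsum_ennreal_cmult[symmetric] using h[of k] by (simp add: ennreal_mult)
    also have "(\<integral>\<^sup>+ x. ennreal (?f x) \<partial>energy_measure (h k) (U k)) + ?T R k \<le> ennreal (e' / 2) + ennreal (e' / 2)"
      by (intro add_mono less_imp_le elim)
    also have "\<dots> = ennreal e'" using e' by (simp add: ennreal_plus[symmetric] del: ennreal_plus)
    finally show ?case .
  qed
qed

section \<open>The Wigner measure at scale h\<close>

subsection \<open>Lattice sums\<close>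

text \<open>The reference weight: exponent 2d makes it integrable, and by comparison with the
  integral also summable over translates of the lattice.\<close>

abbreviation dec :: "real ^ 'n::finite \<Rightarrow> real" where
  "dec x \<equiv> 1 / (1 + norm x) ^ (2 * CARD('n))"

lemma one_plus_norm_pos: "0 < 1 + norm x"
  using norm_ge_zero[of x] by linarith

lemma dec_pos: "0 < dec x"
  using one_plus_norm_pos[of x] by simp

lemma dec_bound_nonneg:
  assumes "\<And>x :: real ^ 'n::finite. norm (b x) \<le> K * dec x"
  shows "0 \<le> K"
  using order_trans[OF norm_ge_zero assms[of 0]] by simp

lemma dec_compare:
  fixes x y :: "real ^ 'n::finite"
  assumes "1 + norm y \<le> M * (1 + norm x)"
  shows "dec x \<le> M ^ (2 * CARD('n)) * dec y"
proof -
  have "(1 + norm y) ^ (2 * CARD('n)) \<le> M ^ (2 * CARD('n)) * (1 + norm x) ^ (2 * CARD('n))"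
    unfolding power_mult_distrib[symmetric] by (rule power_mono[OF assms]) (use one_plus_norm_pos[of y] in simp)
  then show ?thesis
    using zero_less_power[OF one_plus_norm_pos[of x], of "2 * CARD('n)"] zero_less_power[OF one_plus_norm_pos[of y], of "2 * CARD('n)"]
    by (simp add: field_simps)
qed

lemma dec_integrable: "integrable lborel (dec :: real ^ 'n::finite \<Rightarrow> real)"
  using integrable_decay[where 'a = "real ^ 'n"] by simp

text \<open>Each term is compared with its average over a cell. Points of Q have norm at most
  \<pi>d, so the weight changes over a cell at most by the power 2d of 1 + \<pi>d, and the sum of
  the averages is an integral over all space.\<close>

lemma lattice_sum_bound:
  "\<exists>C>0. \<forall>\<eta> :: real ^ 'n::finite. (\<Sum>\<^sub>\<infinity>k. ennreal (dec (\<eta> + dual k))) \<le> ennreal C"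
proof -
  let ?N = "2 * CARD('n)" and ?P = "(2 * pi) ^ CARD('n)"
  let ?m = "1 + pi * real CARD('n)"
  have J: "(\<integral>\<^sup>+ y. ennreal (dec (y :: real ^ 'n)) \<partial>lborel) = ennreal (LINT y|lborel. dec (y :: real ^ 'n))"
    by (rule nn_integral_eq_integral[OF dec_integrable]) simp
  have J0: "0 \<le> (LINT y|lborel. dec (y :: real ^ 'n))" by simp
  let ?C = "1 / ?P * (?m ^ ?N * (LINT y|lborel. dec (y :: real ^ 'n)))"
  have "(\<Sum>\<^sub>\<infinity>k. ennreal (dec (\<eta> + dual k))) \<le> ennreal ?C" for \<eta> :: "real ^ 'n"
  proof -
    let ?S = "\<Sum>\<^sub>\<infinity>k. ennreal (dec (\<eta> + dual k))"
    have "?S * ennreal ?P = (\<integral>\<^sup>+ y. ?S \<partial>(MQ :: (real ^ 'n) measure))" by (simp add: emeasure_MQ)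
    also have "\<dots> \<le> (\<integral>\<^sup>+ y. (\<Sum>\<^sub>\<infinity>k. ennreal (?m ^ ?N * dec (\<eta> + (y + dual k)))) \<partial>MQ)"
    proof (intro nn_integral_mono infsum_ennreal_mono ennreal_leI dec_compare)
      fix y k assume "y \<in> space (MQ :: (real ^ 'n) measure)"
      then have "y \<in> cellQ" by (simp add: MQ_def space_restrict_space)
      then have "\<bar>y $ i\<bar> \<le> pi" for i by (simp add: cellQ_def abs_le_iff) (metis less_eq_real_def minus_le_iff)
      then have "norm y \<le> (\<Sum>i\<in>(UNIV :: 'n set). pi)" by (intro order_trans[OF norm_le_l1_cart] sum_mono)
      then have ny: "norm y \<le> pi * real CARD('n)" by (simp add: mult.commute)
      let ?a = "\<eta> + dual k"
      have "norm (\<eta> + (y + dual k)) \<le> norm ?a + norm y"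
        using norm_triangle_ineq[of ?a y] by (simp add: algebra_simps)
      moreover have "0 \<le> pi * real CARD('n) * norm ?a" by simp
      ultimately show "1 + norm (\<eta> + (y + dual k)) \<le> ?m * (1 + norm ?a)"
        using ny unfolding distrib_left distrib_right mult_1_left mult_1_right by linarith
    qed
    also have "\<dots> = (\<integral>\<^sup>+ y. ennreal (?m ^ ?N * dec (\<eta> + y)) \<partial>lborel)"
      by (rule nn_integral_tiling[symmetric]) simp
    also have "\<dots> = ennreal (?m ^ ?N) * (\<integral>\<^sup>+ y. ennreal (dec (\<eta> + y)) \<partial>lborel)"
      by (subst nn_integral_cmult[symmetric]) (auto simp: ennreal_mult[symmetric])
    also have "(\<integral>\<^sup>+ y. ennreal (dec (\<eta> + y)) \<partial>lborel) = (\<integral>\<^sup>+ y. ennreal (dec (y :: real ^ 'n)) \<partial>lborel)"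
      by (subst (2) nn_integral_lborel_affine[of _ 1 \<eta>]) simp_all
    finally have "?S * ennreal ?P \<le> ennreal (?m ^ ?N * (LINT y|lborel. dec (y :: real ^ 'n)))"
      unfolding J by (simp add: ennreal_mult)
    then have "ennreal (1 / ?P) * (?S * ennreal ?P) \<le> ennreal (1 / ?P) * ennreal (?m ^ ?N * (LINT y|lborel. dec (y :: real ^ 'n)))"
      by (rule mult_left_mono) simp
    moreover have "ennreal (1 / ?P) * (?S * ennreal ?P) = ?S"
    proof -
      have "ennreal (1 / ?P) * (?S * ennreal ?P) = (ennreal (1 / ?P) * ennreal ?P) * ?S" by (simp only: mult_ac)
      also have "ennreal (1 / ?P) * ennreal ?P = 1" by (subst ennreal_mult[symmetric]) auto
      finally show ?thesis by simp
    qed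
    moreover have "ennreal (1 / ?P) * ennreal (?m ^ ?N * (LINT y|lborel. dec (y :: real ^ 'n))) = ennreal ?C"
      by (rule ennreal_mult[symmetric]) auto
    ultimately show ?thesis by simp
  qed
  then have "\<forall>\<eta> :: real ^ 'n. (\<Sum>\<^sub>\<infinity>k. ennreal (dec (\<eta> + dual k))) \<le> ennreal (\<bar>?C\<bar> + 1)"
    by (meson abs_ge_self add_increasing2 ennreal_leI order_trans zero_le_one)
  then show ?thesis by (meson abs_ge_zero add_nonneg_pos zero_less_one)
qed

lemma latt_dec_sum: "(\<Sum>\<^sub>\<infinity>j. ennreal (dec (latt j :: real ^ 'n::finite))) < \<infinity>"
proof -
  obtain C where C: "\<And>\<eta> :: real ^ 'n. (\<Sum>\<^sub>\<infinity>k. ennreal (dec (\<eta> + dual k))) \<le> ennreal C"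
    using lattice_sum_bound by blast
  have "(\<Sum>\<^sub>\<infinity>j. ennreal (dec (latt j :: real ^ 'n))) \<le> (\<Sum>\<^sub>\<infinity>j. ennreal (7 ^ (2 * CARD('n))) * ennreal (dec (0 + dual j :: real ^ 'n)))"
  proof (rule infsum_ennreal_mono)
    fix j :: "int ^ 'n"
    \<comment> \<open>An integer above 2\<pi>, used to pass from the lattice 2\<pi>Z^d to
      Z^d.\<close>
    have "2 * pi \<le> 7" using pi_less_4 pi_approx by simp
    then have "2 * pi * norm (latt j) \<le> 7 * norm (latt j)" by (rule mult_right_mono) simp
    then have "dec (latt j) \<le> 7 ^ (2 * CARD('n)) * dec (0 + dual j)"
      by (intro dec_compare) (simp add: distrib_left)
    then show "ennreal (dec (latt j)) \<le> ennreal (7 ^ (2 * CARD('n))) * ennreal (dec (0 + dual j))"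
      by (subst ennreal_mult[symmetric]) (auto intro: ennreal_leI)
  qed
  also have "\<dots> \<le> ennreal (7 ^ (2 * CARD('n))) * ennreal C"
    unfolding infsum_ennreal_cmult by (rule mult_left_mono[OF C]) simp
  also have "\<dots> < \<infinity>" by (simp add: ennreal_mult_less_top)
  finally show ?thesis .
qed

lemma norm_infsum_le_ennreal:
  fixes f :: "'a::countable \<Rightarrow> complex"
  shows "ennreal (norm (infsum f A)) \<le> (\<Sum>\<^sub>\<infinity>k\<in>A. ennreal (norm (f k)))"
proof (cases "f summable_on A")
  case True
  then have ab: "(\<lambda>k. norm (f k)) summable_on A" by (simp only: summable_on_iff_abs_summable_on_complex)
  then have "ennreal (norm (infsum f A)) \<le> ennreal (\<Sum>\<^sub>\<infinity>k\<in>A. norm (f k))"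
    by (intro ennreal_leI norm_infsum_bound)
  then show ?thesis using infsum_ennreal_of_real[OF ab] by simp
qed (simp add: infsum_not_exists)

lemma summable_on_ennreal_bound:
  fixes f :: "'a::countable \<Rightarrow> complex"
  assumes "(\<Sum>\<^sub>\<infinity>k. ennreal (norm (f k))) < \<infinity>"
  shows "f summable_on UNIV"
proof -
  obtain s where s: "(\<Sum>\<^sub>\<infinity>k. ennreal (norm (f k))) = ennreal s" "s \<ge> 0" using assms by (cases "\<Sum>\<^sub>\<infinity>k. ennreal (norm (f k))") auto
  have "(\<lambda>k. norm (f k)) summable_on UNIV"
  proof (rule nonneg_bdd_above_summable_on)
    show "bdd_above (sum (\<lambda>k. norm (f k)) ` {F. F \<subseteq> UNIV \<and> finite F})"
    proof (rule bdd_aboveI)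
      fix x assume "x \<in> sum (\<lambda>k. norm (f k)) ` {F. F \<subseteq> UNIV \<and> finite F}"
      then obtain F where F: "finite F" "x = (\<Sum>k\<in>F. norm (f k))" by auto
      have "ennreal x = (\<Sum>k\<in>F. ennreal (norm (f k)))" unfolding F(2) by (rule sum_ennreal[symmetric]) simp
      also have "\<dots> \<le> ennreal s"
        unfolding s(1)[symmetric] by (rule sum_le_infsum_ennreal[OF F(1)]) simp
      finally show "x \<le> s" using s by (simp add: ennreal_le_iff)
    qed
  qed auto
  then show ?thesis by (rule abs_summable_summable)
qed

lemma infsum_eq_LINT:
  fixes f :: "'a::countable \<Rightarrow> complex"
  assumes "(\<Sum>\<^sub>\<infinity>k. ennreal (norm (f k))) < \<infinity>"
  shows "(\<Sum>\<^sub>\<infinity>k. f k) = (LINT k|count_space UNIV. f k)" "integrable (count_space UNIV) f"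
proof -
  show i: "integrable (count_space UNIV) f"
    using assms unfolding infsum_ennreal_eq_nn_integral by (intro integrableI_bounded) auto
  then show "(\<Sum>\<^sub>\<infinity>k. f k) = (LINT k|count_space UNIV. f k)"
    by (metis abs_summable_on_def infsetsum_def infsetsum_infsum)
qed

subsection \<open>Concentration of the lattice Fourier transform at the origin\<close>

text \<open>The qualitative form of \<open>concentration_estimate\<close>: a bounded weight that is
  small near the origin is invisible to Uhat in the limit.\<close>

lemma (in oscillating_sequence) concentration:
  fixes w :: "real ^ 'n \<Rightarrow> ennreal"
  assumes [measurable]: "w \<in> borel_measurable borel" and W: "\<And>\<xi>. w \<xi> \<le> ennreal W"
    and near: "\<And>\<delta>. \<delta> > 0 \<Longrightarrow> \<exists>r>0. \<forall>\<xi>. norm \<xi> < r \<longrightarrow> w \<xi> \<le> ennreal \<delta>"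
  shows "(\<lambda>k. ennreal (h k ^ CARD('n)) * (\<integral>\<^sup>+ \<eta>. nsq (lattice_fourier (U k) \<eta>) * w \<eta> \<partial>MQ)) \<longlonglongrightarrow> 0"
proof (rule tendsto_0_ennrealI)
  fix e :: real assume e: "e > 0"
  have "0 \<le> (2 * pi) ^ CARD('n) * C\<^sup>2 + 1" by simp
  then obtain t where t: "t > 0" "t * ((2 * pi) ^ CARD('n) * C\<^sup>2 + 1) \<le> e" using small_multiple[OF _ e] by blast
  obtain r where r: "r > 0" "\<And>\<xi>. norm \<xi> < r \<Longrightarrow> w \<xi> \<le> ennreal t" using near[OF t(1)] by auto
  have "\<forall>\<^sub>F k in sequentially. ennreal (h k ^ CARD('n)) * (\<integral>\<^sup>+ \<eta>. nsq (lattice_fourier (U k) \<eta>) * w \<eta> \<partial>MQ)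
    \<le> ennreal (t * ((2 * pi) ^ CARD('n) * C\<^sup>2) + t)"
    by (rule concentration_estimate[OF _ AE_I2[OF W] r(1) AE_I2 less_imp_le[OF t(1)] t(1)]) (use r(2) in auto)
  then show "\<forall>\<^sub>F k in sequentially. ennreal (h k ^ CARD('n)) * (\<integral>\<^sup>+ \<eta>. nsq (lattice_fourier (U k) \<eta>) * w \<eta> \<partial>MQ) \<le> ennreal e"
    by eventually_elim (use t(2) in \<open>auto simp: distrib_left intro: order_trans[OF _ ennreal_leI]\<close>)
qed

text \<open>Shifting by j multiplies Uhat by a character, and |e^(ij\<bullet>\<xi>) - 1|^2 is a
  bounded weight vanishing at the origin. Hence the sequence varies slowly on the lattice; Bessel's
  inequality brings the statement back to U.\<close>

lemma (in oscillating_sequence) shift_tendsto_0: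
  shows "(\<lambda>k. \<Sum>\<^sub>\<infinity>m. ennreal (h k ^ CARD('n) * (norm (U k (m + j) - U k m))\<^sup>2)) \<longlonglongrightarrow> 0"
proof -
  let ?d = "CARD('n)"
  let ?P = "(2 * pi) ^ ?d"
  let ?c = "\<lambda>\<xi>. cis (latt j \<bullet> \<xi>) - 1"
  let ?w = "\<lambda>\<xi>. nsq (?c \<xi>)"
  have lim: "(\<lambda>k. ennreal (h k ^ ?d) * (\<integral>\<^sup>+ \<eta>. nsq (lattice_fourier (U k) \<eta>) * ?w \<eta> \<partial>MQ)) \<longlonglongrightarrow> 0"
  proof (rule concentration)
    show "?w \<xi> \<le> ennreal (2\<^sup>2)" for \<xi>
      using norm_triangle_ineq4[of "cis (latt j \<bullet> \<xi>)" 1] by (intro ennreal_leI power_mono) auto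
    fix \<delta> :: real assume "\<delta> > 0"
    moreover have "isCont (\<lambda>\<xi>. (norm (?c \<xi>))\<^sup>2) 0"
      unfolding cis_conv_exp by (intro continuous_intros)
    ultimately obtain r where "r > 0" "\<And>\<xi>. norm \<xi> < r \<Longrightarrow> (norm (?c \<xi>))\<^sup>2 \<le> \<delta>"
      using isCont_le_near[of "\<lambda>\<xi>. (norm (?c \<xi>))\<^sup>2" \<delta>] by auto
    then show "\<exists>r>0. \<forall>\<xi>. norm \<xi> < r \<longrightarrow> ?w \<xi> \<le> ennreal \<delta>" by (auto intro: ennreal_leI)
  qed simp
  have le: "(\<Sum>\<^sub>\<infinity>m. ennreal (h k ^ ?d * (norm (U k (m + j) - U k m))\<^sup>2)) \<le>
    ennreal (1 / ?P) * (ennreal (h k ^ ?d) * (\<integral>\<^sup>+ \<eta>. nsq (lattice_fourier (U k) \<eta>) * ?w \<eta> \<partial>MQ))" for k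
  proof -
    let ?F = "lattice_fourier (U k)"
    note [measurable] = lattice_fourier_measurable[OF U[of k]]
    let ?G = "\<lambda>\<xi>. ?F \<xi> * ?c \<xi>"
    have G: "L2sq MQ ?G = (\<integral>\<^sup>+ \<eta>. nsq (?F \<eta>) * ?w \<eta> \<partial>MQ)"
      unfolding L2sq_def by (simp add: norm_mult power_mult_distrib ennreal_mult)
    have Gfin: "L2sq MQ ?G < \<infinity>"
    proof -
      have "L2sq MQ ?G \<le> (\<integral>\<^sup>+ \<eta>. nsq (?F \<eta>) * ennreal (2\<^sup>2) \<partial>MQ)"
        unfolding G using norm_triangle_ineq4[of "cis (latt j \<bullet> _)" 1]
        by (intro nn_integral_mono mult_left_mono ennreal_leI power_mono) auto
      also have "\<dots> = L2sq MQ ?F * ennreal (2\<^sup>2)" unfolding L2sq_def by (rule nn_integral_multc) simp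
      also have "\<dots> < \<infinity>" using lattice_fourier_L2[OF U[of k]] by (simp add: ennreal_mult_less_top)
      finally show ?thesis .
    qed
    have i: "integrable MQ (\<lambda>\<xi>. ?F \<xi> * cis (latt n \<bullet> \<xi>))" for n
      by (rule integrable_L2_mult[OF _ _ lattice_fourier_L2[OF U] L2sq_MQ_bounded[where B = 1]]) simp_all
    have coeff: "(LINT \<xi>|MQ. ?G \<xi> * cis (latt m \<bullet> \<xi>)) = complex_of_real ?P * (U k (m + j) - U k m)" for m
    proof -
      have "?G \<xi> * cis (latt m \<bullet> \<xi>) = ?F \<xi> * cis (latt (m + j) \<bullet> \<xi>) - ?F \<xi> * cis (latt m \<bullet> \<xi>)" for \<xi>
        by (simp add: latt_add inner_add_left cis_mult[symmetric] algebra_simps)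
      then show ?thesis
        using Bochner_Integration.integral_diff[OF i[of "m + j"] i[of m]] lattice_fourier_coeff[OF U, of k]
        by (simp add: right_diff_distrib)
    qed
    show ?thesis
    proof (subst nonneg_infsum_complete, simp, rule SUP_least)
      fix A assume "A \<in> {F. finite F \<and> F \<subseteq> (UNIV :: (int ^ 'n) set)}"
      then have A: "finite A" by simp
      have hd: "0 \<le> h k ^ ?d" using h[of k] by simp
      have "(\<Sum>m\<in>A. ennreal (h k ^ ?d * (norm (U k (m + j) - U k m))\<^sup>2)) = ennreal (h k ^ ?d * (\<Sum>m\<in>A. (norm (U k (m + j) - U k m))\<^sup>2))"
        unfolding sum_distrib_left using hd by (intro sum_ennreal) auto
      also have "h k ^ ?d * (\<Sum>m\<in>A. (norm (U k (m + j) - U k m))\<^sup>2) = (1 / ?P) * (h k ^ ?d * (?P * (\<Sum>m\<in>A. (norm (U k (m + j) - U k m))\<^sup>2)))"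
        by simp
      also have "ennreal \<dots> = ennreal (1 / ?P) * (ennreal (h k ^ ?d) * ennreal (?P * (\<Sum>m\<in>A. (norm (U k (m + j) - U k m))\<^sup>2)))"
        using hd by (subst ennreal_mult, simp, intro mult_nonneg_nonneg sum_nonneg, simp_all)
          (subst ennreal_mult, auto intro!: mult_nonneg_nonneg sum_nonneg)
      also have "\<dots> \<le> ennreal (1 / ?P) * (ennreal (h k ^ ?d) * L2sq MQ ?G)"
        by (intro mult_left_mono Bessel_inequality A coeff Gfin) simp_all
      finally show "(\<Sum>m\<in>A. ennreal (h k ^ ?d * (norm (U k (m + j) - U k m))\<^sup>2)) \<le> ennreal (1 / ?P) * (ennreal (h k ^ ?d) * (\<integral>\<^sup>+ \<eta>. nsq (?F \<eta>) * ?w \<eta> \<partial>MQ))"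
        unfolding G .
    qed
  qed
  show ?thesis
    by (rule ennreal_tendsto_0_le[OF _ le]) (use ennreal_tendsto_cmult[OF _ lim, of "ennreal (1 / ?P)"] in simp)
qed

subsection \<open>Lattice correlations\<close>

lemma perT_dec:
  fixes Z :: "real ^ 'n::finite \<Rightarrow> complex"
  assumes Z: "\<And>\<xi>. (norm (Z \<xi>))\<^sup>2 \<le> K * dec \<xi>"
  shows "\<exists>B. \<forall>\<eta>. perT Z \<eta> \<le> ennreal B"
proof -
  obtain C where C: "\<And>\<eta> :: real ^ 'n. (\<Sum>\<^sub>\<infinity>k. ennreal (dec (\<eta> + dual k))) \<le> ennreal C"
    using lattice_sum_bound by blast
  have K: "0 \<le> K" using order_trans[OF zero_le_power2 Z[of 0]] by simp
  have "perT Z \<eta> \<le> ennreal (K * \<bar>C\<bar>)" for \<eta>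
  proof -
    have "perT Z \<eta> \<le> (\<Sum>\<^sub>\<infinity>k. ennreal K * ennreal (dec (\<eta> + dual k)))"
      unfolding perT_def using K
      by (intro infsum_ennreal_mono) (subst ennreal_mult[symmetric], auto intro!: ennreal_leI Z[simplified])
    also have "\<dots> \<le> ennreal K * ennreal \<bar>C\<bar>"
      unfolding infsum_ennreal_cmult
      by (rule mult_left_mono[OF order_trans[OF C ennreal_leI]]) auto
    finally show ?thesis using K by (simp add: ennreal_mult)
  qed
  then show ?thesis by blast
qed

lemma dec_sqrt: "(1 / (1 + norm (\<xi> :: real ^ 'n::finite)) ^ CARD('n))\<^sup>2 = dec \<xi>"
  by (simp add: power_divide power_mult[symmetric] mult.commute)

lemma weight_cancel: "complex_of_real ((1 + norm (\<xi> :: real ^ 'n::finite)) ^ CARD('n)) * complex_of_real (1 / (1 + norm \<xi>) ^ CARD('n)) = 1"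
  using one_plus_norm_pos[of \<xi>] unfolding of_real_mult[symmetric] by simp

lemma weight_sq_le:
  fixes b :: "real ^ 'n::finite \<Rightarrow> complex"
  assumes b: "norm (b \<xi>) \<le> K * dec \<xi>"
  shows "(norm (b \<xi> * complex_of_real ((1 + norm \<xi>) ^ CARD('n))))\<^sup>2 \<le> K\<^sup>2 * dec \<xi>"
proof -
  have p: "0 < 1 + norm \<xi>" by (rule one_plus_norm_pos)
  have "norm (b \<xi> * complex_of_real ((1 + norm \<xi>) ^ CARD('n))) = norm (b \<xi>) * (1 + norm \<xi>) ^ CARD('n)"
    unfolding norm_mult norm_of_real using p by simp
  also have "\<dots> \<le> K * dec \<xi> * (1 + norm \<xi>) ^ CARD('n)" using p by (intro mult_right_mono b) simp
  also have "\<dots> = K * (1 / (1 + norm \<xi>) ^ CARD('n))"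
  proof -
    have "(1 + norm \<xi>) ^ (2 * CARD('n)) = (1 + norm \<xi>) ^ CARD('n) * (1 + norm \<xi>) ^ CARD('n)"
      by (simp add: power_add[symmetric] mult_2)
    then show ?thesis using p by simp
  qed
  finally have "(norm (b \<xi> * complex_of_real ((1 + norm \<xi>) ^ CARD('n))))\<^sup>2 \<le> (K * (1 / (1 + norm \<xi>) ^ CARD('n)))\<^sup>2"
    by (rule power_mono) simp
  then show ?thesis unfolding power_mult_distrib dec_sqrt .
qed

text \<open>A function with decay 2d splits into b (1 + |\<xi>|)^d, whose periodised square is
  bounded, and the square integrable weight (1 + |\<xi>|)^(-d); these are the Z and \<psi> of
  \<open>lattice_fourier_pairing\<close>. For the second claim the conjugate of Uhat is put into
  \<psi>, which stays in L2, and the resulting sum is conjugated.\<close>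

lemma pairing_decay:
  fixes U :: "int ^ 'n::finite \<Rightarrow> complex"
  assumes U: "U \<in> lattice_L2" and [measurable]: "b \<in> borel_measurable borel" and b: "\<And>\<xi>. norm (b \<xi>) \<le> K * dec \<xi>"
  shows "((\<lambda>n. U n * (LINT \<xi>|lborel. cis (- (latt n \<bullet> \<xi>)) * b \<xi>)) has_sum (LINT \<xi>|lborel. lattice_fourier U \<xi> * b \<xi>)) UNIV"
    and "((\<lambda>m. cnj (U m) * (LINT \<xi>|lborel. lattice_fourier U \<xi> * (cis (latt m \<bullet> \<xi>) * b \<xi>))) has_sum
      (LINT \<xi>|lborel. lattice_fourier U \<xi> * cnj (lattice_fourier U \<xi>) * b \<xi>)) UNIV"
proof -
  let ?F = "lattice_fourier U"
  note [measurable] = lattice_fourier_measurable[OF U]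
  let ?v = "\<lambda>\<xi> :: real ^ 'n. complex_of_real ((1 + norm \<xi>) ^ CARD('n))"
  let ?\<psi> = "\<lambda>\<xi> :: real ^ 'n. complex_of_real (1 / (1 + norm \<xi>) ^ CARD('n))"
  have psq: "(norm (?\<psi> \<xi>))\<^sup>2 = dec \<xi>" for \<xi>
    unfolding norm_of_real power2_abs by (rule dec_sqrt)
  have wb: "(norm ((\<lambda>\<xi>. b \<xi> * ?v \<xi>) \<xi>))\<^sup>2 \<le> K\<^sup>2 * dec \<xi>" for \<xi> by (rule weight_sq_le, rule b)
  obtain B where B: "\<And>\<eta>. perT (\<lambda>\<xi>. b \<xi> * ?v \<xi>) \<eta> \<le> ennreal B"
    using perT_dec[of "\<lambda>\<xi>. b \<xi> * ?v \<xi>", OF wb] by blast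
  have Z2: "L2sq lborel (\<lambda>\<xi>. b \<xi> * ?v \<xi>) < \<infinity>" by (rule perT_L2[OF _ AE_I2[OF B]]) simp
  have p2: "L2sq lborel ?\<psi> < \<infinity>"
    using dec_integrable[where 'n='n] unfolding L2sq_def psq integrable_iff_bounded by simp
  have c: "b \<xi> * ?v \<xi> * ?\<psi> \<xi> = b \<xi>" for \<xi> by (simp only: mult.assoc weight_cancel mult_1_right)
  have i: "integrable lborel (\<lambda>\<xi>. b \<xi> * ?v \<xi> * ?\<psi> \<xi>)"
    by (rule integrable_L2_mult[OF _ _ Z2 p2]) simp_all
  show "((\<lambda>n. U n * (LINT \<xi>|lborel. cis (- (latt n \<bullet> \<xi>)) * b \<xi>)) has_sum (LINT \<xi>|lborel. ?F \<xi> * b \<xi>)) UNIV"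
    using lattice_fourier_pairing[OF U _ _ AE_I2[OF B] p2 i] unfolding c by simp
  obtain B' where B': "\<And>\<eta>. perT ?\<psi> \<eta> \<le> ennreal B'"
    using perT_dec[of ?\<psi> 1] psq by auto
  let ?Z = "\<lambda>\<xi>. cnj (b \<xi>) * ?v \<xi>" and ?p = "\<lambda>\<xi>. cnj (?F \<xi>) * ?\<psi> \<xi>"
  have Zn: "norm (?Z \<xi>) = norm (b \<xi> * ?v \<xi>)" for \<xi> by (simp add: norm_mult)
  have BZ: "perT ?Z \<eta> \<le> ennreal B" for \<eta> using B[of \<eta>] unfolding perT_def Zn .
  have Z2': "L2sq lborel ?Z < \<infinity>" using Z2 unfolding L2sq_def Zn .
  have "L2sq lborel ?p \<le> ennreal B' * L2sq MQ (\<lambda>\<xi>. cnj (?F \<xi>))"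
    by (rule L2sq_periodic_le[OF _ _ _ AE_I2[OF B']]) (simp_all add: lattice_fourier_periodic[OF U])
  also have "\<dots> < \<infinity>" using lattice_fourier_L2[OF U] by (simp add: L2sq_def ennreal_mult_less_top)
  finally have p2': "L2sq lborel ?p < \<infinity>" .
  have c': "?Z \<xi> * ?p \<xi> = cnj (?F \<xi>) * cnj (b \<xi>)" for \<xi>
  proof -
    have "?Z \<xi> * ?p \<xi> = (cnj (?F \<xi>) * cnj (b \<xi>)) * (?v \<xi> * ?\<psi> \<xi>)" by (simp only: mult_ac)
    then show ?thesis by (simp only: weight_cancel mult_1_right)
  qed
  have "integrable lborel (\<lambda>\<xi>. ?Z \<xi> * ?p \<xi>)" by (rule integrable_L2_mult[OF _ _ Z2' p2']) simp_all
  from lattice_fourier_pairing[OF U _ _ AE_I2[OF BZ] p2' this]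
  have "((\<lambda>n. U n * (LINT \<xi>|lborel. cis (- (latt n \<bullet> \<xi>)) * (cnj (?F \<xi>) * cnj (b \<xi>)))) has_sum (LINT \<xi>|lborel. ?F \<xi> * (cnj (?F \<xi>) * cnj (b \<xi>)))) UNIV"
    unfolding c' by simp
  then have "((\<lambda>n. cnj (U n * (LINT \<xi>|lborel. cis (- (latt n \<bullet> \<xi>)) * (cnj (?F \<xi>) * cnj (b \<xi>))))) has_sum cnj (LINT \<xi>|lborel. ?F \<xi> * (cnj (?F \<xi>) * cnj (b \<xi>)))) UNIV"
    by (simp only: has_sum_cnj_iff)
  then show "((\<lambda>m. cnj (U m) * (LINT \<xi>|lborel. ?F \<xi> * (cis (latt m \<bullet> \<xi>) * b \<xi>))) has_sum (LINT \<xi>|lborel. ?F \<xi> * cnj (?F \<xi>) * b \<xi>)) UNIV"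
    unfolding complex_cnj_mult Bochner_Integration.integral_cnj[symmetric] by (simp add: cis_cnj mult_ac)
qed

text \<open>The contribution of the base point m to a quadratic form in U, with a kernel depending
  on the offset n - m and on m. Both the Wigner transform and the pairing of |Uhat|^2 with a
  function have this shape.\<close>

definition corr :: "(int ^ 'n::finite \<Rightarrow> complex) \<Rightarrow> (int ^ 'n \<Rightarrow> int ^ 'n \<Rightarrow> complex) \<Rightarrow> int ^ 'n \<Rightarrow> complex" where
  "corr U \<alpha> m = cnj (U m) * (\<Sum>\<^sub>\<infinity>n. U n * \<alpha> (n - m) m)"

lemma infsum_ennreal_swap:
  fixes f :: "'a::countable \<Rightarrow> 'b::countable \<Rightarrow> ennreal"
  shows "(\<Sum>\<^sub>\<infinity>m. \<Sum>\<^sub>\<infinity>j. f j m) = (\<Sum>\<^sub>\<infinity>j. \<Sum>\<^sub>\<infinity>m. f j m)"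
proof -
  have "(\<integral>\<^sup>+ m. (\<Sum>\<^sub>\<infinity>j. f j m) \<partial>count_space UNIV) = (\<Sum>\<^sub>\<infinity>j. \<integral>\<^sup>+ m. f j m \<partial>count_space UNIV)"
    by (rule nn_integral_infsum) simp
  then show ?thesis by (simp only: infsum_ennreal_eq_nn_integral)
qed

lemma lattice_L2_bounded:
  assumes "U \<in> lattice_L2"
  obtains M where "M > 0" "\<And>n. norm (U n) \<le> M"
proof
  let ?s = "\<Sum>\<^sub>\<infinity>n. (norm (U n))\<^sup>2"
  have sm: "(\<lambda>n. (norm (U n))\<^sup>2) summable_on UNIV" using assms by (simp add: lattice_L2_def)
  fix n
  have "(\<Sum>n\<in>{n}. (norm (U n))\<^sup>2) \<le> ?s" by (rule finite_sum_le_infsum[OF sm]) auto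
  then have "norm (U n) \<le> sqrt ?s" by (intro real_le_rsqrt) simp
  then show "norm (U n) \<le> sqrt \<bar>?s\<bar> + 1" using real_sqrt_le_mono[OF abs_ge_self[of ?s]] by linarith
qed (simp add: add_nonneg_pos)

text \<open>In the sum over offsets U (m + j) is replaced by U m. Young's inequality with parameter
  t splits the error into a multiple of t times the total mass and a multiple of 1/t times the shift
  differences.\<close>

lemma corr_error:
  fixes U :: "int ^ 'n::finite \<Rightarrow> complex"
  assumes U: "U \<in> lattice_L2" and h: "h > 0" and \<alpha>: "\<And>j m. norm (\<alpha> j m) \<le> \<beta> j"
    and \<beta>: "(\<Sum>\<^sub>\<infinity>j. ennreal (\<beta> j)) < \<infinity>" and t: "t > 0"
  shows "(\<Sum>\<^sub>\<infinity>m. ennreal (h ^ CARD('n) * norm (corr U \<alpha> m - complex_of_real ((norm (U m))\<^sup>2) * (\<Sum>\<^sub>\<infinity>j. \<alpha> j m))))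
    \<le> ennreal t * ((\<Sum>\<^sub>\<infinity>j. ennreal (\<beta> j)) * (\<Sum>\<^sub>\<infinity>m. ennreal (h ^ CARD('n) * (norm (U m))\<^sup>2)))
     + ennreal (1 / t) * (\<Sum>\<^sub>\<infinity>j. ennreal (\<beta> j) * (\<Sum>\<^sub>\<infinity>m. ennreal (h ^ CARD('n) * (norm (U (m + j) - U m))\<^sup>2)))"
proof -
  let ?d = "CARD('n)"
  obtain M0 where M0: "M0 > 0" "\<And>n. norm (U n) \<le> M0" using lattice_L2_bounded[OF U] by blast
  define M where "M = 2 * M0"
  have M: "M > 0" "norm (U n) \<le> M" "norm (U n - U m) \<le> M" for n m
    using M0(1) M0(2)[of n] M0(2)[of m] norm_triangle_ineq4[of "U n" "U m"] by (auto simp: M_def)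
  have \<beta>0: "0 \<le> \<beta> j" for j using order_trans[OF norm_ge_zero \<alpha>] .
  have sm: "(\<lambda>j. c j * \<alpha> j m) summable_on UNIV" if c: "\<And>j. norm (c j) \<le> M" for c m
  proof (rule summable_on_ennreal_bound)
    have "(\<Sum>\<^sub>\<infinity>j. ennreal (norm (c j * \<alpha> j m))) \<le> (\<Sum>\<^sub>\<infinity>j. ennreal M * ennreal (\<beta> j))"
      using M(1) \<beta>0 by (intro infsum_ennreal_mono)
        (subst ennreal_mult[symmetric], auto simp: norm_mult intro!: ennreal_leI mult_mono c \<alpha>)
    then show "(\<Sum>\<^sub>\<infinity>j. ennreal (norm (c j * \<alpha> j m))) < \<infinity>"
      unfolding infsum_ennreal_cmult using \<beta> by (auto intro: le_less_trans simp: ennreal_mult_less_top)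
  qed
  let ?V = "\<lambda>j m. U (m + j) - U m"
  have diff: "corr U \<alpha> m - complex_of_real ((norm (U m))\<^sup>2) * (\<Sum>\<^sub>\<infinity>j. \<alpha> j m) = cnj (U m) * (\<Sum>\<^sub>\<infinity>j. ?V j m * \<alpha> j m)" for m
  proof -
    have "(\<Sum>\<^sub>\<infinity>n. U n * \<alpha> (n - m) m) = (\<Sum>\<^sub>\<infinity>j. U (m + j) * \<alpha> (m + j - m) m)"
    proof (rule infsum_reindex_bij_betw[symmetric])
      show "bij_betw (\<lambda>j. m + j) UNIV UNIV" by (rule bij_betw_byWitness[where f' = "\<lambda>n. n - m"]) auto
    qed
    then have e1: "(\<Sum>\<^sub>\<infinity>n. U n * \<alpha> (n - m) m) = (\<Sum>\<^sub>\<infinity>j. U (m + j) * \<alpha> j m)" by simp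
    have e2: "U m * (\<Sum>\<^sub>\<infinity>j. \<alpha> j m) = (\<Sum>\<^sub>\<infinity>j. U m * \<alpha> j m)" by (rule infsum_cmult_right'[symmetric])
    have "(\<Sum>\<^sub>\<infinity>j. ?V j m * \<alpha> j m + U m * \<alpha> j m) = (\<Sum>\<^sub>\<infinity>j. ?V j m * \<alpha> j m) + (\<Sum>\<^sub>\<infinity>j. U m * \<alpha> j m)"
      by (rule infsum_add) (intro sm M)+
    then have e3: "(\<Sum>\<^sub>\<infinity>j. U (m + j) * \<alpha> j m) = (\<Sum>\<^sub>\<infinity>j. ?V j m * \<alpha> j m) + U m * (\<Sum>\<^sub>\<infinity>j. \<alpha> j m)"
      unfolding e2 by (simp add: distrib_right[symmetric])
    show ?thesis unfolding corr_def e1 e3 complex_norm_square distrib_left by simp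
  qed
  have pt: "ennreal (h ^ ?d * norm (corr U \<alpha> m - complex_of_real ((norm (U m))\<^sup>2) * (\<Sum>\<^sub>\<infinity>j. \<alpha> j m)))
     \<le> (\<Sum>\<^sub>\<infinity>j. ennreal t * (ennreal (\<beta> j) * ennreal (h ^ ?d * (norm (U m))\<^sup>2)) + ennreal (1 / t) * (ennreal (\<beta> j) * ennreal (h ^ ?d * (norm (?V j m))\<^sup>2)))" for m
  proof -
    have "ennreal (h ^ ?d * norm (cnj (U m) * (\<Sum>\<^sub>\<infinity>j. ?V j m * \<alpha> j m))) = ennreal (h ^ ?d * norm (U m)) * ennreal (norm (\<Sum>\<^sub>\<infinity>j. ?V j m * \<alpha> j m))"
      using h by (subst ennreal_mult[symmetric]) (auto simp: norm_mult mult_ac)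
    also have "\<dots> \<le> ennreal (h ^ ?d * norm (U m)) * (\<Sum>\<^sub>\<infinity>j. ennreal (norm (?V j m * \<alpha> j m)))"
      by (rule mult_left_mono[OF norm_infsum_le_ennreal]) simp
    also have "\<dots> = (\<Sum>\<^sub>\<infinity>j. ennreal (h ^ ?d * norm (U m)) * ennreal (norm (?V j m * \<alpha> j m)))"
      by (rule infsum_ennreal_cmult[symmetric])
    also have "\<dots> \<le> (\<Sum>\<^sub>\<infinity>j. ennreal t * (ennreal (\<beta> j) * ennreal (h ^ ?d * (norm (U m))\<^sup>2)) + ennreal (1 / t) * (ennreal (\<beta> j) * ennreal (h ^ ?d * (norm (?V j m))\<^sup>2)))"
    proof (rule infsum_ennreal_mono)
      fix j
      let ?u = "norm (U m)" and ?v = "norm (?V j m)"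
      have hd: "0 \<le> h ^ ?d" using h by simp
      have uv: "?u * ?v \<le> t * ?u\<^sup>2 + 1 / t * ?v\<^sup>2"
      proof -
        have "0 \<le> (t * ?u - ?v)\<^sup>2 / t" using t by simp
        also have "\<dots> = t * ?u\<^sup>2 + 1 / t * ?v\<^sup>2 - 2 * (?u * ?v)" using t by (simp add: power2_eq_square field_simps)
        finally have "2 * (?u * ?v) \<le> t * ?u\<^sup>2 + 1 / t * ?v\<^sup>2" by simp
        moreover have "0 \<le> ?u * ?v" by simp
        ultimately show ?thesis by linarith
      qed
      have "h ^ ?d * ?u * norm (?V j m * \<alpha> j m) = h ^ ?d * ((?u * ?v) * norm (\<alpha> j m))" by (simp add: norm_mult)
      also have "\<dots> \<le> h ^ ?d * ((t * ?u\<^sup>2 + 1 / t * ?v\<^sup>2) * \<beta> j)"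
        using t by (intro mult_left_mono mult_mono uv \<alpha> hd) auto
      also have "\<dots> = t * (\<beta> j * (h ^ ?d * ?u\<^sup>2)) + 1 / t * (\<beta> j * (h ^ ?d * ?v\<^sup>2))" by (simp add: algebra_simps)
      finally have "ennreal (h ^ ?d * ?u * norm (?V j m * \<alpha> j m)) \<le> ennreal (t * (\<beta> j * (h ^ ?d * ?u\<^sup>2)) + 1 / t * (\<beta> j * (h ^ ?d * ?v\<^sup>2)))"
        by (rule ennreal_leI)
      moreover have "ennreal (t * (\<beta> j * (h ^ ?d * ?u\<^sup>2)) + 1 / t * (\<beta> j * (h ^ ?d * ?v\<^sup>2)))
        = ennreal (t * (\<beta> j * (h ^ ?d * ?u\<^sup>2))) + ennreal (1 / t * (\<beta> j * (h ^ ?d * ?v\<^sup>2)))"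
        using t \<beta>0 hd by (intro ennreal_plus mult_nonneg_nonneg) auto
      moreover have pp: "ennreal (x * (\<beta> j * (h ^ ?d * y\<^sup>2))) = ennreal x * (ennreal (\<beta> j) * ennreal (h ^ ?d * y\<^sup>2))" if "0 \<le> x" for x y :: real
        using that \<beta>0 hd by (simp add: ennreal_mult)
      moreover have "0 \<le> t" "0 \<le> 1 / t" using t by auto
      moreover have "ennreal (h ^ ?d * ?u * norm (?V j m * \<alpha> j m)) = ennreal (h ^ ?d * ?u) * ennreal (norm (?V j m * \<alpha> j m))"
        using hd by (intro ennreal_mult mult_nonneg_nonneg) auto
      ultimately show "ennreal (h ^ ?d * ?u) * ennreal (norm (?V j m * \<alpha> j m)) \<le>
        ennreal t * (ennreal (\<beta> j) * ennreal (h ^ ?d * ?u\<^sup>2)) + ennreal (1 / t) * (ennreal (\<beta> j) * ennreal (h ^ ?d * ?v\<^sup>2))"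
        by (simp only: pp)
    qed
    finally show ?thesis unfolding diff .
  qed
  have "(\<Sum>\<^sub>\<infinity>m. ennreal (h ^ ?d * norm (corr U \<alpha> m - complex_of_real ((norm (U m))\<^sup>2) * (\<Sum>\<^sub>\<infinity>j. \<alpha> j m))))
    \<le> (\<Sum>\<^sub>\<infinity>m. \<Sum>\<^sub>\<infinity>j. ennreal t * (ennreal (\<beta> j) * ennreal (h ^ ?d * (norm (U m))\<^sup>2)) + ennreal (1 / t) * (ennreal (\<beta> j) * ennreal (h ^ ?d * (norm (?V j m))\<^sup>2)))"
    by (rule infsum_ennreal_mono[OF pt])
  also have "\<dots> = ennreal t * ((\<Sum>\<^sub>\<infinity>j. ennreal (\<beta> j)) * (\<Sum>\<^sub>\<infinity>m. ennreal (h ^ ?d * (norm (U m))\<^sup>2)))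
     + ennreal (1 / t) * (\<Sum>\<^sub>\<infinity>j. ennreal (\<beta> j) * (\<Sum>\<^sub>\<infinity>m. ennreal (h ^ ?d * (norm (?V j m))\<^sup>2)))"
  proof -
    have "(\<Sum>\<^sub>\<infinity>j. ennreal (\<beta> j) * N) = (\<Sum>\<^sub>\<infinity>j. ennreal (\<beta> j)) * N" for N
      using infsum_ennreal_cmult[of N "\<lambda>j. ennreal (\<beta> j)" UNIV] by (simp add: mult.commute)
    then show ?thesis
      by (subst infsum_ennreal_swap) (simp only: infsum_ennreal_add infsum_ennreal_cmult)
  qed
  finally show ?thesis .
qed

text \<open>Slow variation makes a correlation asymptotically diagonal: the kernel may be summed
  over all offsets in front of |U m|^2. In \<open>corr_error\<close> the parameter t is fixed small,
  and then the shift differences vanish by dominated convergence in j.\<close>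

lemma (in oscillating_sequence) corr_tendsto:
  assumes \<alpha>: "\<And>k j m. norm (\<alpha> k j m) \<le> \<beta> j" and \<beta>: "(\<Sum>\<^sub>\<infinity>j. ennreal (\<beta> j)) < \<infinity>"
  shows "(\<lambda>k. complex_of_real (h k ^ CARD('n)) * (\<Sum>\<^sub>\<infinity>m. corr (U k) (\<alpha> k) m)
    - complex_of_real (h k ^ CARD('n)) * (\<Sum>\<^sub>\<infinity>m. complex_of_real ((norm (U k m))\<^sup>2) * (\<Sum>\<^sub>\<infinity>j. \<alpha> k j m))) \<longlonglongrightarrow> 0"
proof -
  let ?d = "CARD('n)"
  let ?g = "\<lambda>k m. complex_of_real ((norm (U k m))\<^sup>2) * (\<Sum>\<^sub>\<infinity>j. \<alpha> k j m)"
  let ?N = "\<lambda>k. \<Sum>\<^sub>\<infinity>m. ennreal (h k ^ ?d * (norm (U k m))\<^sup>2)"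
  let ?D = "\<lambda>k j. \<Sum>\<^sub>\<infinity>m. ennreal (h k ^ ?d * (norm (U k (m + j) - U k m))\<^sup>2)"
  let ?B = "\<Sum>\<^sub>\<infinity>j. ennreal (\<beta> j)"
  define E where "E k = (\<Sum>\<^sub>\<infinity>m. ennreal (h k ^ ?d * norm (corr (U k) (\<alpha> k) m - ?g k m)))" for k
  have N: "?N k \<le> ennreal (C\<^sup>2)" for k
    unfolding lattice_L2_infsum[OF U h]
    by (intro ennreal_leI power_mono C) (auto simp: lattice_norm_def h less_imp_le infsum_nonneg)
  \<comment> \<open>The bound, uniform in k and j, that provides the majorant \<beta> j times 4
    C^2.\<close>
  have D4: "?D k j \<le> 4 * ennreal (C\<^sup>2)" for k j
  proof -
    have "?D k j \<le> (\<Sum>\<^sub>\<infinity>m. 2 * ennreal (h k ^ ?d * (norm (U k (m - - j)))\<^sup>2) + 2 * ennreal (h k ^ ?d * (norm (U k m))\<^sup>2))"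
    proof (rule infsum_ennreal_mono)
      fix m
      have hd: "0 \<le> h k ^ ?d" using h[of k] by simp
      have "(norm (x - y))\<^sup>2 \<le> 2 * (norm x)\<^sup>2 + 2 * (norm y)\<^sup>2" for x y :: complex
        using norm_add_sq_le[of 1 x "- y"] by simp
      then have "h k ^ ?d * (norm (U k (m + j) - U k m))\<^sup>2 \<le> h k ^ ?d * (2 * (norm (U k (m + j)))\<^sup>2 + 2 * (norm (U k m))\<^sup>2)"
        by (rule mult_left_mono) (rule hd)
      then have "ennreal (h k ^ ?d * (norm (U k (m + j) - U k m))\<^sup>2) \<le> ennreal (2 * (h k ^ ?d * (norm (U k (m + j)))\<^sup>2) + 2 * (h k ^ ?d * (norm (U k m))\<^sup>2))"
        by (intro ennreal_leI) (simp add: algebra_simps)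
      also have "\<dots> = 2 * ennreal (h k ^ ?d * (norm (U k (m + j)))\<^sup>2) + 2 * ennreal (h k ^ ?d * (norm (U k m))\<^sup>2)"
        using hd by (subst ennreal_plus) (auto simp: ennreal_mult)
      finally show "ennreal (h k ^ ?d * (norm (U k (m + j) - U k m))\<^sup>2) \<le> 2 * ennreal (h k ^ ?d * (norm (U k (m - - j)))\<^sup>2) + 2 * ennreal (h k ^ ?d * (norm (U k m))\<^sup>2)"
        by simp
    qed
    also have "\<dots> = 2 * (\<Sum>\<^sub>\<infinity>m. ennreal (h k ^ ?d * (norm (U k (m - - j)))\<^sup>2)) + 2 * ?N k"
      by (simp only: infsum_ennreal_add infsum_ennreal_cmult)
    also have "\<dots> \<le> 2 * ennreal (C\<^sup>2) + 2 * ennreal (C\<^sup>2)"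
      by (intro add_mono mult_left_mono N order_trans[OF infsum_shift_le[where J = UNIV and f = "\<lambda>m. ennreal (h k ^ ?d * (norm (U k m))\<^sup>2)"] N]) auto
    also have "\<dots> = 4 * ennreal (C\<^sup>2)" by (simp add: distrib_right[symmetric])
    finally show ?thesis .
  qed
  have DS: "(\<lambda>k. \<Sum>\<^sub>\<infinity>j. ennreal (\<beta> j) * ?D k j) \<longlonglongrightarrow> 0"
  proof -
    have "(\<lambda>k. \<integral>\<^sup>+ j. ennreal (\<beta> j) * ?D k j \<partial>count_space UNIV) \<longlonglongrightarrow> (\<integral>\<^sup>+ j. 0 \<partial>count_space (UNIV :: (int ^ 'n) set))"
    proof (rule nn_integral_dominated_convergence[where w = "\<lambda>j. ennreal (\<beta> j) * (4 * ennreal (C\<^sup>2))"])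
      show "AE j in count_space UNIV. ennreal (\<beta> j) * ?D k j \<le> ennreal (\<beta> j) * (4 * ennreal (C\<^sup>2))" for k
        by (intro AE_I2 mult_left_mono D4) simp
      show "(\<integral>\<^sup>+ j. ennreal (\<beta> j) * (4 * ennreal (C\<^sup>2)) \<partial>count_space UNIV) < \<infinity>"
        using \<beta> unfolding infsum_ennreal_eq_nn_integral by (simp add: nn_integral_multc ennreal_mult_less_top)
      show "AE j in count_space UNIV. (\<lambda>k. ennreal (\<beta> j) * ?D k j) \<longlonglongrightarrow> 0"
      proof (rule AE_I2)
        fix j show "(\<lambda>k. ennreal (\<beta> j) * ?D k j) \<longlonglongrightarrow> 0"
          using ennreal_tendsto_cmult[OF _ shift_tendsto_0[of j], of "ennreal (\<beta> j)"] by simp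
      qed
    qed simp_all
    then show ?thesis by (simp add: infsum_ennreal_eq_nn_integral)
  qed
  have bound: "E k \<le> ennreal t * (?B * ennreal (C\<^sup>2)) + ennreal (1 / t) * (\<Sum>\<^sub>\<infinity>j. ennreal (\<beta> j) * ?D k j)" if t: "t > 0" for t k
    unfolding E_def
    by (rule order_trans[OF corr_error[OF U h \<alpha> \<beta> t]]) (intro add_right_mono mult_left_mono N, auto)
  obtain b where b: "?B = ennreal b" "b \<ge> 0" using \<beta> by (cases ?B) auto
  have E0: "E \<longlonglongrightarrow> 0"
  proof (rule tendsto_0_ennrealI)
    fix e :: real assume e: "e > 0"
    have "0 \<le> b * C\<^sup>2" using b by simp
    then obtain t where t: "t > 0" "t * (b * C\<^sup>2) \<le> e / 2" using small_multiple[of "b * C\<^sup>2" "e / 2"] e by auto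
    have tb: "ennreal t * (?B * ennreal (C\<^sup>2)) \<le> ennreal (e / 2)"
      using ennreal_leI[OF t(2)] t(1) b by (simp add: ennreal_mult)
    have "(\<lambda>k. ennreal (1 / t) * (\<Sum>\<^sub>\<infinity>j. ennreal (\<beta> j) * ?D k j)) \<longlonglongrightarrow> ennreal (1 / t) * 0"
      by (rule ennreal_tendsto_cmult[OF _ DS]) simp
    then have "\<forall>\<^sub>F k in sequentially. ennreal (1 / t) * (\<Sum>\<^sub>\<infinity>j. ennreal (\<beta> j) * ?D k j) < ennreal (e / 2)"
      using e by (intro order_tendstoD(2)) auto
    then show "\<forall>\<^sub>F k in sequentially. E k \<le> ennreal e"
    proof eventually_elim
      case (elim k)
      have "E k \<le> ennreal (e / 2) + ennreal (e / 2)"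
        by (rule order_trans[OF bound[OF t(1)]]) (intro add_mono tb less_imp_le[OF elim])
      then show ?case using e by (simp add: ennreal_plus[symmetric] del: ennreal_plus)
    qed
  qed
  have fin: "E k < \<infinity>" for k
  proof -
    have "(\<Sum>\<^sub>\<infinity>j. ennreal (\<beta> j) * ?D k j) \<le> (\<Sum>\<^sub>\<infinity>j. (4 * ennreal (C\<^sup>2)) * ennreal (\<beta> j))"
      by (rule infsum_ennreal_mono, subst mult.commute, rule mult_right_mono[OF D4]) simp
    then have "(\<Sum>\<^sub>\<infinity>j. ennreal (\<beta> j) * ?D k j) < \<infinity>"
      unfolding infsum_ennreal_cmult using \<beta> by (auto intro: le_less_trans simp: ennreal_mult_less_top)
    then show ?thesis using bound[of 1 k] \<beta> by (auto intro: le_less_trans simp: ennreal_mult_less_top ennreal_add_less_top)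
  qed
  have le: "ennreal (norm (complex_of_real (h k ^ ?d) * (\<Sum>\<^sub>\<infinity>m. corr (U k) (\<alpha> k) m) - complex_of_real (h k ^ ?d) * (\<Sum>\<^sub>\<infinity>m. ?g k m))) \<le> E k" for k
  proof -
    have hd: "0 < h k ^ ?d" using h[of k] by simp
    have Ek: "E k = ennreal (h k ^ ?d) * (\<Sum>\<^sub>\<infinity>m. ennreal (norm (corr (U k) (\<alpha> k) m - ?g k m)))"
      unfolding E_def infsum_ennreal_cmult[symmetric] using hd by (simp add: ennreal_mult)
    then have "(\<Sum>\<^sub>\<infinity>m. ennreal (norm (corr (U k) (\<alpha> k) m - ?g k m))) < \<infinity>"
      using fin[of k] hd h[of k] by (auto simp: ennreal_mult_less_top)
    then have sd: "(\<lambda>m. corr (U k) (\<alpha> k) m - ?g k m) summable_on UNIV" by (rule summable_on_ennreal_bound)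
    have sg: "?g k summable_on UNIV"
    proof (rule summable_on_ennreal_bound)
      have "(\<Sum>\<^sub>\<infinity>m. ennreal (norm (?g k m))) \<le> (\<Sum>\<^sub>\<infinity>m. ?B * nsq (U k m))"
      proof (rule infsum_ennreal_mono)
        fix m
        have "ennreal (norm (\<Sum>\<^sub>\<infinity>j. \<alpha> k j m)) \<le> ?B"
          by (rule order_trans[OF norm_infsum_le_ennreal]) (intro infsum_ennreal_mono ennreal_leI \<alpha>)
        moreover have "ennreal (norm (?g k m)) = ennreal (norm (\<Sum>\<^sub>\<infinity>j. \<alpha> k j m)) * nsq (U k m)"
          unfolding norm_mult norm_of_real by (subst ennreal_mult[symmetric]) (auto simp: mult.commute)
        ultimately show "ennreal (norm (?g k m)) \<le> ?B * nsq (U k m)"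
          by (simp add: mult_right_mono)
      qed
      also have "\<dots> < \<infinity>"
      proof -
        have "(\<lambda>n. (norm (U k n))\<^sup>2) summable_on UNIV" using U by (simp add: lattice_L2_def)
        then show ?thesis using \<beta> by (simp add: infsum_ennreal_cmult infsum_ennreal_of_real ennreal_mult_less_top)
      qed
      finally show "(\<Sum>\<^sub>\<infinity>m. ennreal (norm (?g k m))) < \<infinity>" .
    qed
    have "(\<Sum>\<^sub>\<infinity>m. (corr (U k) (\<alpha> k) m - ?g k m) + ?g k m) = (\<Sum>\<^sub>\<infinity>m. corr (U k) (\<alpha> k) m - ?g k m) + (\<Sum>\<^sub>\<infinity>m. ?g k m)"
      by (rule infsum_add[OF sd sg])
    then have "complex_of_real (h k ^ ?d) * (\<Sum>\<^sub>\<infinity>m. corr (U k) (\<alpha> k) m) - complex_of_real (h k ^ ?d) * (\<Sum>\<^sub>\<infinity>m. ?g k m)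
      = complex_of_real (h k ^ ?d) * (\<Sum>\<^sub>\<infinity>m. corr (U k) (\<alpha> k) m - ?g k m)"
      by (simp add: algebra_simps)
    also have "ennreal (norm \<dots>) = ennreal (h k ^ ?d) * ennreal (norm (\<Sum>\<^sub>\<infinity>m. corr (U k) (\<alpha> k) m - ?g k m))"
      unfolding norm_mult norm_of_real using hd by (subst ennreal_mult[symmetric]) auto
    also have "\<dots> \<le> E k" unfolding Ek by (rule mult_left_mono[OF norm_infsum_le_ennreal]) simp
    finally show ?thesis .
  qed
  show ?thesis by (rule tendsto_0_norm_ennreal[OF E0 le])
qed

subsection \<open>Poisson summation along the sequence\<close>

lemma sigma_finite_count: "sigma_finite_measure (count_space (UNIV :: 'a::countable set))"
  by (rule sigma_finite_measure_count_space_countable) simp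

text \<open>Lebesgue measure is presented as an image of a product measure, which gives the tiling
  identity for complex integrals through Fubini; the version for nonnegative functions does not
  cover these.\<close>

lemma lborel_tiling_distr:
  defines "T \<equiv> \<lambda>z. fst z + dual (snd z) :: real ^ 'n::finite"
  shows "T \<in> borel_measurable (MQ \<Otimes>\<^sub>M count_space UNIV)" "lborel = distr (MQ \<Otimes>\<^sub>M count_space UNIV) borel T"
proof -
  interpret C: sigma_finite_measure "count_space (UNIV :: (int ^ 'n) set)" by (rule sigma_finite_count)
  show T[measurable]: "T \<in> borel_measurable (MQ \<Otimes>\<^sub>M count_space UNIV)"
  proof -
    have [measurable]: "fst \<in> borel_measurable (MQ \<Otimes>\<^sub>M count_space (UNIV :: (int ^ 'n) set))"
      using measurable_compose[OF measurable_fst measurable_MQ[OF measurable_ident]] by (simp add: comp_def)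
    show ?thesis unfolding T_def
      by (rule measurable_compose_countable[OF _ measurable_snd]) measurable
  qed
  show "lborel = distr (MQ \<Otimes>\<^sub>M count_space UNIV) borel T"
  proof (rule measure_eqI)
    fix A :: "(real ^ 'n) set" assume "A \<in> sets lborel"
    then have [measurable]: "A \<in> sets borel" by simp
    have "emeasure lborel A = (\<integral>\<^sup>+ x. indicator A x \<partial>lborel)" by simp
    also have "\<dots> = (\<integral>\<^sup>+ \<eta>. (\<Sum>\<^sub>\<infinity>k. indicator A (T (\<eta>, k))) \<partial>MQ)"
      unfolding T_def by (subst nn_integral_tiling) simp_all
    also have "\<dots> = (\<integral>\<^sup>+ z. indicator A (T z) \<partial>(MQ \<Otimes>\<^sub>M count_space UNIV))"
      unfolding infsum_ennreal_eq_nn_integral by (rule C.nn_integral_fst) measurable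
    also have "\<dots> = emeasure (distr (MQ \<Otimes>\<^sub>M count_space UNIV) borel T) A"
      by (subst nn_integral_distr[OF T, of "indicator A", symmetric]) simp_all
    finally show "emeasure lborel A = emeasure (distr (MQ \<Otimes>\<^sub>M count_space UNIV) borel T) A" .
  qed simp
qed

lemma integral_tiling:
  fixes F :: "real ^ 'n::finite \<Rightarrow> complex"
  assumes F: "integrable lborel F"
  shows "(LINT x|lborel. F x) = (LINT \<eta>|MQ. LINT n|count_space UNIV. F (\<eta> + dual n))"
proof -
  interpret C: sigma_finite_measure "count_space (UNIV :: (int ^ 'n) set)" by (rule sigma_finite_count)
  interpret Q: finite_measure "MQ :: (real ^ 'n) measure" by (rule finite_measure_MQ)
  interpret P: pair_sigma_finite "MQ :: (real ^ 'n) measure" "count_space (UNIV :: (int ^ 'n) set)" ..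
  let ?T = "\<lambda>z. fst z + dual (snd z) :: real ^ 'n"
  have Fm: "F \<in> borel_measurable borel" using F by auto
  have "integrable (MQ \<Otimes>\<^sub>M count_space UNIV) (\<lambda>z. F (?T z))"
    using F unfolding lborel_tiling_distr(2) by (subst (asm) integrable_distr_eq[OF lborel_tiling_distr(1) Fm])
  from P.integral_fst'[OF this] show ?thesis
    unfolding lborel_tiling_distr(2)[where 'n = 'n]
    by (subst integral_distr[OF lborel_tiling_distr(1) Fm]) simp
qed

section \<open>Periodisation of decaying functions\<close>

lemma dec_series_integrable:
  "integrable (count_space UNIV) (\<lambda>n. dec (\<eta> + dual n :: real ^ 'n::finite))"
proof (rule integrableI_bounded)
  obtain C where C: "\<And>\<eta> :: real ^ 'n. (\<Sum>\<^sub>\<infinity>k. ennreal (dec (\<eta> + dual k))) \<le> ennreal C"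
    using lattice_sum_bound by blast
  have "(\<integral>\<^sup>+ n. ennreal (norm (dec (\<eta> + dual n))) \<partial>count_space UNIV) \<le> ennreal C"
    using C[of \<eta>] by (simp add: infsum_ennreal_eq_nn_integral)
  then show "(\<integral>\<^sup>+ n. ennreal (norm (dec (\<eta> + dual n))) \<partial>count_space UNIV) < \<infinity>"
    by (rule le_less_trans) simp
qed simp

lemma dec_series_bounded:
  "\<exists>C\<ge>0. \<forall>\<eta> :: real ^ 'n::finite. (LINT n|count_space UNIV. dec (\<eta> + dual n)) \<le> C"
proof -
  obtain C where C: "C > 0" "\<And>\<eta> :: real ^ 'n. (\<Sum>\<^sub>\<infinity>k. ennreal (dec (\<eta> + dual k))) \<le> ennreal C"
    using lattice_sum_bound by blast
  have "(LINT n|count_space UNIV. dec (\<eta> + dual n)) \<le> C" for \<eta> :: "real ^ 'n"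
  proof -
    have "ennreal (LINT n|count_space UNIV. dec (\<eta> + dual n)) = (\<integral>\<^sup>+ n. ennreal (dec (\<eta> + dual n)) \<partial>count_space UNIV)"
      by (rule nn_integral_eq_integral[symmetric, OF dec_series_integrable]) simp
    then have "ennreal (LINT n|count_space UNIV. dec (\<eta> + dual n)) \<le> ennreal C"
      using C(2)[of \<eta>] unfolding infsum_ennreal_eq_nn_integral by (simp only:)
    then show ?thesis using C(1) by (simp only: ennreal_le_iff[OF less_imp_le[OF C(1)]])
  qed
  then show ?thesis using C(1) by (intro exI[of _ C]) auto
qed

text \<open>A Bochner integral over the counting measure is used for the series, so that dominated
  convergence and Fubini apply to it directly.\<close>

abbreviation periodized :: "(real ^ 'n::finite \<Rightarrow> complex) \<Rightarrow> real ^ 'n \<Rightarrow> complex" where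
  "periodized b \<eta> \<equiv> LINT n|count_space UNIV. b (\<eta> + dual n)"

lemma periodized_integrable:
  fixes b :: "real ^ 'n::finite \<Rightarrow> complex"
  assumes b: "\<And>\<xi>. norm (b \<xi>) \<le> K * dec \<xi>"
  shows "integrable (count_space UNIV) (\<lambda>n. b (\<eta> + dual n))"
  by (rule Bochner_Integration.integrable_bound[OF integrable_mult_right[OF dec_series_integrable[of \<eta>], of K]])
     (simp, unfold real_norm_def, rule AE_I2, rule order_trans[OF b abs_ge_self])

lemma periodized_bounded:
  fixes b :: "real ^ 'n::finite \<Rightarrow> complex"
  assumes b: "\<And>\<xi>. norm (b \<xi>) \<le> K * dec \<xi>"
  shows "\<exists>W\<ge>0. \<forall>\<eta>. norm (periodized b \<eta>) \<le> W"
proof -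
  have K: "0 \<le> K" by (rule dec_bound_nonneg, rule b)
  obtain C where C: "C \<ge> 0" "\<And>\<eta> :: real ^ 'n. (LINT n|count_space UNIV. dec (\<eta> + dual n)) \<le> C"
    using dec_series_bounded by blast
  have "norm (periodized b \<eta>) \<le> K * C" for \<eta>
  proof -
    have "norm (periodized b \<eta>) \<le> (LINT n|count_space UNIV. K * dec (\<eta> + dual n))"
      by (rule order_trans[OF integral_norm_bound integral_mono])
         (intro integrable_norm periodized_integrable[OF b] integrable_mult_right dec_series_integrable b)+
    also have "\<dots> = K * (LINT n|count_space UNIV. dec (\<eta> + dual n))" by (rule integral_mult_right_zero)
    also have "\<dots> \<le> K * C" by (rule mult_left_mono[OF C(2) K])
    finally show ?thesis .
  qed
  then show ?thesis using K C(1) by (intro exI[of _ "K * C"]) simp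
qed

lemma periodized_measurable:
  fixes b :: "real ^ 'n::finite \<Rightarrow> complex"
  assumes [measurable]: "b \<in> borel_measurable borel"
  shows "periodized b \<in> borel_measurable borel"
proof (rule sigma_finite_measure.borel_measurable_lebesgue_integral[OF sigma_finite_count])
  show "(\<lambda>(\<eta>, n). b (\<eta> + dual n)) \<in> borel_measurable (borel \<Otimes>\<^sub>M count_space UNIV)"
    unfolding case_prod_beta
    by (rule measurable_compose_countable[where f = "\<lambda>n z. b (fst z + dual n)"]) measurable
qed

text \<open>Along a convergent, hence bounded, sequence of base points the weights are comparable to
  those at base point 0, which gives a summable majorant.\<close>

lemma periodized_isCont:
  fixes b :: "real ^ 'n::finite \<Rightarrow> complex"
  assumes c: "continuous_on UNIV b" and b: "\<And>\<xi>. norm (b \<xi>) \<le> K * dec \<xi>"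
  shows "isCont (periodized b) 0"
  unfolding continuous_at_sequentially o_def
proof (intro allI impI)
  fix x :: "nat \<Rightarrow> real ^ 'n" assume x: "x \<longlonglongrightarrow> 0"
  have K: "0 \<le> K" by (rule dec_bound_nonneg, rule b)
  obtain M where M: "M > 0" "\<And>i. norm (x i) \<le> M"
    using convergent_imp_Bseq[OF convergentI[OF x]] by (auto simp: Bseq_def)
  show "(\<lambda>i. periodized b (x i)) \<longlonglongrightarrow> periodized b 0"
  proof (rule integral_dominated_convergence[where w = "\<lambda>n. (K * (1 + M) ^ (2 * CARD('n))) * dec (0 + dual n :: real ^ 'n)"])
    show "integrable (count_space UNIV) (\<lambda>n. (K * (1 + M) ^ (2 * CARD('n))) * dec (0 + dual n :: real ^ 'n))"
      by (intro integrable_mult_right dec_series_integrable)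
    show "AE n in count_space UNIV. (\<lambda>i. b (x i + dual n)) \<longlonglongrightarrow> b (0 + dual n)"
      using c by (intro AE_I2 isCont_tendsto_compose[of _ b] tendsto_intros x) (simp add: continuous_on_eq_continuous_at)
    show "AE n in count_space UNIV. norm (b (x i + dual n)) \<le> (K * (1 + M) ^ (2 * CARD('n))) * dec (0 + dual n :: real ^ 'n)" for i
    proof (rule AE_I2)
      fix n
      let ?y = "dual n :: real ^ 'n"
      have "norm ?y \<le> norm (x i + ?y) + norm (x i)" using norm_triangle_ineq4[of "x i + ?y" "x i"] by simp
      then have "1 + norm (0 + ?y) \<le> 1 + norm (x i + ?y) + M" using M(2)[of i] by simp
      also have "\<dots> \<le> (1 + M) * (1 + norm (x i + ?y))"
        unfolding distrib_left distrib_right using M(1) by simp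
      finally have "dec (x i + ?y) \<le> (1 + M) ^ (2 * CARD('n)) * dec (0 + ?y)" by (rule dec_compare)
      from mult_left_mono[OF this K] show "norm (b (x i + ?y)) \<le> (K * (1 + M) ^ (2 * CARD('n))) * dec (0 + ?y)"
        unfolding mult.assoc by (rule order_trans[OF b])
    qed
  qed simp_all
qed

text \<open>The frequency-side evaluation: folding turns b into its periodisation, a bounded
  function continuous at 0, and concentration of Uhat replaces it by the value there. Parseval
  identifies the mass in front.\<close>

lemma (in oscillating_sequence) spectral_tendsto:
  fixes b :: "real ^ 'n \<Rightarrow> complex"
  assumes c: "continuous_on UNIV b" and b: "\<And>\<xi>. norm (b \<xi>) \<le> K * dec \<xi>"
  shows "(\<lambda>k. complex_of_real (h k ^ CARD('n)) * (LINT \<xi>|lborel. lattice_fourier (U k) \<xi> * cnj (lattice_fourier (U k) \<xi>) * b \<xi>)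
    - complex_of_real ((2 * pi) ^ CARD('n) * (lattice_norm (h k) (U k))\<^sup>2) * periodized b 0) \<longlonglongrightarrow> 0"
proof -
  let ?d = "CARD('n)"
  let ?S = "periodized b"
  let ?w = "\<lambda>\<xi>. ennreal (norm (?S \<xi> - ?S 0))"
  have bm[measurable]: "b \<in> borel_measurable borel" by (rule borel_measurable_continuous_onI[OF c])
  note Sm[measurable] = periodized_measurable[OF bm]
  obtain W where W: "W \<ge> 0" "\<And>\<eta>. norm (?S \<eta>) \<le> W" using periodized_bounded[of b K] b by blast
  have lim: "(\<lambda>k. ennreal (h k ^ ?d) * (\<integral>\<^sup>+ \<eta>. nsq (lattice_fourier (U k) \<eta>) * ?w \<eta> \<partial>MQ)) \<longlonglongrightarrow> 0"
  proof (rule concentration)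
    show "?w \<xi> \<le> ennreal (2 * W)" for \<xi>
      using norm_triangle_ineq4[of "?S \<xi>" "?S 0"] W(2)[of \<xi>] W(2)[of 0] by (intro ennreal_leI) linarith
    fix \<delta> :: real assume "\<delta> > 0"
    moreover have "isCont (\<lambda>\<xi>. norm (?S \<xi> - ?S 0)) 0"
      by (intro continuous_intros periodized_isCont[OF c b])
    ultimately obtain r where "r > 0" "\<And>\<xi>. norm \<xi> < r \<Longrightarrow> norm (?S \<xi> - ?S 0) \<le> \<delta>"
      using isCont_le_near[of "\<lambda>\<xi>. norm (?S \<xi> - ?S 0)" \<delta>] by auto
    then show "\<exists>r>0. \<forall>\<xi>. norm \<xi> < r \<longrightarrow> ?w \<xi> \<le> ennreal \<delta>" by (auto intro: ennreal_leI)
  qed measurable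
  have le: "ennreal (norm (complex_of_real (h k ^ ?d) * (LINT \<xi>|lborel. lattice_fourier (U k) \<xi> * cnj (lattice_fourier (U k) \<xi>) * b \<xi>)
      - complex_of_real ((2 * pi) ^ ?d * (lattice_norm (h k) (U k))\<^sup>2) * ?S 0))
    \<le> ennreal (h k ^ ?d) * (\<integral>\<^sup>+ \<eta>. nsq (lattice_fourier (U k) \<eta>) * ?w \<eta> \<partial>MQ)" for k
  proof -
    let ?F = "lattice_fourier (U k)"
    let ?G = "\<lambda>\<xi>. ?F \<xi> * cnj (?F \<xi>)"
    note Fm[measurable] = lattice_fourier_measurable[OF U[of k]]
    have nG: "norm (?G \<xi>) = (norm (?F \<xi>))\<^sup>2" for \<xi> by (simp add: norm_mult power2_eq_square)
    have hd: "0 < h k ^ ?d" using h[of k] by simp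
    have L: "ennreal (h k ^ ?d) * L2sq MQ ?F = ennreal ((2 * pi) ^ ?d * (lattice_norm (h k) (U k))\<^sup>2)"
      by (rule L2sq_MQ_lattice[OF U h])
    have iF: "integrable MQ (\<lambda>\<xi>. (norm (?F \<xi>))\<^sup>2)"
      using lattice_fourier_L2[OF U[of k]] unfolding L2sq_def by (intro integrableI_bounded) auto
    have "L2sq MQ ?F = ennreal (LINT \<xi>|MQ. (norm (?F \<xi>))\<^sup>2)"
      unfolding L2sq_def by (rule nn_integral_eq_integral[OF iF]) simp
    then have mass: "h k ^ ?d * (LINT \<xi>|MQ. (norm (?F \<xi>))\<^sup>2) = (2 * pi) ^ ?d * (lattice_norm (h k) (U k))\<^sup>2"
      using L hd by (simp add: ennreal_mult[symmetric] ennreal_inj)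
    have iG: "integrable MQ (\<lambda>\<xi>. ?G \<xi> * Z \<xi>)" if [measurable]: "Z \<in> borel_measurable borel" and Z: "\<And>\<xi>. norm (Z \<xi>) \<le> W" for Z
    proof (rule Bochner_Integration.integrable_bound[OF integrable_mult_left[OF iF, of W]])
      show "AE \<xi> in MQ. norm (?G \<xi> * Z \<xi>) \<le> norm ((norm (?F \<xi>))\<^sup>2 * W)"
        using W(1) by (intro AE_I2) (simp add: norm_mult[of "?G _"] nG mult_left_mono[OF Z] del: norm_mult)
    qed measurable
    have int: "integrable lborel (\<lambda>\<xi>. ?G \<xi> * b \<xi>)"
    proof (rule integrableI_bounded)
      obtain D where D: "\<And>\<eta> :: real ^ 'n. (\<Sum>\<^sub>\<infinity>k. ennreal (dec (\<eta> + dual k))) \<le> ennreal D"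
        using lattice_sum_bound by blast
      have K: "0 \<le> K" by (rule dec_bound_nonneg, rule b)
      have "(\<integral>\<^sup>+ \<xi>. ennreal (norm (?G \<xi> * b \<xi>)) \<partial>lborel) \<le> (\<integral>\<^sup>+ \<xi>. nsq (?F \<xi>) * (ennreal K * ennreal (dec \<xi>)) \<partial>lborel)"
      proof (rule nn_integral_mono)
        fix \<xi>
        have "norm (?G \<xi> * b \<xi>) \<le> (norm (?F \<xi>))\<^sup>2 * (K * dec \<xi>)"
          unfolding norm_mult[of "?G _"] nG by (rule mult_left_mono[OF b]) simp
        then have "ennreal (norm (?G \<xi> * b \<xi>)) \<le> ennreal ((norm (?F \<xi>))\<^sup>2 * (K * dec \<xi>))" by (rule ennreal_leI)
        also have "\<dots> = nsq (?F \<xi>) * (ennreal K * ennreal (dec \<xi>))"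
          unfolding ennreal_mult[OF K less_imp_le[OF dec_pos], symmetric]
          by (rule ennreal_mult) (use K dec_pos[of \<xi>] in auto)
        finally show "ennreal (norm (?G \<xi> * b \<xi>)) \<le> nsq (?F \<xi>) * (ennreal K * ennreal (dec \<xi>))" .
      qed
      also have "\<dots> = (\<integral>\<^sup>+ \<eta>. nsq (?F \<eta>) * (ennreal K * (\<Sum>\<^sub>\<infinity>k. ennreal (dec (\<eta> + dual k)))) \<partial>MQ)"
        by (subst nn_integral_tiling, measurable) (simp only: lattice_fourier_periodic[OF U] infsum_ennreal_cmult)
      also have "\<dots> \<le> (\<integral>\<^sup>+ \<eta>. nsq (?F \<eta>) * (ennreal K * ennreal D) \<partial>MQ)"
        by (intro nn_integral_mono mult_left_mono D) simp_all
      also have "\<dots> = L2sq MQ ?F * (ennreal K * ennreal D)" unfolding L2sq_def by (rule nn_integral_multc) simp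
      also have "\<dots> < \<infinity>" using lattice_fourier_L2[OF U[of k]] by (simp add: ennreal_mult_less_top)
      finally show "(\<integral>\<^sup>+ \<xi>. ennreal (norm (?G \<xi> * b \<xi>)) \<partial>lborel) < \<infinity>" .
    qed measurable
    have 1: "(LINT \<xi>|lborel. ?G \<xi> * b \<xi>) = (LINT \<eta>|MQ. ?G \<eta> * ?S \<eta>)"
      unfolding integral_tiling[OF int] by (simp add: lattice_fourier_periodic[OF U])
    have 2: "complex_of_real ((2 * pi) ^ ?d * (lattice_norm (h k) (U k))\<^sup>2) * ?S 0 = complex_of_real (h k ^ ?d) * (LINT \<eta>|MQ. ?G \<eta> * ?S 0)"
    proof -
      have "(LINT \<eta>|MQ. ?G \<eta> * ?S 0) = (LINT \<eta>|MQ. complex_of_real ((norm (?F \<eta>))\<^sup>2)) * ?S 0"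
        unfolding complex_norm_square[symmetric] by (rule integral_mult_left_zero)
      also have "(LINT \<eta>|MQ. complex_of_real ((norm (?F \<eta>))\<^sup>2)) = complex_of_real (LINT \<eta>|MQ. (norm (?F \<eta>))\<^sup>2)"
        by (rule integral_complex_of_real)
      finally show ?thesis unfolding mass[symmetric] by (simp only: of_real_mult mult.assoc)
    qed
    have e0: "complex_of_real (h k ^ ?d) * (LINT \<xi>|lborel. ?G \<xi> * b \<xi>) - complex_of_real ((2 * pi) ^ ?d * (lattice_norm (h k) (U k))\<^sup>2) * ?S 0
      = complex_of_real (h k ^ ?d) * (LINT \<eta>|MQ. ?G \<eta> * ?S \<eta> - ?G \<eta> * ?S 0)"
    proof -
      have "(LINT \<eta>|MQ. ?G \<eta> * ?S \<eta> - ?G \<eta> * ?S 0) = (LINT \<eta>|MQ. ?G \<eta> * ?S \<eta>) - (LINT \<eta>|MQ. ?G \<eta> * ?S 0)"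
        by (intro Bochner_Integration.integral_diff iG W Sm borel_measurable_const)
      then show ?thesis unfolding 1 2 by (simp only: right_diff_distrib)
    qed
    have "ennreal (norm (complex_of_real (h k ^ ?d) * (LINT \<eta>|MQ. ?G \<eta> * ?S \<eta> - ?G \<eta> * ?S 0))) = ennreal (h k ^ ?d) * ennreal (norm (LINT \<eta>|MQ. ?G \<eta> * ?S \<eta> - ?G \<eta> * ?S 0))"
      unfolding norm_mult norm_of_real using hd by (subst ennreal_mult[symmetric]) auto
    also have "\<dots> \<le> ennreal (h k ^ ?d) * (\<integral>\<^sup>+ \<eta>. ennreal (norm (?G \<eta> * ?S \<eta> - ?G \<eta> * ?S 0)) \<partial>MQ)"
      by (intro mult_left_mono norm_integral_le_nn) auto
    also have "(\<integral>\<^sup>+ \<eta>. ennreal (norm (?G \<eta> * ?S \<eta> - ?G \<eta> * ?S 0)) \<partial>MQ) = (\<integral>\<^sup>+ \<eta>. nsq (?F \<eta>) * ?w \<eta> \<partial>MQ)"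
      unfolding right_diff_distrib[symmetric] norm_mult[of "?G _"] nG by (simp add: ennreal_mult)
    finally show ?thesis unfolding e0 .
  qed
  show ?thesis by (rule tendsto_0_norm_ennreal[OF lim le])
qed

text \<open>With the kernel given by samples of a Fourier transform at lattice offsets, the inner
  sum is the pairing of Uhat with b m times a character. This is the integral that occurs in the
  Wigner transform.\<close>

lemma corr_fourier:
  fixes U :: "int ^ 'n::finite \<Rightarrow> complex"
  assumes U: "U \<in> lattice_L2" and [measurable]: "b m \<in> borel_measurable borel" and b: "\<And>\<xi>. norm (b m \<xi>) \<le> K * dec \<xi>"
  shows "corr U (\<lambda>j m. fourier (b m) (latt j)) m = cnj (U m) * (LINT \<xi>|lborel. lattice_fourier U \<xi> * (cis (latt m \<bullet> \<xi>) * b m \<xi>))"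
proof -
  have e: "cis (- (latt n \<bullet> \<xi>)) * (cis (latt m \<bullet> \<xi>) * b m \<xi>) = b m \<xi> * cis (- (\<xi> \<bullet> latt (n - m)))" for n \<xi>
  proof -
    have "cis (- (latt n \<bullet> \<xi>)) * cis (latt m \<bullet> \<xi>) = cis (- (\<xi> \<bullet> latt (n - m)))"
      by (simp add: cis_mult latt_diff inner_diff_right inner_commute)
    then show ?thesis by (metis mult.assoc mult.commute)
  qed
  have "(\<lambda>n. U n * fourier (b m) (latt (n - m))) = (\<lambda>n. U n * (LINT \<xi>|lborel. cis (- (latt n \<bullet> \<xi>)) * (cis (latt m \<bullet> \<xi>) * b m \<xi>)))"
    unfolding fourier_def by (simp only: e)
  moreover have "((\<lambda>n. U n * (LINT \<xi>|lborel. cis (- (latt n \<bullet> \<xi>)) * (cis (latt m \<bullet> \<xi>) * b m \<xi>))) has_sum (LINT \<xi>|lborel. lattice_fourier U \<xi> * (cis (latt m \<bullet> \<xi>) * b m \<xi>))) UNIV"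
    by (rule pairing_decay(1)[OF U, where K = K]) (use b in \<open>simp_all add: norm_mult\<close>)
  ultimately show ?thesis unfolding corr_def by (simp add: infsumI)
qed

lemma schwartz_dec:
  fixes f :: "real ^ 'n::finite \<Rightarrow> complex"
  assumes "f \<in> schwartz"
  obtains K where "\<And>x. norm (f x) \<le> K * dec x"
  using schwartz_decay'[OF assms, of "2 * CARD('n)"] by (metis mult.right_neutral times_divide_eq_right)

lemma mass_infsum:
  fixes U :: "int ^ 'n::finite \<Rightarrow> complex"
  assumes "h > 0" "U \<in> lattice_L2"
  shows "complex_of_real (h ^ CARD('n)) * (\<Sum>\<^sub>\<infinity>m. complex_of_real ((norm (U m))\<^sup>2) * c) = complex_of_real ((lattice_norm h U)\<^sup>2) * c"
proof -
  have "(lattice_norm h U)\<^sup>2 = h ^ CARD('n) * (\<Sum>\<^sub>\<infinity>n. (norm (U n))\<^sup>2)"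
    unfolding lattice_norm_def using assms by (intro real_sqrt_pow2 mult_nonneg_nonneg infsum_nonneg) auto
  show ?thesis
  proof -
    have "((\<lambda>m. complex_of_real ((norm (U m))\<^sup>2)) has_sum complex_of_real (\<Sum>\<^sub>\<infinity>n. (norm (U n))\<^sup>2)) UNIV"
      using assms(2) unfolding has_sum_of_real_iff by (intro has_sum_infsum) (simp add: lattice_L2_def)
    then have "(\<Sum>\<^sub>\<infinity>m. complex_of_real ((norm (U m))\<^sup>2)) = complex_of_real (\<Sum>\<^sub>\<infinity>n. (norm (U n))\<^sup>2)"
      by (rule infsumI)
    then show ?thesis
      unfolding \<open>(lattice_norm h U)\<^sup>2 = _\<close> by (simp only: infsum_cmult_left' of_real_mult mult.assoc)
  qed
qed

text \<open>Poisson's formula is read off from the two limits of the same correlations, the one in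
  physical and the one in frequency space.\<close>

lemma (in oscillating_sequence) poisson_summation:
  fixes b :: "real ^ 'n \<Rightarrow> complex"
  assumes mass: "\<not> (\<lambda>k. (lattice_norm (h k) (U k))\<^sup>2) \<longlonglongrightarrow> 0" and bs: "b \<in> schwartz"
  shows "(\<Sum>\<^sub>\<infinity>j. fourier b (latt j)) = complex_of_real ((2 * pi) ^ CARD('n)) * periodized b 0"
proof -
  let ?d = "CARD('n)"
  let ?\<alpha> = "\<lambda>k j m. fourier b (latt j) :: complex"
  let ?P = "\<Sum>\<^sub>\<infinity>j. fourier b (latt j)"
  obtain K where K: "\<And>\<xi>. norm (b \<xi>) \<le> K * dec \<xi>" using schwartz_dec[OF bs] by blast
  obtain K' where K': "\<And>\<xi>. norm (fourier b \<xi>) \<le> K' * dec \<xi>" using schwartz_dec[OF fourier_schwartz[OF bs]] by blast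
  have bm: "b \<in> borel_measurable borel" by (rule schwartz_measurable[OF bs])
  have K'0: "0 \<le> K'" by (rule dec_bound_nonneg, rule K')
  have \<beta>: "(\<Sum>\<^sub>\<infinity>j. ennreal (K' * dec (latt j :: real ^ 'n))) < \<infinity>"
    unfolding ennreal_mult[OF K'0 less_imp_le[OF dec_pos]] infsum_ennreal_cmult
    using latt_dec_sum[where 'n = 'n] by (simp add: ennreal_mult_less_top)
  have "(\<Sum>\<^sub>\<infinity>m. corr (U k) (?\<alpha> k) m) = (LINT \<xi>|lborel. lattice_fourier (U k) \<xi> * cnj (lattice_fourier (U k) \<xi>) * b \<xi>)" for k
    using pairing_decay(2)[OF U bm K] unfolding corr_fourier[OF U, of "\<lambda>m. b", OF bm K]
    by (rule infsumI)
  then have 1: "(\<lambda>k. complex_of_real (h k ^ ?d) * (LINT \<xi>|lborel. lattice_fourier (U k) \<xi> * cnj (lattice_fourier (U k) \<xi>) * b \<xi>)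
      - complex_of_real ((lattice_norm (h k) (U k))\<^sup>2) * ?P) \<longlonglongrightarrow> 0"
    using corr_tendsto[OF K' \<beta>] by (simp only: mass_infsum[OF h U])
  \<comment> \<open>The two evaluations subtract to the mass times a constant, the discrepancy in
    Poisson's formula. As the masses do not tend to 0, this constant must vanish.\<close>
  have 2: "(\<lambda>k. complex_of_real ((lattice_norm (h k) (U k))\<^sup>2) * (?P - complex_of_real ((2 * pi) ^ ?d) * periodized b 0)) \<longlonglongrightarrow> 0"
    using tendsto_diff[OF spectral_tendsto[OF schwartz_continuous[OF bs] K] 1]
    by (simp add: algebra_simps)
  show ?thesis
  proof (rule ccontr)
    assume n: "?P \<noteq> complex_of_real ((2 * pi) ^ ?d) * periodized b 0"
    let ?c = "?P - complex_of_real ((2 * pi) ^ ?d) * periodized b 0"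
    have "(\<lambda>k. complex_of_real ((lattice_norm (h k) (U k))\<^sup>2) * ?c / ?c) \<longlonglongrightarrow> 0 / ?c"
      using n by (intro tendsto_divide 2 tendsto_const) auto
    then have "(\<lambda>k. complex_of_real ((lattice_norm (h k) (U k))\<^sup>2)) \<longlonglongrightarrow> complex_of_real 0" using n by simp
    then have "(\<lambda>k. (lattice_norm (h k) (U k))\<^sup>2) \<longlonglongrightarrow> 0" by (simp only: tendsto_of_real_iff)
    then show False using mass by simp
  qed
qed

subsection \<open>Slices of Schwartz functions\<close>

abbreviation slice :: "'a \<Rightarrow> ('a \<times> 'b \<Rightarrow> complex) \<Rightarrow> 'b \<Rightarrow> complex" where
  "slice x a \<equiv> \<lambda>\<xi>. a (x, \<xi>)"

lemma slice_has_derivative: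
  fixes a :: "'a::euclidean_space \<times> 'b::euclidean_space \<Rightarrow> complex"
  assumes "a \<in> schwartz"
  shows "(slice x a has_derivative (\<lambda>v. frechet_derivative a (at (x, \<xi>)) (0, v))) (at \<xi>)"
proof -
  have "((\<lambda>\<xi>. (x, \<xi>)) has_derivative (\<lambda>v. (0, v))) (at \<xi>)" by (auto intro!: derivative_eq_intros)
  from diff_chain_at[OF this schwartz_has_derivative[OF assms]] show ?thesis by (simp add: o_def)
qed

lemma slice_dirderiv:
  fixes a :: "'a::euclidean_space \<times> 'b::euclidean_space \<Rightarrow> complex"
  assumes "a \<in> schwartz"
  shows "dirderiv b (slice x a) = slice x (dirderiv (0, b) a)"
  unfolding dirderiv_def using frechet_derivative_at[OF slice_has_derivative[OF assms]] by metis

lemma slice_schwartz: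
  fixes a :: "'a::euclidean_space \<times> 'b::euclidean_space \<Rightarrow> complex"
  assumes a: "a \<in> schwartz"
  shows "slice x a \<in> schwartz"
proof -
  have "slice x a \<in> {slice x a | a. a \<in> schwartz}" using a by blast
  then show ?thesis
  proof (induction rule: schwartz_coinduct)
    case (decay g N)
    then obtain a where g: "g = slice x a" and a: "a \<in> schwartz" by blast
    obtain K where K: "\<And>z. (1 + norm z) ^ N * norm (a z) \<le> K" using schwartz_decay[OF a] by blast
    have "(1 + norm \<xi>) ^ N * norm (g \<xi>) \<le> K" for \<xi>
    proof -
      have "(1 + norm \<xi>) ^ N \<le> (1 + norm (x, \<xi>)) ^ N" using norm_snd_le[of "\<xi>" x] by (intro power_mono) auto
      then have "(1 + norm \<xi>) ^ N * norm (g \<xi>) \<le> (1 + norm (x, \<xi>)) ^ N * norm (a (x, \<xi>))"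
        unfolding g by (rule mult_right_mono) simp
      then show ?thesis using K order_trans by blast
    qed
    then show ?case by blast
  next
    case (step g)
    then obtain a where g: "g = slice x a" and a: "a \<in> schwartz" by blast
    show ?case
    proof (intro exI conjI allI ballI)
      show "(g has_derivative (\<lambda>v. frechet_derivative a (at (x, \<xi>)) (0, v))) (at \<xi>)" for \<xi>
        unfolding g by (rule slice_has_derivative[OF a])
      fix b :: 'b assume "b \<in> Basis"
      then have "(0, b) \<in> (Basis :: ('a \<times> 'b) set)" by (simp add: Basis_prod_def)
      then have "dirderiv (0, b) a \<in> schwartz" by (rule schwartz_dirderiv[OF a])
      moreover have "(\<lambda>\<xi>. frechet_derivative a (at (x, \<xi>)) (0, b)) = slice x (dirderiv (0, b) a)"
        by (simp only: dirderiv_def)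
      ultimately show "(\<lambda>\<xi>. frechet_derivative a (at (x, \<xi>)) (0, b)) \<in> {slice x a | a. a \<in> schwartz}"
        by (intro CollectI exI[of _ "dirderiv (0, b) a"] conjI)
    qed
  qed
qed

text \<open>Applying 1 - \<Delta> in the second variable to all slices at once yields the slices of
  one Schwartz function of both variables. The bounds derived from it are therefore uniform in
  x.\<close>

lemma slice_helmholtz:
  fixes a :: "'a::euclidean_space \<times> 'b::euclidean_space \<Rightarrow> complex"
  assumes a: "a \<in> schwartz"
  shows "\<exists>c\<in>schwartz. \<forall>x. (helmholtz ^^ N) (slice x a) = slice x c"
proof (induction N)
  case 0
  then show ?case using a by auto
next
  case (Suc N)
  then obtain c where c: "c \<in> schwartz" "\<And>x. (helmholtz ^^ N) (slice x a) = slice x c" by blast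
  have B: "(0, b) \<in> (Basis :: ('a \<times> 'b) set)" if "b \<in> Basis" for b :: 'b using that by (simp add: Basis_prod_def)
  let ?c = "\<lambda>z. c z + (-1) * (\<Sum>b\<in>Basis. dirderiv (0, b) (dirderiv (0, b) c) z)"
  have "?c \<in> schwartz" by (intro schwartz_add schwartz_cmult schwartz_sum schwartz_dirderiv c(1) B)
  moreover have "dirderiv b (dirderiv b (slice x c)) = slice x (dirderiv (0, b) (dirderiv (0, b) c))" if "b \<in> Basis" for b x
    unfolding slice_dirderiv[OF c(1)] by (rule slice_dirderiv[OF schwartz_dirderiv[OF c(1) B[OF that]]])
  then have "(helmholtz ^^ Suc N) (slice x a) = slice x ?c" for x
    by (auto simp: c(2) helmholtz_def fun_eq_iff cong: sum.cong)
  ultimately show ?case by (intro bexI[of _ ?c] allI)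
qed

text \<open>Decay of order 2d + 1 in the pair is distributed: one power for x, which gives decay of
  the periodised slices at infinity, and 2d powers for \<xi>, which give summability over the
  lattice.\<close>

lemma schwartz_prod_dec:
  fixes a :: "(real ^ 'n::finite) \<times> (real ^ 'n) \<Rightarrow> complex"
  assumes a: "a \<in> schwartz"
  obtains K where "K \<ge> 0" "\<And>x \<xi>. norm (a (x, \<xi>)) \<le> K / (1 + norm x) * dec \<xi>"
proof -
  let ?N = "2 * CARD('n)"
  obtain K where K: "K > 0" "\<And>z. norm (a z) \<le> K / (1 + norm z) ^ (Suc ?N)" using schwartz_decay'[OF a] by metis
  have "norm (a (x, \<xi>)) \<le> K / (1 + norm x) * dec \<xi>" for x \<xi>
  proof -
    have "(1 + norm x) * (1 + norm \<xi>) ^ ?N \<le> (1 + norm (x, \<xi>)) * (1 + norm (x, \<xi>)) ^ ?N"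
      using norm_fst_le[of x \<xi>] norm_snd_le[of \<xi> x] by (intro mult_mono power_mono) auto
    moreover have "0 < (1 + norm x) * (1 + norm \<xi>) ^ ?N" using one_plus_norm_pos[of x] one_plus_norm_pos[of \<xi>] by simp
    ultimately have "K / (1 + norm (x, \<xi>)) ^ (Suc ?N) \<le> K / ((1 + norm x) * (1 + norm \<xi>) ^ ?N)"
      using K(1) by (intro divide_left_mono mult_pos_pos) (auto simp: power_Suc intro!: zero_less_power one_plus_norm_pos)
    then show ?thesis using K(2)[of "(x, \<xi>)"] by simp
  qed
  then show ?thesis using K(1) that[of K] by auto
qed

lemma schwartz_prod_dec':
  fixes a :: "(real ^ 'n::finite) \<times> (real ^ 'n) \<Rightarrow> complex"
  assumes a: "a \<in> schwartz"
  obtains K where "K \<ge> 0" "\<And>x \<xi>. norm (a (x, \<xi>)) \<le> K * dec \<xi>"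
proof -
  obtain K where K: "K \<ge> 0" "\<And>x \<xi>. norm (a (x, \<xi>)) \<le> K / (1 + norm x) * dec \<xi>" using schwartz_prod_dec[OF a] by blast
  have "K / (1 + norm x) * dec \<xi> \<le> K * dec \<xi>" for x \<xi> :: "real ^ 'n"
  proof (rule mult_right_mono)
    show "K / (1 + norm x) \<le> K" using K(1) one_plus_norm_pos[of x] by (simp add: divide_le_eq distrib_left)
  qed simp
  then show ?thesis using K that[of K] order_trans by blast
qed

lemma slice_fourier_bound:
  fixes a :: "(real ^ 'n::finite) \<times> (real ^ 'n) \<Rightarrow> complex"
  assumes a: "a \<in> schwartz"
  obtains K where "K \<ge> 0" "\<And>x \<zeta>. norm (fourier (slice x a) \<zeta>) \<le> K * dec \<zeta>"
proof -
  let ?N = "2 * CARD('n)"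
  obtain c where c: "c \<in> schwartz" "\<And>x. (helmholtz ^^ ?N) (slice x a) = slice x c" using slice_helmholtz[OF a] by blast
  obtain K where K: "K \<ge> 0" "\<And>x \<xi>. norm (c (x, \<xi>)) \<le> K * dec \<xi>" using schwartz_prod_dec'[OF c(1)] by blast
  let ?J = "LINT \<xi>|lborel. dec (\<xi> :: real ^ 'n)"
  have "norm (fourier (slice x a) \<zeta>) \<le> (2 ^ ?N * (K * ?J)) * dec \<zeta>" for x \<zeta>
  proof -
    have "(1 + norm \<zeta>) ^ ?N * norm (fourier (slice x a) \<zeta>) \<le> (2 ^ ?N * (1 + (norm \<zeta>)\<^sup>2) ^ ?N) * norm (fourier (slice x a) \<zeta>)"
      by (rule mult_right_mono[OF one_plus_norm_power_le]) simp
    also have "\<dots> \<le> 2 ^ ?N * (LINT \<xi>|lborel. norm (c (x, \<xi>)))"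
      unfolding mult.assoc using fourier_decay[OF slice_schwartz[OF a], where N = ?N] by (intro mult_left_mono) (simp_all add: c(2))
    also have "(LINT \<xi>|lborel. norm (c (x, \<xi>))) \<le> (LINT \<xi>|lborel. K * dec (\<xi> :: real ^ 'n))"
    proof (rule integral_mono)
      show "integrable lborel (\<lambda>\<xi>. norm (c (x, \<xi>)))" by (rule integrable_norm[OF schwartz_integrable[OF slice_schwartz[OF c(1)]]])
      show "integrable lborel (\<lambda>\<xi> :: real ^ 'n. K * dec \<xi>)" by (rule integrable_mult_right[OF dec_integrable])
    qed (rule K(2))
    also have "\<dots> = K * ?J" by (rule integral_mult_right_zero)
    finally have "(1 + norm \<zeta>) ^ ?N * norm (fourier (slice x a) \<zeta>) \<le> 2 ^ ?N * (K * ?J)" by simp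
    then show ?thesis using zero_less_power[OF one_plus_norm_pos[of \<zeta>], of ?N] by (simp add: le_divide_eq mult.commute)
  qed
  moreover have "0 \<le> ?J" by simp
  ultimately show ?thesis using K(1) that[of "2 ^ ?N * (K * ?J)"] by (simp del: integral_nonneg_AE)
qed

subsection \<open>Bounded sequences of measures\<close>

text \<open>Cutoffs bound the limit on each ball by the masses of the approximating measures, and
  balls exhaust the space.\<close>

lemma weak_limit_bounded:
  fixes M :: "nat \<Rightarrow> 'a::euclidean_space measure"
  assumes w: "weakly_converges M \<nu>" and bd: "\<And>k. emeasure (M k) UNIV \<le> ennreal C"
  shows "emeasure \<nu> UNIV \<le> ennreal C"
proof -
  have s: "sets (M k) = sets borel" "sets \<nu> = sets borel" for k using w by (auto simp: weakly_converges_def radon_measure_def)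
  have sp: "space (M k) = UNIV" "space \<nu> = UNIV" for k using sets_eq_imp_space_eq[OF s(1)[of k]] sets_eq_imp_space_eq[OF s(2)] by auto
  have "emeasure \<nu> (cball 0 (real n)) \<le> ennreal C" for n
  proof -
    let ?f = "\<lambda>x :: 'a. max 0 (min 1 (real n + 1 - norm x))"
    note cf = cutoff[where R = "real n" and 'a = 'a]
    have "emeasure \<nu> (cball 0 (real n)) = (\<integral>\<^sup>+ x. indicator (cball 0 (real n)) x \<partial>\<nu>)" using s(2) by simp
    also have "\<dots> \<le> (\<integral>\<^sup>+ x. ennreal (?f x) \<partial>\<nu>)"
    proof (rule nn_integral_mono)
      fix x :: 'a
      show "indicator (cball 0 (real n)) x \<le> ennreal (?f x)" using cf(5)[of x] by (auto split: split_indicator)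
    qed
    also have "\<dots> \<le> ennreal C"
      unfolding weakly_converges_nonneg(2)[OF w cf(1-3)]
    proof (rule LIMSEQ_le_const2[OF weakly_converges_nonneg(1)[OF w cf(1-3)]], intro exI allI impI)
      fix k
      have "(\<integral>\<^sup>+ x. ennreal (?f x) \<partial>M k) \<le> (\<integral>\<^sup>+ x. 1 \<partial>M k)" using cf(4) by (intro nn_integral_mono) (simp add: ennreal_le_1)
      then show "(\<integral>\<^sup>+ x. ennreal (?f x) \<partial>M k) \<le> ennreal C" using bd[of k] by (simp add: sp)
    qed
    finally show ?thesis .
  qed
  moreover have "(SUP n. emeasure \<nu> (cball 0 (real n))) = emeasure \<nu> (\<Union>n. cball 0 (real n))"
    by (rule SUP_emeasure_incseq) (auto simp: incseq_def s)
  moreover have "(\<Union>n. cball (0 :: 'a) (real n)) = UNIV" using real_arch_simple by auto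
  ultimately show ?thesis by (metis SUP_least)
qed

text \<open>Uniformly bounded masses extend weak convergence from compactly supported functions to
  continuous functions that vanish at infinity. This is required because periodised slices of a
  Schwartz function are not compactly supported in x.\<close>

lemma weakly_converges_vanishing:
  fixes M :: "nat \<Rightarrow> 'a::euclidean_space measure" and f :: "'a \<Rightarrow> real"
  assumes w: "weakly_converges M \<nu>" and bd: "\<And>k. emeasure (M k) UNIV \<le> ennreal C"
    and f: "continuous_on UNIV f" and K: "\<And>x. \<bar>f x\<bar> \<le> K / (1 + norm x)"
  shows "(\<lambda>k. LINT x|M k. f x) \<longlonglongrightarrow> (LINT x|\<nu>. f x)"
proof -
  have s: "sets (M k) = sets borel" "sets \<nu> = sets borel" for k using w by (auto simp: weakly_converges_def radon_measure_def)
  have K0: "0 \<le> K" using order_trans[OF abs_ge_zero K[of 0]] by simp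
  have [measurable]: "f \<in> borel_measurable borel" by (rule borel_measurable_continuous_onI[OF f])
  let ?c = "\<lambda>R x :: 'a. max 0 (min 1 (R + 1 - norm x))"
  have est: "\<bar>(LINT x|N. f x) - (LINT x|N. ?c R x * f x)\<bar> \<le> \<bar>C\<bar> * (K / (1 + R))"
    if N: "sets N = sets borel" "emeasure N UNIV \<le> ennreal C" and R: "R \<ge> 0" for N R
  proof -
    note [measurable_cong] = N(1)
    have spN: "space N = UNIV" using sets_eq_imp_space_eq[OF N(1)] by simp
    interpret finite_measure N
      by standard (use N(2) in \<open>auto simp: spN top_unique\<close>)
    have cm[measurable]: "?c R \<in> borel_measurable borel" by (rule borel_measurable_continuous_onI[OF cutoff(1)])
    have Kb: "K / (1 + norm x) \<le> K" for x :: 'a using K0 one_plus_norm_pos[of x] by (simp add: divide_le_eq distrib_left)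
    have fb: "\<bar>f x\<bar> \<le> K" for x using order_trans[OF K Kb] .
    have c1: "\<bar>?c R x\<bar> \<le> 1" for x by auto
    have cf: "\<bar>?c R x * f x\<bar> \<le> K" for x
      using mult_mono[OF c1[of x] fb[of x]] unfolding abs_mult by simp
    have i1: "integrable N f" by (rule integrable_const_bound[where B = K]) (auto simp: fb)
    have i2: "integrable N (\<lambda>x. ?c R x * f x)"
      by (rule integrable_const_bound[where B = K]) (simp only: real_norm_def cf, simp, measurable)
    have "(LINT x|N. f x) - (LINT x|N. ?c R x * f x) = (LINT x|N. f x - ?c R x * f x)"
      by (rule Bochner_Integration.integral_diff[symmetric, OF i1 i2])
    also have "\<bar>\<dots>\<bar> \<le> (LINT x|N. \<bar>f x - ?c R x * f x\<bar>)" by (rule integral_abs_bound)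
    also have "\<dots> \<le> (LINT x|N. K / (1 + R))"
    proof (rule integral_mono)
      show "integrable N (\<lambda>x. \<bar>f x - ?c R x * f x\<bar>)" using i1 i2 by simp
      fix x
      show "\<bar>f x - ?c R x * f x\<bar> \<le> K / (1 + R)"
      proof (cases "norm x \<le> R")
        case True
        then show ?thesis using K0 R by (simp add: cutoff(5)[OF True])
      next
        case False
        have "\<bar>f x - ?c R x * f x\<bar> = \<bar>1 - ?c R x\<bar> * \<bar>f x\<bar>" unfolding abs_mult[symmetric] by (simp add: left_diff_distrib)
        also have "\<dots> \<le> 1 * \<bar>f x\<bar>" using cutoff(3,4)[where R = R and x = x] by (intro mult_right_mono) auto
        also have "\<dots> \<le> K / (1 + norm x)" using K[of x] by simp
        also have "\<dots> \<le> K / (1 + R)" using False R K0 by (intro divide_left_mono mult_pos_pos) auto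
        finally show ?thesis .
      qed
    qed simp
    also have "\<dots> = measure N UNIV * (K / (1 + R))" by (simp add: spN)
    also have "\<dots> \<le> \<bar>C\<bar> * (K / (1 + R))"
    proof (rule mult_right_mono)
      have "emeasure N UNIV \<le> ennreal \<bar>C\<bar>" by (rule order_trans[OF N(2) ennreal_leI]) simp
      then show "measure N UNIV \<le> \<bar>C\<bar>" unfolding emeasure_eq_measure by (subst (asm) ennreal_le_iff) auto
    qed (use K0 R in simp)
    finally show ?thesis .
  qed
  show ?thesis
  proof (rule LIMSEQ_I)
    fix e :: real assume e: "0 < e"
    \<comment> \<open>The radius beyond which the cut-off part contributes less than e/3, both for
      the measures of the sequence and for the limit.\<close>
    define R where "R = 3 * \<bar>C\<bar> * K / e"
    have R0: "R \<ge> 0" unfolding R_def using K0 e by simp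
    have Re: "\<bar>C\<bar> * (K / (1 + R)) < e / 3"
    proof -
      have "3 * (\<bar>C\<bar> * K) = R * e" unfolding R_def using e by simp
      then have "3 * (\<bar>C\<bar> * K) < (1 + R) * e" using e by (simp add: distrib_right)
      then show ?thesis using R0 by (simp add: field_simps)
    qed
    have "continuous_on UNIV (\<lambda>x. ?c R x * f x)" by (intro continuous_on_mult cutoff(1) f)
    moreover have "compact (closure {x. ?c R x * f x \<noteq> 0})"
    proof -
      have "closure {x. ?c R x * f x \<noteq> 0} \<subseteq> closure {x. ?c R x \<noteq> 0}" by (rule closure_mono) auto
      then have "closure {x. ?c R x \<noteq> 0} \<inter> closure {x. ?c R x * f x \<noteq> 0} = closure {x. ?c R x * f x \<noteq> 0}" by (rule Int_absorb1)
      then show ?thesis using compact_Int_closed[OF cutoff(2)[where R = R] closed_closure, of "{x. ?c R x * f x \<noteq> 0}"] by simp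
    qed
    ultimately have "(\<lambda>k. LINT x|M k. ?c R x * f x) \<longlonglongrightarrow> (LINT x|\<nu>. ?c R x * f x)"
      using w by (simp add: weakly_converges_def)
    from LIMSEQ_D[OF this, of "e / 3"] e obtain k0 where k0: "\<And>k. k \<ge> k0 \<Longrightarrow> \<bar>(LINT x|M k. ?c R x * f x) - (LINT x|\<nu>. ?c R x * f x)\<bar> < e / 3"
      by auto
    have "norm ((LINT x|M k. f x) - (LINT x|\<nu>. f x)) < e" if "k \<ge> k0" for k
      using est[OF s(1) bd R0, of k] est[OF s(2) weak_limit_bounded[OF w bd] R0] k0[OF that] Re
      unfolding real_norm_def by linarith
    then show "\<exists>k0. \<forall>k\<ge>k0. norm ((LINT x|M k. f x) - (LINT x|\<nu>. f x)) < e" by blast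
  qed
qed

subsection \<open>Wigner measures\<close>

lemma integral_energy_measure:
  fixes U :: "int ^ 'n::finite \<Rightarrow> complex" and f :: "real ^ 'n \<Rightarrow> complex"
  assumes h: "h > 0" and U: "U \<in> lattice_L2" and [measurable]: "f \<in> borel_measurable borel" and B: "\<And>x. norm (f x) \<le> B"
  shows "(LINT x|energy_measure h U. f x) = complex_of_real (h ^ CARD('n)) * (\<Sum>\<^sub>\<infinity>m. complex_of_real ((norm (U m))\<^sup>2) * f (h *\<^sub>R latt m))"
proof -
  let ?d = "CARD('n)"
  have hd: "0 \<le> h ^ ?d" using h by simp
  have "(LINT x|energy_measure h U. f x) = (LINT m|count_space UNIV. (h ^ ?d * (norm (U m))\<^sup>2) *\<^sub>R f (h *\<^sub>R latt m))"
    unfolding energy_measure_def using hd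
    by (subst integral_distr, simp, measurable, subst integral_density) auto
  also have "\<dots> = (\<Sum>\<^sub>\<infinity>m. (h ^ ?d * (norm (U m))\<^sup>2) *\<^sub>R f (h *\<^sub>R latt m))"
  proof (rule infsum_eq_LINT(1)[symmetric])
    have "(\<Sum>\<^sub>\<infinity>m. ennreal (norm ((h ^ ?d * (norm (U m))\<^sup>2) *\<^sub>R f (h *\<^sub>R latt m)))) \<le> (\<Sum>\<^sub>\<infinity>m. ennreal B * ennreal (h ^ ?d * (norm (U m))\<^sup>2))"
    proof (rule infsum_ennreal_mono)
      fix m
      have w: "0 \<le> h ^ ?d * (norm (U m))\<^sup>2" using hd by simp
      have "norm ((h ^ ?d * (norm (U m))\<^sup>2) *\<^sub>R f (h *\<^sub>R latt m)) \<le> B * (h ^ ?d * (norm (U m))\<^sup>2)"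
        unfolding norm_scaleR abs_of_nonneg[OF w] by (subst mult.commute) (rule mult_right_mono[OF B w])
      then show "ennreal (norm ((h ^ ?d * (norm (U m))\<^sup>2) *\<^sub>R f (h *\<^sub>R latt m))) \<le> ennreal B * ennreal (h ^ ?d * (norm (U m))\<^sup>2)"
        unfolding ennreal_mult[OF order_trans[OF norm_ge_zero B] w, symmetric] by (rule ennreal_leI)
    qed
    also have "\<dots> < \<infinity>"
      unfolding infsum_ennreal_cmult lattice_L2_infsum[OF U h] by (simp add: ennreal_mult_less_top)
    finally show "(\<Sum>\<^sub>\<infinity>m. ennreal (norm ((h ^ ?d * (norm (U m))\<^sup>2) *\<^sub>R f (h *\<^sub>R latt m)))) < \<infinity>" .
  qed
  also have "\<dots> = (\<Sum>\<^sub>\<infinity>m. complex_of_real (h ^ ?d) * (complex_of_real ((norm (U m))\<^sup>2) * f (h *\<^sub>R latt m)))"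
    by (simp only: scaleR_conv_of_real of_real_mult mult.assoc)
  also have "\<dots> = complex_of_real (h ^ ?d) * (\<Sum>\<^sub>\<infinity>m. complex_of_real ((norm (U m))\<^sup>2) * f (h *\<^sub>R latt m))"
    by (rule infsum_cmult_right')
  finally show ?thesis .
qed

text \<open>For \<epsilon> = h the dilation by h/\<epsilon> is the identity and the prefactor
  reduces to h^d / (2\<pi>)^d. Each term is then a correlation whose kernel samples the transform of
  the slice at hm.\<close>

lemma wigner_transform_corr:
  fixes U :: "int ^ 'n::finite \<Rightarrow> complex"
  assumes h: "h > 0" and U: "U \<in> lattice_L2" and a: "a \<in> schwartz"
  shows "wigner_transform h h U a = complex_of_real (1 / (2 * pi) ^ CARD('n)) *
    (complex_of_real (h ^ CARD('n)) * (\<Sum>\<^sub>\<infinity>m. corr U (\<lambda>j m. fourier (slice (h *\<^sub>R latt m) a) (latt j)) m))"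
proof -
  let ?d = "CARD('n)"
  obtain K where "K \<ge> 0" and K: "\<And>x \<xi>. norm (a (x, \<xi>)) \<le> K * dec \<xi>" using schwartz_prod_dec'[OF a] by blast
  have c: "h ^ (2 * ?d) / (2 * pi * h) ^ ?d = 1 / (2 * pi) ^ ?d * h ^ ?d"
  proof -
    have "h ^ (2 * ?d) = h ^ ?d * h ^ ?d" by (simp only: mult_2 power_add)
    then show ?thesis unfolding power_mult_distrib[of "2 * pi" h] using h by simp
  qed
  have "(LINT \<xi>|lborel. cnj (U m) * lattice_fourier U ((h / h) *\<^sub>R \<xi>) * cis ((h / h) * (latt m \<bullet> \<xi>)) * a (h *\<^sub>R latt m, \<xi>))
    = corr U (\<lambda>j m. fourier (slice (h *\<^sub>R latt m) a) (latt j)) m" for m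
  proof -
    have "(LINT \<xi>|lborel. cnj (U m) * lattice_fourier U ((h / h) *\<^sub>R \<xi>) * cis ((h / h) * (latt m \<bullet> \<xi>)) * a (h *\<^sub>R latt m, \<xi>))
      = (LINT \<xi>|lborel. cnj (U m) * (lattice_fourier U \<xi> * (cis (latt m \<bullet> \<xi>) * a (h *\<^sub>R latt m, \<xi>))))"
      using h by (simp add: mult.assoc)
    also have "\<dots> = cnj (U m) * (LINT \<xi>|lborel. lattice_fourier U \<xi> * (cis (latt m \<bullet> \<xi>) * a (h *\<^sub>R latt m, \<xi>)))"
      by (rule integral_mult_right_zero)
    also have "\<dots> = corr U (\<lambda>j m. fourier (slice (h *\<^sub>R latt m) a) (latt j)) m"
      by (rule corr_fourier[OF U, where b = "\<lambda>m. slice (h *\<^sub>R latt m) a" and K = K, symmetric])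
         (rule schwartz_measurable[OF slice_schwartz[OF a]], rule K)
    finally show ?thesis .
  qed
  then show ?thesis unfolding wigner_transform_def c by (simp only: of_real_mult mult.assoc)
qed

text \<open>These are the properties that \<open>weakly_converges_vanishing\<close> requires of the
  function x \<mapsto> sum of a(x, 2\<pi>n) over n, which is integrated against the energy
  measures.\<close>

lemma lattice_restriction:
  fixes a :: "(real ^ 'n::finite) \<times> (real ^ 'n) \<Rightarrow> complex"
  assumes a: "a \<in> schwartz"
  shows "continuous_on UNIV (\<lambda>x. periodized (slice x a) 0)" "\<exists>K\<ge>0. \<forall>x. norm (periodized (slice x a) 0) \<le> K / (1 + norm x)"
proof -
  have ac: "isCont a z" for z using schwartz_continuous[OF a] by (metis UNIV_I continuous_on_eq_continuous_at open_UNIV)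
  obtain K where K: "K \<ge> 0" "\<And>x \<xi>. norm (a (x, \<xi>)) \<le> K * dec \<xi>" using schwartz_prod_dec'[OF a] by blast
  have "isCont (\<lambda>x. periodized (slice x a) 0) x" for x
    unfolding continuous_at_sequentially o_def
  proof (intro allI impI)
    fix y assume y: "y \<longlonglongrightarrow> x"
    show "(\<lambda>i. periodized (slice (y i) a) 0) \<longlonglongrightarrow> periodized (slice x a) 0"
    proof (rule integral_dominated_convergence[where w = "\<lambda>n. K * dec (0 + dual n :: real ^ 'n)"])
      show "integrable (count_space UNIV) (\<lambda>n. K * dec (0 + dual n :: real ^ 'n))"
        by (intro integrable_mult_right dec_series_integrable)
      show "AE n in count_space UNIV. (\<lambda>i. a (y i, 0 + dual n)) \<longlonglongrightarrow> a (x, 0 + dual n)"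
        by (intro AE_I2 isCont_tendsto_compose[OF ac] tendsto_intros y)
    qed (simp, simp, rule AE_I2, rule K(2))
  qed
  then show "continuous_on UNIV (\<lambda>x. periodized (slice x a) 0)" by (simp add: continuous_on_eq_continuous_at)
  obtain K' where K': "K' \<ge> 0" "\<And>x \<xi>. norm (a (x, \<xi>)) \<le> K' / (1 + norm x) * dec \<xi>" using schwartz_prod_dec[OF a] by blast
  obtain C where C: "C \<ge> 0" "\<And>\<eta> :: real ^ 'n. (LINT n|count_space UNIV. dec (\<eta> + dual n)) \<le> C"
    using dec_series_bounded by blast
  have "norm (periodized (slice x a) 0) \<le> (K' * C) / (1 + norm x)" for x
  proof -
    let ?k = "K' / (1 + norm x)"
    have k0: "0 \<le> ?k" using K'(1) one_plus_norm_pos[of x] by simp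
    have "norm (periodized (slice x a) 0) \<le> (LINT n|count_space UNIV. ?k * dec (0 + dual n :: real ^ 'n))"
      by (rule order_trans[OF integral_norm_bound integral_mono])
         (intro integrable_norm periodized_integrable[where K = ?k] integrable_mult_right dec_series_integrable K'(2))+
    also have "\<dots> = ?k * (LINT n|count_space UNIV. dec (0 + dual n :: real ^ 'n))"
      by (rule integral_mult_right_zero)
    also have "\<dots> \<le> ?k * C" by (rule mult_left_mono[OF C(2) k0])
    finally show ?thesis by simp
  qed
  then show "\<exists>K\<ge>0. \<forall>x. norm (periodized (slice x a) 0) \<le> K / (1 + norm x)"
    using K'(1) C(1) by (intro exI[of _ "K' * C"]) simp
qed

text \<open>By slow variation the correlation is asymptotically diagonal with the sum of the kernel
  as its factor, Poisson summation evaluates that sum as (2\<pi>)^d times the periodised slice at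
  hm, and what remains is an integral against the energy measure.\<close>

lemma (in oscillating_sequence) wigner_limit:
  assumes mass: "\<not> (\<lambda>k. (lattice_norm (h k) (U k))\<^sup>2) \<longlonglongrightarrow> 0"
    and w: "weakly_converges (\<lambda>k. energy_measure (h k) (U k)) \<nu>" and bd: "\<And>k. emeasure (energy_measure (h k) (U k)) UNIV \<le> ennreal C'"
    and a: "a \<in> schwartz"
  shows "(\<lambda>k. wigner_transform (h k) (h k) (U k) a) \<longlonglongrightarrow> (LINT x|\<nu>. periodized (slice x a) 0)"
proof -
  let ?d = "CARD('n)"
  let ?P = "(2 * pi) ^ ?d"
  let ?\<alpha> = "\<lambda>k j m. fourier (slice (h k *\<^sub>R latt m) a) (latt j)"
  let ?\<Theta> = "\<lambda>x. periodized (slice x a) 0"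
  let ?I = "\<lambda>k. LINT x|energy_measure (h k) (U k). ?\<Theta> x"
  obtain K where K: "K \<ge> 0" "\<And>x. norm (?\<Theta> x) \<le> K / (1 + norm x)" using lattice_restriction(2)[OF a] by blast
  obtain K' where K': "K' \<ge> 0" "\<And>x \<zeta>. norm (fourier (slice x a) \<zeta>) \<le> K' * dec \<zeta>" using slice_fourier_bound[OF a] by blast
  note cont = lattice_restriction(1)[OF a]
  have \<Theta>m[measurable]: "?\<Theta> \<in> borel_measurable borel" by (rule borel_measurable_continuous_onI[OF cont])
  have Kb: "K / (1 + norm x) \<le> K" for x :: "real ^ 'n" using K(1) one_plus_norm_pos[of x] by (simp add: divide_le_eq distrib_left)
  have \<Theta>b: "norm (?\<Theta> x) \<le> K" for x using order_trans[OF K(2) Kb] .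
  have \<beta>: "(\<Sum>\<^sub>\<infinity>j. ennreal (K' * dec (latt j :: real ^ 'n))) < \<infinity>"
    unfolding ennreal_mult[OF K'(1) less_imp_le[OF dec_pos]] infsum_ennreal_cmult
    using latt_dec_sum[where 'n = 'n] by (simp add: ennreal_mult_less_top)
  have "(\<Sum>\<^sub>\<infinity>j. ?\<alpha> k j m) = complex_of_real ?P * ?\<Theta> (h k *\<^sub>R latt m)" for k m
    by (rule poisson_summation[OF mass slice_schwartz[OF a]])
  then have "complex_of_real (h k ^ ?d) * (\<Sum>\<^sub>\<infinity>m. complex_of_real ((norm (U k m))\<^sup>2) * (\<Sum>\<^sub>\<infinity>j. ?\<alpha> k j m)) = complex_of_real ?P * ?I k" for k
    unfolding integral_energy_measure[OF h U \<Theta>m \<Theta>b]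
    by (simp only: mult.left_commute[of _ "complex_of_real ?P"] infsum_cmult_right')
  then have "(\<lambda>k. complex_of_real (h k ^ ?d) * (\<Sum>\<^sub>\<infinity>m. corr (U k) (?\<alpha> k) m) - complex_of_real ?P * ?I k) \<longlonglongrightarrow> 0"
    using corr_tendsto[where \<alpha> = ?\<alpha>, OF K'(2) \<beta>] by simp
  then have 1: "(\<lambda>k. complex_of_real (1 / ?P) * (complex_of_real (h k ^ ?d) * (\<Sum>\<^sub>\<infinity>m. corr (U k) (?\<alpha> k) m) - complex_of_real ?P * ?I k)) \<longlonglongrightarrow> 0"
    by (rule tendsto_mult_right_zero)
  have e: "complex_of_real (1 / ?P) * (complex_of_real (h k ^ ?d) * (\<Sum>\<^sub>\<infinity>m. corr (U k) (?\<alpha> k) m) - complex_of_real ?P * ?I k)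
    = wigner_transform (h k) (h k) (U k) a - ?I k" for k
  proof -
    have "complex_of_real (1 / ?P) * (complex_of_real ?P * z) = z" for z
      unfolding mult.assoc[symmetric] of_real_mult[symmetric] by simp
    then show ?thesis unfolding wigner_transform_corr[OF h U a] right_diff_distrib by simp
  qed
  have 2: "?I \<longlonglongrightarrow> (LINT x|\<nu>. ?\<Theta> x)"
  proof -
    have s: "sets (energy_measure (h k) (U k)) = sets borel" "sets \<nu> = sets borel" for k
      using w by (auto simp: weakly_converges_def radon_measure_def)
    have i: "integrable N ?\<Theta>" if N: "sets N = sets borel" "emeasure N UNIV \<le> ennreal C'" for N
    proof -
      note [measurable_cong] = N(1)
      interpret finite_measure N
        by standard (use N(2) in \<open>auto simp: sets_eq_imp_space_eq[OF N(1)] top_unique\<close>)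
      show ?thesis by (rule integrable_const_bound[where B = K]) (rule AE_I2[OF \<Theta>b], measurable)
    qed
    have iE: "integrable (energy_measure (h k) (U k)) ?\<Theta>" for k by (rule i[OF s(1) bd])
    have i\<nu>: "integrable \<nu> ?\<Theta>" by (rule i[OF s(2) weak_limit_bounded[OF w bd]])
    have "(\<lambda>k. LINT x|energy_measure (h k) (U k). Re (?\<Theta> x)) \<longlonglongrightarrow> (LINT x|\<nu>. Re (?\<Theta> x))"
      by (rule weakly_converges_vanishing[OF w bd continuous_on_Re[OF cont] order_trans[OF abs_Re_le_cmod K(2)]])
    moreover have "(\<lambda>k. LINT x|energy_measure (h k) (U k). Im (?\<Theta> x)) \<longlonglongrightarrow> (LINT x|\<nu>. Im (?\<Theta> x))"
      by (rule weakly_converges_vanishing[OF w bd continuous_on_Im[OF cont] order_trans[OF abs_Im_le_cmod K(2)]])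
    ultimately show ?thesis
      unfolding tendsto_complex_iff integral_Re[OF iE] integral_Re[OF i\<nu>] integral_Im[OF iE] integral_Im[OF i\<nu>] by blast
  qed
  show ?thesis using tendsto_add[OF 1[unfolded e] 2] by simp
qed

text \<open>The Wigner measure at scale \<open>h\<close> of a sequence that oscillates at a coarser scale.\<close>

definition lattice_lift :: "(real ^ 'n::finite) measure \<Rightarrow> ((real ^ 'n) \<times> (real ^ 'n)) measure" where
  "lattice_lift \<nu> = distr (\<nu> \<Otimes>\<^sub>M count_space UNIV) borel (\<lambda>z. (fst z, 0 + dual (snd z)))"

lemma lattice_lift_map:
  assumes "sets \<nu> = sets borel"
  shows "(\<lambda>z. (fst z, 0 + dual (snd z)) :: (real ^ 'n::finite) \<times> (real ^ 'n)) \<in> borel_measurable (\<nu> \<Otimes>\<^sub>M count_space UNIV)"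
proof -
  note [measurable_cong] = assms
  have [measurable]: "fst \<in> borel_measurable (\<nu> \<Otimes>\<^sub>M count_space (UNIV :: (int ^ 'n) set))"
    using measurable_fst[of \<nu> "count_space (UNIV :: (int ^ 'n) set)"] assms by (simp cong: measurable_cong_sets)
  show ?thesis
    by (rule measurable_compose_countable[where f = "\<lambda>n z. (fst z, 0 + dual n)", OF _ measurable_snd]) measurable
qed

lemma nn_integral_lattice_lift:
  fixes f :: "(real ^ 'n::finite) \<times> (real ^ 'n) \<Rightarrow> ennreal"
  assumes s: "sets \<nu> = sets borel" and f: "f \<in> borel_measurable borel"
  shows "(\<integral>\<^sup>+ z. f z \<partial>lattice_lift \<nu>) = (\<integral>\<^sup>+ x. (\<Sum>\<^sub>\<infinity>n. f (x, 0 + dual n)) \<partial>\<nu>)"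
proof -
  interpret C: sigma_finite_measure "count_space (UNIV :: (int ^ 'n) set)" by (rule sigma_finite_count)
  show ?thesis
    unfolding lattice_lift_def infsum_ennreal_eq_nn_integral using f
    by (subst nn_integral_distr[OF lattice_lift_map[OF s]], simp, subst C.nn_integral_fst[symmetric])
       (rule measurable_compose[OF lattice_lift_map[OF s] f], simp only: fst_conv snd_conv)
qed

text \<open>Fubini over \<nu> and the counting measure. The summand 0 in the lifting map makes the
  inner integral literally the periodisation at 0.\<close>

lemma lattice_lift_schwartz:
  fixes a :: "(real ^ 'n::finite) \<times> (real ^ 'n) \<Rightarrow> complex"
  assumes s: "sets \<nu> = sets borel" and fin: "emeasure \<nu> UNIV < \<infinity>" and a: "a \<in> schwartz"
  shows "integrable (lattice_lift \<nu>) a" "(LINT z|lattice_lift \<nu>. a z) = (LINT x|\<nu>. periodized (slice x a) 0)"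
proof -
  note am = schwartz_measurable[OF a]
  have sp: "space \<nu> = UNIV" using sets_eq_imp_space_eq[OF s] by simp
  interpret C: sigma_finite_measure "count_space (UNIV :: (int ^ 'n) set)" by (rule sigma_finite_count)
  interpret N: finite_measure \<nu> by standard (use fin in \<open>simp add: sp\<close>)
  interpret P: pair_sigma_finite \<nu> "count_space (UNIV :: (int ^ 'n) set)" ..
  obtain K where K: "K \<ge> 0" "\<And>x \<xi>. norm (a (x, \<xi>)) \<le> K * dec \<xi>" using schwartz_prod_dec'[OF a] by blast
  obtain D where D: "\<And>\<eta> :: real ^ 'n. (\<Sum>\<^sub>\<infinity>k. ennreal (dec (\<eta> + dual k))) \<le> ennreal D"
    using lattice_sum_bound by blast
  show i: "integrable (lattice_lift \<nu>) a"
  proof (rule integrableI_bounded)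
    show "a \<in> borel_measurable (lattice_lift \<nu>)" using am by (simp add: lattice_lift_def)
    have "(\<integral>\<^sup>+ z. ennreal (norm (a z)) \<partial>lattice_lift \<nu>) = (\<integral>\<^sup>+ x. (\<Sum>\<^sub>\<infinity>n. ennreal (norm (a (x, 0 + dual n)))) \<partial>\<nu>)"
      by (rule nn_integral_lattice_lift[OF s]) (use am in measurable)
    also have "\<dots> \<le> (\<integral>\<^sup>+ x. ennreal K * ennreal D \<partial>\<nu>)"
    proof (rule nn_integral_mono)
      fix x
      have "(\<Sum>\<^sub>\<infinity>n. ennreal (norm (a (x, 0 + dual n)))) \<le> (\<Sum>\<^sub>\<infinity>n. ennreal K * ennreal (dec (0 + dual n :: real ^ 'n)))"
        unfolding ennreal_mult[OF K(1) less_imp_le[OF dec_pos], symmetric] by (intro infsum_ennreal_mono ennreal_leI K(2))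
      also have "\<dots> \<le> ennreal K * ennreal D" unfolding infsum_ennreal_cmult by (rule mult_left_mono[OF D]) simp
      finally show "(\<Sum>\<^sub>\<infinity>n. ennreal (norm (a (x, 0 + dual n)))) \<le> ennreal K * ennreal D" .
    qed
    also have "\<dots> < \<infinity>" using fin by (simp add: sp ennreal_mult_less_top)
    finally show "(\<integral>\<^sup>+ z. ennreal (norm (a z)) \<partial>lattice_lift \<nu>) < \<infinity>" .
  qed
  have "integrable (\<nu> \<Otimes>\<^sub>M count_space UNIV) (\<lambda>z. a (fst z, 0 + dual (snd z)))"
    using i unfolding lattice_lift_def by (subst (asm) integrable_distr_eq[OF lattice_lift_map[OF s] am])
  from P.integral_fst'[OF this] show "(LINT z|lattice_lift \<nu>. a z) = (LINT x|\<nu>. periodized (slice x a) 0)"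
    unfolding lattice_lift_def integral_distr[OF lattice_lift_map[OF s] am] by simp
qed

text \<open>A compact set meets only finitely many of the sheets with frequency 2\<pi>n, and each
  sheet carries the finite mass of \<nu>.\<close>

lemma lattice_lift_radon:
  fixes \<nu> :: "(real ^ 'n::finite) measure"
  assumes s: "sets \<nu> = sets borel" and fin: "emeasure \<nu> UNIV < \<infinity>"
  shows "radon_measure (lattice_lift \<nu>)"
  unfolding radon_measure_def
proof (intro conjI allI impI)
  have sp: "space \<nu> = UNIV" using sets_eq_imp_space_eq[OF s] by simp
  show "sets (lattice_lift \<nu>) = sets borel" by (simp add: lattice_lift_def)
  fix K :: "((real ^ 'n) \<times> (real ^ 'n)) set" assume K: "compact K"
  then obtain R where R: "\<And>z. z \<in> K \<Longrightarrow> norm z \<le> R" using compact_imp_bounded bounded_iff by metis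
  let ?A = "{n :: int ^ 'n. norm (latt n) < \<bar>R\<bar> + 1}"
  have le: "(indicator K (x, 0 + dual n) :: ennreal) \<le> indicator ?A n" for x and n :: "int ^ 'n"
  proof (cases "(x, 0 + dual n) \<in> K")
    case True
    have "norm (dual n :: real ^ 'n) \<le> R"
      using R[OF True] norm_snd_le[of "0 + dual n" x] by simp
    moreover have "1 * norm (latt n) \<le> 2 * pi * norm (latt n)" using pi_gt3 by (intro mult_right_mono) auto
    ultimately have "n \<in> ?A" by simp
    then show ?thesis by (simp add: indicator_def)
  qed simp
  have [measurable]: "K \<in> sets borel" using K by (rule borel_compact)
  have "emeasure (lattice_lift \<nu>) K = (\<integral>\<^sup>+ z. indicator K z \<partial>lattice_lift \<nu>)" by (simp add: lattice_lift_def)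
  also have "\<dots> = (\<integral>\<^sup>+ x. (\<Sum>\<^sub>\<infinity>n. indicator K (x, 0 + dual n)) \<partial>\<nu>)"
    by (rule nn_integral_lattice_lift[OF s]) simp
  also have "\<dots> \<le> (\<integral>\<^sup>+ x. of_nat (card ?A) \<partial>\<nu>)"
  proof (rule nn_integral_mono)
    fix x
    have "(\<Sum>\<^sub>\<infinity>n. indicator K (x, 0 + dual n)) \<le> (\<Sum>\<^sub>\<infinity>n. indicator ?A n :: ennreal)"
      by (rule infsum_ennreal_mono[OF le])
    also have "\<dots> = of_nat (card ?A)"
      unfolding infsum_ennreal_eq_nn_integral
      by (subst nn_integral_indicator) (simp_all only: emeasure_count_space_finite[OF subset_UNIV finite_latt_ball] sets_count_space Pow_UNIV UNIV_I)
    finally show "(\<Sum>\<^sub>\<infinity>n. indicator K (x, 0 + dual n)) \<le> (of_nat (card ?A) :: ennreal)" .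
  qed
  also have "\<dots> < \<infinity>" using fin by (simp add: sp ennreal_mult_less_top of_nat_less_top)
  finally show "emeasure (lattice_lift \<nu>) K < \<infinity>" .
qed

text \<open>The sheet n = 0 alone already gives the full mass of \<nu> to any set that contains R^d
  x {0}.\<close>

lemma lattice_lift_null:
  fixes \<nu> :: "(real ^ 'n::finite) measure"
  assumes s: "sets \<nu> = sets borel" and F: "closed F" "0 \<in> F" and z: "emeasure (lattice_lift \<nu>) (UNIV \<times> F) = 0"
  shows "emeasure \<nu> UNIV = 0"
proof -
  have [measurable]: "UNIV \<times> F \<in> sets borel" using F(1) by (intro borel_closed closed_Times) auto
  have "emeasure \<nu> UNIV = (\<integral>\<^sup>+ x. 1 \<partial>\<nu>)" using sets_eq_imp_space_eq[OF s] by simp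
  also have "\<dots> \<le> (\<integral>\<^sup>+ x. (\<Sum>\<^sub>\<infinity>n. indicator (UNIV \<times> F) (x, 0 + dual n :: real ^ 'n)) \<partial>\<nu>)"
  proof (rule nn_integral_mono)
    fix x :: "real ^ 'n"
    have "(1 :: ennreal) = (\<Sum>n\<in>{0}. indicator (UNIV \<times> F) (x, 0 + dual n))" using F(2) by (simp add: latt_0)
    also have "\<dots> \<le> (\<Sum>\<^sub>\<infinity>n. indicator (UNIV \<times> F) (x, 0 + dual n))" by (rule sum_le_infsum_ennreal) auto
    finally show "(1 :: ennreal) \<le> (\<Sum>\<^sub>\<infinity>n. indicator (UNIV \<times> F) (x, 0 + dual n))" .
  qed
  also have "\<dots> = (\<integral>\<^sup>+ y. indicator (UNIV \<times> F) y \<partial>lattice_lift \<nu>)"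
    by (rule nn_integral_lattice_lift[OF s, symmetric]) simp
  also have "\<dots> = 0" using z by (simp add: lattice_lift_def)
  finally show ?thesis by simp
qed

subsection \<open>Convergence of the densities\<close>

lemma emeasure_energy_measure:
  fixes U :: "int ^ 'n::finite \<Rightarrow> complex"
  assumes "h > 0" "U \<in> lattice_L2"
  shows "emeasure (energy_measure h U) UNIV = ennreal ((lattice_norm h U)\<^sup>2)"
proof -
  have "emeasure (energy_measure h U) UNIV = (\<integral>\<^sup>+ x. 1 \<partial>energy_measure h U)" by (simp add: energy_measure_def)
  also have "\<dots> = (\<Sum>\<^sub>\<infinity>m. ennreal (h ^ CARD('n) * (norm (U m))\<^sup>2) * 1)"
    by (rule nn_integral_energy_measure) simp
  finally show ?thesis using lattice_L2_infsum[OF assms(2,1)] by simp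
qed

lemma weakly_converges_shift:
  assumes "weakly_converges M \<nu>"
  shows "weakly_converges (\<lambda>k. M (k + n)) \<nu>"
  using assms unfolding weakly_converges_def by (auto intro: LIMSEQ_ignore_initial_segment)

lemma weak_limit_vanishing:
  fixes M :: "nat \<Rightarrow> 'a::euclidean_space measure"
  assumes w: "weakly_converges M \<nu>" and z: "(\<lambda>k. emeasure (M k) UNIV) \<longlonglongrightarrow> 0"
  shows "emeasure \<nu> UNIV = 0"
proof -
  have eps: "emeasure \<nu> UNIV \<le> 0 + ennreal e" if e: "e > 0" for e
  proof -
    obtain n where n: "\<And>k. k \<ge> n \<Longrightarrow> emeasure (M k) UNIV < ennreal e"
      using order_tendstoD(2)[OF z, of "ennreal e"] e by (auto simp: eventually_sequentially)
    have "emeasure \<nu> UNIV \<le> ennreal e"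
      by (rule weak_limit_bounded[OF weakly_converges_shift[OF w, of n]]) (use n in \<open>auto intro: less_imp_le\<close>)
    then show ?thesis by simp
  qed
  have "emeasure \<nu> UNIV \<le> 0" by (rule ennreal_le_epsilon, rule eps)
  then show ?thesis by simp
qed

text \<open>A nonzero weak limit excludes vanishing masses, so \<open>wigner_limit\<close> applies
  and the lift of \<nu> is a Wigner measure. It charges the frequency 0, hence (C) keeps 0 out of
  the closure of the discontinuity set of \<tau>.\<close>

lemma (in oscillating_sequence) conditionC_uniform_tail:
  assumes w: "weakly_converges (\<lambda>k. energy_measure (h k) (U k)) \<nu>" and \<nu>: "emeasure \<nu> UNIV \<noteq> 0"
    and cC: "conditionC s p h U" and cont: "\<And>n. isCont p (dual n)"
    and B: "AE \<xi> in lborel. perT (sym s p) \<xi> \<le> ennreal B" and B0: "B \<ge> 0"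
  shows "uniform_tail s p"
proof (rule isCont_tau_uniform_tail[OF _ cont B B0])
  have s: "sets \<nu> = sets borel" using w by (simp add: weakly_converges_def radon_measure_def)
  have bd: "emeasure (energy_measure (h k) (U k)) UNIV \<le> ennreal (C\<^sup>2)" for k
    unfolding emeasure_energy_measure[OF h U] by (intro ennreal_leI lattice_norm_sq_le h C)
  have fin: "emeasure \<nu> UNIV < \<infinity>" using weak_limit_bounded[OF w bd] by (rule le_less_trans) simp
  have mass: "\<not> (\<lambda>k. (lattice_norm (h k) (U k))\<^sup>2) \<longlonglongrightarrow> 0"
  proof
    assume "(\<lambda>k. (lattice_norm (h k) (U k))\<^sup>2) \<longlonglongrightarrow> 0"
    then have "(\<lambda>k. emeasure (energy_measure (h k) (U k)) UNIV) \<longlonglongrightarrow> 0"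
      unfolding emeasure_energy_measure[OF h U] using tendsto_ennrealI by fastforce
    then show False using weak_limit_vanishing[OF w] \<nu> by simp
  qed
  have "wigner_measure h h U (lattice_lift \<nu>)"
    unfolding wigner_measure_def
  \<comment> \<open>The energy measures converge along the whole sequence, so the identity serves as
    the subsequence.\<close>
  proof (intro conjI exI[of _ id] ballI)
    show "radon_measure (lattice_lift \<nu>)" by (rule lattice_lift_radon[OF s fin])
    show "strict_mono (id :: nat \<Rightarrow> nat)" by (simp add: strict_mono_def)
    fix a :: "(real ^ 'n) \<times> (real ^ 'n) \<Rightarrow> complex" assume a: "a \<in> schwartz"
    show "integrable (lattice_lift \<nu>) a" by (rule lattice_lift_schwartz[OF s fin a])
    show "(\<lambda>k. wigner_transform (h (id k)) (h (id k)) (U (id k)) a) \<longlonglongrightarrow> (LINT z|lattice_lift \<nu>. a z)"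
      unfolding id_apply lattice_lift_schwartz(2)[OF s fin a]
      by (rule wigner_limit[OF mass w bd a])
  qed
  then have "emeasure (lattice_lift \<nu>) (UNIV \<times> closure (discont (tau s p))) = 0"
    using cC by (simp add: conditionC_def)
  then have "0 \<notin> closure (discont (tau s p))" using lattice_lift_null[OF s closed_closure] \<nu> by blast
  then show "isCont (tau s p) 0" using closure_subset[of "discont (tau s p)"] by (auto simp: discont_def)
qed

text \<open>When the masses tend to 0 a norm bound suffices: the L2 norm of g k is controlled by
  that of U k through \<open>FT_norm\<close> and the bounded periodisation of Z.\<close>

lemma density_vanishing:
  fixes U :: "nat \<Rightarrow> int ^ 'n::finite \<Rightarrow> complex" and f :: "real ^ 'n \<Rightarrow> real"
  assumes h: "\<And>k. h k > 0" and U: "\<And>k. U k \<in> lattice_L2" and Zm[measurable]: "Z \<in> borel_measurable borel"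
    and B: "AE \<xi> in lborel. perT Z \<xi> \<le> ennreal B" and g: "\<And>k. FT (g k) (amp (h k) (U k) Z)"
    and mass: "(\<lambda>k. ennreal ((lattice_norm (h k) (U k))\<^sup>2)) \<longlonglongrightarrow> 0" and f: "\<And>x. f x \<le> K"
  shows "(\<lambda>k. \<integral>\<^sup>+ x. nsq (g k x) * ennreal (f x) \<partial>lborel) \<longlonglongrightarrow> 0"
proof -
  let ?P = "(2 * pi) ^ CARD('n)"
  let ?c = "ennreal K * (ennreal (2 / ?P) * (ennreal B * ennreal ?P))"
  have "(\<integral>\<^sup>+ x. nsq (g k x) * ennreal (f x) \<partial>lborel) \<le> ?c * ennreal ((lattice_norm (h k) (U k))\<^sup>2)" for k
  proof -
    note [measurable] = lattice_fourier_measurable[OF U[of k]]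
    have gm[measurable]: "g k \<in> borel_measurable borel" using g[of k] by (simp add: FT_def)
    have "(\<integral>\<^sup>+ x. nsq (g k x) * ennreal (f x) \<partial>lborel) \<le> (\<integral>\<^sup>+ x. ennreal K * nsq (g k x) \<partial>lborel)"
      by (rule nn_integral_mono, subst mult.commute) (intro mult_right_mono ennreal_leI f, simp)
    also have "\<dots> = ennreal K * L2sq lborel (g k)" unfolding L2sq_def by (rule nn_integral_cmult) measurable
    also have "\<dots> \<le> ennreal K * (ennreal (2 / ?P) * L2sq lborel (amp (h k) (U k) Z))"
      using FT_norm[OF g[of k]] by (intro mult_left_mono) simp_all
    also have "L2sq lborel (amp (h k) (U k) Z) \<le> ennreal B * (ennreal ?P * ennreal ((lattice_norm (h k) (U k))\<^sup>2))"
    proof -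
      have "(\<integral>\<^sup>+ \<eta>. nsq (lattice_fourier (U k) \<eta>) * perT Z \<eta> \<partial>MQ) \<le> (\<integral>\<^sup>+ \<eta>. ennreal B * nsq (lattice_fourier (U k) \<eta>) \<partial>MQ)"
        using AE_MQ[OF B] by (intro nn_integral_mono_AE) (auto elim!: eventually_mono simp: mult.commute[of "ennreal B"] intro!: mult_left_mono)
      also have "\<dots> = ennreal B * L2sq MQ (lattice_fourier (U k))" unfolding L2sq_def by (rule nn_integral_cmult) measurable
      finally have "L2sq lborel (amp (h k) (U k) Z) \<le> ennreal (h k ^ CARD('n)) * (ennreal B * L2sq MQ (lattice_fourier (U k)))"
        unfolding L2sq_amp[OF U Zm h] by (rule mult_left_mono) simp
      also have "\<dots> = ennreal B * (ennreal (h k ^ CARD('n)) * L2sq MQ (lattice_fourier (U k)))" by (simp only: mult_ac)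
      also have "\<dots> = ennreal B * (ennreal ?P * ennreal ((lattice_norm (h k) (U k))\<^sup>2))"
        unfolding L2sq_MQ_lattice[OF U h] by (subst ennreal_mult) auto
      finally show ?thesis .
    qed
    finally show ?thesis by (simp add: mult_left_mono mult.assoc)
  qed
  moreover have "(\<lambda>k. ?c * ennreal ((lattice_norm (h k) (U k))\<^sup>2)) \<longlonglongrightarrow> 0"
    using ennreal_tendsto_cmult[OF _ mass, of ?c] by (simp add: ennreal_mult_less_top)
  ultimately show ?thesis by (rule ennreal_tendsto_0_le[rotated])
qed

theorem corollary5p9:
  fixes h \<epsilon> :: "nat \<Rightarrow> real"
    and s :: real
    and \<phi> :: "(real ^ 'n::finite) distribution"
    and \<phi>hat :: "real ^ 'n \<Rightarrow> complex"
    and U :: "nat \<Rightarrow> int ^ 'n \<Rightarrow> complex"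
    and \<nu> :: "(real ^ 'n) measure"
  assumes "is_scale h" and "is_scale \<epsilon>" and "(\<lambda>k. h k / \<epsilon> k) \<longlonglongrightarrow> 0"
    and "represents (dist_fourier \<phi>) \<phi>hat"
    and "BP s \<phi> \<phi>hat"
    and "h_bounded h U"
    and "oscillatory h \<epsilon> U"
    and "weakly_converges (\<lambda>k. energy_measure (h k) (U k)) \<nu>"
    and "\<forall>n. isCont \<phi>hat ((2 * pi) *\<^sub>R latt n)"
    and "conditionD s \<phi>hat \<or> conditionC s \<phi>hat h U"
  shows "(\<forall>k. \<exists>g. represents (bessel_potential (h k) s (T_op (h k) \<phi> (U k))) g \<and> square_integrable g)
    \<and> (\<forall>g. (\<forall>k. represents (bessel_potential (h k) s (T_op (h k) \<phi> (U k))) (g k)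
                  \<and> square_integrable (g k)) \<longrightarrow>
        weakly_converges (\<lambda>k. density lborel (\<lambda>x. ennreal ((norm (g k x))\<^sup>2)))
          (scale_measure
            (\<Sum>\<^sub>\<infinity>n. ennreal ((japanese ((2 * pi) *\<^sub>R latt n) powr s
                              * norm (\<phi>hat ((2 * pi) *\<^sub>R latt n)))\<^sup>2)) \<nu>))"
proof -
  let ?Z = "sym s \<phi>hat"
  have h: "\<And>k. h k > 0" and h0: "h \<longlonglongrightarrow> 0" using assms(1) by (auto simp: is_scale_def)
  note q = assms(3) and p = assms(4) and o = assms(7) and w = assms(8)
  have cont: "\<And>n. isCont \<phi>hat (dual n)" using assms(9) by blast
  have U: "\<And>k. U k \<in> lattice_L2" using assms(6) by (simp add: h_bounded_def)
  obtain C where C: "\<And>k. lattice_norm (h k) (U k) \<le> C" using assms(6) by (auto simp: h_bounded_def)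
  interpret oscillating_sequence h \<epsilon> U C by unfold_locales (fact h o q U C)+
  obtain B where B0: "B \<ge> 0" and B: "AE \<xi> in lborel. perT ?Z \<xi> \<le> ennreal B"
    using assms(5) unfolding BP_def tau_eq by (auto intro: less_imp_le)
  have pm: "\<phi>hat \<in> borel_measurable borel" using p by (simp add: represents_def)
  note Zm = sym_measurable[OF pm, of s]
  note iff = represents_bessel_T_op_iff[OF h U p B]
  obtain c where c: "c \<ge> 0" "(\<Sum>\<^sub>\<infinity>n. nsq (coef s \<phi>hat n)) = ennreal c"
    "\<And>A. finite A \<Longrightarrow> (\<Sum>n\<in>A. (norm (coef s \<phi>hat n))\<^sup>2) \<le> c"
    "\<And>e. e > 0 \<Longrightarrow> \<exists>A0. finite A0 \<and> (\<forall>A. finite A \<longrightarrow> A0 \<subseteq> A \<longrightarrow> c - (\<Sum>n\<in>A. (norm (coef s \<phi>hat n))\<^sup>2) \<le> e)"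
    by (rule infsum_ennreal_approx[of "coef s \<phi>hat" B]) (use coef_sum_le[OF cont B B0] in auto)
  have const: "(\<Sum>\<^sub>\<infinity>n. ennreal ((japanese (dual n) powr s * norm (\<phi>hat (dual n)))\<^sup>2)) = ennreal c"
    using c(2) by (simp add: coef_def sym_def norm_mult)
  show ?thesis
    unfolding const iff
  proof (intro conjI allI impI)
    show "\<exists>g. FT g (amp (h k) (U k) ?Z)" for k
      using FT_exists[OF amp_measurable[OF U Zm] L2sq_amp_finite[OF U Zm h B]] by blast
    fix g assume "\<forall>k. FT (g k) (amp (h k) (U k) ?Z)"
    then have g: "\<And>k. FT (g k) (amp (h k) (U k) ?Z)" by blast
    then have gm: "\<And>k. g k \<in> borel_measurable borel" and g2: "\<And>k. L2sq lborel (g k) < \<infinity>" by (auto simp: FT_def)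
    have r\<nu>: "radon_measure \<nu>" using w by (simp add: weakly_converges_def)
    have s\<nu>: "sets \<nu> = sets borel" using r\<nu> by (simp add: radon_measure_def)
    show "weakly_converges (\<lambda>k. density lborel (\<lambda>x. nsq (g k x))) (scale_measure (ennreal c) \<nu>)"
    proof (rule weakly_converges_densityI[OF r\<nu> c(1) gm g2])
      fix f :: "real ^ 'n \<Rightarrow> real"
      assume f: "continuous_on UNIV f" "compact (closure {x. f x \<noteq> 0})" "\<And>x. 0 \<le> f x"
      show "(\<lambda>k. \<integral>\<^sup>+ x. nsq (g k x) * ennreal (f x) \<partial>lborel) \<longlonglongrightarrow> ennreal (c * (LINT x|\<nu>. f x))"
      \<comment> \<open>The case split is on the tail property itself. If it fails, (D) is excluded,
        and (C) then forces \<nu> = 0; both sides of the limit are 0 in that case.\<close>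
      proof (cases "uniform_tail s \<phi>hat")
        case True
        show ?thesis
          by (rule density_test_tendsto[OF h h0 U C comparison_estimate[OF pm True cont B g] gm g2 c(1,3,4) f _ weakly_converges_nonneg(1)[OF w f]])
             (assumption | rule integral_nonneg_AE AE_I2 f(3))+
      next
        case False
        then have cC: "conditionC s \<phi>hat h U" using assms(10) conditionD_uniform_tail by blast
        then have z: "emeasure \<nu> UNIV = 0"
          using conditionC_uniform_tail[OF w _ cC cont B B0] False by blast
        then have I: "(LINT x|\<nu>. f x) = (LINT x|\<nu>. 0)"
          using emeasure_0_AE[of \<nu>] sets_eq_imp_space_eq[OF s\<nu>] by (intro integral_cong_AE) (auto simp: borel_measurable_continuous_onI[OF f(1)] cong: measurable_cong_sets[OF s\<nu>])
        have mass: "(\<lambda>k. ennreal ((lattice_norm (h k) (U k))\<^sup>2)) \<longlonglongrightarrow> 0"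
          using mass_tendsto_0[OF h w _ z] cC unfolding lattice_L2_infsum[OF U h] by (simp add: conditionC_def)
        obtain K where "0 < K" "\<And>x. \<bar>f x\<bar> \<le> K" "\<And>x. f x \<le> K" by (rule test_function_bounded[OF f(1,2)]) blast
        then have "(\<lambda>k. \<integral>\<^sup>+ x. nsq (g k x) * ennreal (f x) \<partial>lborel) \<longlonglongrightarrow> 0"
          by (intro density_vanishing[where g = g and h = h and U = U, OF h U Zm B g mass])
        then show ?thesis unfolding I by simp
      qed
    qed
  qed
qed

end
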